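(* Let $k,\ell,m\in\mathbb N$ with $\ell<m$, let $\mathcal A$ be an $\ell$-link of order $m$ and uniformity $k$, and let $d\in[k-1]$. Let $\delta=\delta(\mathcal A,d)$ be the uncoloured minimum $d$-degree threshold for the containment of a Hamilton $\mathcal A$-cycle, and suppose that $\mathcal A$ is $(\delta_0,d)$-good for some $\delta_0\ge\delta$. Then for any $\alpha>0$ there exists $n_0=n_0(\mathcal A,\alpha,d)\in\mathbb N$ such that for any $n\in(m-\ell)\mathbb N$ with $n\ge n_0$ the following holds. Let $\mathbf H$ be a $k$-uniform hypergraph collection on vertex set $[n]$ with $|\mathbf H|=\frac{e(\mathcal A)-e(\mathcal A_s)}{m-\ell}\,n$ and $\delta_d(\mathbf H)\ge(\delta_0+\alpha)n^{k-d}$. Then $\mathbf H$ contains a transversal copy of a Hamilton $\mathcal A$-cycle.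
   Context: Basic notions. For a $k$-uniform hypergraph $H$ and $1\le d<k$, $\delta_d(H)$ is the minimum, over all sets of $d$ vertices of $H$, of the number of edges of $H$ containing that set. A hypergraph collection $\mathbf H=(H_1,\dots,H_M)$ on vertex set $V$ is a sequence of (not necessarily distinct) hypergraphs each with vertex set $V$; $|\mathbf H|=M$, and $\delta_d(\mathbf H)=\min_{i}\delta_d(H_i)$. For an $M$-edge hypergraph $F$, $\mathbf H$ contains a transversal copy of $F$ if there is a copy $F'$ of $F$ with vertices in $V$ and a bijection $\phi:E(F')\to[M]$ with $e\in E(H_{\phi(e)})$ for all $e\in E(F')$. $v(\cdot)$ and $e(\cdot)$ denote numbers of vertices and edges. Ordered hypergraphs. An ordered hypergraph is a hypergraph with a linear order on its vertex set; vertices are indexed $v_1<v_2<\cdots$. Subgraphs inherit the order, and isomorphism of ordered hypergraphs means order-preserving isomorphism. Links. An $\ell$-link of uniformity $k$ and order $m$ is an ordered $k$-uniform hypergraph $\mathcal A$ on $m$ vertices $v_1,\dots,v_m$ such that $\mathcal A_s=\mathcal A[\{v_1,\dots,v_\ell\}]$ (the start) and $\mathcal A_t=\mathcal A[\{v_{m-\ell+1},\dots,v_m\}]$ (the end) are isomorphic as ordered hypergraphs. Chains. An ordered hypergraph $\mathcal P$ is an $\mathcal A$-chain of length $t\in\mathbb N$ if: (1) $v(\mathcal P)=(m-\ell)t+\ell$; (2) with $S_q=\{(q-1)(m-\ell)+1,\dots,(q-1)(m-\ell)+m\}$ for $1\le q\le t$, each induced ordered subhypergraph $\mathcal P_q=\mathcal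 P[\{v_i:i\in S_q\}]$ is isomorphic to $\mathcal A$; (3) every edge of $\mathcal P$ is contained in some $\mathcal P_q$. The start of $\mathcal P$ is the start of $\mathcal P_1$ and the end of $\mathcal P$ is the end of $\mathcal P_t$. Cycles. An $\mathcal A$-cycle is the (unordered) hypergraph obtained from an $\mathcal A$-chain with start $\mathcal S$ and end $\mathcal T$ by identifying each $x\in\mathcal S$ with $\phi(x)\in\mathcal T$, where $\phi:\mathcal S\to\mathcal T$ is the ordered isomorphism. A Hamilton $\mathcal A$-cycle is an $\mathcal A$-cycle covering all vertices of the host vertex set. (An $\mathcal A$-cycle on $n$ vertices has $\frac{e(\mathcal A)-e(\mathcal A_s)}{m-\ell}n$ edges.) Threshold. $\delta(\mathcal A,d)$ is the smallest real number $\delta$ such that for any $\alpha>0$ there is $n_0\in\mathbb N$ such that for any $n\in(m-\ell)\mathbb N$ with $n\ge n_0$, every $k$-uniform hypergraph $\mathcal H$ on $n$ vertices with $\delta_d(\mathcal H)\ge(\delta+\alpha)n^{k-d}$ contains a Hamilton $\mathcal A$-cycle. Good links. $\mathcal A$ is $(\delta_0,d)$-good if the following three properties hold (with $\delta_0$ in the role of the degree parameter). Ab: For any $\alpha>0$ there exist $0<\tau,\eta\le\alpha$ and $n_0\in\mathbb N$ such that if $\mathcal H$ is a $k$-uniform hypergraph on $n\ge n_0$ vertices with $\delta_d(\mathcal H)\ge(\delta_0+\alpha)n^{k-d}$, then there exists $A\subseteq V(\mathcal H)$ of size at most $\tau n$ such that for any $L\subseteq V(\mathcal H)\setminus A$ of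 size at most $\eta n$ with $|L|$ a non-negative integer multiple of $m-\ell$ (so $L=\emptyset$ is allowed), there is an embedding of an $\mathcal A$-chain into $\mathcal H$ with vertex set $A\cup L$; furthermore, the embedding of the start and of the end of this $\mathcal A$-chain does not depend on $L$. Con: For any $\alpha>0$ there exist a positive integer $c$ and $n_0\in\mathbb N$ such that if $\mathcal H$ is a $k$-uniform hypergraph on $n\ge n_0$ vertices with $\delta_d(\mathcal H)\ge(\delta_0+\alpha)n^{k-d}$, then for any vertex-disjoint copies $\mathcal S,\mathcal T$ of (the ordered hypergraph) $\mathcal A_s$ in $\mathcal H$, $\mathcal H$ contains an embedding of an $\mathcal A$-chain of length at most $c$ with start $\mathcal S$ and end $\mathcal T$. Fac: For any $\alpha>0$ there exist $\beta_0>0$ and $n_0\in\mathbb N$ such that for any $n\ge n_0$ and $\beta\le\beta_0$: if $\mathbf H$ is a $k$-uniform hypergraph collection on vertex set $[n]$ with $|\mathbf H|\le\beta n$, $\delta_d(\mathbf H)\ge(\delta_0+\alpha)n^{k-d}$ and $e(\mathcal A)$ divides $|\mathbf H|$, then $\mathbf H$ contains a transversal which consists of $|\mathbf H|/e(\mathcal A)$ vertex-disjoint copies of $\mathcal A$. *)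

theory Defs
  imports Complex_Main "HOL-Library.Extended_Real"
begin

section \<open>Hypergraphs, degrees and collections\<close>

type_synonym 'a hypergraph = "'a set \<times> 'a set set"

abbreviation verts :: "'a hypergraph \<Rightarrow> 'a set" where "verts H \<equiv> fst H"
abbreviation edges :: "'a hypergraph \<Rightarrow> 'a set set" where "edges H \<equiv> snd H"

definition uniform_hypergraph :: "nat \<Rightarrow> 'a hypergraph \<Rightarrow> bool" where
  "uniform_hypergraph k H \<longleftrightarrow>
     finite (verts H) \<and> (\<forall>e \<in> edges H. e \<subseteq> verts H \<and> card e = k)"

definition induced :: "'a hypergraph \<Rightarrow> 'a set \<Rightarrow> 'a hypergraph" where
  "induced H U = (U, {e \<in> edges H. e \<subseteq> U})"

text \<open>Only meaningful if \<open>d \<le> card (verts H)\<close>: otherwise this is a minimum over the empty set.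
  It is used below only for hypergraphs with sufficiently many vertices.\<close>

definition min_degree :: "nat \<Rightarrow> 'a hypergraph \<Rightarrow> nat" where
  "min_degree d H =
     Min ((\<lambda>D. card {e \<in> edges H. D \<subseteq> e}) ` {D. D \<subseteq> verts H \<and> card D = d})"

text \<open>A collection \<open>(H\<^sub>1, \<dots>, H\<^sub>M)\<close> is a list, so the indices run over \<open>0, \<dots>, M - 1\<close>
  and \<open>M\<close> is the length of the list.\<close>

definition hypergraph_collection :: "nat \<Rightarrow> 'a set \<Rightarrow> 'a hypergraph list \<Rightarrow> bool" where
  "hypergraph_collection k V Hs \<longleftrightarrow>
     (\<forall>H \<in> set Hs. uniform_hypergraph k H \<and> verts H = V)"

text \<open>Extended-real valued, so that the empty collection gets minimum degree \<open>\<infinity>\<close>, i.e. it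
  satisfies every minimum degree condition.\<close>

definition collection_min_degree :: "nat \<Rightarrow> 'a hypergraph list \<Rightarrow> ereal" where
  "collection_min_degree d Hs = (INF H \<in> set Hs. ereal (real (min_degree d H)))"

text \<open>\<open>F\<close> is already a concrete hypergraph on vertices of the host.\<close>

definition transversal :: "'a hypergraph list \<Rightarrow> 'a hypergraph \<Rightarrow> bool" where
  "transversal Hs F \<longleftrightarrow>
     (\<exists>\<phi>. bij_betw \<phi> (edges F) {..<length Hs} \<and> (\<forall>e \<in> edges F. e \<in> edges (Hs ! \<phi> e)))"

text \<open>Embeddings are not required to be induced.\<close>

definition embedding :: "('a \<Rightarrow> 'b) \<Rightarrow> 'a hypergraph \<Rightarrow> 'b hypergraph \<Rightarrow> bool" where
  "embedding f P H \<longleftrightarrow>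
     inj_on f (verts P) \<and> f ` verts P \<subseteq> verts H \<and> (\<forall>e \<in> edges P. f ` e \<in> edges H)"

section \<open>Links, chains and cycles\<close>

definition ordered_iso :: "'a::linorder hypergraph \<Rightarrow> 'b::linorder hypergraph \<Rightarrow> bool" where
  "ordered_iso G H \<longleftrightarrow>
     (\<exists>f. bij_betw f (verts G) (verts H) \<and> strict_mono_on (verts G) f \<and>
          (`) f ` edges G = edges H)"

text \<open>An ordered hypergraph with vertices \<open>v\<^sub>1 < \<dots> < v\<^sub>m\<close> is represented with \<open>v\<^sub>i = i\<close>.\<close>

definition is_link :: "nat \<Rightarrow> nat \<Rightarrow> nat \<Rightarrow> nat hypergraph \<Rightarrow> bool" where
  "is_link k l m A \<longleftrightarrow>
     uniform_hypergraph k A \<and> verts A = {1..m} \<and>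
     ordered_iso (induced A {1..l}) (induced A {m - l + 1..m})"

definition link_start :: "nat \<Rightarrow> nat hypergraph \<Rightarrow> nat hypergraph" where
  "link_start l A = induced A {1..l}"

definition chain_block :: "nat \<Rightarrow> nat \<Rightarrow> nat \<Rightarrow> nat set" where
  "chain_block l m q = {(q - 1) * (m - l) + 1..(q - 1) * (m - l) + m}"

text \<open>In a chain of length \<open>t\<close> the start consists of the vertices \<open>1, \<dots>, l\<close> and the end of the
  vertices \<open>(m - l) * t + 1, \<dots>, (m - l) * t + l\<close>; the ordered isomorphism from start to end is
  \<open>i \<mapsto> (m - l) * t + i\<close>.\<close>

definition is_chain :: "nat \<Rightarrow> nat \<Rightarrow> nat hypergraph \<Rightarrow> nat \<Rightarrow> nat hypergraph \<Rightarrow> bool" where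
  "is_chain l m A t P \<longleftrightarrow>
     1 \<le> t \<and> verts P = {1..(m - l) * t + l} \<and>
     (\<forall>q \<in> {1..t}. ordered_iso (induced P (chain_block l m q)) A) \<and>
     (\<forall>e \<in> edges P. \<exists>q \<in> {1..t}. e \<subseteq> chain_block l m q)"

text \<open>The map \<open>f\<close> is the quotient map of the identification, so \<open>C\<close> is a copy of the cycle with
  vertices of type \<open>'a\<close>.  The equivalence closure matters only for short chains, whose start and
  end overlap.\<close>

definition is_cycle :: "nat \<Rightarrow> nat \<Rightarrow> nat hypergraph \<Rightarrow> 'a hypergraph \<Rightarrow> bool" where
  "is_cycle l m A C \<longleftrightarrow>
     (\<exists>t P f. is_chain l m A t P \<and>
        (\<forall>i \<in> verts P. \<forall>j \<in> verts P.
           f i = f j \<longleftrightarrow> equivclp (\<lambda>x y. x \<in> {1..l} \<and> y = (m - l) * t + x) i j) \<and>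
        verts C = f ` verts P \<and> edges C = (`) f ` edges P)"

definition hamilton_cycle_on :: "nat \<Rightarrow> nat \<Rightarrow> nat hypergraph \<Rightarrow> 'a set \<Rightarrow> 'a hypergraph \<Rightarrow> bool" where
  "hamilton_cycle_on l m A V C \<longleftrightarrow> is_cycle l m A C \<and> verts C = V"

section \<open>Threshold and good links\<close>

definition hamilton_degree_suffices ::
  "nat \<Rightarrow> nat \<Rightarrow> nat \<Rightarrow> nat hypergraph \<Rightarrow> nat \<Rightarrow> real \<Rightarrow> bool" where
  "hamilton_degree_suffices k l m A d \<delta> \<longleftrightarrow>
     (\<forall>\<alpha>>0. \<exists>n0::nat. \<forall>n\<ge>n0. (m - l) dvd n \<longrightarrow>
        (\<forall>H :: nat hypergraph.
           uniform_hypergraph k H \<and> card (verts H) = n \<and>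
           real (min_degree d H) \<ge> (\<delta> + \<alpha>) * real n ^ (k - d) \<longrightarrow>
           (\<exists>C. hamilton_cycle_on l m A (verts H) C \<and> edges C \<subseteq> edges H)))"

text \<open>If \<open>A\<close> has an edge then the minimum is attained.  For edgeless \<open>A\<close> every real number
  suffices, and the value is unspecified.\<close>

definition hamilton_threshold :: "nat \<Rightarrow> nat \<Rightarrow> nat \<Rightarrow> nat hypergraph \<Rightarrow> nat \<Rightarrow> real" where
  "hamilton_threshold k l m A d = (LEAST \<delta>. hamilton_degree_suffices k l m A d \<delta>)"

text \<open>The maps \<open>s\<close> and \<open>e\<close> are the embeddings of the start and of the end; being chosen before
  \<open>L\<close>, they do not depend on \<open>L\<close>.\<close>

definition prop_Ab :: "nat \<Rightarrow> nat \<Rightarrow> nat \<Rightarrow> nat hypergraph \<Rightarrow> nat \<Rightarrow> real \<Rightarrow> bool" where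
  "prop_Ab k l m A d \<delta>0 \<longleftrightarrow>
     (\<forall>\<alpha>>0. \<exists>\<tau> \<eta> :: real. \<exists>n0::nat. 0 < \<tau> \<and> \<tau> \<le> \<alpha> \<and> 0 < \<eta> \<and> \<eta> \<le> \<alpha> \<and>
        (\<forall>n\<ge>n0. \<forall>H :: nat hypergraph.
           uniform_hypergraph k H \<and> card (verts H) = n \<and>
           real (min_degree d H) \<ge> (\<delta>0 + \<alpha>) * real n ^ (k - d) \<longrightarrow>
           (\<exists>X s e. X \<subseteq> verts H \<and> real (card X) \<le> \<tau> * real n \<and>
              (\<forall>L. L \<subseteq> verts H - X \<and> real (card L) \<le> \<eta> * real n \<and> (m - l) dvd card L \<longrightarrow>
                 (\<exists>t P f. is_chain l m A t P \<and> embedding f P H \<and> f ` verts P = X \<union> L \<and>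
                    (\<forall>i \<in> {1..l}. f i = s i \<and> f ((m - l) * t + i) = e i))))))"

text \<open>A copy of the ordered hypergraph \<open>link_start l A\<close> in the unordered \<open>H\<close> is an embedding,
  whose values on \<open>1, \<dots>, l\<close> record the order of the copy.\<close>

definition prop_Con :: "nat \<Rightarrow> nat \<Rightarrow> nat \<Rightarrow> nat hypergraph \<Rightarrow> nat \<Rightarrow> real \<Rightarrow> bool" where
  "prop_Con k l m A d \<delta>0 \<longleftrightarrow>
     (\<forall>\<alpha>>0. \<exists>c n0 :: nat. 1 \<le> c \<and>
        (\<forall>n\<ge>n0. \<forall>H :: nat hypergraph.
           uniform_hypergraph k H \<and> card (verts H) = n \<and>
           real (min_degree d H) \<ge> (\<delta>0 + \<alpha>) * real n ^ (k - d) \<longrightarrow>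
           (\<forall>s e. embedding s (link_start l A) H \<and> embedding e (link_start l A) H \<and>
              s ` {1..l} \<inter> e ` {1..l} = {} \<longrightarrow>
              (\<exists>t P f. t \<le> c \<and> is_chain l m A t P \<and> embedding f P H \<and>
                 (\<forall>i \<in> {1..l}. f i = s i \<and> f ((m - l) * t + i) = e i)))))"

definition prop_Fac :: "nat \<Rightarrow> nat hypergraph \<Rightarrow> nat \<Rightarrow> real \<Rightarrow> bool" where
  "prop_Fac k A d \<delta>0 \<longleftrightarrow>
     (\<forall>\<alpha>>0. \<exists>\<beta>0::real. \<exists>n0::nat. 0 < \<beta>0 \<and>
        (\<forall>n\<ge>n0. \<forall>\<beta>\<le>\<beta>0. \<forall>Hs :: nat hypergraph list.
           hypergraph_collection k {1..n} Hs \<and> real (length Hs) \<le> \<beta> * real n \<and>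
           collection_min_degree d Hs \<ge> ereal ((\<delta>0 + \<alpha>) * real n ^ (k - d)) \<and>
           card (edges A) dvd length Hs \<longrightarrow>
           (\<exists>f. let r = length Hs div card (edges A) in
              (\<forall>j<r. inj_on (f j) (verts A) \<and> f j ` verts A \<subseteq> {1..n}) \<and>
              (\<forall>i<r. \<forall>j<r. i \<noteq> j \<longrightarrow> f i ` verts A \<inter> f j ` verts A = {}) \<and>
              transversal Hs (\<Union>j<r. f j ` verts A, \<Union>j<r. (`) (f j) ` edges A))))"

definition good_link :: "nat \<Rightarrow> nat \<Rightarrow> nat \<Rightarrow> nat hypergraph \<Rightarrow> real \<Rightarrow> nat \<Rightarrow> bool" where
  "good_link k l m A \<delta>0 d \<longleftrightarrow>
     prop_Ab k l m A d \<delta>0 \<and> prop_Con k l m A d \<delta>0 \<and> prop_Fac k A d \<delta>0"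

end

theory Submission
  imports Defs "HOL-Library.FuncSet"
begin

text \<open>
  Let a popular edge be one that lies in at least a fixed proportion of the hypergraphs under
  consideration. By averaging, the popular edges satisfy the degree condition as well, with a
  negligible loss, and a structure of popular edges with few edges compared to the number of
  available colours can be coloured greedily. The uncoloured threshold thus yields short rainbow
  chains: split the vertices randomly into many parts that inherit all degree conditions, and cover one
  part after the other by a chain of edges popular for the colours not yet used, until only a tiny
  proportion of the colours is left.

  Three reserves make this exact. The first is a chain Q whose colouring is flexible: the bipartite
  graph between its edges and the colours is dense, hence contains a dense pair without sparse spots
  (density increment), and there any set of colours of the right size can be matched perfectly. So
  for a linear-sized set C of colours, Q can be completed with any subset of C of the right size. The
  second is a small reservoir of vertices, in which Fac uses up precisely the colours outside C that
  are left, and in which Con links all pieces. The third is the absorber given by Ab for the edges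
  popular for C, which takes in the uncovered vertices. The edges not coloured so far are popular for
  C and receive colours from C greedily, and since the Hamilton cycle has as many edges as there are
  colours, the number of unused colours is the number needed for Q.
\<close>

text \<open>Popularity offers many colours to each edge, but it never forces a prescribed colour to
  be used. So the last colours of the bulk must be exhausted by \<open>prop_Fac\<close>, whose
  divisibility condition is met by adding at most e(A) colours of the flexible set. Vertices and
  colours are coupled: a long chain uses \<rho> = r / h colours per vertex, the same ratio as in
  total. Stopping the bulk when its colours are nearly exhausted therefore fixes, up to a small
  error, how many vertices stay uncovered. The absorber tolerates only a short range of such
  numbers, and the flexible surplus steers into it: part of the surplus is handed back to the bulk
  beforehand. The constants are chosen in the order degree slack, surplus of the flexible chain,
  absorber, reservoir, colours kept for \<open>prop_Fac\<close>, number of parts for the bulk, n.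
  The absorber comes after the surplus because its edges are coloured from it, and the parts of the
  bulk come last because a chain in one of them must have few edges compared with the colours kept
  for \<open>prop_Fac\<close>.\<close>

section \<open>Concentration for random partitions\<close>

lemma exp_le_quadratic:
  fixes x :: real
  assumes "\<bar>x\<bar> \<le> 1"
  shows "exp x \<le> 1 + x + x\<^sup>2"
proof (cases "0 \<le> x")
  case True
  then show ?thesis using exp_bound[of x] assms by simp
next
  case False
  define y where "y = - x"
  have y: "0 \<le> y" "y \<le> 1" using False assms by (auto simp: y_def)
  \<comment> \<open>The product is 1 + y^3, so 1 / (1 + y), and with it exp (- y), is at most 1 - y
    + y^2.\<close>
  have "1 \<le> (1 + y) * (1 - y + y\<^sup>2)"
  proof -
    have "(1 + y) * (1 - y + y\<^sup>2) = 1 + y ^ 3"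
      by (simp add: algebra_simps power2_eq_square power3_eq_cube)
    then show ?thesis using y by simp
  qed
  also have "\<dots> \<le> exp y * (1 - y + y\<^sup>2)"
  proof (rule mult_right_mono)
    show "0 \<le> 1 - y + y\<^sup>2" using y by simp
  qed (simp add: exp_ge_add_one_self)
  finally have "exp (- y) * 1 \<le> exp (- y) * (exp y * (1 - y + y\<^sup>2))"
    by (intro mult_left_mono) auto
  then have "exp (- y) \<le> 1 - y + y\<^sup>2"
    by (simp add: exp_minus field_simps)
  then show ?thesis by (simp add: y_def)
qed

text \<open>Because the \<open>x j\<close> sum to zero, the linear terms of the exponentials cancel
  and only the quadratic error remains. This bounds the effect of a single random coordinate in
  \<open>mcdiarmid_exp_moment\<close>.\<close>

lemma sum_exp_centred_le:
  fixes x :: "'a \<Rightarrow> real"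
  assumes "finite J" "sum x J = 0" "\<And>j. j \<in> J \<Longrightarrow> \<bar>x j\<bar> \<le> c" "c \<le> 1"
  shows "(\<Sum>j\<in>J. exp (x j)) \<le> real (card J) * exp (c\<^sup>2)"
proof -
  have "(\<Sum>j\<in>J. exp (x j)) \<le> (\<Sum>j\<in>J. 1 + x j + c\<^sup>2)"
  proof (rule sum_mono)
    fix j assume j: "j \<in> J"
    have "exp (x j) \<le> 1 + x j + (x j)\<^sup>2"
      using assms(3)[OF j] assms(4) by (intro exp_le_quadratic) simp
    moreover have "(x j)\<^sup>2 \<le> c\<^sup>2"
      using power_mono[OF assms(3)[OF j], of 2] by simp
    ultimately show "exp (x j) \<le> 1 + x j + c\<^sup>2" by simp
  qed
  also have "\<dots> = real (card J) * (1 + c\<^sup>2)"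
    using assms(2) by (simp add: sum.distrib algebra_simps)
  also have "\<dots> \<le> real (card J) * exp (c\<^sup>2)"
    by (intro mult_left_mono) (auto simp: exp_ge_add_one_self)
  finally show ?thesis .
qed

text \<open>The uniform probability space of partitions into \<open>s\<close> labelled parts,
  handled by counting: \<open>\<rightarrow>\<^sub>E\<close> makes it finite, and an expectation is a
  sum divided by \<open>s ^ card S\<close>.\<close>

definition assignments :: "'a set \<Rightarrow> nat \<Rightarrow> ('a \<Rightarrow> nat) set" where
  "assignments S s = S \<rightarrow>\<^sub>E {..<s}"

lemma finite_assignments: "finite S \<Longrightarrow> finite (assignments S s)"
  by (simp add: assignments_def finite_PiE)

lemma card_assignments: "finite S \<Longrightarrow> card (assignments S s) = s ^ card S"
  by (simp add: assignments_def card_PiE)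

lemma sum_assignments_insert:
  assumes "x \<notin> S"
  shows "(\<Sum>g\<in>assignments (insert x S) s. F g) = (\<Sum>j<s. \<Sum>g\<in>assignments S s. F (g(x := j)))"
proof -
  have "assignments (insert x S) s = (\<lambda>(y, g). g(x := y)) ` ({..<s} \<times> assignments S s)"
    unfolding assignments_def by (rule PiE_insert_eq)
  moreover have "inj_on (\<lambda>(y, g). g(x := y)) ({..<s} \<times> assignments S s)"
    unfolding assignments_def using inj_combinator[OF assms, where T="\<lambda>_. {..<s}"] by simp
  ultimately have "(\<Sum>g\<in>assignments (insert x S) s. F g) = 
      (\<Sum>p\<in>{..<s} \<times> assignments S s. F ((\<lambda>(y, g). g(x := y)) p))"
    by (simp add: sum.reindex o_def)
  also have "\<dots> = (\<Sum>j<s. \<Sum>g\<in>assignments S s. F (g(x := j)))"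
    by (simp add: sum.cartesian_product case_prod_beta)
  finally show ?thesis .
qed

text \<open>Bounded differences, by exposing one vertex \<open>x\<close> at a time. With
  \<open>x\<close> fixed in part \<open>j\<close>, the induction hypothesis controls the fluctuation
  around the conditional mean \<open>mu j\<close>. The conditional means differ pairwise by at most
  \<open>c\<close>, so their deviations from \<open>M\<close> are centred and bounded, which is the
  setting of \<open>sum_exp_centred_le\<close>.\<close>

lemma mcdiarmid_exp_moment:
  fixes f :: "('a \<Rightarrow> nat) \<Rightarrow> real"
  assumes "finite S" and s: "s \<ge> 1" and lam: "0 \<le> lam" "lam * c \<le> 1"
    and lip: "\<And>g v j. g \<in> assignments S s \<Longrightarrow> v \<in> S \<Longrightarrow> j < s \<Longrightarrow> \<bar>f g - f (g(v := j))\<bar> \<le> c"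
  shows "(\<Sum>g\<in>assignments S s. exp (lam * ((\<Sum>g\<in>assignments S s. f g) / real s ^ card S - f g)))
           \<le> real s ^ card S * exp ((lam * c)\<^sup>2) ^ card S"
  using assms(1) lip
proof (induction S arbitrary: f rule: finite_induct)
  case empty
  show ?case by (simp add: assignments_def)
next
  case (insert x S)
  let ?A = "assignments S s"
  let ?n = "card S"
  let ?B = "exp ((lam * c)\<^sup>2)"
  define mu where "mu j = (\<Sum>g\<in>?A. f (g(x := j))) / real s ^ ?n" for j
  define M where "M = (\<Sum>j<s. mu j) / real s"
  have M: "(\<Sum>g\<in>assignments (insert x S) s. f g) / real s ^ card (insert x S) = M"
    using insert.hyps s by (simp add: sum_assignments_insert M_def mu_def sum_divide_distrib mult.commute)
  have mem: "g(x := j) \<in> assignments (insert x S) s" if "g \<in> ?A" "j < s" for g j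
    using that unfolding assignments_def by (auto simp: PiE_def extensional_def)
  have step: "(\<Sum>g\<in>?A. exp (lam * (mu j - f (g(x := j))))) \<le> real s ^ ?n * ?B ^ ?n" if j: "j < s" for j
    unfolding mu_def
  proof (rule insert.IH[where f = "\<lambda>g. f (g(x := j))"])
    fix g v i assume g: "g \<in> ?A" "v \<in> S" "i < s"
    have "v \<noteq> x" using g insert.hyps by auto
    then have eq: "g(v := i, x := j) = g(x := j, v := i)" by (simp add: fun_upd_twist)
    show "\<bar>f (g(x := j)) - f (g(v := i, x := j))\<bar> \<le> c"
      unfolding eq by (rule insert.prems[OF mem[OF g(1) j] insertI2[OF g(2)] g(3)])
  qed
  have diff: "\<bar>mu i - mu j\<bar> \<le> c" if ij: "i < s" "j < s" for i j
  proof -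
    have "\<bar>(\<Sum>g\<in>?A. f (g(x := i))) - (\<Sum>g\<in>?A. f (g(x := j)))\<bar>
            \<le> (\<Sum>g\<in>?A. \<bar>f (g(x := i)) - f (g(x := j))\<bar>)"
      by (simp add: sum_abs flip: sum_subtractf)
    also have "\<dots> \<le> (\<Sum>g\<in>?A. c)"
    proof (rule sum_mono)
      fix g assume g: "g \<in> ?A"
      show "\<bar>f (g(x := i)) - f (g(x := j))\<bar> \<le> c"
        using insert.prems[OF mem[OF g ij(1)] insertI1 ij(2)] by (simp only: fun_upd_upd)
    qed
    also have "\<dots> = real s ^ ?n * c" using insert.hyps by (simp add: card_assignments)
    finally have "\<bar>(\<Sum>g\<in>?A. f (g(x := i))) - (\<Sum>g\<in>?A. f (g(x := j)))\<bar> / real s ^ ?n \<le> c"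
      using s by (simp add: field_simps)
    then show ?thesis unfolding mu_def by (simp flip: diff_divide_distrib)
  qed
  have dev: "\<bar>lam * (M - mu j)\<bar> \<le> lam * c" if j: "j < s" for j
  proof -
    have "\<bar>\<Sum>i<s. mu i - mu j\<bar> \<le> (\<Sum>i<s. c)"
      by (rule order_trans[OF sum_abs sum_mono]) (use diff j in auto)
    moreover have "(\<Sum>i<s. mu i - mu j) = real s * (M - mu j)"
      using s by (simp add: M_def sum_subtractf field_simps)
    ultimately have "real s * \<bar>M - mu j\<bar> \<le> real s * c" by (simp add: abs_mult)
    then have "\<bar>M - mu j\<bar> \<le> c" using s by simp
    then show ?thesis using lam by (simp add: abs_mult mult_left_mono)
  qed
  have "(\<Sum>g\<in>assignments (insert x S) s. exp (lam * (M - f g)))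
      = (\<Sum>j<s. \<Sum>g\<in>?A. exp (lam * (M - f (g(x := j)))))"
    using insert.hyps by (simp add: sum_assignments_insert)
  also have "\<dots> = (\<Sum>j<s. exp (lam * (M - mu j)) * (\<Sum>g\<in>?A. exp (lam * (mu j - f (g(x := j))))))"
    by (simp add: sum_distrib_left exp_add[symmetric] distrib_left[symmetric])
  also have "\<dots> \<le> (\<Sum>j<s. exp (lam * (M - mu j)) * (real s ^ ?n * ?B ^ ?n))"
    by (intro sum_mono mult_left_mono step) auto
  also have "\<dots> = (\<Sum>j<s. exp (lam * (M - mu j))) * (real s ^ ?n * ?B ^ ?n)"
    by (simp add: sum_distrib_right)
  also have "\<dots> \<le> (real (card {..<s}) * ?B) * (real s ^ ?n * ?B ^ ?n)"
  proof (intro mult_right_mono sum_exp_centred_le)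
    show "(\<Sum>j<s. lam * (M - mu j)) = 0"
      using s by (simp add: M_def sum_subtractf flip: sum_distrib_left)
  qed (use dev lam in auto)
  also have "\<dots> = real s ^ card (insert x S) * ?B ^ card (insert x S)"
    using insert.hyps by (simp add: algebra_simps)
  finally show ?case unfolding M .
qed

text \<open>Exponential moments and a union bound: if each assignment failed for some index, the sum
  over \<open>I\<close> of the exponentials would be at least \<open>exp (lam * t)\<close>
  everywhere, against \<open>mcdiarmid_exp_moment\<close> on average. Only the lower tail is
  treated; an upper bound is obtained by passing to the negative function.\<close>

lemma exists_assignment_near_mean:
  fixes f :: "'i \<Rightarrow> ('a \<Rightarrow> nat) \<Rightarrow> real"
  assumes "finite S" "s \<ge> 1" "finite I" "0 < lam" "lam * c \<le> 1"
    and lip: "\<And>i g v j. i \<in> I \<Longrightarrow> g \<in> assignments S s \<Longrightarrow> v \<in> S \<Longrightarrow> j < s \<Longrightarrow> \<bar>f i g - f i (g(v := j))\<bar> \<le> c"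
    and small: "real (card I) * exp (real (card S) * (lam * c)\<^sup>2 - lam * t) < 1"
  shows "\<exists>g\<in>assignments S s. \<forall>i\<in>I. (\<Sum>g\<in>assignments S s. f i g) / real s ^ card S - t < f i g"
proof (rule ccontr)
  let ?A = "assignments S s"
  define mu where "mu i = (\<Sum>g\<in>?A. f i g) / real s ^ card S" for i
  let ?N = "real s ^ card S"
  let ?B = "exp ((lam * c)\<^sup>2) ^ card S"
  assume "\<not> ?thesis"
  then have bad: "\<exists>i\<in>I. f i g \<le> mu i - t" if "g \<in> ?A" for g
    using that unfolding mu_def by (meson not_less)
  have N: "?N > 0" using assms(2) by simp
  have "?N * exp (lam * t) = (\<Sum>g\<in>?A. exp (lam * t))"
    using assms(1) by (simp add: card_assignments)
  also have "\<dots> \<le> (\<Sum>g\<in>?A. \<Sum>i\<in>I. exp (lam * (mu i - f i g)))"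
  proof (rule sum_mono)
    fix g assume "g \<in> ?A"
    then obtain i where i: "i \<in> I" "f i g \<le> mu i - t" using bad by blast
    have "exp (lam * t) \<le> exp (lam * (mu i - f i g))" using i assms(4) by simp
    also have "\<dots> \<le> (\<Sum>i\<in>I. exp (lam * (mu i - f i g)))"
      using i assms(3) by (intro member_le_sum) auto
    finally show "exp (lam * t) \<le> (\<Sum>i\<in>I. exp (lam * (mu i - f i g)))" .
  qed
  also have "\<dots> = (\<Sum>i\<in>I. \<Sum>g\<in>?A. exp (lam * (mu i - f i g)))" by (rule sum.swap)
  also have "\<dots> \<le> (\<Sum>i\<in>I. ?N * ?B)"
  proof (rule sum_mono)
    fix i assume i: "i \<in> I"
    show "(\<Sum>g\<in>?A. exp (lam * (mu i - f i g))) \<le> ?N * ?B"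
      unfolding mu_def
      by (rule mcdiarmid_exp_moment) (use assms(1,2,4,5) lip[OF i] in auto)
  qed
  also have "\<dots> = ?N * (real (card I) * ?B)" by simp
  finally have "exp (lam * t) \<le> real (card I) * ?B" using N by simp
  then have "exp (lam * t) * exp (- (lam * t)) \<le> real (card I) * ?B * exp (- (lam * t))"
    by (rule mult_right_mono) simp
  moreover have "?B * exp (- (lam * t)) = exp (real (card S) * (lam * c)\<^sup>2 - lam * t)"
    by (simp add: exp_of_nat_mult[symmetric] exp_diff exp_minus divide_inverse)
  moreover have "exp (lam * t) * exp (- (lam * t)) = 1" by (simp add: exp_minus)
  ultimately show False using small by (simp add: mult.assoc)
qed

section \<open>Set families under a random partition\<close>

lemma binomial_le_power: "n choose k \<le> n ^ k"
  by (cases "k \<le> n") (auto simp: binomial_le_pow binomial_eq_0)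

lemma card_subsets_le: "finite S \<Longrightarrow> card {T. T \<subseteq> S \<and> card T = p} \<le> card S ^ p"
  by (simp add: n_subsets binomial_le_power)

lemma card_subsets_through_le:
  assumes "finite S" "p \<ge> 1" "v \<in> S"
  shows "card {T. T \<subseteq> S \<and> card T = p \<and> v \<in> T} \<le> card S ^ (p - 1)"
proof -
  have "card {T. T \<subseteq> S \<and> card T = p \<and> v \<in> T} \<le> card {T. T \<subseteq> S \<and> card T = p - 1}"
  proof (rule card_inj_on_le[where f = "\<lambda>T. T - {v}"])
    show "inj_on (\<lambda>T. T - {v}) {T. T \<subseteq> S \<and> card T = p \<and> v \<in> T}"
      by (rule inj_onI) blast
    show "(\<lambda>T. T - {v}) ` {T. T \<subseteq> S \<and> card T = p \<and> v \<in> T} \<subseteq> {T. T \<subseteq> S \<and> card T = p - 1}"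
      using assms by (auto simp: card_Diff_singleton)
    show "finite {T. T \<subseteq> S \<and> card T = p - 1}" using assms by simp
  qed
  also have "\<dots> \<le> card S ^ (p - 1)" by (rule card_subsets_le[OF assms(1)])
  finally show ?thesis .
qed

lemma card_subsets_meeting_le:
  assumes "finite S" "p \<ge> 1" "Z \<subseteq> S"
  shows "card {T. T \<subseteq> S \<and> card T = p \<and> T \<inter> Z \<noteq> {}} \<le> card Z * card S ^ (p - 1)"
proof -
  have fZ: "finite Z" using assms finite_subset by blast
  have "{T. T \<subseteq> S \<and> card T = p \<and> T \<inter> Z \<noteq> {}} = (\<Union>v\<in>Z. {T. T \<subseteq> S \<and> card T = p \<and> v \<in> T})"
    by auto
  then have "card {T. T \<subseteq> S \<and> card T = p \<and> T \<inter> Z \<noteq> {}}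
      \<le> (\<Sum>v\<in>Z. card {T. T \<subseteq> S \<and> card T = p \<and> v \<in> T})"
    using card_UN_le[OF fZ, of "\<lambda>v. {T. T \<subseteq> S \<and> card T = p \<and> v \<in> T}"] by simp
  also have "\<dots> \<le> (\<Sum>v\<in>Z. card S ^ (p - 1))"
    using assms by (intro sum_mono card_subsets_through_le) auto
  finally show ?thesis by simp
qed

text \<open>Linearity of expectation: a fixed \<open>p\<close>-set falls entirely into part
  \<open>j\<close> with probability \<open>1 / s ^ p\<close>.\<close>

lemma sum_assignments_monochromatic:
  assumes S: "finite S" "s \<ge> 1" "j < s" and F: "F \<subseteq> {T. T \<subseteq> S \<and> card T = p}"
  shows "(\<Sum>g\<in>assignments S s. real (card {T \<in> F. \<forall>v\<in>T. g v = j})) / real s ^ card S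
           = real (card F) / real s ^ p"
proof -
  have fF: "finite F" by (rule finite_subset[OF F]) (use S in simp)
  have fT: "card {g \<in> assignments S s. \<forall>v\<in>T. g v = j} * s ^ p = s ^ card S" if "T \<in> F" for T
  proof -
    have T: "T \<subseteq> S" "card T = p" using that F by auto
    have "{g \<in> assignments S s. \<forall>v\<in>T. g v = j} = (\<Pi>\<^sub>E v\<in>S. if v \<in> T then {j} else {..<s})"
    proof (intro set_eqI iffI)
      fix g assume g: "g \<in> {g \<in> assignments S s. \<forall>v\<in>T. g v = j}"
      then have g: "g \<in> S \<rightarrow>\<^sub>E {..<s}" "\<And>v. v \<in> T \<Longrightarrow> g v = j" by (simp_all add: assignments_def)
      show "g \<in> (\<Pi>\<^sub>E v\<in>S. if v \<in> T then {j} else {..<s})"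
      proof (rule PiE_I)
        show "g v \<in> (if v \<in> T then {j} else {..<s})" if "v \<in> S" for v
          using g(2)[of v] PiE_mem[OF g(1) that] by simp
        show "g v = undefined" if "v \<notin> S" for v
          using PiE_arb[OF g(1) that] .
      qed
    next
      fix g assume g: "g \<in> (\<Pi>\<^sub>E v\<in>S. if v \<in> T then {j} else {..<s})"
      have "g v = j" if "v \<in> T" for v
        using PiE_mem[OF g, of v] that T by auto
      moreover have "g v < s" if "v \<in> S" for v
        using PiE_mem[OF g that] S by (auto split: if_splits)
      moreover have "g v = undefined" if "v \<notin> S" for v
        using PiE_arb[OF g that] .
      ultimately show "g \<in> {g \<in> assignments S s. \<forall>v\<in>T. g v = j}"
        by (auto simp: assignments_def)
    qed
    then have "card {g \<in> assignments S s. \<forall>v\<in>T. g v = j} = (\<Prod>v\<in>S. card (if v \<in> T then {j} else {..<s}))"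
      using S by (simp add: card_PiE)
    also have "\<dots> = (\<Prod>v\<in>S - T. s)"
      using S T by (intro prod.mono_neutral_cong_right) auto
    also have "\<dots> = s ^ (card S - p)"
      using S T by (simp add: card_Diff_subset finite_subset)
    finally show ?thesis
      using S T card_mono[of S T] by (simp flip: power_add)
  qed
  have "(\<Sum>g\<in>assignments S s. real (card {T \<in> F. \<forall>v\<in>T. g v = j}))
      = (\<Sum>g\<in>assignments S s. \<Sum>T\<in>F. if \<forall>v\<in>T. g v = j then 1 else 0)"
    using fF by (simp add: sum.If_cases Int_def)
  also have "\<dots> = (\<Sum>T\<in>F. \<Sum>g\<in>assignments S s. if \<forall>v\<in>T. g v = j then 1 else 0)"
    by (rule sum.swap)
  also have "\<dots> = (\<Sum>T\<in>F. real (card {g \<in> assignments S s. \<forall>v\<in>T. g v = j}))"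
    using finite_assignments[OF S(1)] by (simp add: sum.If_cases Int_def)
  also have "\<dots> = (\<Sum>T\<in>F. real s ^ card S / real s ^ p)"
  proof (rule sum.cong)
    fix T assume "T \<in> F"
    from arg_cong[OF fT[OF this], of real]
    show "real (card {g \<in> assignments S s. \<forall>v\<in>T. g v = j}) = real s ^ card S / real s ^ p"
      using S by (simp add: field_simps)
  qed simp
  finally show ?thesis using S by simp
qed

text \<open>The left-hand side is the union bound of \<open>exists_balanced_partition\<close>:
  \<open>s\<close> parts, at most \<open>n ^ b\<close> families and two size conditions per part,
  each failing with exponentially small probability.\<close>

lemma poly_times_exp_decay:
  fixes \<kappa> :: real
  assumes "\<kappa> > 0"
  shows "\<exists>n0. \<forall>n\<ge>n0. real s * (real n ^ b + 2) * exp (- \<kappa> * real n) < 1"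
proof -
  have "filterlim (\<lambda>n. \<kappa> * real n) at_top sequentially"
    using assms filterlim_tendsto_pos_mult_at_top[OF tendsto_const assms filterlim_real_sequentially] by simp
  from filterlim_compose[OF tendsto_power_div_exp_0 this]
  have lim: "(\<lambda>n. (\<kappa> * real n) ^ k / exp (\<kappa> * real n)) \<longlonglongrightarrow> 0" for k .
  have "(\<lambda>n. real s / \<kappa> ^ b * ((\<kappa> * real n) ^ b / exp (\<kappa> * real n))
           + 2 * real s * ((\<kappa> * real n) ^ 0 / exp (\<kappa> * real n))) \<longlonglongrightarrow> real s / \<kappa> ^ b * 0 + 2 * real s * 0"
    by (intro tendsto_intros lim)
  then have "eventually (\<lambda>n. real s / \<kappa> ^ b * ((\<kappa> * real n) ^ b / exp (\<kappa> * real n))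
           + 2 * real s * ((\<kappa> * real n) ^ 0 / exp (\<kappa> * real n)) < 1) sequentially"
    by (rule order_tendstoD) simp
  moreover have "real s / \<kappa> ^ b * ((\<kappa> * real n) ^ b / exp (\<kappa> * real n))
           + 2 * real s * ((\<kappa> * real n) ^ 0 / exp (\<kappa> * real n))
       = real s * (real n ^ b + 2) * exp (- \<kappa> * real n)" for n
    using assms by (simp add: exp_minus field_simps)
  ultimately show ?thesis by (simp add: eventually_sequentially)
qed

lemma card_diff_le_card_exception:
  assumes "finite X" "finite Y" "finite Z" "X \<subseteq> Y \<union> Z" "Y \<subseteq> X \<union> Z"
  shows "\<bar>real (card X) - real (card Y)\<bar> \<le> real (card Z)"
proof -
  have "card X \<le> card Y + card Z"
    using card_mono[OF _ assms(4)] card_Un_le[of Y Z] assms by simp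
  moreover have "card Y \<le> card X + card Z"
    using card_mono[OF _ assms(5)] card_Un_le[of X Z] assms by simp
  ultimately show ?thesis by linarith
qed

text \<open>Moving one vertex only affects the sets through it.\<close>

lemma card_monochromatic_lipschitz:
  assumes "finite S" "p \<ge> 1" "F \<subseteq> {T. T \<subseteq> S \<and> card T = p}" "v \<in> S"
  shows "\<bar>real (card {T \<in> F. \<forall>u\<in>T. g u = j}) - real (card {T \<in> F. \<forall>u\<in>T. (g(v := i)) u = j})\<bar>
           \<le> real (card S) ^ (p - 1)"
proof -
  let ?Z = "{T. T \<subseteq> S \<and> card T = p \<and> v \<in> T}"
  have fin: "finite F" by (rule finite_subset[OF assms(3)]) (use assms(1) in simp)
  have "\<bar>real (card {T \<in> F. \<forall>u\<in>T. g u = j}) - real (card {T \<in> F. \<forall>u\<in>T. (g(v := i)) u = j})\<bar>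
          \<le> real (card ?Z)"
  proof (rule card_diff_le_card_exception)
    show "{T \<in> F. \<forall>u\<in>T. g u = j} \<subseteq> {T \<in> F. \<forall>u\<in>T. (g(v := i)) u = j} \<union> ?Z"
    proof
      fix T assume T: "T \<in> {T \<in> F. \<forall>u\<in>T. g u = j}"
      show "T \<in> {T \<in> F. \<forall>u\<in>T. (g(v := i)) u = j} \<union> ?Z"
      proof (cases "v \<in> T")
        case True
        then show ?thesis using T assms(3) by auto
      next
        case False
        have "(g(v := i)) u = j" if "u \<in> T" for u
        proof -
          have "u \<noteq> v" using False that by blast
          moreover have "g u = j" using T that by blast
          ultimately show ?thesis by simp
        qed
        then show ?thesis using T by blast
      qed
    qed
    show "{T \<in> F. \<forall>u\<in>T. (g(v := i)) u = j} \<subseteq> {T \<in> F. \<forall>u\<in>T. g u = j} \<union> ?Z"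
    proof
      fix T assume T: "T \<in> {T \<in> F. \<forall>u\<in>T. (g(v := i)) u = j}"
      show "T \<in> {T \<in> F. \<forall>u\<in>T. g u = j} \<union> ?Z"
      proof (cases "v \<in> T")
        case True
        then show ?thesis using T assms(3) by auto
      next
        case False
        have "g u = j" if "u \<in> T" for u
        proof -
          have "u \<noteq> v" using False that by blast
          moreover have "(g(v := i)) u = j" using T that by blast
          ultimately show ?thesis by simp
        qed
        then show ?thesis using T by simp
      qed
    qed
  qed (use fin assms(1) in auto)
  also have "\<dots> \<le> real (card S ^ (p - 1))"
    using card_subsets_through_le[OF assms(1,2,4)] by linarith
  finally show ?thesis by simp
qed

text \<open>The families \<open>F i\<close> will be the links of the \<open>d\<close>-sets in the
  hypergraphs of a collection. There are only polynomially many of them, so exponential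
  concentration lets one partition serve all.\<close>

lemma exists_balanced_partition:
  fixes \<epsilon> :: real
  assumes p: "p \<ge> 1" and s: "s \<ge> 1" and eps: "\<epsilon> > 0"
  shows "\<exists>n0. \<forall>(S :: 'a set) (I :: 'i set) F.
    finite S \<and> card S \<ge> n0 \<and> finite I \<and> card I \<le> card S ^ b \<and>
    (\<forall>i\<in>I. F i \<subseteq> {T. T \<subseteq> S \<and> card T = p}) \<longrightarrow>
    (\<exists>g. (\<forall>v\<in>S. g v < s) \<and>
      (\<forall>j<s. real (card S) / real s - \<epsilon> * real (card S) \<le> real (card {v \<in> S. g v = j}) \<and>
             real (card {v \<in> S. g v = j}) \<le> real (card S) / real s + \<epsilon> * real (card S) \<and>
        (\<forall>i\<in>I. real (card (F i)) / real s ^ p - \<epsilon> * real (card S) ^ p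
                  \<le> real (card {T \<in> F i. \<forall>v\<in>T. g v = j}))))"
proof -
  \<comment> \<open>With \<open>lam = \<theta> / c\<close> the exponent becomes
    \<open>n * \<theta> * (\<theta> - \<epsilon>)\<close>, at most
    \<open>- (\<theta> * \<epsilon> / 2) * n\<close> as
    \<open>\<theta> \<le> \<epsilon> / 2\<close>; the moment bound asks for
    \<open>\<theta> \<le> 1\<close>.\<close>
  define \<theta> where "\<theta> = min \<epsilon> 1 / 2"
  have \<theta>: "0 < \<theta>" "\<theta> \<le> 1" "\<theta> \<le> \<epsilon> / 2" using eps by (auto simp: \<theta>_def)
  have "0 < \<theta> * \<epsilon> / 2" using \<theta> eps by simp
  from poly_times_exp_decay[OF this, of s b]
  obtain n0 where n0: "\<And>n. n \<ge> n0 \<Longrightarrow> real s * (real n ^ b + 2) * exp (- (\<theta> * \<epsilon> / 2) * real n) < 1"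
    by blast
  show ?thesis
  proof (intro exI[of _ "max n0 1"] allI impI, elim conjE)
    fix S :: "'a set" and I :: "'i set" and F
    assume S: "finite S" and nS: "max n0 1 \<le> card S" and I: "finite I" "card I \<le> card S ^ b"
      and F: "\<forall>i\<in>I. F i \<subseteq> {T. T \<subseteq> S \<and> card T = p}"
    define n where "n = card S"
    define c where "c = real n ^ (p - 1)"
    have n: "n \<ge> n0" "n \<ge> 1" using nS by (auto simp: n_def)
    have c: "c > 0" "c * real n = real n ^ p" using n p by (auto simp: c_def power_Suc2[symmetric] simp del: power_Suc)
    define J where "J = {..<s} \<times> (Inl ` I \<union> {Inr True, Inr False})"
    \<comment> \<open>All observables get the Lipschitz constant \<open>c\<close>: the part sizes
      are scaled by it, and they appear with both signs because the concentration lemma only bounds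
      from below.\<close>
    define f :: "nat \<times> ('i + bool) \<Rightarrow> ('a \<Rightarrow> nat) \<Rightarrow> real" where
      "f z g = (case z of (j, Inl i) \<Rightarrow> real (card {T \<in> F i. \<forall>v\<in>T. g v = j})
          | (j, Inr b) \<Rightarrow> (if b then c else - c) * real (card {T \<in> (\<lambda>v. {v}) ` S. \<forall>v\<in>T. g v = j}))" for z g
    have sing: "(\<lambda>v. {v}) ` S \<subseteq> {T. T \<subseteq> S \<and> card T = 1}" by auto
    have card_sing: "card {T \<in> (\<lambda>v. {v}) ` S. \<forall>v\<in>T. g v = j} = card {v \<in> S. g v = j}" for g :: "'a \<Rightarrow> nat" and j
    proof -
      have "{T \<in> (\<lambda>v. {v}) ` S. \<forall>v\<in>T. g v = j} = (\<lambda>v. {v}) ` {v \<in> S. g v = j}" by auto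
      then show ?thesis by (simp add: card_image)
    qed
    have "\<exists>g\<in>assignments S s. \<forall>z\<in>J. (\<Sum>g\<in>assignments S s. f z g) / real s ^ card S - \<epsilon> * real n ^ p < f z g"
    proof (rule exists_assignment_near_mean[where lam = "\<theta> / c" and c = c])
      show "finite J" using I by (simp add: J_def)
      show "0 < \<theta> / c" "\<theta> / c * c \<le> 1" using \<theta> c by auto
      fix z g v i assume z: "z \<in> J" and g: "g \<in> assignments S s" "v \<in> S" "i < s"
      from z consider j x where "z = (j, Inl x)" "x \<in> I" | j b where "z = (j, Inr b)"
        by (auto simp: J_def)
      then show "\<bar>f z g - f z (g(v := i))\<bar> \<le> c"
      proof cases
        case 1
        then show ?thesis
          using card_monochromatic_lipschitz[OF S p _ g(2), of "F x" g j i] F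
          by (simp add: f_def c_def n_def del: fun_upd_apply)
      next
        case 2
        have "\<bar>real (card {T \<in> (\<lambda>v. {v}) ` S. \<forall>v\<in>T. g v = j})
            - real (card {T \<in> (\<lambda>v. {v}) ` S. \<forall>u\<in>T. (g(v := i)) u = j})\<bar> \<le> 1"
          using card_monochromatic_lipschitz[OF S order_refl sing g(2), of g j i] by simp
        then have "c * \<bar>real (card {T \<in> (\<lambda>v. {v}) ` S. \<forall>v\<in>T. g v = j})
            - real (card {T \<in> (\<lambda>v. {v}) ` S. \<forall>u\<in>T. (g(v := i)) u = j})\<bar> \<le> c * 1"
          using c by (intro mult_left_mono) auto
        moreover have "f z g - f z (g(v := i)) = (if b then c else - c) *
           (real (card {T \<in> (\<lambda>v. {v}) ` S. \<forall>v\<in>T. g v = j})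
            - real (card {T \<in> (\<lambda>v. {v}) ` S. \<forall>u\<in>T. (g(v := i)) u = j}))"
          unfolding f_def 2 by (simp add: right_diff_distrib del: fun_upd_apply)
        ultimately show ?thesis using c(1) by (simp add: abs_mult del: fun_upd_apply)
      qed
    next
      have "card J = s * (card I + 2)"
        using I by (simp add: J_def card_cartesian_product card_Un_disjoint card_image image_iff disjoint_iff)
      then have "real (card J) = real s * (real (card I) + 2)" by (simp add: algebra_simps)
      also have "\<dots> \<le> real s * (real n ^ b + 2)"
      proof (intro mult_left_mono add_right_mono)
        show "real (card I) \<le> real n ^ b" using I(2) unfolding n_def
          by (metis of_nat_le_iff of_nat_power)
      qed simp
      finally have cJ: "real (card J) \<le> real s * (real n ^ b + 2)" .
      have "real (card S) * (\<theta> / c * c)\<^sup>2 - \<theta> / c * (\<epsilon> * real n ^ p) = real n * (\<theta> * (\<theta> - \<epsilon>))"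
        using c(1) unfolding c(2)[symmetric] n_def[symmetric] by (simp add: power2_eq_square algebra_simps)
      also have "\<dots> \<le> real n * (\<theta> * (- (\<epsilon> / 2)))"
        using \<theta> by (intro mult_left_mono) auto
      finally have ex: "real (card S) * (\<theta> / c * c)\<^sup>2 - \<theta> / c * (\<epsilon> * real n ^ p)
          \<le> - (\<theta> * \<epsilon> / 2) * real n" by (simp add: algebra_simps)
      have "real (card J) * exp (real (card S) * (\<theta> / c * c)\<^sup>2 - \<theta> / c * (\<epsilon> * real n ^ p))
          \<le> real s * (real n ^ b + 2) * exp (- (\<theta> * \<epsilon> / 2) * real n)"
        using cJ ex by (intro mult_mono) auto
      also have "\<dots> < 1" by (rule n0[OF n(1)])
      finally show "real (card J) * exp (real (card S) * (\<theta> / c * c)\<^sup>2 - \<theta> / c * (\<epsilon> * real n ^ p)) < 1" .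
    qed (use S s in auto)
    then obtain g where g: "g \<in> assignments S s"
      and near: "\<And>z. z \<in> J \<Longrightarrow> (\<Sum>g\<in>assignments S s. f z g) / real s ^ card S - \<epsilon> * real n ^ p < f z g"
      by blast
    have gs: "g v < s" if "v \<in> S" for v using g that by (auto simp: assignments_def PiE_iff)
    have sizes: "real (card S) / real s - \<epsilon> * real (card S) \<le> real (card {v \<in> S. g v = j}) \<and>
             real (card {v \<in> S. g v = j}) \<le> real (card S) / real s + \<epsilon> * real (card S)" if j: "j < s" for j
    proof -
      have mean: "(\<Sum>g\<in>assignments S s. f (j, Inr b) g) / real s ^ card S
            = (if b then c else - c) * (real n / real s)" for b
      proof -
        have "(\<Sum>g\<in>assignments S s. f (j, Inr b) g) / real s ^ card S
            = (if b then c else - c) * ((\<Sum>g\<in>assignments S s. real (card {T \<in> (\<lambda>v. {v}) ` S. \<forall>v\<in>T. g v = j})) / real s ^ card S)"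
          unfolding f_def by (simp add: sum_negf flip: sum_distrib_left)
        then show ?thesis
          using sum_assignments_monochromatic[OF S s j sing] by (simp add: card_image n_def)
      qed
      have "(j, Inr b) \<in> J" for b using j by (cases b) (auto simp: J_def)
      from near[OF this[of True]] near[OF this[of False]]
      have "c * (real n / real s) - c * (\<epsilon> * real n) < c * real (card {v \<in> S. g v = j})"
        "- c * (real n / real s) - c * (\<epsilon> * real n) < - c * real (card {v \<in> S. g v = j})"
        unfolding mean unfolding c(2)[symmetric] by (simp_all add: f_def card_sing algebra_simps)
      then have "c * (real n / real s - \<epsilon> * real n) < c * real (card {v \<in> S. g v = j})"
        "c * real (card {v \<in> S. g v = j}) < c * (real n / real s + \<epsilon> * real n)"
        by (simp_all add: algebra_simps)
      then show ?thesis using c(1) by (simp add: n_def)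
    qed
    have "real (card (F i)) / real s ^ p - \<epsilon> * real (card S) ^ p
                  \<le> real (card {T \<in> F i. \<forall>v\<in>T. g v = j})" if "j < s" "i \<in> I" for i j
    proof -
      have "(j, Inl i) \<in> J" using that by (auto simp: J_def)
      from near[OF this] show ?thesis
        using sum_assignments_monochromatic[OF S s that(1), of "F i" p] F that by (simp add: f_def n_def)
    qed
    with gs sizes show "\<exists>g. (\<forall>v\<in>S. g v < s) \<and>
      (\<forall>j<s. real (card S) / real s - \<epsilon> * real (card S) \<le> real (card {v \<in> S. g v = j}) \<and>
             real (card {v \<in> S. g v = j}) \<le> real (card S) / real s + \<epsilon> * real (card S) \<and>
        (\<forall>i\<in>I. real (card (F i)) / real s ^ p - \<epsilon> * real (card S) ^ p
                  \<le> real (card {T \<in> F i. \<forall>v\<in>T. g v = j})))" by blast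
  qed
qed

section \<open>Popular elements and greedy colouring\<close>

lemma card_popular_ge:
  fixes x \<gamma> :: real
  assumes "finite R" "R \<noteq> {}" "finite T" "\<gamma> \<ge> 0"
    and "\<And>c. c \<in> R \<Longrightarrow> x \<le> real (card {e \<in> T. e \<in> H c})"
  shows "x - \<gamma> * real (card T) \<le> real (card {e \<in> T. \<gamma> * real (card R) \<le> real (card {c \<in> R. e \<in> H c})})"
proof -
  let ?P = "{e \<in> T. \<gamma> * real (card R) \<le> real (card {c \<in> R. e \<in> H c})}"
  have "real (card R) * x = (\<Sum>c\<in>R. x)" by simp
  also have "\<dots> \<le> (\<Sum>c\<in>R. real (card {e \<in> T. e \<in> H c}))" by (intro sum_mono assms(5))
  also have "\<dots> = (\<Sum>c\<in>R. \<Sum>e\<in>T. if e \<in> H c then 1 else 0)"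
    using assms(3) by (simp add: sum.If_cases Int_def)
  also have "\<dots> = (\<Sum>e\<in>T. \<Sum>c\<in>R. if e \<in> H c then 1 else 0)" by (rule sum.swap)
  also have "\<dots> = (\<Sum>e\<in>T. real (card {c \<in> R. e \<in> H c}))"
    using assms(1) by (simp add: sum.If_cases Int_def)
  \<comment> \<open>This is the double count of pairs of a colour and an element: outside
    \<open>?P\<close> an element lies in at most \<open>\<gamma> * card R\<close> of the sets
    \<open>H c\<close>, inside \<open>?P\<close> in at most \<open>card R\<close> of them.\<close>
  also have "\<dots> \<le> (\<Sum>e\<in>T. (if e \<in> ?P then real (card R) else 0) + \<gamma> * real (card R))"
  proof (rule sum_mono)
    fix e assume "e \<in> T"
    have "card {c \<in> R. e \<in> H c} \<le> card R" using assms(1) by (intro card_mono) auto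
    then show "real (card {c \<in> R. e \<in> H c}) \<le> (if e \<in> ?P then real (card R) else 0) + \<gamma> * real (card R)"
      using \<open>e \<in> T\<close> assms(4) by (auto intro: add_increasing2)
  qed
  also have "\<dots> = real (card R) * (real (card ?P) + \<gamma> * real (card T))"
    using assms(3) by (simp add: sum.distrib sum.If_cases Int_def algebra_simps)
  finally have "real (card R) * x \<le> real (card R) * (real (card ?P) + \<gamma> * real (card T))" .
  moreover have "real (card R) > 0" using assms(1,2) by (simp add: card_gt_0_iff)
  ultimately show ?thesis by simp
qed

lemma exists_greedy_colouring:
  assumes "finite Y" "\<And>y. y \<in> Y \<Longrightarrow> finite (N y) \<and> card Y \<le> card (N y)"
  shows "\<exists>\<phi>. inj_on \<phi> Y \<and> (\<forall>y\<in>Y. \<phi> y \<in> N y)"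
  using assms
proof (induction Y rule: finite_induct)
  case empty
  then show ?case by simp
next
  case (insert y Y)
  have "\<exists>\<phi>. inj_on \<phi> Y \<and> (\<forall>y\<in>Y. \<phi> y \<in> N y)"
    using insert.prems insert.hyps by (intro insert.IH) (auto dest: Suc_leD)
  then obtain \<phi> where \<phi>: "inj_on \<phi> Y" "\<forall>y\<in>Y. \<phi> y \<in> N y" by blast
  have "card (\<phi> ` Y) < card (N y)"
    using insert.prems[of y] insert.hyps card_image_le[of Y \<phi>] by simp
  then have "\<not> N y \<subseteq> \<phi> ` Y" using insert.hyps card_mono[of "\<phi> ` Y" "N y"] by auto
  then obtain c where c: "c \<in> N y" "c \<notin> \<phi> ` Y" by blast
  have "inj_on (\<phi>(y := c)) (insert y Y)"
    using \<phi>(1) c(2) insert.hyps(2) by (auto simp: inj_on_def)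
  moreover have "\<forall>z\<in>insert y Y. (\<phi>(y := c)) z \<in> N z" using \<phi>(2) c(1) by simp
  ultimately show ?case by blast
qed

section \<open>Dense pairs and flexible matchings\<close>

text \<open>Deleting an element of least value never lowers the average, so this is repeated until
  \<open>a\<close> elements are left. The inequality compares the two averages with denominators
  cleared.\<close>

lemma exists_heavy_subset:
  fixes f :: "'a \<Rightarrow> real"
  assumes "finite Y" "a \<le> card Y"
  shows "\<exists>Y'\<subseteq>Y. card Y' = a \<and> real a * sum f Y \<le> real (card Y) * sum f Y'"
  using assms
proof (induction "card Y - a" arbitrary: Y)
  case 0
  then show ?case by (intro exI[of _ Y]) simp
next
  case (Suc d)
  show ?case
  proof (cases "a = 0")
    case True
    then show ?thesis by (intro exI[of _ "{}"]) simp
  next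
    case False
    let ?N = "real (card Y)"
    have N: "card Y > a" "card Y \<ge> 2" using Suc.hyps(2) False by auto
    then have ne: "Y \<noteq> {}" by auto
    obtain y where y: "y \<in> Y" "f y = Min (f ` Y)"
      using Min_in[of "f ` Y"] Suc.prems(1) ne by fastforce
    have "?N * f y \<le> sum f Y"
      using sum_bounded_below[of Y "f y" f] y Suc.prems(1) by simp
    moreover have sum: "sum f (Y - {y}) = sum f Y - f y" using y Suc.prems(1) by (simp add: sum_diff1)
    ultimately have le: "(?N - 1) * sum f Y \<le> ?N * sum f (Y - {y})"
      unfolding sum by (simp add: algebra_simps)
    have cY: "card (Y - {y}) = card Y - 1" using y by simp
    have "d = card (Y - {y}) - a" "a \<le> card (Y - {y})" using Suc.hyps(2) N cY by auto
    from Suc.hyps(1)[OF this(1) _ this(2)] Suc.prems(1)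
    obtain Y' where Y': "Y' \<subseteq> Y - {y}" "card Y' = a"
      "real a * sum f (Y - {y}) \<le> real (card (Y - {y})) * sum f Y'" by auto
    have r: "real (card (Y - {y})) = ?N - 1" using cY N by simp
    have "(?N - 1) * (real a * sum f Y) = real a * ((?N - 1) * sum f Y)" by simp
    also have "\<dots> \<le> real a * (?N * sum f (Y - {y}))" by (rule mult_left_mono[OF le]) simp
    also have "\<dots> = ?N * (real a * sum f (Y - {y}))" by simp
    also have "\<dots> \<le> ?N * ((?N - 1) * sum f Y')" using Y'(3) unfolding r by (intro mult_left_mono) auto
    also have "\<dots> = (?N - 1) * (?N * sum f Y')" by simp
    finally have "real a * sum f Y \<le> ?N * sum f Y'" using N by simp
    then show ?thesis using Y' by blast
  qed
qed

lemma exists_light_subset: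
  fixes f :: "'a \<Rightarrow> real"
  assumes "finite Y" "a \<le> card Y"
  shows "\<exists>Y'\<subseteq>Y. card Y' = a \<and> real (card Y) * sum f Y' \<le> real a * sum f Y"
  using exists_heavy_subset[OF assms, of "\<lambda>x. - f x"] by (simp add: sum_negf)

definition pair_count :: "('a \<Rightarrow> 'b \<Rightarrow> bool) \<Rightarrow> 'a set \<Rightarrow> 'b set \<Rightarrow> real" where
  "pair_count adj X Y = (\<Sum>x\<in>X. real (card {y \<in> Y. adj x y}))"

lemma pair_count_swap:
  assumes "finite X" "finite Y"
  shows "pair_count adj X Y = (\<Sum>y\<in>Y. real (card {x \<in> X. adj x y}))"
proof -
  have "pair_count adj X Y = (\<Sum>x\<in>X. \<Sum>y\<in>Y. if adj x y then 1 else 0)"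
    using assms by (simp add: pair_count_def sum.If_cases Int_def)
  also have "\<dots> = (\<Sum>y\<in>Y. \<Sum>x\<in>X. if adj x y then 1 else 0)" by (rule sum.swap)
  also have "\<dots> = (\<Sum>y\<in>Y. real (card {x \<in> X. adj x y}))"
    using assms by (simp add: sum.If_cases Int_def)
  finally show ?thesis .
qed

lemma pair_count_le:
  assumes "finite X" "finite Y"
  shows "pair_count adj X Y \<le> real (card X) * real (card Y)"
proof -
  have "pair_count adj X Y \<le> (\<Sum>x\<in>X. real (card Y))"
    unfolding pair_count_def by (intro sum_mono) (simp add: card_mono assms)
  then show ?thesis by simp
qed

text \<open>Keeping the \<open>b\<close> heaviest vertices first on one side and then on the other
  does not lower the density, by \<open>exists_heavy_subset\<close>.\<close>

lemma exists_dense_subpair: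
  assumes fin: "finite X" "finite Y" and b: "b \<le> card X" "b \<le> card Y" "b \<ge> 1"
    and d: "p * (real (card X) * real (card Y)) \<le> pair_count adj X Y"
  shows "\<exists>X'\<subseteq>X. \<exists>Y'\<subseteq>Y. card X' = b \<and> card Y' = b \<and> p * (real b * real b) \<le> pair_count adj X' Y'"
proof -
  obtain X' where X': "X' \<subseteq> X" "card X' = b" "real b * pair_count adj X Y \<le> real (card X) * pair_count adj X' Y"
    using exists_heavy_subset[OF fin(1) b(1), of "\<lambda>x. real (card {y \<in> Y. adj x y})"]
    unfolding pair_count_def by blast
  have fX': "finite X'" using X'(1) fin(1) finite_subset by blast
  obtain Y' where Y': "Y' \<subseteq> Y" "card Y' = b" "real b * pair_count adj X' Y \<le> real (card Y) * pair_count adj X' Y'"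
  proof -
    obtain Y' where Y': "Y' \<subseteq> Y" "card Y' = b" "real b * (\<Sum>y\<in>Y. real (card {x \<in> X'. adj x y}))
        \<le> real (card Y) * (\<Sum>y\<in>Y'. real (card {x \<in> X'. adj x y}))"
      using exists_heavy_subset[OF fin(2) b(2), of "\<lambda>y. real (card {x \<in> X'. adj x y})"] by blast
    have "finite Y'" using Y'(1) fin(2) finite_subset by blast
    then show ?thesis using that[OF Y'(1,2)] Y'(3) by (simp only: pair_count_swap[OF fX'] fin(2))
  qed
  have "real b * (p * (real (card X) * real (card Y))) \<le> real b * pair_count adj X Y"
    using d by (rule mult_left_mono) simp
  then have "real (card X) * (p * real b * real (card Y)) \<le> real (card X) * pair_count adj X' Y"
    using X'(3) by (simp add: algebra_simps)
  then have "p * real b * real (card Y) \<le> pair_count adj X' Y" using b by simp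
  then have "real b * (p * real b * real (card Y)) \<le> real b * pair_count adj X' Y"
    by (rule mult_left_mono) simp
  then have "real (card Y) * (p * (real b * real b)) \<le> real (card Y) * pair_count adj X' Y'"
    using Y'(3) by (simp add: algebra_simps)
  then have "p * (real b * real b) \<le> pair_count adj X' Y'" using b by simp
  then show ?thesis using X' Y' by blast
qed

text \<open>The lower half of regularity: there is no sparse spot of size \<open>b\<close> by
  \<open>b\<close>. Larger pairs are covered as well, since their density is an average over
  subpairs of this size.\<close>

definition bi_dense :: "('a \<Rightarrow> 'b \<Rightarrow> bool) \<Rightarrow> 'a set \<Rightarrow> 'b set \<Rightarrow> nat \<Rightarrow> real \<Rightarrow> bool" where
  "bi_dense adj X Y b p \<longleftrightarrow>
     (\<forall>X'\<subseteq>X. \<forall>Y'\<subseteq>Y. card X' = b \<and> card Y' = b \<longrightarrow> p * (real b * real b) \<le> pair_count adj X' Y')"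

text \<open>If the pair of \<open>X2\<close> and \<open>Y2\<close> is sparse, the rest of the edges is concentrated on
  \<open>(X - X2) \<times> Y\<close> and \<open>X2 \<times> (Y - Y2)\<close>, one of which is therefore denser.\<close>

lemma density_increment:
  assumes fin: "finite X" "finite Y" and c: "card X = a" "card Y = a" "a \<ge> 4"
    and eps: "0 < \<epsilon>" "\<epsilon> \<le> 1 / 4" and p: "0 < \<gamma>" "\<gamma> \<le> p"
    and d: "p * (real a * real a) \<le> pair_count adj X Y"
    and b: "b = nat \<lceil>\<epsilon> * real a\<rceil>"
    and nd: "\<not> bi_dense adj X Y b (\<gamma> / 2)"
  shows "\<exists>X'\<subseteq>X. \<exists>Y'\<subseteq>Y. card X' = b \<and> card Y' = b \<and>
           p * (1 + \<epsilon>\<^sup>2 / 2) * (real b * real b) \<le> pair_count adj X' Y'"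
proof -
  have "0 \<le> \<epsilon> * real a" using eps by simp
  then have "0 \<le> \<lceil>\<epsilon> * real a\<rceil>" by simp
  then have "real b = real_of_int \<lceil>\<epsilon> * real a\<rceil>" unfolding b by simp
  then have eb: "\<epsilon> * real a \<le> real b" "real b < \<epsilon> * real a + 1" by linarith+
  have b2: "2 * b \<le> a"
  proof -
    have "\<epsilon> * real a \<le> (1 / 4) * real a" using eps by (intro mult_right_mono) auto
    then have "2 * real b < real a + 1" using eb c(3) by linarith
    then show ?thesis by linarith
  qed
  have b1: "b \<ge> 1"
  proof -
    have "0 < \<epsilon> * real a" using eps c by simp
    then show ?thesis using eb by linarith
  qed
  from nd obtain X2 Y2 where X2: "X2 \<subseteq> X" "card X2 = b" and Y2: "Y2 \<subseteq> Y" "card Y2 = b"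
    and lt: "pair_count adj X2 Y2 < \<gamma> / 2 * (real b * real b)"
    unfolding bi_dense_def not_all not_imp not_le by blast
  have f2: "finite X2" "finite Y2" using X2 Y2 fin finite_subset by blast+
  have split1: "pair_count adj X Y = pair_count adj (X - X2) Y + pair_count adj X2 Y"
    unfolding pair_count_def by (rule sum.subset_diff[OF X2(1) fin(1)])
  have split2: "pair_count adj X2 Y = pair_count adj X2 (Y - Y2) + pair_count adj X2 Y2"
    unfolding pair_count_swap[OF f2(1) fin(2)] pair_count_swap[OF f2(1) f2(2)]
      pair_count_swap[OF f2(1) finite_Diff[OF fin(2)]]
    by (rule sum.subset_diff[OF Y2(1) fin(2)])
  have cX: "card (X - X2) = a - b" and cY: "card (Y - Y2) = a - b"
    using X2 Y2 c f2 by (auto simp: card_Diff_subset)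
  define p' where "p' = p * (1 + \<epsilon>\<^sup>2 / 2)"
  \<comment> \<open>The sparse spot falls short of density \<open>p\<close> by at least
    \<open>p / 2 * b\<^sup>2\<close> pairs, where \<open>b \<ge> \<epsilon> * a\<close>. This pays
    for the gain \<open>\<epsilon>\<^sup>2 / 2\<close> on the \<open>a\<^sup>2 - b\<^sup>2\<close>
    pairs of the two remaining rectangles.\<close>
  have "p' * (real (a - b) * real a) \<le> pair_count adj (X - X2) Y \<or>
        p' * (real b * real (a - b)) \<le> pair_count adj X2 (Y - Y2)"
  proof (rule ccontr)
    assume "\<not> ?thesis"
    then have "pair_count adj (X - X2) Y + pair_count adj X2 (Y - Y2)
        < p' * (real (a - b) * real a) + p' * (real b * real (a - b))" by linarith
    also have "\<dots> = p' * (real a * real a - real b * real b)" using b2 by (simp add: of_nat_diff algebra_simps)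
    also have "\<dots> \<le> p * (real a * real a) - p / 2 * (real b * real b)"
    proof -
      have "(\<epsilon> * real a) * (\<epsilon> * real a) \<le> real b * real b"
        using eb eps by (intro mult_mono) auto
      then have "(1 + \<epsilon>\<^sup>2 / 2) * (real a * real a - real b * real b) \<le> real a * real a - (real b * real b) / 2"
        using zero_le_mult_iff[of "\<epsilon> * \<epsilon>" "real b * real b"] by (simp add: algebra_simps power2_eq_square)
      from mult_left_mono[OF this, of p] p show ?thesis by (simp add: p'_def algebra_simps)
    qed
    also have "\<dots> \<le> pair_count adj X Y - pair_count adj X2 Y2"
    proof -
      have "\<gamma> / 2 * (real b * real b) \<le> p / 2 * (real b * real b)" using p by (intro mult_right_mono) auto
      then show ?thesis using d lt by linarith
    qed
    finally show False using split1 split2 by linarith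
  qed
  then show ?thesis
  proof
    assume "p' * (real (a - b) * real a) \<le> pair_count adj (X - X2) Y"
    then have "\<exists>X'\<subseteq>X - X2. \<exists>Y'\<subseteq>Y. card X' = b \<and> card Y' = b \<and> p' * (real b * real b) \<le> pair_count adj X' Y'"
      using fin b1 b2 c cX by (intro exists_dense_subpair) auto
    then show ?thesis unfolding p'_def by blast
  next
    assume "p' * (real b * real (a - b)) \<le> pair_count adj X2 (Y - Y2)"
    then have "\<exists>X'\<subseteq>X2. \<exists>Y'\<subseteq>Y - Y2. card X' = b \<and> card Y' = b \<and> p' * (real b * real b) \<le> pair_count adj X' Y'"
      using fin f2 b1 b2 X2 cY by (intro exists_dense_subpair) auto
    then show ?thesis using X2 unfolding p'_def by blast
  qed
qed

text \<open>Each failure of \<open>bi_dense\<close> raises the density by the factor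
  \<open>1 + \<epsilon>\<^sup>2 / 2\<close>. As densities are at most 1, this happens fewer than
  \<open>T\<close> times, and each time the sides shrink by about the factor
  \<open>\<epsilon>\<close>; hence \<open>\<kappa> = \<epsilon> ^ T\<close>.\<close>

lemma exists_bi_dense_subpair:
  fixes \<gamma> \<epsilon> :: real
  assumes eps: "0 < \<epsilon>" "\<epsilon> \<le> 1 / 4" and gam: "0 < \<gamma>"
  shows "\<exists>\<kappa>>0. \<kappa> \<le> 1 \<and> (\<forall>(X :: 'a set) (Y :: 'b set) q adj. finite X \<and> finite Y \<and> card X = q \<and> card Y = q \<and>
    4 \<le> \<kappa> * real q \<and> \<gamma> * (real q * real q) \<le> pair_count adj X Y \<longrightarrow>
    (\<exists>X'\<subseteq>X. \<exists>Y'\<subseteq>Y. \<exists>a. card X' = a \<and> card Y' = a \<and> \<kappa> * real q \<le> real a \<and>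
       bi_dense adj X' Y' (nat \<lceil>\<epsilon> * real a\<rceil>) (\<gamma> / 2)))"
proof -
  have "1 < 1 + \<epsilon>\<^sup>2 / 2" using eps by simp
  from real_arch_pow[OF this, of "1 / \<gamma>"] obtain T where T: "1 / \<gamma> < (1 + \<epsilon>\<^sup>2 / 2) ^ T" by blast
  show ?thesis
  proof (intro exI[of _ "\<epsilon> ^ T"] conjI allI impI)
    show "0 < \<epsilon> ^ T" using eps by simp
    show "\<epsilon> ^ T \<le> 1" using eps by (intro power_le_one) auto
    fix X :: "'a set" and Y :: "'b set" and q adj
    assume *: "finite X \<and> finite Y \<and> card X = q \<and> card Y = q \<and>
      4 \<le> \<epsilon> ^ T * real q \<and> \<gamma> * (real q * real q) \<le> pair_count adj X Y"
    let ?goal = "\<exists>X'\<subseteq>X. \<exists>Y'\<subseteq>Y. \<exists>a. card X' = a \<and> card Y' = a \<and> \<epsilon> ^ T * real q \<le> real a \<and>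
       bi_dense adj X' Y' (nat \<lceil>\<epsilon> * real a\<rceil>) (\<gamma> / 2)"
    have "?goal \<or> (\<exists>X'\<subseteq>X. \<exists>Y'\<subseteq>Y. \<exists>a. card X' = a \<and> card Y' = a \<and> \<epsilon> ^ i * real q \<le> real a \<and>
        \<gamma> * (1 + \<epsilon>\<^sup>2 / 2) ^ i * (real a * real a) \<le> pair_count adj X' Y')" if "i \<le> T" for i
      using that
    proof (induction i)
      case 0
      show ?case using * by (intro disjI2 exI[of _ X] exI[of _ Y]) auto
    next
      case (Suc i)
      have Ti: "\<epsilon> ^ T \<le> \<epsilon> ^ i" using eps Suc.prems by (intro power_decreasing) auto
      from Suc consider ?goal | X' Y' a where "X' \<subseteq> X" "Y' \<subseteq> Y" "card X' = a" "card Y' = a"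
        "\<epsilon> ^ i * real q \<le> real a" "\<gamma> * (1 + \<epsilon>\<^sup>2 / 2) ^ i * (real a * real a) \<le> pair_count adj X' Y'"
        by auto
      then show ?case
      proof cases
        case 2
        have "\<epsilon> ^ T * real q \<le> \<epsilon> ^ i * real q" using Ti by (rule mult_right_mono) simp
        then have qa: "\<epsilon> ^ T * real q \<le> real a" using 2(5) by linarith
        then have a4: "a \<ge> 4" using * by linarith
        show ?thesis
        proof (cases "bi_dense adj X' Y' (nat \<lceil>\<epsilon> * real a\<rceil>) (\<gamma> / 2)")
          case True
          then show ?thesis using 2 qa by blast
        next
          case False
          have "\<gamma> * 1 \<le> \<gamma> * (1 + \<epsilon>\<^sup>2 / 2) ^ i" using gam by (intro mult_left_mono one_le_power) auto
          then have "\<exists>X''\<subseteq>X'. \<exists>Y''\<subseteq>Y'. card X'' = nat \<lceil>\<epsilon> * real a\<rceil> \<and> card Y'' = nat \<lceil>\<epsilon> * real a\<rceil> \<and>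
              (\<gamma> * (1 + \<epsilon>\<^sup>2 / 2) ^ i) * (1 + \<epsilon>\<^sup>2 / 2) * (real (nat \<lceil>\<epsilon> * real a\<rceil>) * real (nat \<lceil>\<epsilon> * real a\<rceil>)) \<le> pair_count adj X'' Y''"
            using 2 * eps gam a4 False
            by (intro density_increment[where a = a and \<gamma> = \<gamma>]) (auto intro: finite_subset)
          then obtain X'' Y'' where X'': "X'' \<subseteq> X'" "Y'' \<subseteq> Y'" "card X'' = nat \<lceil>\<epsilon> * real a\<rceil>"
            "card Y'' = nat \<lceil>\<epsilon> * real a\<rceil>"
            "(\<gamma> * (1 + \<epsilon>\<^sup>2 / 2) ^ i) * (1 + \<epsilon>\<^sup>2 / 2) * (real (nat \<lceil>\<epsilon> * real a\<rceil>) * real (nat \<lceil>\<epsilon> * real a\<rceil>)) \<le> pair_count adj X'' Y''"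
            by blast
          have "\<epsilon> ^ Suc i * real q = \<epsilon> * (\<epsilon> ^ i * real q)" by simp
          also have "\<dots> \<le> \<epsilon> * real a" using 2(5) eps by (intro mult_left_mono) auto
          also have "\<dots> \<le> real (nat \<lceil>\<epsilon> * real a\<rceil>)" by linarith
          finally have "\<epsilon> ^ Suc i * real q \<le> real (nat \<lceil>\<epsilon> * real a\<rceil>)" .
          moreover have "\<gamma> * (1 + \<epsilon>\<^sup>2 / 2) ^ Suc i * (real (nat \<lceil>\<epsilon> * real a\<rceil>) * real (nat \<lceil>\<epsilon> * real a\<rceil>)) \<le> pair_count adj X'' Y''"
            using X''(5) by (simp only: power_Suc2 mult.assoc)
          moreover have "X'' \<subseteq> X" "Y'' \<subseteq> Y" using X'' 2(1,2) by blast+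
          ultimately show ?thesis using X''(3,4)
            by (intro disjI2 exI[of _ X''] exI[of _ Y''] exI[of _ "nat \<lceil>\<epsilon> * real a\<rceil>"] conjI) assumption+
        qed
      qed blast
    qed
    note dichotomy = this[of T]
    show ?goal
    proof (rule disjE[OF dichotomy[OF order_refl]])
      assume ?goal
      then show ?goal .
    next
      assume "\<exists>X'\<subseteq>X. \<exists>Y'\<subseteq>Y. \<exists>a. card X' = a \<and> card Y' = a \<and> \<epsilon> ^ T * real q \<le> real a \<and>
        \<gamma> * (1 + \<epsilon>\<^sup>2 / 2) ^ T * (real a * real a) \<le> pair_count adj X' Y'"
      then obtain X' Y' a where X': "X' \<subseteq> X" "Y' \<subseteq> Y" "card X' = a" "card Y' = a"
        "\<epsilon> ^ T * real q \<le> real a" "\<gamma> * (1 + \<epsilon>\<^sup>2 / 2) ^ T * (real a * real a) \<le> pair_count adj X' Y'" by blast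
      have "pair_count adj X' Y' \<le> real a * real a"
        using pair_count_le[of X' Y' adj] X' * finite_subset[of X' X] finite_subset[of Y' Y] by simp
      moreover have "1 * (real a * real a) < \<gamma> * (1 + \<epsilon>\<^sup>2 / 2) ^ T * (real a * real a)"
      proof (rule mult_strict_right_mono)
        show "1 < \<gamma> * (1 + \<epsilon>\<^sup>2 / 2) ^ T" using T gam by (simp add: field_simps)
        have "a > 0" using X'(5) * by linarith
        then show "0 < real a * real a" by simp
      qed
      ultimately have False using X'(6) by linarith
      then show ?goal ..
    qed
  qed
qed

text \<open>A maximal matching is perfect: if \<open>x\<close> and \<open>y\<close> are unmatched,
  all neighbours of either are matched, so \<open>x\<close> reaches at least \<open>b\<close>
  elements of \<open>X\<close> and \<open>y\<close> at least \<open>b\<close> elements of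
  \<open>U\<close> by alternating steps. The density condition yields an edge between these two sets
  and so an augmenting path.\<close>

lemma exists_perfect_matching:
  assumes fin: "finite X" "finite U" and card: "card X = card U"
    and degX: "\<And>x. x \<in> X \<Longrightarrow> b \<le> card {y \<in> U. adj x y}"
    and degU: "\<And>y. y \<in> U \<Longrightarrow> b \<le> card {x \<in> X. adj x y}"
    and dense: "\<And>X' Y'. X' \<subseteq> X \<Longrightarrow> Y' \<subseteq> U \<Longrightarrow> card X' = b \<Longrightarrow> card Y' = b \<Longrightarrow> \<exists>x\<in>X'. \<exists>y\<in>Y'. adj x y"
  shows "\<exists>f. bij_betw f X U \<and> (\<forall>x\<in>X. adj x (f x))"
proof -
  define P where "P = {A. A \<subseteq> X \<and> (\<exists>f. inj_on f A \<and> f ` A \<subseteq> U \<and> (\<forall>x\<in>A. adj x (f x)))}"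
  have "finite P" using fin by (simp add: P_def)
  moreover have "P \<noteq> {}" by (auto simp: P_def)
  ultimately obtain A where A: "A \<in> P" and max: "\<And>B. B \<in> P \<Longrightarrow> A \<subseteq> B \<Longrightarrow> A = B"
    using finite_has_maximal[of P] by blast
  then obtain f where f: "A \<subseteq> X" "inj_on f A" "f ` A \<subseteq> U" "\<And>x. x \<in> A \<Longrightarrow> adj x (f x)"
    by (auto simp: P_def)
  have fA: "finite A" using f(1) fin finite_subset by blast
  have ext: False if "x \<in> X - A" "inj_on f' (insert x A)" "f' ` insert x A \<subseteq> U" "\<forall>z\<in>insert x A. adj z (f' z)" for x f'
    using max[of "insert x A"] that f(1) by (auto simp: P_def)
  have "A = X"
  proof (rule ccontr)
    assume "A \<noteq> X"
    then obtain x where x: "x \<in> X" "x \<notin> A" using f(1) by blast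
    have "card (f ` A) < card U"
      using card_image[OF f(2)] psubset_card_mono[of X A] fin f(1) \<open>A \<noteq> X\<close> card by auto
    then have "f ` A \<noteq> U" by auto
    then obtain y where y: "y \<in> U" "y \<notin> f ` A" using f(3) by blast
    have nx: "y' \<in> f ` A" if "y' \<in> U" "adj x y'" for y'
    proof (rule ccontr)
      assume n: "y' \<notin> f ` A"
      show False
        by (rule ext[of x "f(x := y')"]) (use x n that f in \<open>auto simp: inj_on_def\<close>)
    qed
    have ny: "x' \<in> A" if "x' \<in> X" "adj x' y" for x'
    proof (rule ccontr)
      assume n: "x' \<notin> A"
      show False
        by (rule ext[of x' "f(x' := y)"]) (use y n that f in \<open>auto simp: inj_on_def\<close>)
    qed
    define P0 where "P0 = {a \<in> A. adj x (f a)}"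
    define Q0 where "Q0 = {a \<in> A. adj a y}"
    have "{y \<in> U. adj x y} \<subseteq> f ` P0" using nx by (auto simp: P0_def)
    then have "b \<le> card (f ` P0)"
      using degX[OF x(1)] card_mono[of "f ` P0" "{y \<in> U. adj x y}"] fA by (auto simp: P0_def)
    also have "card (f ` P0) \<le> card P0" using fA by (intro card_image_le) (simp add: P0_def)
    finally obtain X' where X': "X' \<subseteq> P0" "card X' = b" by (meson obtain_subset_with_card_n)
    have "{x \<in> X. adj x y} \<subseteq> Q0" using ny by (auto simp: Q0_def)
    then have "b \<le> card Q0"
      using degU[OF y(1)] card_mono[of Q0 "{x \<in> X. adj x y}"] fA by (auto simp: Q0_def)
    also have "card Q0 = card (f ` Q0)"
      by (rule card_image[symmetric], rule inj_on_subset[OF f(2)]) (auto simp: Q0_def)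
    finally obtain Y' where Y': "Y' \<subseteq> f ` Q0" "card Y' = b" by (meson obtain_subset_with_card_n)
    have "f ` Q0 \<subseteq> U" using f(3) by (auto simp: Q0_def)
    then have "X' \<subseteq> X" "Y' \<subseteq> U" using X' Y' f(1) by (auto simp: P0_def)
    from dense[OF this X'(2) Y'(2)] X' Y' obtain a a' where a: "a \<in> P0" "a' \<in> Q0" "adj a (f a')" by blast
    then have aA: "a \<in> A" "a' \<in> A" "adj x (f a)" "adj a' y" by (auto simp: P0_def Q0_def)
    \<comment> \<open>The matching is shifted along the path x, f a, a, f a', a', y. The order of
      the updates matters if \<open>a = a'\<close>: then the last one wins and the path is x, f a,
      a, y.\<close>
    define f' where "f' = f(x := f a, a := f a', a' := y)"
    have neq: "a \<noteq> x" "a' \<noteq> x" using aA x by auto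
    have inj: "f u = f v \<longleftrightarrow> u = v" if "u \<in> A" "v \<in> A" for u v
      using inj_on_eq_iff[OF f(2) that] .
    show False
    proof (rule ext[of x f'])
      show "x \<in> X - A" using x by simp
      show "inj_on f' (insert x A)"
      proof (cases "a = a'")
        case True
        then show ?thesis using x y aA neq inj unfolding f'_def inj_on_def by (auto split: if_splits)
      next
        case False
        then show ?thesis using x y aA neq inj unfolding f'_def inj_on_def by (auto split: if_splits)
      qed
      show "f' ` insert x A \<subseteq> U" using f(3) y aA unfolding f'_def by auto
      show "\<forall>z\<in>insert x A. adj z (f' z)" using f(4) a aA neq unfolding f'_def by auto
    qed
  qed
  moreover have "f ` A = U"
    using f(2,3) card fin card_image[OF f(2)] \<open>A = X\<close> by (intro card_subset_eq) auto
  ultimately show ?thesis using f unfolding bij_betw_def by blast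
qed

lemma bi_dense_flip:
  assumes "finite X" "finite Y" "bi_dense adj X Y b p"
  shows "bi_dense (\<lambda>y x. adj x y) Y X b p"
  unfolding bi_dense_def
proof (intro allI impI, elim conjE)
  fix Y' X' assume *: "Y' \<subseteq> Y" "X' \<subseteq> X" "card Y' = b" "card X' = b"
  then have "finite X'" "finite Y'" using assms(1,2) finite_subset by blast+
  then have "pair_count (\<lambda>y x. adj x y) Y' X' = pair_count adj X' Y'"
    using pair_count_swap[of X' Y' adj] by (simp add: pair_count_def)
  then show "p * (real b * real b) \<le> pair_count (\<lambda>y x. adj x y) Y' X'"
    using assms(3) * unfolding bi_dense_def by simp
qed

text \<open>Otherwise \<open>b\<close> vertices of low degree together with the \<open>b\<close>
  vertices of \<open>Y\<close> that are least adjacent to them would form a sparse spot.\<close>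

lemma bi_dense_few_low_degree:
  assumes fin: "finite X" "finite Y" and c: "card Y = a" "b \<le> a" "b \<ge> 1"
    and bd: "bi_dense adj X Y b p"
  shows "card {x \<in> X. real (card {y \<in> Y. adj x y}) < p * real a} < b"
proof (rule ccontr)
  let ?B = "{x \<in> X. real (card {y \<in> Y. adj x y}) < p * real a}"
  assume "\<not> card ?B < b"
  then obtain S where S: "S \<subseteq> ?B" "card S = b" "finite S"
    by (meson not_less obtain_subset_with_card_n)
  obtain Y' where Y': "Y' \<subseteq> Y" "card Y' = b" "real (card Y) * (\<Sum>y\<in>Y'. real (card {x \<in> S. adj x y}))
        \<le> real b * (\<Sum>y\<in>Y. real (card {x \<in> S. adj x y}))"
    using exists_light_subset[OF fin(2), of b "\<lambda>y. real (card {x \<in> S. adj x y})"] c by auto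
  have fY': "finite Y'" using Y'(1) fin(2) finite_subset by blast
  have "pair_count adj S Y < (\<Sum>x\<in>S. p * real a)"
    unfolding pair_count_def
  proof (rule sum_strict_mono)
    show "S \<noteq> {}" using S(2) c(3) by auto
  qed (use S in auto)
  then have "pair_count adj S Y < real b * (p * real a)" using S(2) by simp
  then have "real b * pair_count adj S Y < real b * (real b * (p * real a))" using c(3) by simp
  moreover have "real a * pair_count adj S Y' \<le> real b * pair_count adj S Y"
    using Y'(3) by (simp only: pair_count_swap[OF S(3)] fY' fin(2) c(1))
  moreover have "real b * (real b * (p * real a)) = real a * (p * (real b * real b))" by simp
  ultimately have "real a * pair_count adj S Y' < real a * (p * (real b * real b))" by linarith
  then have "pair_count adj S Y' < p * (real b * real b)" using c by simp
  moreover have "S \<subseteq> X" using S(1) by blast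
  then have "p * (real b * real b) \<le> pair_count adj S Y'"
    using bd S(2) Y'(1,2) unfolding bi_dense_def by simp
  ultimately show False by linarith
qed

lemma card_restrict_ge:
  assumes "finite Y" "U \<subseteq> Y" "x \<le> real (card {y \<in> Y. P y})" "real (card Y) - real (card U) \<le> z"
  shows "x - z \<le> real (card {y \<in> U. P y})"
proof -
  have "card {y \<in> Y. P y} \<le> card ({y \<in> U. P y} \<union> (Y - U))"
    using assms(1,2) finite_subset[OF assms(2,1)] by (intro card_mono) auto
  also have "\<dots> \<le> card {y \<in> U. P y} + card (Y - U)" by (rule card_Un_le)
  also have "card (Y - U) = card Y - card U"
    using assms(1,2) finite_subset by (intro card_Diff_subset) auto
  finally have "card {y \<in> Y. P y} \<le> card {y \<in> U. P y} + (card Y - card U)" .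
  moreover have "card U \<le> card Y" using assms(1,2) by (rule card_mono)
  ultimately show ?thesis using assms(3,4) by linarith
qed

text \<open>Inside a pair without sparse spots, vertices of low degree are dropped and
  \<open>X2\<close> is taken \<open>2 * b\<close> smaller than \<open>Y2\<close>. For any
  \<open>U\<close> of the right size, at most \<open>3 * b\<close> vertices of the pair are missing
  on either side, so all degrees stay at least \<open>b\<close> and
  \<open>exists_perfect_matching\<close> applies. The surplus \<open>w\<close> is linear in
  \<open>card X\<close>, which is the flexibility gained; its upper bound ensures that whatever is
  adjacent to a proportion \<open>\<gamma>\<close> of \<open>Y2\<close> survives the loss of
  \<open>w\<close> elements.\<close>

lemma exists_flexible_matching:
  fixes \<gamma> :: real
  assumes gam: "0 < \<gamma>" "\<gamma> \<le> 1"
  shows "\<exists>\<omega>>0. \<exists>q0. \<forall>(X :: 'a set) (Y :: 'b set) adj.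
     finite X \<and> finite Y \<and> q0 \<le> card X \<and> card X \<le> card Y \<and>
     (\<forall>x\<in>X. \<gamma> * real (card Y) \<le> real (card {y \<in> Y. adj x y})) \<longrightarrow>
     (\<exists>X2\<subseteq>X. \<exists>Y2\<subseteq>Y. \<exists>w. card Y2 = card X2 + w \<and> \<omega> * real (card X) \<le> real w \<and> real w \<le> \<gamma> / 2 * real (card Y2) \<and>
        (\<forall>U\<subseteq>Y2. card U = card X2 \<longrightarrow> (\<exists>f. bij_betw f X2 U \<and> (\<forall>x\<in>X2. adj x (f x)))))"
proof -
  \<comment> \<open>With \<open>b\<close> about \<open>\<epsilon> * a\<close>, the divisor 16 leaves
    room for \<open>4 * b \<le> \<gamma> * a / 2\<close>, the degree condition after losing
    \<open>3 * b\<close> vertices, and for \<open>5 * b \<le> \<gamma> * a\<close>, which gives the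
    bound on \<open>w\<close>.\<close>
  define \<epsilon> where "\<epsilon> = \<gamma> / 16"
  have eps: "0 < \<epsilon>" "\<epsilon> \<le> 1 / 4" using gam by (auto simp: \<epsilon>_def)
  obtain \<kappa> where kap: "\<kappa> > 0" "\<kappa> \<le> 1"
    and sub: "\<forall>(X :: 'a set) (Y :: 'b set) q adj. finite X \<and> finite Y \<and> card X = q \<and> card Y = q \<and>
    4 \<le> \<kappa> * real q \<and> \<gamma> * (real q * real q) \<le> pair_count adj X Y \<longrightarrow>
    (\<exists>X'\<subseteq>X. \<exists>Y'\<subseteq>Y. \<exists>a. card X' = a \<and> card Y' = a \<and> \<kappa> * real q \<le> real a \<and>
       bi_dense adj X' Y' (nat \<lceil>\<epsilon> * real a\<rceil>) (\<gamma> / 2))"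
    using exists_bi_dense_subpair[OF eps gam(1), where 'a = 'a and 'b = 'b] by (elim exE conjE) (rule that)
  \<comment> \<open>This yields \<open>20 \<le> \<gamma> * a\<close> below, which absorbs the
    rounding up in \<open>b\<close>.\<close>
  obtain q0 :: nat where q0: "20 / (\<gamma> * \<kappa>) \<le> real q0" using real_arch_simple by blast
  have om: "2 * \<epsilon> * \<kappa> > 0" using eps kap by simp
  show ?thesis
  proof (intro exI[of _ "2 * \<epsilon> * \<kappa>"] conjI om exI[of _ q0] allI impI, elim conjE)
    fix X :: "'a set" and Y :: "'b set" and adj
    assume fin: "finite X" "finite Y" and q: "q0 \<le> card X" "card X \<le> card Y"
      and deg: "\<forall>x\<in>X. \<gamma> * real (card Y) \<le> real (card {y \<in> Y. adj x y})"
    define q where "q = card X"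
    have "20 / (\<gamma> * \<kappa>) \<le> real q" using q0 q by (simp add: q_def)
    then have q20: "20 \<le> \<gamma> * (\<kappa> * real q)" using gam kap by (simp add: field_simps)
    have "\<gamma> * (\<kappa> * real q) \<le> 1 * (\<kappa> * real q)" using gam kap by (intro mult_right_mono) auto
    then have q4: "4 \<le> \<kappa> * real q" using q20 by linarith
    then have qpos: "q > 0" by (cases "q = 0") auto
    obtain Y1 where Y1: "Y1 \<subseteq> Y" "card Y1 = q" "real q * pair_count adj X Y \<le> real (card Y) * pair_count adj X Y1"
    proof -
      obtain Y1 where Y1: "Y1 \<subseteq> Y" "card Y1 = q" "real q * (\<Sum>y\<in>Y. real (card {x \<in> X. adj x y}))
          \<le> real (card Y) * (\<Sum>y\<in>Y1. real (card {x \<in> X. adj x y}))"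
        using exists_heavy_subset[OF fin(2), of q "\<lambda>y. real (card {x \<in> X. adj x y})"] q by (auto simp: q_def)
      have "finite Y1" using Y1(1) fin(2) finite_subset by blast
      then show ?thesis using that[OF Y1(1,2)] Y1(3) by (simp only: pair_count_swap[OF fin(1)] fin(2))
    qed
    have fY1: "finite Y1" using Y1(1) fin(2) finite_subset by blast
    have "(\<Sum>x\<in>X. \<gamma> * real (card Y)) \<le> pair_count adj X Y"
      unfolding pair_count_def by (rule sum_mono) (use deg in auto)
    then have "real q * (real q * (\<gamma> * real (card Y))) \<le> real q * pair_count adj X Y"
      by (intro mult_left_mono) (auto simp: q_def)
    then have "real (card Y) * (\<gamma> * (real q * real q)) \<le> real (card Y) * pair_count adj X Y1"
      using Y1(3) by (simp add: algebra_simps)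
    moreover have "real (card Y) > 0" using qpos q by (simp add: q_def)
    ultimately have "\<gamma> * (real q * real q) \<le> pair_count adj X Y1" by simp
    then have "\<exists>X'\<subseteq>X. \<exists>Y'\<subseteq>Y1. \<exists>a. card X' = a \<and> card Y' = a \<and> \<kappa> * real q \<le> real a \<and>
       bi_dense adj X' Y' (nat \<lceil>\<epsilon> * real a\<rceil>) (\<gamma> / 2)"
      using fin(1) fY1 q_def Y1(2) q4 by (intro sub[rule_format]) simp
    then obtain X' Y' a where X': "X' \<subseteq> X" "card X' = a" and Y': "Y' \<subseteq> Y1" "card Y' = a"
      and aq: "\<kappa> * real q \<le> real a" and bd: "bi_dense adj X' Y' (nat \<lceil>\<epsilon> * real a\<rceil>) (\<gamma> / 2)" by blast
    have fX': "finite X'" and fY': "finite Y'" using X' Y' fin fY1 finite_subset by blast+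
    define b where "b = nat \<lceil>\<epsilon> * real a\<rceil>"
    have "\<gamma> * (\<kappa> * real q) \<le> \<gamma> * real a" using aq gam by simp
    then have ga: "20 \<le> \<gamma> * real a" using q20 by linarith
    have bd': "bi_dense adj X' Y' b (\<gamma> / 2)" using bd by (simp only: b_def)
    have ga': "\<gamma> * real a \<le> real a" using gam by (simp add: mult_left_le_one_le)
    have ea: "\<epsilon> * real a = \<gamma> * real a / 16" by (simp add: \<epsilon>_def)
    have "0 \<le> \<epsilon> * real a" using ea ga by linarith
    then have "0 \<le> \<lceil>\<epsilon> * real a\<rceil>" by simp
    then have "real b = real_of_int \<lceil>\<epsilon> * real a\<rceil>" by (simp add: b_def)
    then have b: "\<epsilon> * real a \<le> real b" "real b < \<epsilon> * real a + 1" by linarith+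
    have b1: "1 \<le> b" using b ea ga by linarith
    have b4: "4 * real b \<le> \<gamma> * real a / 2" using b ea ga by linarith
    have b5: "5 * real b \<le> \<gamma> * real a" using b ea ga by linarith
    have ba: "3 * b \<le> a" using b4 ga' by linarith
    define BX where "BX = {x \<in> X'. real (card {y \<in> Y'. adj x y}) < \<gamma> / 2 * real a}"
    define BY where "BY = {y \<in> Y'. real (card {x \<in> X'. adj x y}) < \<gamma> / 2 * real a}"
    have BX: "card BX < b" unfolding BX_def
      by (rule bi_dense_few_low_degree[OF fX' fY' Y'(2)]) (use ba b1 bd' in auto)
    have BY: "card BY < b" unfolding BY_def
      by (rule bi_dense_few_low_degree[OF fY' fX' X'(2) _ _ bi_dense_flip[OF fX' fY']]) (use ba b1 bd' in auto)
    define Y2 where "Y2 = Y' - BY"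
    have cY2: "card Y2 = a - card BY" unfolding Y2_def
      using fY' Y'(2) by (subst card_Diff_subset) (auto simp: BY_def intro: finite_subset)
    have "card (X' - BX) = a - card BX"
      using fX' X'(2) by (subst card_Diff_subset) (auto simp: BX_def intro: finite_subset)
    then have "card Y2 - 2 * b \<le> card (X' - BX)" using cY2 BX by linarith
    then obtain X2 where X2: "X2 \<subseteq> X' - BX" "card X2 = card Y2 - 2 * b" by (meson obtain_subset_with_card_n)
    have Y2b: "a - b \<le> card Y2" "2 * b \<le> card Y2" using cY2 BY ba by linarith+
    have match: "\<exists>f. bij_betw f X2 U \<and> (\<forall>x\<in>X2. adj x (f x))" if U: "U \<subseteq> Y2" "card U = card X2" for U
    proof (rule exists_perfect_matching[where b = b])
      have sz: "real a - real (card X2) \<le> 3 * real b" using X2(2) Y2b by linarith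
      have UY: "U \<subseteq> Y'" using U(1) by (auto simp: Y2_def)
      have XX: "X2 \<subseteq> X'" using X2(1) by blast
      show "finite X2" "finite U" using XX UY fX' fY' finite_subset by blast+
      show "card X2 = card U" using U(2) by simp
      show "b \<le> card {y \<in> U. adj x y}" if "x \<in> X2" for x
      proof -
        have "x \<in> X'" "x \<notin> BX" using that X2(1) by auto
        then have "\<gamma> / 2 * real a \<le> real (card {y \<in> Y'. adj x y})" by (simp add: BX_def not_less)
        from card_restrict_ge[OF fY' UY this, of "3 * real b"] show ?thesis using sz b4 U(2) Y'(2) by simp
      qed
      show "b \<le> card {x \<in> X2. adj x y}" if "y \<in> U" for y
      proof -
        have "y \<in> Y'" "y \<notin> BY" using that U(1) by (auto simp: Y2_def)
        then have "\<gamma> / 2 * real a \<le> real (card {x \<in> X'. adj x y})" by (simp add: BY_def not_less)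
        from card_restrict_ge[OF fX' XX this, of "3 * real b"] show ?thesis using sz b4 X'(2) by simp
      qed
      show "\<exists>x\<in>X''. \<exists>y\<in>Y''. adj x y" if "X'' \<subseteq> X2" "Y'' \<subseteq> U" "card X'' = b" "card Y'' = b" for X'' Y''
      proof (rule ccontr)
        assume none: "\<not> ?thesis"
        have "pair_count adj X'' Y'' = 0" unfolding pair_count_def
        proof (rule sum.neutral, rule ballI)
          fix x assume "x \<in> X''"
          then have "{y \<in> Y''. adj x y} = {}" using none by blast
          then show "real (card {y \<in> Y''. adj x y}) = 0" by (simp only: card.empty of_nat_0)
        qed
        moreover have "\<gamma> / 2 * (real b * real b) \<le> pair_count adj X'' Y''"
        proof -
          have "X'' \<subseteq> X'" "Y'' \<subseteq> Y'" using that(1,2) XX UY by blast+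
          then show ?thesis using bd' that(3,4) unfolding bi_dense_def by blast
        qed
        moreover have "\<gamma> / 2 * (real b * real b) > 0" using gam b1 by simp
        ultimately show False by linarith
      qed
    qed
    have c1: "card Y2 = card X2 + 2 * b" using X2(2) Y2b(2) by simp
    have c2: "2 * \<epsilon> * \<kappa> * real (card X) \<le> real (2 * b)"
    proof -
      have "\<epsilon> * (\<kappa> * real q) \<le> \<epsilon> * real a" using aq eps by simp
      then show ?thesis using b(1) by (simp add: q_def)
    qed
    have c3: "real (2 * b) \<le> \<gamma> / 2 * real (card Y2)"
    proof -
      have "\<gamma> * (real a - real b) \<le> \<gamma> * real (card Y2)" using Y2b(1) gam by (intro mult_left_mono) linarith+
      moreover have "\<gamma> * real b \<le> real b" using gam by (simp add: mult_left_le_one_le)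
      ultimately show ?thesis using b5 by (simp add: algebra_simps)
    qed
    have "X2 \<subseteq> X" "Y2 \<subseteq> Y" using X2(1) X'(1) Y'(1) Y1(1) by (auto simp: Y2_def)
    with c1 c2 c3 match show "\<exists>X2\<subseteq>X. \<exists>Y2\<subseteq>Y. \<exists>w. card Y2 = card X2 + w \<and> 2 * \<epsilon> * \<kappa> * real (card X) \<le> real w \<and>
        real w \<le> \<gamma> / 2 * real (card Y2) \<and>
        (\<forall>U\<subseteq>Y2. card U = card X2 \<longrightarrow> (\<exists>f. bij_betw f X2 U \<and> (\<forall>x\<in>X2. adj x (f x))))"
      by (intro exI[of _ X2] exI[of _ Y2] exI[of _ "2 * b"] conjI allI impI) assumption+
  qed
qed

section \<open>Degrees into a vertex set\<close>

definition uniform_edges :: "nat \<Rightarrow> 'a set \<Rightarrow> 'a set set \<Rightarrow> bool" where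
  "uniform_edges k V E \<longleftrightarrow> (\<forall>e\<in>E. e \<subseteq> V \<and> card e = k)"

text \<open>\<open>D\<close> ranges over all of \<open>V\<close>, whereas the other \<open>p\<close>
  vertices come from \<open>S\<close>. In this form the condition passes to a random part of
  \<open>S\<close>, and it survives the addition of a few vertices of \<open>V\<close> to
  \<open>S\<close>, such as the ends of chains that are to be connected.\<close>

definition degree_into :: "nat \<Rightarrow> nat \<Rightarrow> 'a set \<Rightarrow> 'a set set \<Rightarrow> 'a set \<Rightarrow> real \<Rightarrow> bool" where
  "degree_into d p V E S x \<longleftrightarrow>
     (\<forall>D\<subseteq>V. card D = d \<longrightarrow> x * real (card S) ^ p \<le> real (card {e \<in> E. D \<subseteq> e \<and> e - D \<subseteq> S}))"

definition popular_edges :: "real \<Rightarrow> nat \<Rightarrow> 'a set \<Rightarrow> (nat \<Rightarrow> 'a set set) \<Rightarrow> nat set \<Rightarrow> 'a set set" where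
  "popular_edges \<gamma> k V H R = {e. e \<subseteq> V \<and> card e = k \<and> \<gamma> * real (card R) \<le> real (card {c \<in> R. e \<in> H c})}"

lemma uniform_popular_edges: "uniform_edges k V (popular_edges \<gamma> k V H R)"
  by (simp add: uniform_edges_def popular_edges_def)

lemma finite_uniform_edges: "finite V \<Longrightarrow> uniform_edges k V E \<Longrightarrow> finite E"
  by (rule finite_subset[of _ "Pow V"]) (auto simp: uniform_edges_def)

lemma card_extensions_le:
  assumes "finite S" "card D = d" "finite D"
  shows "card {e. D \<subseteq> e \<and> e - D \<subseteq> S \<and> card e = d + p} \<le> card S ^ p"
    "finite {e. D \<subseteq> e \<and> e - D \<subseteq> S \<and> card e = d + p}"
proof -
  let ?T = "{e. D \<subseteq> e \<and> e - D \<subseteq> S \<and> card e = d + p}"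
  show fin: "finite ?T" by (rule finite_subset[of _ "Pow (D \<union> S)"]) (use assms in auto)
  have "card ?T \<le> card {T. T \<subseteq> S \<and> card T = p}"
  proof (rule card_inj_on_le[where f = "\<lambda>e. e - D"])
    show "inj_on (\<lambda>e. e - D) ?T" by (rule inj_onI) blast
    show "(\<lambda>e. e - D) ` ?T \<subseteq> {T. T \<subseteq> S \<and> card T = p}"
      using assms by (auto simp: card_Diff_subset)
    show "finite {T. T \<subseteq> S \<and> card T = p}" using assms by simp
  qed
  also have "\<dots> \<le> card S ^ p" by (rule card_subsets_le[OF assms(1)])
  finally show "card ?T \<le> card S ^ p" .
qed

lemma degree_into_min_degree:
  assumes "uniform_hypergraph k H" "verts H = V" "x * real (card V) ^ p \<le> real (min_degree d H)"
  shows "degree_into d p V (edges H) V x"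
  unfolding degree_into_def
proof (intro allI impI)
  fix D assume D: "D \<subseteq> V" "card D = d"
  have fin: "finite V" and E: "\<And>e. e \<in> edges H \<Longrightarrow> e \<subseteq> V" using assms by (auto simp: uniform_hypergraph_def)
  have "finite {D. D \<subseteq> verts H \<and> card D = d}" using fin assms(2) by simp
  then have "min_degree d H \<le> card {e \<in> edges H. D \<subseteq> e}"
    unfolding min_degree_def using D assms(2) by (intro Min_le) auto
  also have "{e \<in> edges H. D \<subseteq> e} = {e \<in> edges H. D \<subseteq> e \<and> e - D \<subseteq> V}" using E by auto
  finally show "x * real (card V) ^ p \<le> real (card {e \<in> edges H. D \<subseteq> e \<and> e - D \<subseteq> V})"
    using assms(3) by linarith
qed

text \<open>Degree conditions with density above 1 are vacuous. This disposes of the range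
  \<open>\<delta>0 + \<alpha> > 1\<close> in the theorem and shows that the density 1 suffices for
  Hamilton cycles.\<close>

lemma degree_into_le_one:
  assumes fin: "finite V" "V \<noteq> {}" "d \<le> card V" and unif: "uniform_edges (d + p) V E"
    and deg: "degree_into d p V E V x"
  shows "x \<le> 1"
proof -
  obtain D where D: "D \<subseteq> V" "card D = d" "finite D"
    using obtain_subset_with_card_n[OF fin(3)] by blast
  have "x * real (card V) ^ p \<le> real (card {e \<in> E. D \<subseteq> e \<and> e - D \<subseteq> V})"
    using deg D unfolding degree_into_def by blast
  also have "card {e \<in> E. D \<subseteq> e \<and> e - D \<subseteq> V} \<le> card {e. D \<subseteq> e \<and> e - D \<subseteq> V \<and> card e = d + p}"
    using unif card_extensions_le(2)[OF fin(1) D(2,3)] by (intro card_mono) (auto simp: uniform_edges_def)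
  also have "\<dots> \<le> card V ^ p" by (rule card_extensions_le(1)[OF fin(1) D(2,3)])
  finally have "x * real (card V) ^ p \<le> 1 * real (card V) ^ p" by simp
  moreover have "real (card V) ^ p > 0" using fin by (simp add: card_gt_0_iff)
  ultimately show ?thesis by (simp only: mult_le_cancel_right_pos)
qed

lemma min_degree_geI:
  assumes "finite T" "d \<le> card T" "\<And>D. D \<subseteq> T \<Longrightarrow> card D = d \<Longrightarrow> x \<le> real (card {e \<in> E. D \<subseteq> e})"
  shows "x \<le> real (min_degree d (T, E))"
proof -
  let ?D = "{D. D \<subseteq> T \<and> card D = d}"
  have "finite ?D" using assms(1) by simp
  moreover have "?D \<noteq> {}" using obtain_subset_with_card_n[OF assms(2)] by blast
  ultimately have "min_degree d (T, E) \<in> (\<lambda>D. card {e \<in> E. D \<subseteq> e}) ` ?D"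
    unfolding min_degree_def by (auto intro!: Min_in)
  then show ?thesis using assms(3) by auto
qed

lemma min_degree_host:
  assumes fin: "finite T" "T \<subseteq> V" "d \<le> card T" and deg: "degree_into d p V E T x"
    and E': "finite E'" "\<And>e. e \<in> E \<Longrightarrow> e \<subseteq> T \<Longrightarrow> e \<in> E'"
  shows "x * real (card T) ^ p \<le> real (min_degree d (T, E'))"
proof (rule min_degree_geI[OF fin(1,3)])
  fix D assume D: "D \<subseteq> T" "card D = d"
  have "x * real (card T) ^ p \<le> real (card {e \<in> E. D \<subseteq> e \<and> e - D \<subseteq> T})"
    using deg D fin(2) unfolding degree_into_def by blast
  also have "card {e \<in> E. D \<subseteq> e \<and> e - D \<subseteq> T} \<le> card {e \<in> E'. D \<subseteq> e}"
    using E' D(1) by (intro card_mono) auto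
  finally show "x * real (card T) ^ p \<le> real (card {e \<in> E'. D \<subseteq> e})" by simp
qed

text \<open>\<open>card_popular_ge\<close> is applied to the extensions of \<open>D\<close> into
  \<open>S\<close>; as there are at most \<open>card S ^ p\<close> of them, the loss in density is
  at most \<open>\<gamma>\<close>.\<close>

lemma degree_into_popular:
  assumes fin: "finite V" "S \<subseteq> V" and R: "finite R" "R \<noteq> {}" and gam: "\<gamma> \<ge> 0"
    and unif: "\<And>c. c \<in> R \<Longrightarrow> uniform_edges (d + p) V (H c)"
    and deg: "\<And>c. c \<in> R \<Longrightarrow> degree_into d p V (H c) S x"
  shows "degree_into d p V (popular_edges \<gamma> (d + p) V H R) S (x - \<gamma>)"
  unfolding degree_into_def
proof (intro allI impI)
  fix D assume D: "D \<subseteq> V" "card D = d"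
  let ?T = "{e. D \<subseteq> e \<and> e - D \<subseteq> S \<and> card e = d + p}"
  have fS: "finite S" "finite D" using fin D finite_subset by blast+
  note T = card_extensions_le[OF fS(1) D(2) fS(2), of p]
  have "x * real (card S) ^ p - \<gamma> * real (card ?T)
      \<le> real (card {e \<in> ?T. \<gamma> * real (card R) \<le> real (card {c \<in> R. e \<in> H c})})"
  proof (rule card_popular_ge[OF R T(2) gam])
    fix c assume c: "c \<in> R"
    have eq: "{e \<in> H c. D \<subseteq> e \<and> e - D \<subseteq> S} = {e \<in> ?T. e \<in> H c}"
      using unif[OF c] by (auto simp: uniform_edges_def)
    show "x * real (card S) ^ p \<le> real (card {e \<in> ?T. e \<in> H c})"
      unfolding eq[symmetric] using deg[OF c] D unfolding degree_into_def by blast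
  qed
  moreover have "\<gamma> * real (card ?T) \<le> \<gamma> * real (card S) ^ p"
    using T(1) gam by (intro mult_left_mono) (simp_all flip: of_nat_power)
  moreover have "{e \<in> ?T. \<gamma> * real (card R) \<le> real (card {c \<in> R. e \<in> H c})}
      = {e \<in> popular_edges \<gamma> (d + p) V H R. D \<subseteq> e \<and> e - D \<subseteq> S}"
    using D fin(2) by (auto simp: popular_edges_def)
  ultimately show "(x - \<gamma>) * real (card S) ^ p
      \<le> real (card {e \<in> popular_edges \<gamma> (d + p) V H R. D \<subseteq> e \<and> e - D \<subseteq> S})"
    by (simp add: algebra_simps)
qed

lemma power_one_plus_le:
  fixes \<xi> :: real
  assumes "0 \<le> \<xi>" "\<xi> \<le> 1"
  shows "(1 + \<xi>) ^ p \<le> 1 + 3 ^ p * \<xi>"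
proof (induction p)
  case (Suc p)
  have "(1 + \<xi>) ^ Suc p \<le> (1 + \<xi>) * (1 + 3 ^ p * \<xi>)"
    using mult_left_mono[OF Suc, of "1 + \<xi>"] assms by simp
  also have "\<dots> = 1 + \<xi> + 3 ^ p * \<xi> + 3 ^ p * \<xi> * \<xi>" by (simp add: algebra_simps)
  also have "\<dots> \<le> 1 + 3 ^ p * \<xi> + 3 ^ p * \<xi> + 3 ^ p * \<xi>"
  proof -
    have "3 ^ p * \<xi> * \<xi> \<le> 3 ^ p * \<xi> * 1" using assms by (intro mult_left_mono) auto
    moreover have "1 * \<xi> \<le> 3 ^ p * \<xi>" using assms by (intro mult_right_mono) auto
    ultimately show ?thesis by linarith
  qed
  also have "\<dots> = 1 + 3 ^ Suc p * \<xi>" by simp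
  finally show ?case .
qed (use assms in simp)

text \<open>A proportion of vertices that may be exchanged at the cost of at most \<open>a\<close>
  in the degree density: \<open>3 ^ p\<close> bounds the effect of a larger set on the
  normalisation, through \<open>power_one_plus_le\<close>, and the 1 stands for the edges
  lost.\<close>

definition slack :: "nat \<Rightarrow> real \<Rightarrow> real" where
  "slack p a = min (a / (3 ^ p + 1)) (1 / 2)"

lemma slack:
  assumes "a > 0"
  shows "0 < slack p a" "slack p a \<le> 1 / 2"
    "\<And>x. 0 \<le> x \<Longrightarrow> x \<le> 1 \<Longrightarrow> x * (1 + slack p a) ^ p \<le> x + a - slack p a"
proof -
  let ?\<xi> = "slack p a"
  have three: "(0::real) < 3 ^ p + 1" by (simp add: add_pos_pos)
  show pos: "0 < ?\<xi>" using assms three by (simp add: slack_def)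
  show half: "?\<xi> \<le> 1 / 2" unfolding slack_def by (rule min.cobounded2)
  have "?\<xi> \<le> a / (3 ^ p + 1)" by (simp add: slack_def)
  then have xa: "3 ^ p * ?\<xi> + ?\<xi> \<le> a" using three by (simp add: pos_le_divide_eq algebra_simps)
  fix x :: real assume x: "0 \<le> x" "x \<le> 1"
  have "x * (1 + ?\<xi>) ^ p \<le> x * (1 + 3 ^ p * ?\<xi>)"
    using power_one_plus_le[of ?\<xi> p] pos half x by (intro mult_left_mono) auto
  also have "\<dots> = x + x * (3 ^ p * ?\<xi>)" by (simp add: algebra_simps)
  also have "x * (3 ^ p * ?\<xi>) \<le> 1 * (3 ^ p * ?\<xi>)" using x pos by (intro mult_right_mono) auto
  finally show "x * (1 + ?\<xi>) ^ p \<le> x + a - ?\<xi>" using xa by linarith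
qed

text \<open>Losing \<open>S - S'\<close> destroys at most
  \<open>card (S - S') * card S ^ (p - 1)\<close> extensions of each \<open>D\<close>; new vertices
  do harm only through the normalisation by \<open>card S'\<close>.\<close>

lemma degree_into_change:
  assumes fin: "finite V" "S \<subseteq> V" and S': "finite S'" and p: "p \<ge> 1" and a: "a > 0" and x: "0 \<le> x" "x \<le> 1"
    and unif: "uniform_edges (d + p) V E"
    and lost: "real (card (S - S')) \<le> slack p a * real (card S)"
    and card: "real (card S') \<le> (1 + slack p a) * real (card S)"
    and deg: "degree_into d p V E S (x + a)"
  shows "degree_into d p V E S' x"
  unfolding degree_into_def
proof (intro allI impI)
  fix D assume D: "D \<subseteq> V" "card D = d"
  let ?\<xi> = "slack p a"
  let ?n = "real (card S)"
  have fS: "finite S" "finite D" using fin D finite_subset by blast+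
  have fE: "finite E" by (rule finite_uniform_edges[OF fin(1) unif])
  have lose: "card {e \<in> E. D \<subseteq> e \<and> e - D \<subseteq> S \<and> (e - D) \<inter> (S - S') \<noteq> {}} \<le> card (S - S') * card S ^ (p - 1)"
  proof -
    have "card {e \<in> E. D \<subseteq> e \<and> e - D \<subseteq> S \<and> (e - D) \<inter> (S - S') \<noteq> {}}
        \<le> card {T. T \<subseteq> S \<and> card T = p \<and> T \<inter> (S - S') \<noteq> {}}"
    proof (rule card_inj_on_le[where f = "\<lambda>e. e - D"])
      show "inj_on (\<lambda>e. e - D) {e \<in> E. D \<subseteq> e \<and> e - D \<subseteq> S \<and> (e - D) \<inter> (S - S') \<noteq> {}}"
        by (rule inj_onI) blast
      show "(\<lambda>e. e - D) ` {e \<in> E. D \<subseteq> e \<and> e - D \<subseteq> S \<and> (e - D) \<inter> (S - S') \<noteq> {}}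
          \<subseteq> {T. T \<subseteq> S \<and> card T = p \<and> T \<inter> (S - S') \<noteq> {}}"
        using unif D fS by (auto simp: uniform_edges_def card_Diff_subset)
      show "finite {T. T \<subseteq> S \<and> card T = p \<and> T \<inter> (S - S') \<noteq> {}}" using fS by simp
    qed
    also have "\<dots> \<le> card (S - S') * card S ^ (p - 1)"
      by (rule card_subsets_meeting_le[OF fS(1) p]) auto
    finally show ?thesis .
  qed
  have "{e \<in> E. D \<subseteq> e \<and> e - D \<subseteq> S} \<subseteq> {e \<in> E. D \<subseteq> e \<and> e - D \<subseteq> S'} \<union>
      {e \<in> E. D \<subseteq> e \<and> e - D \<subseteq> S \<and> (e - D) \<inter> (S - S') \<noteq> {}}" by auto
  then have "card {e \<in> E. D \<subseteq> e \<and> e - D \<subseteq> S} \<le> card ({e \<in> E. D \<subseteq> e \<and> e - D \<subseteq> S'} \<union>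
      {e \<in> E. D \<subseteq> e \<and> e - D \<subseteq> S \<and> (e - D) \<inter> (S - S') \<noteq> {}})"
    using fE by (intro card_mono) auto
  also have "\<dots> \<le> card {e \<in> E. D \<subseteq> e \<and> e - D \<subseteq> S'} + card (S - S') * card S ^ (p - 1)"
    using card_Un_le lose by (rule order_trans[OF _ add_left_mono])
  finally have "real (card {e \<in> E. D \<subseteq> e \<and> e - D \<subseteq> S})
      \<le> real (card {e \<in> E. D \<subseteq> e \<and> e - D \<subseteq> S'}) + real (card (S - S')) * ?n ^ (p - 1)"
    by (simp only: of_nat_add[symmetric] of_nat_mult[symmetric] of_nat_power[symmetric] of_nat_le_iff)
  moreover have "(x + a) * ?n ^ p \<le> real (card {e \<in> E. D \<subseteq> e \<and> e - D \<subseteq> S})"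
    using deg D unfolding degree_into_def by blast
  moreover have "real (card (S - S')) * ?n ^ (p - 1) \<le> ?\<xi> * ?n ^ p"
  proof -
    have "real (card (S - S')) * ?n ^ (p - 1) \<le> (?\<xi> * ?n) * ?n ^ (p - 1)"
      by (rule mult_right_mono[OF lost]) simp
    also have "\<dots> = ?\<xi> * ?n ^ p" using p by (cases p) auto
    finally show ?thesis .
  qed
  moreover have "x * real (card S') ^ p \<le> (x + a - ?\<xi>) * ?n ^ p"
  proof -
    have "x * real (card S') ^ p \<le> x * ((1 + ?\<xi>) * ?n) ^ p"
      using card x by (intro mult_left_mono power_mono) auto
    also have "\<dots> = (x * (1 + ?\<xi>) ^ p) * ?n ^ p" by (simp add: power_mult_distrib)
    also have "\<dots> \<le> (x + a - ?\<xi>) * ?n ^ p"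
      by (intro mult_right_mono slack(3)[OF a]) (use slack[OF a, of p] x in auto)
    finally show ?thesis .
  qed
  ultimately show "x * real (card S') ^ p \<le> real (card {e \<in> E. D \<subseteq> e \<and> e - D \<subseteq> S'})"
    by (simp add: algebra_simps)
qed

text \<open>This is \<open>exists_balanced_partition\<close> for the links \<open>F (c, D)\<close>
  of all \<open>d\<close>-sets \<open>D\<close> in all hypergraphs. The bounds on \<open>M\<close>
  and \<open>card V\<close> keep their number below a fixed power of \<open>card S\<close>.\<close>

lemma exists_degree_partition:
  fixes x a \<epsilon> :: real
  assumes p: "p \<ge> 1" and s: "s \<ge> 1" and a: "a > 0" and eps: "\<epsilon> > 0" and x: "0 \<le> x" "x \<le> 1"
  shows "\<exists>n0. \<forall>(V :: 'a set) S M H. finite V \<and> S \<subseteq> V \<and> n0 \<le> card S \<and> card V \<le> 2 * card S \<and> M \<le> card S ^ 2 \<and>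
     (\<forall>c<M. uniform_edges (d + p) V (H c) \<and> degree_into d p V (H c) S (x + a)) \<longrightarrow>
     (\<exists>W. (\<forall>j<s. W j \<subseteq> S \<and> real (card S) / real s - \<epsilon> * real (card S) \<le> real (card (W j)) \<and>
              real (card (W j)) \<le> real (card S) / real s + \<epsilon> * real (card S)) \<and>
          (\<forall>i<s. \<forall>j<s. i \<noteq> j \<longrightarrow> W i \<inter> W j = {}) \<and>
          (\<forall>j<s. \<forall>c<M. degree_into d p V (H c) (W j) x))"
proof -
  define \<xi> where "\<xi> = slack p a"
  have xi: "0 < \<xi>" "\<xi> \<le> 1 / 2" unfolding \<xi>_def using slack[OF a] by auto
  \<comment> \<open>A part contains only a \<open>1 / s ^ p\<close> share of the
    \<open>p\<close>-sets, so an error \<open>\<xi>\<close> relative to a part is an error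
    \<open>\<xi> / s ^ p\<close> relative to \<open>S\<close>.\<close>
  define e1 where "e1 = min \<epsilon> (\<xi> / real s ^ p)"
  have e1: "0 < e1" "e1 \<le> \<epsilon>" "e1 * real s ^ p \<le> \<xi>" using eps xi s by (auto simp: e1_def min_def field_simps)
  have e1s: "e1 * real s \<le> \<xi>"
  proof -
    have "real s ^ 1 \<le> real s ^ p" using p s by (intro power_increasing) auto
    then have "e1 * real s \<le> e1 * real s ^ p" using e1 by (intro mult_left_mono) auto
    then show ?thesis using e1(3) by linarith
  qed
  obtain n0 where part: "\<forall>(S :: 'a set) (I :: (nat \<times> 'a set) set) F.
    finite S \<and> card S \<ge> n0 \<and> finite I \<and> card I \<le> card S ^ (2 + 2 * d) \<and>
    (\<forall>i\<in>I. F i \<subseteq> {T. T \<subseteq> S \<and> card T = p}) \<longrightarrow>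
    (\<exists>g. (\<forall>v\<in>S. g v < s) \<and>
      (\<forall>j<s. real (card S) / real s - e1 * real (card S) \<le> real (card {v \<in> S. g v = j}) \<and>
             real (card {v \<in> S. g v = j}) \<le> real (card S) / real s + e1 * real (card S) \<and>
        (\<forall>i\<in>I. real (card (F i)) / real s ^ p - e1 * real (card S) ^ p
                  \<le> real (card {T \<in> F i. \<forall>v\<in>T. g v = j}))))"
    using exists_balanced_partition[OF p s e1(1), where 'a = 'a and 'i = "nat \<times> 'a set", of "2 + 2 * d"]
    by (elim exE) (rule that)
  show ?thesis
  proof (intro exI[of _ "max n0 2"] allI impI, elim conjE)
    fix V S :: "'a set" and M and H :: "nat \<Rightarrow> 'a set set"
    assume fin: "finite V" "S \<subseteq> V" and n: "max n0 2 \<le> card S" and VS: "card V \<le> 2 * card S" and M: "M \<le> card S ^ 2"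
      and H: "\<forall>c<M. uniform_edges (d + p) V (H c) \<and> degree_into d p V (H c) S (x + a)"
    have fS: "finite S" using fin finite_subset by blast
    define I where "I = {..<M} \<times> {D. D \<subseteq> V \<and> card D = d}"
    define F where "F z = (\<lambda>e. e - snd z) ` {e \<in> H (fst z). snd z \<subseteq> e \<and> e - snd z \<subseteq> S}" for z :: "nat \<times> 'a set"
    have fI: "finite I" using fin by (simp add: I_def)
    have cI: "card I \<le> card S ^ (2 + 2 * d)"
    proof -
      have "card I = M * card {D. D \<subseteq> V \<and> card D = d}" by (simp add: I_def card_cartesian_product)
      also have "\<dots> \<le> card S ^ 2 * (card V ^ d)"
        using M card_subsets_le[OF fin(1)] by (rule mult_le_mono)
      also have "\<dots> \<le> card S ^ 2 * ((card S * card S) ^ d)"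
      proof (intro mult_left_mono power_mono)
        have "2 * card S \<le> card S * card S" using n by (intro mult_right_mono) auto
        then show "card V \<le> card S * card S" using VS by linarith
      qed auto
      also have "\<dots> = card S ^ (2 + 2 * d)" by (simp add: power_add power_mult power2_eq_square)
      finally show ?thesis .
    qed
    have FS: "\<forall>i\<in>I. F i \<subseteq> {T. T \<subseteq> S \<and> card T = p}"
    proof
      fix z assume "z \<in> I"
      then obtain c D where z: "z = (c, D)" "c < M" "D \<subseteq> V" "card D = d" by (auto simp: I_def)
      then have "finite D" using fin finite_subset by blast
      moreover have "uniform_edges (d + p) V (H c)" using H z by blast
      ultimately show "F z \<subseteq> {T. T \<subseteq> S \<and> card T = p}"
        using z by (auto simp: F_def uniform_edges_def card_Diff_subset)
    qed
    have "\<exists>g. (\<forall>v\<in>S. g v < s) \<and>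
      (\<forall>j<s. real (card S) / real s - e1 * real (card S) \<le> real (card {v \<in> S. g v = j}) \<and>
             real (card {v \<in> S. g v = j}) \<le> real (card S) / real s + e1 * real (card S) \<and>
        (\<forall>i\<in>I. real (card (F i)) / real s ^ p - e1 * real (card S) ^ p
                  \<le> real (card {T \<in> F i. \<forall>v\<in>T. g v = j})))"
      by (rule part[rule_format]) (use fS fI cI FS n in auto)
    then obtain g where size: "\<And>j. j < s \<Longrightarrow> real (card S) / real s - e1 * real (card S) \<le> real (card {v \<in> S. g v = j})"
        "\<And>j. j < s \<Longrightarrow> real (card {v \<in> S. g v = j}) \<le> real (card S) / real s + e1 * real (card S)"
      and F: "\<And>i j. j < s \<Longrightarrow> i \<in> I \<Longrightarrow> real (card (F i)) / real s ^ p - e1 * real (card S) ^ p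
                  \<le> real (card {T \<in> F i. \<forall>v\<in>T. g v = j})" by auto
    define W where "W j = {v \<in> S. g v = j}" for j
    have e1S: "e1 * real (card S) \<le> \<epsilon> * real (card S)" using e1 by (intro mult_right_mono) auto
    have "degree_into d p V (H c) (W j) x" if j: "j < s" and c: "c < M" for j c
      unfolding degree_into_def
    proof (intro allI impI)
      fix D assume D: "D \<subseteq> V" "card D = d"
      let ?n = "real (card S)"
      have cD: "(c, D) \<in> I" using c D by (simp add: I_def)
      have inj: "inj_on (\<lambda>e. e - D) {e \<in> H c. D \<subseteq> e \<and> e - D \<subseteq> Z}" for Z
        by (rule inj_onI) blast
      have cF: "card (F (c, D)) = card {e \<in> H c. D \<subseteq> e \<and> e - D \<subseteq> S}"
        unfolding F_def fst_conv snd_conv by (rule card_image[OF inj])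
      have "{T \<in> F (c, D). \<forall>v\<in>T. g v = j} = (\<lambda>e. e - D) ` {e \<in> H c. D \<subseteq> e \<and> e - D \<subseteq> W j}"
        unfolding F_def W_def by auto
      then have cW: "card {T \<in> F (c, D). \<forall>v\<in>T. g v = j} = card {e \<in> H c. D \<subseteq> e \<and> e - D \<subseteq> W j}"
        using card_image[OF inj] by simp
      have "(x + a) * ?n ^ p \<le> real (card (F (c, D)))"
        unfolding cF using H c D unfolding degree_into_def by blast
      then have low: "(x + a) * ?n ^ p / real s ^ p - e1 * ?n ^ p \<le> real (card {e \<in> H c. D \<subseteq> e \<and> e - D \<subseteq> W j})"
      proof -
        have "(x + a) * ?n ^ p / real s ^ p \<le> real (card (F (c, D))) / real s ^ p"
          by (rule divide_right_mono) (use \<open>(x + a) * ?n ^ p \<le> real (card (F (c, D)))\<close> in auto)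
        then show ?thesis using F[OF j cD] unfolding cW by linarith
      qed
      have "real (card (W j)) \<le> (1 + \<xi>) * (?n / real s)"
      proof -
        have "e1 * ?n = (e1 * real s) * (?n / real s)" using s by simp
        also have "\<dots> \<le> \<xi> * (?n / real s)" using e1s by (intro mult_right_mono) auto
        finally show ?thesis
          using size(2)[OF j] unfolding W_def distrib_right mult_1_left by linarith
      qed
      then have "x * real (card (W j)) ^ p \<le> x * ((1 + \<xi>) * (?n / real s)) ^ p"
        using x by (intro mult_left_mono power_mono) auto
      also have "\<dots> = (x * (1 + \<xi>) ^ p) * (?n / real s) ^ p" by (simp only: power_mult_distrib mult.assoc)
      also have "\<dots> \<le> (x + a - \<xi>) * (?n / real s) ^ p"
        unfolding \<xi>_def by (intro mult_right_mono slack(3)[OF a]) (use slack[OF a, of p] x in auto)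
      also have "\<dots> = (x + a) * ?n ^ p / real s ^ p - \<xi> * (?n ^ p / real s ^ p)"
        by (simp only: power_divide left_diff_distrib times_divide_eq_right diff_divide_distrib)
      also have "\<dots> \<le> (x + a) * ?n ^ p / real s ^ p - e1 * ?n ^ p"
      proof -
        have "e1 * ?n ^ p = (e1 * real s ^ p) * (?n ^ p / real s ^ p)" using s by simp
        also have "\<dots> \<le> \<xi> * (?n ^ p / real s ^ p)" using e1(3) by (intro mult_right_mono) auto
        finally show ?thesis by simp
      qed
      also note low
      finally show "x * real (card (W j)) ^ p \<le> real (card {e \<in> H c. D \<subseteq> e \<and> e - D \<subseteq> W j})" .
    qed
    moreover have "\<forall>j<s. W j \<subseteq> S \<and> real (card S) / real s - \<epsilon> * real (card S) \<le> real (card (W j)) \<and>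
              real (card (W j)) \<le> real (card S) / real s + \<epsilon> * real (card S)"
    proof (intro allI impI)
      fix j assume "j < s"
      from size[OF this] e1S show "W j \<subseteq> S \<and> real (card S) / real s - \<epsilon> * real (card S) \<le> real (card (W j)) \<and>
              real (card (W j)) \<le> real (card S) / real s + \<epsilon> * real (card S)"
        unfolding W_def by auto
    qed
    moreover have "\<forall>i<s. \<forall>j<s. i \<noteq> j \<longrightarrow> W i \<inter> W j = {}" by (auto simp: W_def)
    ultimately show "\<exists>W. (\<forall>j<s. W j \<subseteq> S \<and> real (card S) / real s - \<epsilon> * real (card S) \<le> real (card (W j)) \<and>
              real (card (W j)) \<le> real (card S) / real s + \<epsilon> * real (card S)) \<and>
          (\<forall>i<s. \<forall>j<s. i \<noteq> j \<longrightarrow> W i \<inter> W j = {}) \<and>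
          (\<forall>j<s. \<forall>c<M. degree_into d p V (H c) (W j) x)" by blast
  qed
qed

section \<open>Chains and cycles\<close>

text \<open>A squeeze: counting from the left end gives \<open>b + i \<le> f (a + i)\<close>,
  counting from the right end gives the reverse.\<close>

lemma strict_mono_on_interval_unique:
  fixes f :: "nat \<Rightarrow> nat"
  assumes bij: "bij_betw f {a+1..a+n} {b+1..b+n}" and mono: "strict_mono_on {a+1..a+n} f"
    and i: "1 \<le> i" "i \<le> n"
  shows "f (a + i) = b + i"
proof -
  have range: "b + 1 \<le> f (a + j) \<and> f (a + j) \<le> b + n" if "1 \<le> j" "j \<le> n" for j
  proof -
    have "f (a + j) \<in> {b+1..b+n}" using bij_betwE[OF bij] that by auto
    then show ?thesis by auto
  qed
  have step: "f (a + j) < f (a + Suc j)" if "1 \<le> j" "Suc j \<le> n" for j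
    using mono that by (auto simp: strict_mono_on_def)
  have lower: "b + j \<le> f (a + j)" if "1 \<le> j" "j \<le> n" for j
    using that
  proof (induction j)
    case (Suc j)
    show ?case
    proof (cases "j = 0")
      case True
      then show ?thesis using range[of 1] Suc.prems by simp
    next
      case False
      then show ?thesis using Suc step[of j] by force
    qed
  qed simp
  have upper: "f (a + (n - j)) \<le> b + (n - j)" if "j < n" for j
    using that
  proof (induction j)
    case 0
    then show ?case using range[of n] by simp
  next
    case (Suc j)
    have "f (a + (n - Suc j)) < f (a + Suc (n - Suc j))" using Suc.prems by (intro step) auto
    moreover have "Suc (n - Suc j) = n - j" using Suc.prems by simp
    ultimately show ?case using Suc by simp
  qed
  show ?thesis using lower[OF i] upper[of "n - i"] i by simp
qed

definition shift :: "nat \<Rightarrow> nat set \<Rightarrow> nat set" where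
  "shift a e = (\<lambda>i. i + a) ` e"

lemma shift_shift: "shift a (shift b e) = shift (a + b) e"
  by (simp add: shift_def image_image add.assoc add.commute[of a b])

lemma shift_0 [simp]: "shift 0 e = e" by (simp add: shift_def)

lemma inj_shift: "inj (shift a)"
  unfolding shift_def by (intro inj_onI) (metis inj_image_eq_iff inj_on_add')

lemma finite_shift [simp]: "finite (shift a e) \<longleftrightarrow> finite e"
  by (simp add: shift_def finite_image_iff)

lemma shift_subset_iff: "shift a e \<subseteq> {a + b..a + c} \<longleftrightarrow> e \<subseteq> {b..c}"
  by (auto simp: shift_def subset_iff)

text \<open>Between two intervals of equal length the only increasing bijection is the translation,
  so isomorphism becomes equality up to \<open>shift\<close>.\<close>

lemma ordered_iso_interval_iff:
  assumes "verts G = {a+1..a+n}" "verts H = {b+1..b+n}"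
    and "\<And>e. e \<in> edges G \<Longrightarrow> e \<subseteq> verts G" and "a \<le> b"
  shows "ordered_iso G H \<longleftrightarrow> edges H = shift (b - a) ` edges G"
proof
  assume "ordered_iso G H"
  then obtain f where f: "bij_betw f {a+1..a+n} {b+1..b+n}" "strict_mono_on {a+1..a+n} f"
    "(`) f ` edges G = edges H" unfolding ordered_iso_def assms by blast
  have "f ` e = shift (b - a) e" if "e \<in> edges G" for e
    unfolding shift_def
  proof (rule image_cong)
    fix x assume "x \<in> e"
    then have "a + 1 \<le> x" "x \<le> a + n" using assms(1) assms(3)[OF that] by auto
    then show "f x = x + (b - a)"
      using strict_mono_on_interval_unique[OF f(1,2), of "x - a"] assms(4) by simp
  qed simp
  then show "edges H = shift (b - a) ` edges G" using f(3) by force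
next
  assume *: "edges H = shift (b - a) ` edges G"
  have "bij_betw (\<lambda>x. x + (b - a)) {a+1..a+n} {b+1..b+n}"
    by (rule bij_betw_byWitness[where f' = "\<lambda>x. x - (b - a)"]) (use assms(4) in auto)
  then show "ordered_iso G H" unfolding ordered_iso_def assms
    by (intro exI[of _ "\<lambda>x. x + (b - a)"]) (auto simp: * shift_def strict_mono_on_def)
qed


section \<open>The infinite chain of a link\<close>

locale link =
  fixes k l m :: nat and A :: "nat hypergraph"
  assumes l_less_m: "l < m" and is_link: "is_link k l m A" and k_pos: "k \<ge> 1"
begin

definition h :: nat where "h = m - l"

lemma h_pos: "h \<ge> 1" and h_l: "h + l = m" "l + h = m" using l_less_m by (auto simp: h_def)

lemma edges_A: "e \<in> edges A \<Longrightarrow> e \<subseteq> {1..m}" "e \<in> edges A \<Longrightarrow> card e = k" "e \<in> edges A \<Longrightarrow> finite e"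
  using is_link finite_subset[of e "{1..m}"] by (auto simp: is_link_def uniform_hypergraph_def)

lemma finite_edges_A: "finite (edges A)"
  by (rule finite_subset[of _ "Pow {1..m}"]) (use edges_A in auto)

lemma shift_edge_subset: "e \<in> edges A \<Longrightarrow> shift a e \<subseteq> {a + 1..a + m}"
  using shift_subset_iff[of a e 1 m] edges_A(1)[of e] by simp

text \<open>The isomorphism of start and end is a translation by \<open>h\<close>. This consistency
  is what makes overlapping translates of \<open>A\<close> fit together.\<close>

lemma shift_end_iff:
  assumes "e \<subseteq> {1..l}"
  shows "shift h e \<in> edges A \<longleftrightarrow> e \<in> edges A"
proof -
  have "ordered_iso (induced A {0+1..0+l}) (induced A {h+1..h+l})"
    using is_link h_l(1) unfolding is_link_def h_def by simp
  then have eq: "{e \<in> edges A. e \<subseteq> {h+1..h+l}} = shift h ` {e \<in> edges A. e \<subseteq> {1..l}}"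
    by (subst (asm) ordered_iso_interval_iff[where a = 0 and b = h and n = l]) (auto simp: induced_def)
  have sub: "shift h e \<subseteq> {h+1..h+l}" using assms shift_subset_iff[of h e 1 l] by simp
  show ?thesis
  proof
    assume "e \<in> edges A"
    then show "shift h e \<in> edges A" using eq assms by blast
  next
    assume "shift h e \<in> edges A"
    then have "shift h e \<in> shift h ` {e \<in> edges A. e \<subseteq> {1..l}}" using sub eq by blast
    then show "e \<in> edges A" using inj_shift[of h] by (auto dest: injD)
  qed
qed

text \<open>The edges of the infinite chain: every chain consists of the edges of this hypergraph inside
  an initial segment.\<close>

definition chain_edges :: "nat set set" where
  "chain_edges = {shift (q * h) e | q e. e \<in> edges A}"

definition initial_edges :: "nat \<Rightarrow> nat set set" where
  "initial_edges t = {g \<in> chain_edges. g \<subseteq> {1..h * t + l}}"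

lemma chain_edgesI: "e \<in> edges A \<Longrightarrow> shift (q * h) e \<in> chain_edges"
  by (auto simp: chain_edges_def)

text \<open>The spread \<open>x < y + m\<close> later separates the edges of a cycle, and
  nonemptiness, which comes from \<open>k_pos\<close>, makes edges on disjoint vertex sets
  distinct.\<close>

lemma chain_edges_bounds:
  "g \<in> chain_edges \<Longrightarrow> finite g \<and> card g = k \<and> g \<noteq> {} \<and> (\<forall>x\<in>g. 1 \<le> x) \<and> (\<forall>x\<in>g. \<forall>y\<in>g. x < y + m)"
proof -
  assume "g \<in> chain_edges"
  then obtain q e where e: "e \<in> edges A" "g = shift (q * h) e" by (auto simp: chain_edges_def)
  have "card g = k" using edges_A(2)[OF e(1)] by (simp add: e shift_def card_image)
  moreover have "finite g" using edges_A(3)[OF e(1)] by (simp add: e)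
  moreover have "g \<noteq> {}" using \<open>card g = k\<close> k_pos by auto
  moreover have "\<forall>x\<in>g. 1 \<le> x"
    using edges_A(1)[OF e(1)] unfolding e shift_def by fastforce
  moreover have "\<forall>x\<in>g. \<forall>y\<in>g. x < y + m"
  proof (intro ballI)
    fix x y assume "x \<in> g" "y \<in> g"
    then obtain i j where "i \<in> e" "j \<in> e" "x = i + q * h" "y = j + q * h" by (auto simp: e shift_def)
    moreover have "i \<le> m" "1 \<le> j" using edges_A(1)[OF e(1)] \<open>i \<in> e\<close> \<open>j \<in> e\<close> by auto
    ultimately show "x < y + m" by linarith
  qed
  ultimately show ?thesis by blast
qed

text \<open>Walk from block \<open>q'\<close> to block \<open>q\<close> one block at a time: an edge
  of a translate that also lies in a block further left lies in the start of its translate, hence in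
  the end of the previous one, by \<open>shift_end_iff\<close>; similarly to the right. This is why
  the blocks of the infinite chain induce copies of \<open>A\<close>.\<close>

lemma chain_edges_in_block_aux:
  "e \<in> edges A \<Longrightarrow> shift (q' * h) e \<subseteq> {q * h + 1..q * h + m} \<Longrightarrow> q' = q + j \<or> q = q' + j \<Longrightarrow>
    \<exists>e'\<in>edges A. shift (q' * h) e = shift (q * h) e'"
proof (induction j arbitrary: q' e)
  case 0
  then show ?case by auto
next
  case (Suc j)
  from Suc.prems(3) show ?case
  proof
    assume q': "q' = q + Suc j"
    have "e \<subseteq> {1..l}"
    proof
      fix x assume x: "x \<in> e"
      then have "x + q' * h \<le> q * h + m" using Suc.prems(2) by (auto simp: shift_def)
      moreover have "q' * h = q * h + h + j * h" using q' by (simp add: algebra_simps)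
      ultimately have "x \<le> l" using h_l by linarith
      then show "x \<in> {1..l}" using edges_A(1)[OF Suc.prems(1)] x by auto
    qed
    then have e': "shift h e \<in> edges A" using shift_end_iff Suc.prems(1) by blast
    have eq: "shift (q' * h) e = shift ((q + j) * h) (shift h e)"
      by (simp add: shift_shift q' algebra_simps)
    show ?thesis unfolding eq using Suc.IH[OF e', of "q + j"] Suc.prems(2) unfolding eq by blast
  next
    assume q: "q = q' + Suc j"
    define e1 where "e1 = (\<lambda>x. x - h) ` e"
    have ge: "h + 1 \<le> x \<and> x \<le> h + l" if x: "x \<in> e" for x
    proof -
      have "q * h + 1 \<le> x + q' * h" using Suc.prems(2) x by (auto simp: shift_def)
      moreover have "q * h = q' * h + h + j * h" using q by (simp add: algebra_simps)
      ultimately have "h + 1 \<le> x" by linarith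
      then show ?thesis using edges_A(1)[OF Suc.prems(1)] x h_l by auto
    qed
    have e_eq: "e = shift h e1"
    proof -
      have "x - h + h = x" if "x \<in> e" for x using ge[OF that] by simp
      then have "(\<lambda>x. x - h + h) ` e = (\<lambda>x. x) ` e" by (intro image_cong) auto
      then show ?thesis by (simp add: e1_def shift_def image_image)
    qed
    have "e1 \<subseteq> {1..l}" using ge by (fastforce simp: e1_def)
    then have e1: "e1 \<in> edges A" using shift_end_iff Suc.prems(1) e_eq by simp
    have eq: "shift (q' * h) e = shift ((q' + 1) * h) e1"
      by (simp add: shift_shift e_eq algebra_simps)
    show ?thesis unfolding eq using Suc.IH[OF e1, of "q' + 1"] Suc.prems(2) q unfolding eq by simp
  qed
qed

lemma chain_edges_in_block:
  assumes "g \<in> chain_edges" "g \<subseteq> {q * h + 1..q * h + m}"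
  shows "\<exists>e\<in>edges A. g = shift (q * h) e"
proof -
  obtain q' e where e: "e \<in> edges A" "g = shift (q' * h) e" using assms by (auto simp: chain_edges_def)
  have "q' = q + (q' - q) \<or> q = q' + (q - q')" by linarith
  then have "\<exists>j. q' = q + j \<or> q = q' + j" by blast
  then show ?thesis using chain_edges_in_block_aux[OF e(1), of q' q] assms(2) e(2) by blast
qed

lemma initial_edges_0: "initial_edges 0 = edges (link_start l A)"
proof -
  have "g \<in> edges A" if "g \<in> chain_edges" "g \<subseteq> {1..l}" for g
  proof -
    have "g \<subseteq> {0 * h + 1..0 * h + m}" using that(2) l_less_m by fastforce
    then show ?thesis using chain_edges_in_block[OF that(1), of 0] by auto
  qed
  moreover have "g \<in> chain_edges" if "g \<in> edges A" for g
    using chain_edgesI[OF that, of 0] by simp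
  ultimately show ?thesis by (auto simp: initial_edges_def link_start_def induced_def)
qed

lemma shift_chain_edge: "g \<in> chain_edges \<Longrightarrow> shift (q * h) g \<in> chain_edges"
proof -
  assume "g \<in> chain_edges"
  then obtain q' e where "e \<in> edges A" "g = shift (q' * h) e" unfolding chain_edges_def by blast
  then show ?thesis using chain_edgesI[of e "q + q'"] by (simp add: shift_shift distrib_right)
qed

definition new_edges :: "nat set set" where
  "new_edges = {e \<in> edges A. \<not> e \<subseteq> {1..l}}"

text \<open>A new block meets the initial segment exactly in its own start, so it adds the
  translates of the edges of \<open>A\<close> outside the start and nothing else.\<close>

lemma initial_edges_Suc:
  "initial_edges (Suc t) = initial_edges t \<union> shift (t * h) ` new_edges" (is ?eq)
  "initial_edges t \<inter> shift (t * h) ` new_edges = {}" (is ?disj)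
proof -
  have block: "g \<subseteq> {t * h + 1..t * h + m} \<or> g \<subseteq> {1..h * t + l}"
    if gc: "g \<in> chain_edges" and gs: "g \<subseteq> {1..h * Suc t + l}" for g
  proof (rule disjCI)
    assume "\<not> g \<subseteq> {1..h * t + l}"
    obtain q e where e: "e \<in> edges A" "g = shift (q * h) e"
      using gc unfolding chain_edges_def by blast
    have "t \<le> q"
    proof (rule ccontr)
      assume "\<not> t \<le> q"
      then have "Suc q \<le> t" by simp
      then have "Suc q * h \<le> t * h" by (rule mult_right_mono) simp
      then have "q * h + m \<le> h * t + l" using h_l by (simp add: mult.commute)
      moreover have "1 \<le> x" "x \<le> q * h + m" if "x \<in> g" for x
        using that shift_edge_subset[OF e(1), of "q * h"] e(2) by auto
      ultimately have "x \<in> {1..h * t + l}" if "x \<in> g" for x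
        using that le_trans unfolding atLeastAtMost_iff by blast
      then have "g \<subseteq> {1..h * t + l}" by blast
      with \<open>\<not> g \<subseteq> {1..h * t + l}\<close> show False by simp
    qed
    then have le: "t * h \<le> q * h" by simp
    have eq: "h * Suc t + l = t * h + m" using h_l by (simp add: mult.commute)
    have "t * h + 1 \<le> x \<and> x \<le> t * h + m" if x: "x \<in> g" for x
    proof -
      have "q * h + 1 \<le> x" "x \<le> h * Suc t + l"
        using x gs shift_edge_subset[OF e(1), of "q * h"] e(2) by auto
      then show ?thesis using le eq by linarith
    qed
    then show "g \<subseteq> {t * h + 1..t * h + m}" by auto
  qed
  have in_init: "shift (t * h) e \<subseteq> {1..h * t + l} \<longleftrightarrow> e \<subseteq> {1..l}" if "e \<in> edges A" for e
    using edges_A(1)[OF that] by (fastforce simp: shift_def subset_iff mult.commute)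
  show ?disj using in_init by (auto simp: initial_edges_def new_edges_def)
  show ?eq
  proof (intro set_eqI iffI)
    fix g assume g: "g \<in> initial_edges (Suc t)"
    show "g \<in> initial_edges t \<union> shift (t * h) ` new_edges"
    proof (cases "g \<subseteq> {1..h * t + l}")
      case True
      then show ?thesis using g by (simp add: initial_edges_def)
    next
      case False
      then have "g \<subseteq> {t * h + 1..t * h + m}" using block[of g] g by (auto simp: initial_edges_def)
      then obtain e where "e \<in> edges A" "g = shift (t * h) e"
        using chain_edges_in_block[of g t] g by (auto simp: initial_edges_def)
      then show ?thesis using False in_init by (auto simp: new_edges_def)
    qed
  next
    fix g assume "g \<in> initial_edges t \<union> shift (t * h) ` new_edges"
    then show "g \<in> initial_edges (Suc t)"
    proof
      assume "g \<in> initial_edges t"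
      then show ?thesis by (force simp: initial_edges_def)
    next
      assume "g \<in> shift (t * h) ` new_edges"
      then obtain e where e: "e \<in> edges A" "g = shift (t * h) e" by (auto simp: new_edges_def)
      moreover have eq: "h * Suc t + l = t * h + m" using h_l by (simp add: mult.commute)
      ultimately have "x \<in> {1..h * Suc t + l}" if "x \<in> g" for x
        unfolding eq using that shift_edge_subset[OF e(1), of "t * h"] by auto
      then have "g \<subseteq> {1..h * Suc t + l}" by blast
      then show ?thesis using chain_edgesI[OF e(1), of t] e(2) by (simp add: initial_edges_def)
    qed
  qed
qed

text \<open>The number e(A) - e(A_s) of edges that each further block adds; a sufficiently long
  cycle has \<open>r\<close> edges per \<open>h\<close> vertices.\<close>

definition r :: nat where "r = card new_edges"
definition es :: nat where "es = card (edges (link_start l A))"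

lemma card_edges_A: "card (edges A) = es + r"
proof -
  have "edges A = edges (link_start l A) \<union> new_edges" "edges (link_start l A) \<inter> new_edges = {}"
    by (auto simp: link_start_def induced_def new_edges_def)
  moreover have "finite (edges (link_start l A))" "finite new_edges"
    using finite_edges_A by (simp_all add: link_start_def induced_def new_edges_def)
  ultimately show ?thesis unfolding es_def r_def by (simp only: card_Un_disjoint)
qed

lemma finite_initial_edges: "finite (initial_edges t)"
  by (rule finite_subset[of _ "Pow {1..h * t + l}"]) (auto simp: initial_edges_def)

lemma card_initial_edges: "card (initial_edges t) = es + r * t"
proof (induction t)
  case 0
  then show ?case by (simp add: initial_edges_0 es_def)
next
  case (Suc t)
  have "finite new_edges" using finite_edges_A by (simp add: new_edges_def)
  then have "card (initial_edges (Suc t)) = card (initial_edges t) + card (shift (t * h) ` new_edges)"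
    unfolding initial_edges_Suc(1)
    using initial_edges_Suc(2) by (intro card_Un_disjoint finite_initial_edges) auto
  also have "card (shift (t * h) ` new_edges) = r"
    unfolding r_def by (rule card_image) (rule inj_on_subset[OF inj_shift subset_UNIV])
  finally show ?case using Suc by simp
qed

text \<open>If all edges were inside the start, each edge could be shifted right by \<open>h\<close>
  and would again be an edge, hence again inside the start, without end.\<close>

lemma r_pos:
  assumes "edges A \<noteq> {}"
  shows "r \<ge> 1"
proof (rule ccontr)
  assume "\<not> r \<ge> 1"
  moreover have "finite new_edges" using finite_edges_A by (simp add: new_edges_def)
  ultimately have "new_edges = {}" by (simp add: r_def not_le)
  then have sub: "e \<subseteq> {1..l}" if "e \<in> edges A" for e using that unfolding new_edges_def by blast
  have "\<exists>e\<in>edges A. q * h \<le> Max e" for q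
  proof (induction q)
    case 0
    then show ?case using assms by auto
  next
    case (Suc q)
    then obtain e where e: "e \<in> edges A" "q * h \<le> Max e" by blast
    have ne: "e \<noteq> {}" using edges_A(2)[OF e(1)] k_pos by auto
    have "shift h e \<in> edges A" using e(1) sub shift_end_iff by blast
    moreover have "Max e + h \<in> shift h e"
      unfolding shift_def using Max_in[OF edges_A(3)[OF e(1)] ne] by blast
    moreover from this have "Max e + h \<le> Max (shift h e)"
      using edges_A(3)[OF e(1)] by (intro Max_ge) auto
    ultimately show ?case using e(2) by (intro bexI[of _ "shift h e"]) auto
  qed
  then obtain e where e: "e \<in> edges A" "Suc m * h \<le> Max e" by blast
  have ne: "e \<noteq> {}" using edges_A(2)[OF e(1)] k_pos by auto
  have "Max e \<le> m" using Max_in[OF edges_A(3)[OF e(1)] ne] edges_A(1)[OF e(1)] by auto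
  moreover have "Suc m * 1 \<le> Suc m * h" using h_pos by (rule mult_left_mono) simp
  ultimately show False using e(2) by simp
qed

end

text \<open>\<open>shift\<close> only moves upwards, so an isomorphism towards a lower interval gets
  a version of its own.\<close>

lemma ordered_iso_interval_iff':
  assumes "verts G = {a+1..a+n}" "verts H = {b+1..b+n}"
    and "\<And>e. e \<in> edges G \<Longrightarrow> e \<subseteq> verts G" "\<And>e. e \<in> edges H \<Longrightarrow> e \<subseteq> verts H" and "b \<le> a"
  shows "ordered_iso G H \<longleftrightarrow> edges G = shift (a - b) ` edges H"
proof
  assume "ordered_iso G H"
  then obtain f where f: "bij_betw f {a+1..a+n} {b+1..b+n}" "strict_mono_on {a+1..a+n} f"
    "(`) f ` edges G = edges H" unfolding ordered_iso_def assms(1,2) by blast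
  have "shift (a - b) (f ` e) = e" if "e \<in> edges G" for e
  proof -
    have "f x + (a - b) = x" if "x \<in> e" for x
    proof -
      have "a + 1 \<le> x" "x \<le> a + n" using assms(1) assms(3)[OF \<open>e \<in> edges G\<close>] that by auto
      then show ?thesis
        using strict_mono_on_interval_unique[OF f(1,2), of "x - a"] assms(5) by simp
    qed
    then show ?thesis by (simp add: shift_def image_image)
  qed
  then have "(\<lambda>e. shift (a - b) (f ` e)) ` edges G = edges G" by simp
  then show "edges G = shift (a - b) ` edges H" unfolding f(3)[symmetric] by (simp add: image_image)
next
  assume *: "edges G = shift (a - b) ` edges H"
  have "bij_betw (\<lambda>x. x - (a - b)) {a+1..a+n} {b+1..b+n}"
    by (rule bij_betw_byWitness[where f' = "\<lambda>x. x + (a - b)"]) (use assms(5) in auto)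
  moreover have "strict_mono_on {a+1..a+n} (\<lambda>x. x - (a - b))"
    using assms(5) by (auto simp: strict_mono_on_def)
  moreover have "(`) (\<lambda>x. x - (a - b)) ` edges G = edges H"
    unfolding * by (simp add: image_image shift_def)
  ultimately show "ordered_iso G H" unfolding ordered_iso_def assms(1,2) by blast
qed

context link
begin

lemma initial_edges_in_block:
  assumes "g \<in> initial_edges t" "t \<ge> 1"
  shows "\<exists>q<t. \<exists>e\<in>edges A. g = shift (q * h) e"
  using assms
proof (induction t)
  case (Suc t)
  show ?case
  proof (cases "g \<in> initial_edges t")
    case True
    show ?thesis
    proof (cases "t = 0")
      case True
      then have "g \<in> edges A"
        using \<open>g \<in> initial_edges t\<close> by (simp add: initial_edges_0 link_start_def induced_def)
      then show ?thesis by (intro exI[of _ 0]) auto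
    next
      case False
      then show ?thesis using Suc.IH True less_SucI by (metis less_one linorder_not_le)
    qed
  next
    case False
    then have "g \<in> shift (t * h) ` new_edges" using Suc.prems(1) initial_edges_Suc(1) by blast
    then show ?thesis unfolding new_edges_def by blast
  qed
qed simp

lemma chain_block_eq: "q \<ge> 1 \<Longrightarrow> chain_block l m q = {(q - 1) * h + 1..(q - 1) * h + m}"
  by (simp add: chain_block_def h_def)

lemma block_subset: "q < t \<Longrightarrow> {q * h + 1..q * h + m} \<subseteq> {1..h * t + l}"
proof -
  assume "q < t"
  then have "Suc q * h \<le> t * h" by (intro mult_right_mono) auto
  then have "q * h + m \<le> h * t + l" using h_l by (simp add: mult.commute)
  then show ?thesis by auto
qed

lemma block_iso_iff:
  assumes "1 \<le> q"
  shows "ordered_iso (induced P (chain_block l m q)) A \<longleftrightarrow>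
    {g \<in> edges P. g \<subseteq> chain_block l m q} = shift ((q - 1) * h) ` edges A"
proof -
  have "ordered_iso (induced P (chain_block l m q)) A \<longleftrightarrow>
      edges (induced P (chain_block l m q)) = shift ((q - 1) * h - 0) ` edges A"
  proof (rule ordered_iso_interval_iff')
    show "verts (induced P (chain_block l m q)) = {(q - 1) * h + 1..(q - 1) * h + m}"
      by (simp add: induced_def chain_block_eq[OF assms])
    show "verts A = {0 + 1..0 + m}" using is_link by (simp add: is_link_def)
    then show "e \<subseteq> verts A" if "e \<in> edges A" for e using edges_A(1)[OF that] by simp
  qed (auto simp: induced_def)
  then show ?thesis by (simp add: induced_def)
qed

text \<open>The blocks prescribe their edges and every edge lies in a block, so there is exactly one
  chain of each length. From here on a chain is represented by its length alone.\<close>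

lemma is_chain_iff:
  "is_chain l m A t P \<longleftrightarrow> 1 \<le> t \<and> P = ({1..h * t + l}, initial_edges t)"
proof
  assume P: "is_chain l m A t P"
  then have t: "1 \<le> t" and V: "verts P = {1..h * t + l}" by (auto simp: is_chain_def h_def)
  have iso: "{g \<in> edges P. g \<subseteq> chain_block l m q} = shift ((q - 1) * h) ` edges A" if "q \<in> {1..t}" for q
    using P that block_iso_iff[of q P] by (simp add: is_chain_def)
  have "edges P = initial_edges t"
  proof
    show "edges P \<subseteq> initial_edges t"
    proof
      fix g assume g: "g \<in> edges P"
      then obtain q where q: "q \<in> {1..t}" "g \<subseteq> chain_block l m q" using P by (auto simp: is_chain_def)
      then have "g \<in> shift ((q - 1) * h) ` edges A" using iso g by blast
      then have "g \<in> chain_edges" using chain_edgesI by blast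
      moreover have "g \<subseteq> {1..h * t + l}"
        using q chain_block_eq[of q] block_subset[of "q - 1" t] by fastforce
      ultimately show "g \<in> initial_edges t" by (simp add: initial_edges_def)
    qed
    show "initial_edges t \<subseteq> edges P"
    proof
      fix g assume "g \<in> initial_edges t"
      then obtain q e where q: "q < t" "e \<in> edges A" "g = shift (q * h) e"
        using initial_edges_in_block t by blast
      then have "g \<in> shift ((Suc q - 1) * h) ` edges A" by simp
      then show "g \<in> edges P" using iso[of "Suc q"] q by auto
    qed
  qed
  then show "1 \<le> t \<and> P = ({1..h * t + l}, initial_edges t)" using t V by (simp add: prod_eq_iff)
next
  assume *: "1 \<le> t \<and> P = ({1..h * t + l}, initial_edges t)"
  have iso: "ordered_iso (induced P (chain_block l m q)) A" if q: "q \<in> {1..t}" for q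
  proof -
    have q1: "1 \<le> q" "q - 1 < t" using q by auto
    have "{g \<in> initial_edges t. g \<subseteq> chain_block l m q} = shift ((q - 1) * h) ` edges A"
    proof (intro set_eqI iffI)
      fix g assume "g \<in> {g \<in> initial_edges t. g \<subseteq> chain_block l m q}"
      then show "g \<in> shift ((q - 1) * h) ` edges A"
        using chain_edges_in_block[of g "q - 1"] chain_block_eq[OF q1(1)] by (auto simp: initial_edges_def)
    next
      fix g assume "g \<in> shift ((q - 1) * h) ` edges A"
      then obtain e where e: "e \<in> edges A" "g = shift ((q - 1) * h) e" by blast
      have "g \<subseteq> {(q - 1) * h + 1..(q - 1) * h + m}"
        unfolding e(2) by (rule shift_edge_subset[OF e(1)])
      then show "g \<in> {g \<in> initial_edges t. g \<subseteq> chain_block l m q}"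
        using block_subset[OF q1(2)] chain_edgesI[OF e(1), of "q - 1"] e(2) chain_block_eq[OF q1(1)]
        by (auto simp: initial_edges_def)
    qed
    then show ?thesis using * block_iso_iff[OF q1(1), of P] by simp
  qed
  have "\<exists>q\<in>{1..t}. g \<subseteq> chain_block l m q" if g: "g \<in> initial_edges t" for g
  proof -
    obtain q e where q: "q < t" "e \<in> edges A" "g = shift (q * h) e"
      using initial_edges_in_block[OF g] * by blast
    then have "g \<subseteq> chain_block l m (Suc q)"
      using shift_edge_subset[OF q(2), of "q * h"] by (simp add: chain_block_eq)
    then show ?thesis using q(1) by (intro bexI[of _ "Suc q"]) auto
  qed
  then show "is_chain l m A t P" using * iso by (simp add: is_chain_def h_def)
qed

section \<open>Embedded chains and their concatenation\<close>

definition emb_edges :: "nat \<Rightarrow> (nat \<Rightarrow> 'b) \<Rightarrow> 'b set set" where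
  "emb_edges t f = (`) f ` initial_edges t"

definition span :: "nat \<Rightarrow> (nat \<Rightarrow> 'b) \<Rightarrow> 'b set" where
  "span t f = f ` {1..h * t + l}"

text \<open>A copy of a chain is from now on a pair of a length \<open>t\<close> and a map
  \<open>f\<close>. Length 0 is allowed and stands for a copy of the start alone; the two ends of
  the absorber enter the construction in this form.\<close>

definition chain_map :: "nat \<Rightarrow> (nat \<Rightarrow> 'b) \<Rightarrow> bool" where
  "chain_map t f \<longleftrightarrow> inj_on f {1..h * t + l}"

lemma finite_span [simp]: "finite (span t f)" by (simp add: span_def)

lemma card_span: "chain_map t f \<Longrightarrow> card (span t f) = h * t + l"
  by (simp add: chain_map_def span_def card_image)

lemma finite_emb_edges [simp]: "finite (emb_edges t f)"
  by (simp add: emb_edges_def finite_initial_edges)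

lemma emb_edges_subset_span: "g \<in> emb_edges t f \<Longrightarrow> g \<subseteq> span t f"
  by (auto simp: emb_edges_def span_def initial_edges_def)

lemma emb_edges_nonempty: "g \<in> emb_edges t f \<Longrightarrow> g \<noteq> {}"
  using chain_edges_bounds by (auto simp: emb_edges_def initial_edges_def)

lemma card_emb_edges: "chain_map t f \<Longrightarrow> card (emb_edges t f) = es + r * t"
proof -
  assume "chain_map t f"
  then have "inj_on ((`) f) (Pow {1..h * t + l})" by (simp add: chain_map_def inj_on_image_Pow)
  then have "inj_on ((`) f) (initial_edges t)"
    by (rule inj_on_subset) (auto simp: initial_edges_def)
  then show ?thesis by (simp add: emb_edges_def card_image card_initial_edges)
qed

lemma emb_edges_cong: "(\<And>i. i \<in> {1..h * t + l} \<Longrightarrow> f i = g i) \<Longrightarrow> emb_edges t f = emb_edges t g"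
  unfolding emb_edges_def initial_edges_def by (intro image_cong) auto

lemma embedding_chain_iff:
  "embedding f ({1..h * t + l}, initial_edges t) H \<longleftrightarrow>
     chain_map t f \<and> span t f \<subseteq> verts H \<and> emb_edges t f \<subseteq> edges H"
  by (auto simp: embedding_def chain_map_def span_def emb_edges_def)

lemma initial_edges_mono: "t \<le> t' \<Longrightarrow> initial_edges t \<subseteq> initial_edges t'"
proof -
  assume "t \<le> t'"
  then have "{1..h * t + l} \<subseteq> {1..h * t' + l}" by simp
  then show ?thesis unfolding initial_edges_def by blast
qed

text \<open>The first \<open>l\<close> positions of the second chain coincide with the last
  \<open>l\<close> positions of the first, so the second chain is displaced by \<open>h * t\<close>
  and not by the full number of vertices.\<close>

definition glue :: "nat \<Rightarrow> (nat \<Rightarrow> 'b) \<Rightarrow> (nat \<Rightarrow> 'b) \<Rightarrow> nat \<Rightarrow> 'b" where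
  "glue t f f' i = (if i \<le> h * t + l then f i else f' (i - h * t))"

lemma glue_left: "i \<le> h * t + l \<Longrightarrow> glue t f f' i = f i" by (simp add: glue_def)

lemma glue_right:
  assumes "\<And>i. i \<in> {1..l} \<Longrightarrow> f' i = f (h * t + i)" "1 \<le> i"
  shows "glue t f f' (h * t + i) = f' i"
  using assms by (auto simp: glue_def)

lemma span_glue:
  assumes "\<And>i. i \<in> {1..l} \<Longrightarrow> f' i = f (h * t + i)"
  shows "span (t + t') (glue t f f') = span t f \<union> span t' f'"
proof -
  have "span t f = glue t f f' ` {1..h * t + l}"
    unfolding span_def by (rule image_cong) (auto simp: glue_left)
  moreover have "span t' f' = glue t f f' ` {h * t + 1..h * t + (h * t' + l)}"
  proof -
    have eq: "{h * t + 1..h * t + (h * t' + l)} = (\<lambda>i. h * t + i) ` {1..h * t' + l}"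
      by (simp add: image_add_atLeastAtMost)
    have "glue t f f' ` {h * t + 1..h * t + (h * t' + l)} = (\<lambda>i. glue t f f' (h * t + i)) ` {1..h * t' + l}"
      unfolding eq image_image ..
    also have "\<dots> = f' ` {1..h * t' + l}" using glue_right[where f' = f' and f = f, OF assms] by (intro image_cong) auto
    finally show ?thesis by (simp add: span_def)
  qed
  moreover have "{1..h * (t + t') + l} = {1..h * t + l} \<union> {h * t + 1..h * t + (h * t' + l)}"
    by (auto simp: algebra_simps)
  ultimately show ?thesis by (simp add: span_def image_Un)
qed

lemma chain_map_glue:
  assumes agree: "\<And>i. i \<in> {1..l} \<Longrightarrow> f' i = f (h * t + i)"
    and f: "chain_map t f" "chain_map t' f'" and disj: "span t f \<inter> f' ` {l+1..h * t' + l} = {}"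
  shows "chain_map (t + t') (glue t f f')"
  unfolding chain_map_def
proof (rule inj_onI)
  have f': "glue t f f' i = f' (i - h * t) \<and> i - h * t \<in> {l+1..h * t' + l}"
    if "i \<in> {1..h * (t + t') + l}" "\<not> i \<le> h * t + l" for i
    using that by (auto simp: glue_def algebra_simps)
  have inj: "inj_on f {1..h * t + l}" "inj_on f' {1..h * t' + l}" using f by (auto simp: chain_map_def)
  have cross: False if "i \<in> {1..h * (t + t') + l}" "i \<le> h * t + l" "j \<in> {1..h * (t + t') + l}" "\<not> j \<le> h * t + l"
    "glue t f f' i = glue t f f' j" for i j
  proof -
    have "f i = f' (j - h * t)" using that f'[OF that(3,4)] by (simp add: glue_left)
    moreover have "f i \<in> span t f" using that by (auto simp: span_def)
    ultimately show False using disj f'[OF that(3,4)] by auto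
  qed
  fix i j assume ij: "i \<in> {1..h * (t + t') + l}" "j \<in> {1..h * (t + t') + l}"
    "glue t f f' i = glue t f f' j"
  consider "i \<le> h * t + l" "j \<le> h * t + l" | "\<not> i \<le> h * t + l" "\<not> j \<le> h * t + l"
    using cross[OF ij(1) _ ij(2) _ ij(3)] cross[OF ij(2) _ ij(1) _ ij(3)[symmetric]] by blast
  then show "i = j"
  proof cases
    case 1
    then show ?thesis using ij inj_onD[OF inj(1), of i j] by (auto simp: glue_left)
  next
    case 2
    have "f' (i - h * t) = f' (j - h * t)" using f'[OF ij(1) 2(1)] f'[OF ij(2) 2(2)] ij(3) by simp
    then have "i - h * t = j - h * t"
      using f'[OF ij(1) 2(1)] f'[OF ij(2) 2(2)] inj_onD[OF inj(2)] by auto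
    then show ?thesis using 2 by linarith
  qed
qed

text \<open>An edge that reaches beyond the first \<open>t\<close> blocks comes from a block
  \<open>q \<ge> t\<close>, so it is a translate of an edge of the second chain.\<close>

lemma emb_edges_glue:
  assumes agree: "\<And>i. i \<in> {1..l} \<Longrightarrow> f' i = f (h * t + i)"
  shows "emb_edges (t + t') (glue t f f') = emb_edges t f \<union> emb_edges t' f'"
proof -
  let ?F = "glue t f f'"
  have left: "?F ` g = f ` g" if "g \<subseteq> {1..h * t + l}" for g
    using that by (intro image_cong) (auto simp: glue_left)
  have right: "?F ` shift (h * t) g = f' ` g" if "g \<in> chain_edges" for g
  proof -
    have "?F (i + h * t) = f' i" if "i \<in> g" for i
      using glue_right[where f' = f' and f = f, OF agree, of i] chain_edges_bounds[OF \<open>g \<in> chain_edges\<close>] that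
      by (simp add: add.commute)
    then show ?thesis by (simp add: shift_def image_image)
  qed
  have "emb_edges (t + t') ?F \<subseteq> emb_edges t f \<union> emb_edges t' f'"
  proof
    fix e assume "e \<in> emb_edges (t + t') ?F"
    then obtain g where g: "g \<in> initial_edges (t + t')" "e = ?F ` g" by (auto simp: emb_edges_def)
    show "e \<in> emb_edges t f \<union> emb_edges t' f'"
    proof (cases "g \<subseteq> {1..h * t + l}")
      case True
      then have "g \<in> initial_edges t" using g(1) by (simp add: initial_edges_def)
      then show ?thesis using left[OF True] g(2) by (auto simp: emb_edges_def)
    next
      case False
      then have "t + t' \<ge> 1" using g(1) by (cases "t + t' = 0") (auto simp: initial_edges_def)
      then obtain q a where q: "q < t + t'" "a \<in> edges A" "g = shift (q * h) a"
        using initial_edges_in_block[OF g(1)] by blast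
      have "t \<le> q"
      proof (rule ccontr)
        assume "\<not> t \<le> q"
        then show False
          using block_subset[of q t] shift_edge_subset[OF q(2), of "q * h"] q(3) False by auto
      qed
      then have eq: "g = shift (h * t) (shift ((q - t) * h) a)"
      proof -
        have "t * h + (q - t) * h = q * h" using \<open>t \<le> q\<close> by (simp flip: distrib_right)
        then show ?thesis by (simp add: q(3) shift_shift mult.commute[of h t])
      qed
      have "q - t < t'" using q(1) \<open>t \<le> q\<close> by simp
      then have "shift ((q - t) * h) a \<in> initial_edges t'"
        using block_subset[of "q - t" t'] shift_edge_subset[OF q(2), of "(q - t) * h"] chain_edgesI[OF q(2)]
        by (auto simp: initial_edges_def)
      then show ?thesis
        using right[OF chain_edgesI[OF q(2), of "q - t"]] g(2) eq by (auto simp: emb_edges_def)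
    qed
  qed
  moreover have "emb_edges t f \<subseteq> emb_edges (t + t') ?F"
  proof
    fix e assume "e \<in> emb_edges t f"
    then obtain g where g: "g \<in> initial_edges t" "e = f ` g" by (auto simp: emb_edges_def)
    then have "e = ?F ` g" using left[of g] by (simp add: initial_edges_def)
    then show "e \<in> emb_edges (t + t') ?F"
      using g(1) initial_edges_mono[of t "t + t'"] by (auto simp: emb_edges_def)
  qed
  moreover have "emb_edges t' f' \<subseteq> emb_edges (t + t') ?F"
  proof
    fix e assume "e \<in> emb_edges t' f'"
    then obtain g where g: "g \<in> initial_edges t'" "e = f' ` g" by (auto simp: emb_edges_def)
    then have gc: "g \<in> chain_edges" "g \<subseteq> {1..h * t' + l}" by (auto simp: initial_edges_def)
    have "shift (h * t) g \<subseteq> {1..h * (t + t') + l}"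
      using gc(2) by (auto simp: shift_def algebra_simps)
    then have "shift (h * t) g \<in> initial_edges (t + t')"
      using shift_chain_edge[OF gc(1), of t] by (simp add: initial_edges_def mult.commute)
    then show "e \<in> emb_edges (t + t') ?F"
      unfolding emb_edges_def g(2) right[OF gc(1), symmetric] by (rule imageI)
  qed
  ultimately show ?thesis by blast
qed


section \<open>Closing chains to cycles and cutting cycles open\<close>

lemma cycle_map_eqD:
  fixes F :: "nat \<Rightarrow> 'b"
  assumes inj: "inj_on F {1..n}" and per: "\<And>i. i \<in> {1..l} \<Longrightarrow> F (n + i) = F i" and ln: "l \<le> n"
    and ab: "a \<in> {1..n + l}" "b \<in> {1..n + l}" "F a = F b"
  shows "a = b \<or> a = b + n \<or> b = a + n"
proof -
  define red where "red x = (if x \<le> n then x else x - n)" for x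
  have red: "red x \<in> {1..n}" "F (red x) = F x" if "x \<in> {1..n + l}" for x
  proof -
    show "red x \<in> {1..n}" using that ln by (auto simp: red_def)
    show "F (red x) = F x"
    proof (cases "x \<le> n")
      case False
      then have "x - n \<in> {1..l}" "n + (x - n) = x" using that by auto
      then show ?thesis using per[of "x - n"] False by (simp add: red_def)
    qed (simp add: red_def)
  qed
  have "red a = red b"
    using inj_onD[OF inj _ red(1)[OF ab(1)] red(1)[OF ab(2)]] red(2)[OF ab(1)] red(2)[OF ab(2)] ab(3) by simp
  then show ?thesis unfolding red_def by (auto split: if_splits)
qed

text \<open>The edges of the start are identified with those of the end, so they contribute no
  further images.\<close>

lemma initial_minus_start:
  fixes F :: "nat \<Rightarrow> 'b"
  assumes per: "\<And>i. i \<in> {1..l} \<Longrightarrow> F (h * t + i) = F i" and t: "l \<le> h * t" "1 \<le> t"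
  shows "emb_edges t F = (`) F ` (initial_edges t - initial_edges 0)"
proof -
  have "F ` g \<in> (`) F ` (initial_edges t - initial_edges 0)" if g: "g \<in> initial_edges 0" for g
  proof -
    have gs: "g \<in> chain_edges" "g \<subseteq> {1..l}" using g by (auto simp: initial_edges_def)
    have "shift (h * t) g \<subseteq> {1..h * t + l}" using gs(2) by (auto simp: shift_def)
    then have 1: "shift (h * t) g \<in> initial_edges t"
      using shift_chain_edge[OF gs(1), of t] by (simp add: initial_edges_def mult.commute)
    obtain x where "x \<in> g" using chain_edges_bounds[OF gs(1)] by blast
    then have "x + h * t \<in> shift (h * t) g" "\<not> x + h * t \<le> l" using gs(2) t by (auto simp: shift_def)
    then have 2: "shift (h * t) g \<notin> initial_edges 0" by (auto simp: initial_edges_def)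
    have "F (i + h * t) = F i" if "i \<in> g" for i using per[of i] that gs(2) by (auto simp: add.commute)
    then have "F ` shift (h * t) g = F ` g" by (simp add: shift_def image_image)
    then show ?thesis using 1 2 by (metis DiffI imageI)
  qed
  then show ?thesis unfolding emb_edges_def by blast
qed

text \<open>Two positions with the same image are equal or \<open>n\<close> apart, while the
  positions of an edge lie within distance \<open>m\<close>, where \<open>3 * m \<le> n\<close>.
  After the removal of the start every edge has its maximum above \<open>l\<close>, which rules out
  two edges that are translates of each other by \<open>n\<close>.\<close>

lemma inj_on_cycle_edges:
  fixes F :: "nat \<Rightarrow> 'b"
  assumes inj: "inj_on F {1..h * t}" and per: "\<And>i. i \<in> {1..l} \<Longrightarrow> F (h * t + i) = F i" and big: "3 * m \<le> h * t"
  shows "inj_on ((`) F) (initial_edges t - initial_edges 0)"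
proof -
  define n where "n = h * t"
  have ln: "l \<le> n" using big l_less_m by (simp add: n_def)
  have props: "finite g" "g \<noteq> {}" "g \<subseteq> {1..n + l}" "\<And>x y. x \<in> g \<Longrightarrow> y \<in> g \<Longrightarrow> x < y + m" "l < Max g" "Max g \<in> g"
    "\<And>x. x \<in> g \<Longrightarrow> x \<le> Max g"
    if g: "g \<in> initial_edges t - initial_edges 0" for g
  proof -
    have gc: "g \<in> chain_edges" using g by (simp add: initial_edges_def)
    note b = chain_edges_bounds[OF gc]
    show 1: "finite g" "g \<noteq> {}" "g \<subseteq> {1..n + l}" "\<And>x y. x \<in> g \<Longrightarrow> y \<in> g \<Longrightarrow> x < y + m"
      using b g by (auto simp: initial_edges_def n_def)
    show 2: "Max g \<in> g" and 3: "\<And>x. x \<in> g \<Longrightarrow> x \<le> Max g" using 1 by auto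
    have "\<not> g \<subseteq> {1..l}" using g gc by (simp add: initial_edges_def)
    then obtain x where "x \<in> g" "l < x" using b by fastforce
    then show "l < Max g" using 3 by fastforce
  qed
  have coll: "a = b \<or> a = b + n \<or> b = a + n" if "a \<in> {1..n + l}" "b \<in> {1..n + l}" "F a = F b" for a b
    using cycle_map_eqD[of F n a b] inj per ln that by (simp add: n_def)
  have sub: "g \<subseteq> g'" if g: "g \<in> initial_edges t - initial_edges 0" and g': "g' \<in> initial_edges t - initial_edges 0"
    and eq: "F ` g = F ` g'" for g g'
  proof -
    note p = props[OF g] and p' = props[OF g']
    have match: "\<exists>y'\<in>g'. x = y' \<or> x = y' + n \<or> y' = x + n" if "x \<in> g" for x
    proof -
      have "F x \<in> F ` g'" using that eq by blast
      then obtain y' where "y' \<in> g'" "F x = F y'" by auto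
      moreover from this have "x \<in> {1..n + l}" "y' \<in> {1..n + l}" using p(3) p'(3) that by blast+
      ultimately show ?thesis using coll[of x y'] by blast
    qed
    have match': "\<exists>y\<in>g. x = y \<or> x = y + n \<or> y = x + n" if "x \<in> g'" for x
    proof -
      have "F x \<in> F ` g" using that eq by blast
      then obtain y where "y \<in> g" "F x = F y" by auto
      moreover from this have "x \<in> {1..n + l}" "y \<in> {1..n + l}" using p(3) p'(3) that by blast+
      ultimately show ?thesis using coll[of x y] by blast
    qed
    obtain y' where y': "y' \<in> g'" "Max g = y' \<or> Max g = y' + n"
      using match[OF p(6)] p(5) p'(3) by fastforce
    obtain y where y: "y \<in> g" "Max g' = y \<or> Max g' = y + n"
      using match'[OF p'(6)] p'(5) p(3) by fastforce
    have d: "Max g' < y' + m" "Max g < y + m" "y' \<le> Max g'" "y \<le> Max g"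
      using p(4)[OF p(6) y(1)] p'(4)[OF p'(6) y'(1)] p(7)[OF y(1)] p'(7)[OF y'(1)] by auto
    have mn: "3 * m \<le> n" using big by (simp add: n_def)
    have "Max g = Max g'" using y(2) y'(2) d mn by linarith
    show "g \<subseteq> g'"
    proof
      fix x assume x: "x \<in> g"
      then obtain x' where x': "x' \<in> g'" "x = x' \<or> x = x' + n \<or> x' = x + n" using match by blast
      have "Max g < x + m" "Max g' < x' + m" "x \<le> Max g" "x' \<le> Max g'"
        using p(4)[OF p(6) x] p'(4)[OF p'(6) x'(1)] p(7)[OF x] p'(7)[OF x'(1)] by auto
      then have "x = x'" using x'(2) \<open>Max g = Max g'\<close> mn by linarith
      then show "x \<in> g'" using x' by simp
    qed
  qed
  show ?thesis by (rule inj_onI) (use sub in blast)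
qed

lemma card_cycle_edges:
  fixes F :: "nat \<Rightarrow> 'b"
  assumes "inj_on F {1..h * t}" and "\<And>i. i \<in> {1..l} \<Longrightarrow> F (h * t + i) = F i" and "3 * m \<le> h * t"
  shows "card (emb_edges t F) = r * t"
proof -
  have "t \<noteq> 0" using assms(3) l_less_m by (cases "t = 0") auto
  then have t: "1 \<le> t" "l \<le> h * t" using assms(3) l_less_m by auto
  have "card (emb_edges t F) = card (initial_edges t - initial_edges 0)"
    using initial_minus_start[of F t] inj_on_cycle_edges[of F t] assms t by (simp add: card_image)
  also have "\<dots> = card (initial_edges t) - card (initial_edges 0)"
    by (rule card_Diff_subset[OF finite_initial_edges initial_edges_mono]) simp
  finally show ?thesis by (simp add: card_initial_edges)
qed

lemma cycle_of_map:
  fixes F :: "nat \<Rightarrow> 'b"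
  assumes inj: "inj_on F {1..h * t}" and per: "\<And>i. i \<in> {1..l} \<Longrightarrow> F (h * t + i) = F i"
    and t: "1 \<le> t" "l \<le> h * t"
  shows "hamilton_cycle_on l m A (F ` {1..h * t}) (F ` {1..h * t}, emb_edges t F)"
proof -
  let ?R = "\<lambda>x y. x \<in> {1..l} \<and> y = (m - l) * t + x"
  have hml: "m - l = h" by (simp add: h_def)
  have "F ` {1..h * t + l} = F ` {1..h * t}"
  proof
    show "F ` {1..h * t + l} \<subseteq> F ` {1..h * t}"
    proof
      fix y assume "y \<in> F ` {1..h * t + l}"
      then obtain x where x: "x \<in> {1..h * t + l}" "y = F x" by blast
      show "y \<in> F ` {1..h * t}"
      proof (cases "x \<le> h * t")
        case False
        then have i: "x - h * t \<in> {1..l}" "h * t + (x - h * t) = x" using x by auto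
        then have "y = F (x - h * t)" using per[of "x - h * t"] x(2) by simp
        moreover have "x - h * t \<in> {1..h * t}" using i(1) t(2) by auto
        ultimately show ?thesis by blast
      qed (use x in auto)
    qed
  qed (intro image_mono, auto)
  moreover have "F i = F j \<longleftrightarrow> equivclp ?R i j" if ij: "i \<in> {1..h * t + l}" "j \<in> {1..h * t + l}" for i j
  proof
    assume "F i = F j"
    from cycle_map_eqD[OF inj per t(2) ij this] consider "i = j" | "i = j + h * t" | "j = i + h * t" by blast
    then show "equivclp ?R i j"
    proof cases
      case 2
      then have "?R j i" using ij by (auto simp: hml)
      then show ?thesis by (blast intro: equivclp_sym r_into_equivclp)
    next
      case 3
      then have "?R i j" using ij by (auto simp: hml)
      then show ?thesis by (rule r_into_equivclp)
    qed simp
  next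
    assume "equivclp ?R i j"
    then show "F i = F j"
    proof (induction rule: equivclp_induct)
      case (step y z)
      then show ?case using per by (auto simp: hml)
    qed simp
  qed
  ultimately show ?thesis
    using t(1) unfolding hamilton_cycle_on_def is_cycle_def
    by (intro conjI exI[of _ t] exI[of _ "({1..h * t + l}, initial_edges t)"] exI[of _ F])
      (auto simp: is_chain_iff emb_edges_def)
qed

text \<open>This passes from the Hamilton cycles that the threshold provides to chains of any length
  that fits. The quotient map is injective on \<open>{1..h * t}\<close>, because \<open>red\<close>
  is constant on the identified classes and the identity there.\<close>

lemma cycle_subchain:
  fixes C :: "'b hypergraph"
  assumes C: "is_cycle l m A C" and big: "2 * m \<le> card (verts C)" and t': "h * t' + l \<le> card (verts C)"
  shows "\<exists>F. chain_map t' F \<and> span t' F \<subseteq> verts C \<and> emb_edges t' F \<subseteq> edges C"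
proof -
  have hml: "m - l = h" by (simp add: h_def)
  from C obtain t P F where P: "is_chain l m A t P"
    and eq: "\<forall>i\<in>verts P. \<forall>j\<in>verts P. F i = F j \<longleftrightarrow> equivclp (\<lambda>x y. x \<in> {1..l} \<and> y = (m - l) * t + x) i j"
    and V: "verts C = F ` verts P" "edges C = (`) F ` edges P"
    unfolding is_cycle_def by (elim exE conjE) (rule that)
  have Pe: "verts P = {1..h * t + l}" "edges P = initial_edges t" using P by (auto simp: is_chain_iff)
  let ?R = "\<lambda>x y. x \<in> {1..l} \<and> y = h * t + x"
  have "card (verts C) \<le> h * t + l" unfolding V Pe using card_image_le[of "{1..h * t + l}" F] by simp
  then have ln: "l \<le> h * t" using big l_less_m by linarith
  define red where "red x = (if x \<le> h * t then x else x - h * t)" for x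
  have inv: "red i = red j" if "equivclp ?R i j" for i j
    using that
  proof (induction rule: equivclp_induct)
    case (step y z)
    have "red a = red b" if "?R a b" for a b using that ln by (auto simp: red_def)
    then show ?case using step by auto
  qed simp
  have inj: "inj_on F {1..h * t}"
  proof (rule inj_onI)
    fix i j assume ij: "i \<in> {1..h * t}" "j \<in> {1..h * t}" "F i = F j"
    then have "equivclp ?R i j" using eq by (simp add: Pe hml)
    from inv[OF this] show "i = j" using ij by (simp add: red_def)
  qed
  have "verts C \<subseteq> F ` {1..h * t}"
  proof
    fix y assume "y \<in> verts C"
    then obtain x where x: "x \<in> {1..h * t + l}" "y = F x" unfolding V Pe by blast
    show "y \<in> F ` {1..h * t}"
    proof (cases "x \<le> h * t")
      case False
      then have "?R (x - h * t) x" using x by auto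
      then have "equivclp ?R (x - h * t) x" by (rule r_into_equivclp)
      moreover have "x - h * t \<in> verts P" "x \<in> verts P" using x False ln by (auto simp: Pe)
      ultimately have "F (x - h * t) = y" using eq x(2) by (simp add: hml)
      moreover have "x - h * t \<in> {1..h * t}" using False x ln by auto
      ultimately show ?thesis by blast
    qed (use x in auto)
  qed
  then have "card (verts C) \<le> h * t" using card_mono[of "F ` {1..h * t}" "verts C"] card_image_le[of "{1..h * t}" F] by simp
  then have le: "h * t' + l \<le> h * t" using t' by simp
  have "chain_map t' F" unfolding chain_map_def using le by (intro inj_on_subset[OF inj]) auto
  moreover have "{1..h * t' + l} \<subseteq> {1..h * t + l}"
  proof
    fix x assume "x \<in> {1..h * t' + l}"
    then have "1 \<le> x" "x \<le> h * t' + l" by auto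
    moreover from this have "x \<le> h * t + l" using le by linarith
    ultimately show "x \<in> {1..h * t + l}" by simp
  qed
  then have "span t' F \<subseteq> verts C" unfolding span_def V Pe by (rule image_mono)
  moreover have "emb_edges t' F \<subseteq> edges C"
  proof -
    have "h * t' \<le> h * t" using le by linarith
    then have "t' \<le> t" using h_pos by simp
    then show ?thesis unfolding emb_edges_def V Pe by (intro image_mono initial_edges_mono)
  qed
  ultimately show ?thesis by blast
qed


section \<open>Chains from the threshold and the three properties\<close>

lemma initial_edges_1: "initial_edges 1 = edges A"
proof
  show "initial_edges 1 \<subseteq> edges A"
  proof
    fix g assume "g \<in> initial_edges 1"
    then obtain q e where "q < 1" "e \<in> edges A" "g = shift (q * h) e"
      using initial_edges_in_block[of g 1] by auto
    then show "g \<in> edges A" by simp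
  qed
  show "edges A \<subseteq> initial_edges 1"
  proof
    fix e assume e: "e \<in> edges A"
    have "e \<subseteq> {1..h * 1 + l}" using edges_A(1)[OF e] h_l(1) by simp
    then show "e \<in> initial_edges 1" using chain_edgesI[OF e, of 0] by (simp add: initial_edges_def)
  qed
qed

section \<open>The threshold as an attained minimum\<close>

lemma hamilton_degree_suffices_nonneg:
  assumes "edges A \<noteq> {}" "hamilton_degree_suffices k l m A d \<delta>"
  shows "0 \<le> \<delta>"
proof (rule ccontr)
  assume "\<not> 0 \<le> \<delta>"
  \<comment> \<open>With slack \<open>- \<delta>\<close> the required degree is 0, so the edgeless
    hypergraph would have to contain a cycle.\<close>
  then have "- \<delta> > 0" by simp
  with assms(2) obtain n0 where n0: "\<forall>n\<ge>n0. (m - l) dvd n \<longrightarrow>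
        (\<forall>H :: nat hypergraph.
           uniform_hypergraph k H \<and> card (verts H) = n \<and>
           real (min_degree d H) \<ge> (\<delta> + (- \<delta>)) * real n ^ (k - d) \<longrightarrow>
           (\<exists>C. hamilton_cycle_on l m A (verts H) C \<and> edges C \<subseteq> edges H))"
    unfolding hamilton_degree_suffices_def by blast
  define n where "n = h * n0"
  have "1 * n0 \<le> h * n0" using h_pos by (rule mult_right_mono) simp
  then have "n \<ge> n0" "(m - l) dvd n" by (auto simp: n_def h_def)
  then obtain C :: "nat hypergraph" where C: "is_cycle l m A C" "edges C \<subseteq> {}"
    using n0[rule_format, of n "({1..n}, {})"] by (auto simp: uniform_hypergraph_def hamilton_cycle_on_def)
  then obtain t P f where "is_chain l m A t P" "edges C = (`) f ` edges P"
    unfolding is_cycle_def by (elim exE conjE) (rule that)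
  then have "1 \<le> t" "edges C = (`) f ` initial_edges t" by (auto simp: is_chain_iff)
  then have "edges A = {}" using C(2) initial_edges_mono[of 1 t] initial_edges_1 by auto
  then show False using assms(1) by simp
qed

lemma hamilton_degree_suffices_one:
  assumes "k = d + p"
  shows "hamilton_degree_suffices k l m A d 1"
  unfolding hamilton_degree_suffices_def
proof (intro allI impI)
  fix \<alpha> :: real assume \<alpha>: "\<alpha> > 0"
  have False if H: "uniform_hypergraph k H" "card (verts H) = n"
      "real (min_degree d H) \<ge> (1 + \<alpha>) * real n ^ (k - d)" and n: "n \<ge> max 1 d" for n and H :: "nat hypergraph"
  proof -
    have "degree_into d p (verts H) (edges H) (verts H) (1 + \<alpha>)"
      using degree_into_min_degree[OF H(1) refl] H(2,3) assms by simp
    moreover have "uniform_edges (d + p) (verts H) (edges H)"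
      using H(1) assms by (simp add: uniform_hypergraph_def uniform_edges_def)
    moreover have "finite (verts H)" "verts H \<noteq> {}" "d \<le> card (verts H)"
      using H(1,2) n by (auto simp: uniform_hypergraph_def)
    ultimately have "1 + \<alpha> \<le> 1" by (intro degree_into_le_one)
    then show False using \<alpha> by simp
  qed
  then show "\<exists>n0::nat. \<forall>n\<ge>n0. (m - l) dvd n \<longrightarrow>
        (\<forall>H :: nat hypergraph.
           uniform_hypergraph k H \<and> card (verts H) = n \<and>
           real (min_degree d H) \<ge> (1 + \<alpha>) * real n ^ (k - d) \<longrightarrow>
           (\<exists>C. hamilton_cycle_on l m A (verts H) C \<and> edges C \<subseteq> edges H))"
    by (intro exI[of _ "max 1 d"]) blast
qed

lemma hamilton_degree_suffices_mono:
  assumes "hamilton_degree_suffices k l m A d \<delta>" "\<delta> \<le> \<delta>'"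
  shows "hamilton_degree_suffices k l m A d \<delta>'"
  unfolding hamilton_degree_suffices_def
proof (intro allI impI)
  fix \<alpha> :: real assume "\<alpha> > 0"
  then obtain n0 where n0: "\<forall>n\<ge>n0. (m - l) dvd n \<longrightarrow>
        (\<forall>H :: nat hypergraph.
           uniform_hypergraph k H \<and> card (verts H) = n \<and>
           real (min_degree d H) \<ge> (\<delta> + \<alpha>) * real n ^ (k - d) \<longrightarrow>
           (\<exists>C. hamilton_cycle_on l m A (verts H) C \<and> edges C \<subseteq> edges H))"
    using assms(1) unfolding hamilton_degree_suffices_def by blast
  have le: "(\<delta> + \<alpha>) * real n ^ (k - d) \<le> (\<delta>' + \<alpha>) * real n ^ (k - d)" for n
    using assms(2) by (intro mult_right_mono) auto
  show "\<exists>n0::nat. \<forall>n\<ge>n0. (m - l) dvd n \<longrightarrow>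
        (\<forall>H :: nat hypergraph.
           uniform_hypergraph k H \<and> card (verts H) = n \<and>
           real (min_degree d H) \<ge> (\<delta>' + \<alpha>) * real n ^ (k - d) \<longrightarrow>
           (\<exists>C. hamilton_cycle_on l m A (verts H) C \<and> edges C \<subseteq> edges H))"
    using n0 order_trans[OF le] by (intro exI[of _ n0]) blast
qed

text \<open>The threshold is a minimum: the sufficient degrees form a closed half-line bounded below by 0.\<close>

lemma hamilton_threshold_suffices:
  assumes "edges A \<noteq> {}" "k = d + p"
  shows "hamilton_degree_suffices k l m A d (hamilton_threshold k l m A d)"
    "0 \<le> hamilton_threshold k l m A d"
proof -
  let ?P = "hamilton_degree_suffices k l m A d"
  define \<delta> where "\<delta> = Inf {x. ?P x}"
  have ne: "{x. ?P x} \<noteq> {}" using hamilton_degree_suffices_one[OF assms(2)] by blast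
  have bdd: "bdd_below {x. ?P x}"
    using hamilton_degree_suffices_nonneg[OF assms(1)] by (intro bdd_belowI[of _ 0]) auto
  have "?P \<delta>"
    unfolding hamilton_degree_suffices_def
  proof (intro allI impI)
    fix \<alpha> :: real assume "\<alpha> > 0"
    then have "Inf {x. ?P x} < \<delta> + \<alpha>" by (simp add: \<delta>_def)
    then obtain x where x: "?P x" "x < \<delta> + \<alpha>" using cInf_less_iff[OF ne bdd] by auto
    define \<beta> where "\<beta> = \<delta> + \<alpha> - x"
    have "\<beta> > 0" "x + \<beta> = \<delta> + \<alpha>" using x by (auto simp: \<beta>_def)
    then show "\<exists>n0::nat. \<forall>n\<ge>n0. (m - l) dvd n \<longrightarrow>
        (\<forall>H :: nat hypergraph.
           uniform_hypergraph k H \<and> card (verts H) = n \<and>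
           real (min_degree d H) \<ge> (\<delta> + \<alpha>) * real n ^ (k - d) \<longrightarrow>
           (\<exists>C. hamilton_cycle_on l m A (verts H) C \<and> edges C \<subseteq> edges H))"
      using x(1) unfolding hamilton_degree_suffices_def by metis
  qed
  moreover have "\<delta> \<le> x" if "?P x" for x unfolding \<delta>_def using that bdd by (intro cInf_lower) auto
  ultimately have "hamilton_threshold k l m A d = \<delta>"
    unfolding hamilton_threshold_def by (rule Least_equality)
  then show "?P (hamilton_threshold k l m A d)" using \<open>?P \<delta>\<close> by simp
  then show "0 \<le> hamilton_threshold k l m A d" by (rule hamilton_degree_suffices_nonneg[OF assms(1)])
qed

text \<open>The threshold is applied to the host induced on \<open>S\<close>, after dropping fewer
  than \<open>h\<close> vertices for divisibility, and a chain is cut out of the resulting Hamilton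
  cycle. The extra \<open>m\<close> in the size bound pays for the dropped vertices.\<close>

lemma exists_long_chain:
  fixes x a :: real
  assumes suff: "hamilton_degree_suffices k l m A d x" and k: "k = d + p" "p \<ge> 1"
    and a: "a > 0" and x: "0 \<le> x" "x + a \<le> 1"
  shows "\<exists>n0. \<forall>(V :: nat set) S E t. finite V \<and> S \<subseteq> V \<and> n0 \<le> card S \<and> uniform_edges k V E \<and>
     degree_into d p V E S (x + 2 * a) \<and> h * t + l + m \<le> card S \<longrightarrow>
     (\<exists>f. chain_map t f \<and> span t f \<subseteq> S \<and> emb_edges t f \<subseteq> E)"
proof -
  obtain n1 where n1: "\<forall>n\<ge>n1. (m - l) dvd n \<longrightarrow>
        (\<forall>H :: nat hypergraph.
           uniform_hypergraph k H \<and> card (verts H) = n \<and>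
           real (min_degree d H) \<ge> (x + a) * real n ^ (k - d) \<longrightarrow>
           (\<exists>C. hamilton_cycle_on l m A (verts H) C \<and> edges C \<subseteq> edges H))"
    using suff a unfolding hamilton_degree_suffices_def by blast
  have sl: "slack p a > 0" by (rule slack(1)[OF a])
  obtain n2 :: nat where n2: "real h / slack p a \<le> real n2" using real_arch_simple by blast
  show ?thesis
  proof (intro exI[of _ "n1 + n2 + d + 3 * m"] allI impI, elim conjE)
    fix V S :: "nat set" and E t
    assume fin: "finite V" "S \<subseteq> V" and n: "n1 + n2 + d + 3 * m \<le> card S" and E: "uniform_edges k V E"
      and deg: "degree_into d p V E S (x + 2 * a)" and t: "h * t + l + m \<le> card S"
    have fS: "finite S" using fin finite_subset by blast
    have hm: "h \<le> m" by (simp add: h_def)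
    define b where "b = card S mod h"
    have b: "b < h" using h_pos by (simp add: b_def)
    have "card S - b \<le> card S" by simp
    then obtain T where T: "T \<subseteq> S" "card T = card S - b" "finite T"
      using obtain_subset_with_card_n by blast
    have dvd: "h dvd card T" unfolding T(2) b_def by (simp add: minus_mod_eq_mult_div)
    have bS: "b \<le> card S" using b n hm by linarith
    have "card (S - T) = b" using T fS bS by (simp add: card_Diff_subset)
    have lost: "real (card (S - T)) \<le> slack p a * real (card S)"
    proof -
      have "real h \<le> slack p a * real n2" using n2 sl by (simp add: field_simps)
      also have "\<dots> \<le> slack p a * real (card S)" using n sl by (intro mult_left_mono) auto
      finally show ?thesis using b \<open>card (S - T) = b\<close> by simp
    qed
    have "real (card T) \<le> real (card S)" using T(2) by simp
    also have "\<dots> \<le> (1 + slack p a) * real (card S)" using sl by (simp add: distrib_right)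
    finally have size: "real (card T) \<le> (1 + slack p a) * real (card S)" .
    have degT: "degree_into d p V E T (x + a)"
    proof (rule degree_into_change[OF fin T(3) k(2) a _ _ _ lost size])
      show "uniform_edges (d + p) V E" using E k by simp
      have "x + 2 * a = x + a + a" by simp
      then show "degree_into d p V E S (x + a + a)" using deg by (simp only:)
    qed (use x a in auto)
    define H where "H = (T, {e \<in> E. e \<subseteq> T})"
    have fE: "finite E" using finite_uniform_edges[OF fin(1) E] .
    have "(x + a) * real (card T) ^ p \<le> real (min_degree d H)"
      unfolding H_def by (rule min_degree_host[OF T(3) _ _ degT]) (use T fin n b hm fE in auto)
    moreover have "uniform_hypergraph k H"
      using E T(3) by (auto simp: uniform_hypergraph_def uniform_edges_def H_def)
    moreover have "n1 \<le> card T" using T(2) n b hm by linarith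
    ultimately obtain C where C: "hamilton_cycle_on l m A T C" "edges C \<subseteq> {e \<in> E. e \<subseteq> T}"
      using n1[rule_format, of "card T" H] dvd k(1) by (auto simp: H_def h_def)
    then have "is_cycle l m A C" "verts C = T" by (auto simp: hamilton_cycle_on_def)
    moreover have "2 * m \<le> card T" "h * t + l \<le> card T" using T(2) n b hm t by linarith+
    ultimately obtain f where "chain_map t f" "span t f \<subseteq> T" "emb_edges t f \<subseteq> edges C"
      using cycle_subchain[of C t] by auto
    then show "\<exists>f. chain_map t f \<and> span t f \<subseteq> S \<and> emb_edges t f \<subseteq> E" using T(1) C(2) by blast
  qed
qed


text \<open>The conclusion of property Con, relative to a reservoir \<open>S\<close> with used part \<open>Z\<close>: the new
  vertices of the connecting chain are taken from \<open>S - Z\<close>, its new edges from \<open>E\<close>.\<close>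

definition connects :: "nat set \<Rightarrow> nat set set \<Rightarrow> nat \<Rightarrow> nat set \<Rightarrow> (nat \<Rightarrow> nat) \<Rightarrow> (nat \<Rightarrow> nat) \<Rightarrow> bool" where
  "connects S E c Z s e \<longleftrightarrow>
     (\<exists>t f. 1 \<le> t \<and> t \<le> c \<and> chain_map t f \<and> span t f \<subseteq> (S - Z) \<union> s ` {1..l} \<union> e ` {1..l} \<and>
        (\<forall>i\<in>{1..l}. f i = s i \<and> f (h * t + i) = e i) \<and>
        emb_edges t f \<subseteq> E \<union> emb_edges 0 s \<union> emb_edges 0 e)"

lemma emb_edges_start: "emb_edges 0 f \<subseteq> emb_edges t f"
  unfolding emb_edges_def by (intro image_mono initial_edges_mono) simp

lemma emb_edges_end: "emb_edges 0 (\<lambda>i. f (h * t + i)) \<subseteq> emb_edges t f"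
proof
  fix e assume "e \<in> emb_edges 0 (\<lambda>i. f (h * t + i))"
  then obtain g where g: "g \<in> initial_edges 0" "e = (\<lambda>i. f (h * t + i)) ` g" by (auto simp: emb_edges_def)
  then have gc: "g \<in> chain_edges" "g \<subseteq> {1..l}" by (auto simp: initial_edges_def)
  have "shift (h * t) g \<subseteq> {1..h * t + l}" using gc(2) by (auto simp: shift_def)
  then have "shift (h * t) g \<in> initial_edges t"
    using shift_chain_edge[OF gc(1), of t] by (simp add: initial_edges_def mult.commute)
  moreover have "e = f ` shift (h * t) g" unfolding g(2) shift_def by (simp add: image_image add.commute)
  ultimately show "e \<in> emb_edges t f" unfolding emb_edges_def by blast
qed

text \<open>The pieces are linked in order, by induction on \<open>N\<close>: the end of the chain
  so far is connected to the start of the next piece. Each link uses at most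
  \<open>h * c + l\<close> vertices of the reservoir, so the bound \<open>\<xi>\<close> on its used
  part is respected throughout.\<close>

lemma connect_pieces:
  fixes tf :: "nat \<Rightarrow> nat" and f :: "nat \<Rightarrow> nat \<Rightarrow> nat"
  assumes finS: "finite S"
    and con: "\<And>Z s e. real (card (S \<inter> Z)) \<le> \<xi> \<Longrightarrow> inj_on s {1..l} \<Longrightarrow> inj_on e {1..l} \<Longrightarrow>
        s ` {1..l} \<subseteq> V \<Longrightarrow> e ` {1..l} \<subseteq> V \<Longrightarrow> s ` {1..l} \<inter> e ` {1..l} = {} \<Longrightarrow> connects S E c Z s e"
    and pieces: "\<And>i. i \<le> N \<Longrightarrow> chain_map (tf i) (f i) \<and> span (tf i) (f i) \<subseteq> V \<inter> Z"
    and SV: "S \<subseteq> V"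
    and disj: "\<And>i j. i \<le> N \<Longrightarrow> j \<le> N \<Longrightarrow> i \<noteq> j \<Longrightarrow> span (tf i) (f i) \<inter> span (tf j) (f j) = {}"
    and room: "real (card (S \<inter> Z)) + real (N * (h * c + l)) \<le> \<xi>"
  shows "\<exists>t F. chain_map t F \<and> (\<forall>i\<in>{1..l}. F i = f 0 i \<and> F (h * t + i) = f N (h * tf N + i)) \<and>
     (\<Union>i\<le>N. span (tf i) (f i)) \<subseteq> span t F \<and>
     span t F \<subseteq> (\<Union>i\<le>N. span (tf i) (f i)) \<union> (S - Z) \<and>
     card (span t F - (\<Union>i\<le>N. span (tf i) (f i))) \<le> N * (h * c + l) \<and>
     (\<Union>i\<le>N. emb_edges (tf i) (f i)) \<subseteq> emb_edges t F \<and>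
     emb_edges t F \<subseteq> (\<Union>i\<le>N. emb_edges (tf i) (f i)) \<union> E"
  using pieces disj room
proof (induction N)
  case 0
  then show ?case by (intro exI[of _ "tf 0"] exI[of _ "f 0"]) auto
next
  case (Suc N)
  let ?U = "\<Union>i\<le>N. span (tf i) (f i)"
  let ?g = "f (Suc N)" and ?tg = "tf (Suc N)"
  have "\<exists>t F. chain_map t F \<and> (\<forall>i\<in>{1..l}. F i = f 0 i \<and> F (h * t + i) = f N (h * tf N + i)) \<and>
     ?U \<subseteq> span t F \<and> span t F \<subseteq> ?U \<union> (S - Z) \<and> card (span t F - ?U) \<le> N * (h * c + l) \<and>
     (\<Union>i\<le>N. emb_edges (tf i) (f i)) \<subseteq> emb_edges t F \<and>
     emb_edges t F \<subseteq> (\<Union>i\<le>N. emb_edges (tf i) (f i)) \<union> E"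
  proof (rule Suc.IH)
    have "real (N * (h * c + l)) \<le> real (Suc N * (h * c + l))" by simp
    then show "real (card (S \<inter> Z)) + real (N * (h * c + l)) \<le> \<xi>" using Suc.prems(3) by linarith
  qed (use Suc.prems(1,2) in auto)
  then obtain t F where F1: "chain_map t F" and F2: "\<forall>i\<in>{1..l}. F i = f 0 i \<and> F (h * t + i) = f N (h * tf N + i)"
    and F3: "?U \<subseteq> span t F" "span t F \<subseteq> ?U \<union> (S - Z)" "card (span t F - ?U) \<le> N * (h * c + l)"
    "(\<Union>i\<le>N. emb_edges (tf i) (f i)) \<subseteq> emb_edges t F"
    "emb_edges t F \<subseteq> (\<Union>i\<le>N. emb_edges (tf i) (f i)) \<union> E" by (elim exE conjE) (rule that)
  have "F i = f 0 i" if "i \<in> {1..l}" for i using F2 that by blast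
  note F = F1 this F3
  have g: "chain_map ?tg ?g" "span ?tg ?g \<subseteq> V" "span ?tg ?g \<subseteq> Z" using Suc.prems(1)[of "Suc N"] by auto
  have "span ?tg ?g \<inter> span (tf i) (f i) = {}" if "i \<le> N" for i using Suc.prems(2)[of "Suc N" i] that by simp
  then have gU: "span ?tg ?g \<inter> ?U = {}" by blast
  have "span (tf i) (f i) \<subseteq> V" "span (tf i) (f i) \<subseteq> Z" if "i \<le> N" for i using Suc.prems(1)[of i] that by auto
  then have UV: "?U \<subseteq> V" and UZ: "?U \<subseteq> Z" by blast+
  have gF: "span ?tg ?g \<inter> span t F = {}" using gU g(3) F(4) by blast
  have FV: "span t F \<subseteq> V" using F(4) UV SV by blast
  let ?s = "\<lambda>i. F (h * t + i)"
  \<comment> \<open>The next link avoids the vertices of all pieces, the later ones included, and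
    those of the links made so far.\<close>
  let ?Z = "Z \<union> span t F"
  have sF: "?s ` {1..l} \<subseteq> span t F" by (auto simp: span_def)
  have eg: "?g ` {1..l} \<subseteq> span ?tg ?g" by (auto simp: span_def)
  have "connects S E c ?Z ?s ?g"
  proof (rule con)
    have "card (S \<inter> ?Z) \<le> card ((S \<inter> Z) \<union> (span t F - ?U))"
    proof (rule card_mono)
      show "S \<inter> ?Z \<subseteq> (S \<inter> Z) \<union> (span t F - ?U)" using UZ by blast
    qed (use finS in auto)
    also have "\<dots> \<le> card (S \<inter> Z) + N * (h * c + l)"
      using card_Un_le F(5) by (rule order_trans[OF _ add_left_mono])
    also have "\<dots> \<le> card (S \<inter> Z) + Suc N * (h * c + l)" by simp
    finally have "real (card (S \<inter> ?Z)) \<le> real (card (S \<inter> Z)) + real (Suc N * (h * c + l))"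
      by (simp only: of_nat_add[symmetric] of_nat_le_iff)
    then show "real (card (S \<inter> ?Z)) \<le> \<xi>" using Suc.prems(3) by linarith
    show "inj_on ?s {1..l}"
    proof (rule inj_onI)
      fix i j assume "i \<in> {1..l}" "j \<in> {1..l}" "?s i = ?s j"
      then have "h * t + i = h * t + j"
        using inj_onD[of F "{1..h * t + l}" "h * t + i" "h * t + j"] F(1) by (auto simp: chain_map_def)
      then show "i = j" by simp
    qed
    show "inj_on ?g {1..l}" using g(1) unfolding chain_map_def by (rule inj_on_subset) auto
    show "?s ` {1..l} \<subseteq> V" using sF FV by blast
    show "?g ` {1..l} \<subseteq> V" using eg g(2) by blast
    show "?s ` {1..l} \<inter> ?g ` {1..l} = {}" using sF eg gF by blast
  qed
  then obtain tc q where q: "1 \<le> tc" "tc \<le> c" "chain_map tc q"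
    "span tc q \<subseteq> (S - ?Z) \<union> ?s ` {1..l} \<union> ?g ` {1..l}"
    "\<forall>i\<in>{1..l}. q i = ?s i \<and> q (h * tc + i) = ?g i"
    and q7: "emb_edges tc q \<subseteq> E \<union> emb_edges 0 ?s \<union> emb_edges 0 ?g"
    unfolding connects_def by (elim exE conjE) (rule that)
  have q5: "q i = ?s i" and q6: "q (h * tc + i) = ?g i" if "i \<in> {1..l}" for i using q(5) that by blast+
  define F1 where "F1 = glue t F q"
  define t1 where "t1 = t + tc"
  \<comment> \<open>The link is injective, so beyond its first \<open>l\<close> positions it avoids
    its own start; gluing requires this.\<close>
  have q_new: "q i \<notin> ?s ` {1..l}" if i: "i \<in> {l+1..h * tc + l}" for i
  proof
    assume "q i \<in> ?s ` {1..l}"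
    then obtain j where j: "j \<in> {1..l}" "q i = ?s j" by blast
    then have "q i = q j" using q5 by simp
    then have "i = j" using inj_onD[of q "{1..h * tc + l}" i j] q(3) i j by (auto simp: chain_map_def)
    then show False using i j by auto
  qed
  have q_out: "q i \<in> (S - ?Z) \<union> span ?tg ?g" if i: "i \<in> {l+1..h * tc + l}" for i
  proof -
    have "q i \<in> span tc q" using i by (auto simp: span_def)
    then show ?thesis using q(4) q_new[OF i] eg by blast
  qed
  have F1: "chain_map t1 F1" unfolding F1_def t1_def
  proof (rule chain_map_glue[where f' = q and f = F and t = t, OF q5 F(1) q(3)])
    show "span t F \<inter> q ` {l + 1..h * tc + l} = {}" using q_out gF by blast
  qed
  have spF1: "span t1 F1 = span t F \<union> span tc q" unfolding F1_def t1_def by (rule span_glue[where f' = q and f = F and t = t, OF q5])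
  have edF1: "emb_edges t1 F1 = emb_edges t F \<union> emb_edges tc q" unfolding F1_def t1_def by (rule emb_edges_glue[where f' = q and f = F and t = t, OF q5])
  have endF1: "F1 (h * t1 + i) = ?g i" if "i \<in> {1..l}" for i
  proof -
    have "F1 (h * t1 + i) = glue t F q (h * t + (h * tc + i))" by (simp add: F1_def t1_def algebra_simps)
    also have "\<dots> = q (h * tc + i)" by (rule glue_right[where f' = q and f = F and t = t, OF q5]) (use that in auto)
    finally show ?thesis using q6[OF that] by simp
  qed
  have ag: "?g i = F1 (h * t1 + i)" if "i \<in> {1..l}" for i using endF1[OF that] by simp
  define F2 where "F2 = glue t1 F1 ?g"
  define t2 where "t2 = t1 + ?tg"
  have g_new: "?g i \<notin> ?g ` {1..l}" if i: "i \<in> {l+1..h * ?tg + l}" for i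
  proof
    assume "?g i \<in> ?g ` {1..l}"
    then obtain j where j: "j \<in> {1..l}" "?g i = ?g j" by blast
    then have "i = j" using inj_onD[of ?g "{1..h * ?tg + l}" i j] g(1) i j by (auto simp: chain_map_def)
    then show False using i j by auto
  qed
  have F2: "chain_map t2 F2" unfolding F2_def t2_def
  proof (rule chain_map_glue[where f' = ?g and f = F1 and t = t1, OF ag F1 g(1)])
    have "?g i \<notin> span t1 F1" if i: "i \<in> {l+1..h * ?tg + l}" for i
    proof
      assume "?g i \<in> span t1 F1"
      moreover have gi: "?g i \<in> span ?tg ?g" using i by (auto simp: span_def)
      ultimately have "?g i \<in> span tc q" using gF spF1 by blast
      then show False using q(4) gi g(3) sF gF g_new[OF i] by blast
    qed
    then show "span t1 F1 \<inter> ?g ` {l + 1..h * ?tg + l} = {}" by blast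
  qed
  have spF2: "span t2 F2 = span t F \<union> span tc q \<union> span ?tg ?g"
    unfolding spF1[symmetric] F2_def t2_def by (rule span_glue[where f' = ?g and f = F1 and t = t1, OF ag])
  have edF2: "emb_edges t2 F2 = emb_edges t F \<union> emb_edges tc q \<union> emb_edges ?tg ?g"
    unfolding edF1[symmetric] F2_def t2_def by (rule emb_edges_glue[where f' = ?g and f = F1 and t = t1, OF ag])
  have start: "F2 i = f 0 i" if i: "i \<in> {1..l}" for i
  proof -
    have "F2 i = F1 i" unfolding F2_def by (rule glue_left) (use i in auto)
    also have "\<dots> = F i" unfolding F1_def by (rule glue_left) (use i in auto)
    finally show ?thesis using F(2)[OF i] by simp
  qed
  have fin: "F2 (h * t2 + i) = ?g (h * ?tg + i)" if i: "i \<in> {1..l}" for i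
  proof -
    have "F2 (h * t2 + i) = glue t1 F1 ?g (h * t1 + (h * ?tg + i))" by (simp add: F2_def t2_def algebra_simps)
    also have "\<dots> = ?g (h * ?tg + i)" by (rule glue_right[where f' = ?g and f = F1 and t = t1, OF ag]) (use i in auto)
    finally show ?thesis .
  qed
  have Un: "(\<Union>i\<le>Suc N. X i) = (\<Union>i\<le>N. X i) \<union> X (Suc N)" for X :: "nat \<Rightarrow> 'z set"
    by (auto simp: le_Suc_eq)
  have qsub: "span tc q \<subseteq> (S - Z) \<union> span t F \<union> span ?tg ?g" using q(4) sF eg by blast
  have c1: "card (span t2 F2 - (?U \<union> span ?tg ?g)) \<le> Suc N * (h * c + l)"
  proof -
    have "card (span t2 F2 - (?U \<union> span ?tg ?g)) \<le> card ((span t F - ?U) \<union> span tc q)"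
      unfolding spF2 by (intro card_mono) auto
    also have "\<dots> \<le> card (span t F - ?U) + card (span tc q)" by (rule card_Un_le)
    also have "card (span tc q) \<le> h * c + l"
      unfolding card_span[OF q(3)] using q(2) by simp
    finally show ?thesis using F(5) by simp
  qed
  \<comment> \<open>Edges of the link inside its two ends may lie outside \<open>E\<close>, but they
    are edges of the chain so far or of the next piece.\<close>
  have e1: "emb_edges t2 F2 \<subseteq> (\<Union>i\<le>N. emb_edges (tf i) (f i)) \<union> emb_edges ?tg ?g \<union> E"
    unfolding edF2 using q7 F(7) emb_edges_end[of F t] emb_edges_start[of ?g ?tg] by blast
  show ?case
    unfolding Un
  proof (intro exI[of _ t2] exI[of _ F2] conjI ballI)
    show "?U \<union> span ?tg ?g \<subseteq> span t2 F2" using F(3) spF2 by blast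
    show "span t2 F2 \<subseteq> ?U \<union> span ?tg ?g \<union> (S - Z)" using F(4) qsub unfolding spF2 by blast
    show "(\<Union>i\<le>N. emb_edges (tf i) (f i)) \<union> emb_edges ?tg ?g \<subseteq> emb_edges t2 F2"
      using F(6) edF2 by blast
  qed (use F2 start fin c1 e1 in auto)
qed


section \<open>The three properties relative to a vertex set\<close>

lemma absorbing_set:
  fixes \<delta> a :: real
  assumes Ab: "prop_Ab k l m A d \<delta>" and k: "k = d + p" and a: "a > 0"
  shows "\<exists>\<tau> \<eta> n0. 0 < \<tau> \<and> \<tau> \<le> a \<and> 0 < \<eta> \<and> \<eta> \<le> a \<and>
    (\<forall>(V :: nat set) S E. finite V \<and> S \<subseteq> V \<and> n0 \<le> card S \<and> uniform_edges k V E \<and>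
       degree_into d p V E S (\<delta> + a) \<longrightarrow>
       (\<exists>X s e. X \<subseteq> S \<and> real (card X) \<le> \<tau> * real (card S) \<and>
          (\<forall>L. L \<subseteq> S - X \<and> real (card L) \<le> \<eta> * real (card S) \<and> h dvd card L \<longrightarrow>
             (\<exists>t f. 1 \<le> t \<and> chain_map t f \<and> span t f = X \<union> L \<and> emb_edges t f \<subseteq> E \<and>
                (\<forall>i\<in>{1..l}. f i = s i \<and> f (h * t + i) = e i)))))"
proof -
  obtain \<tau> \<eta> :: real and n1 :: nat where te: "0 < \<tau>" "\<tau> \<le> a" "0 < \<eta>" "\<eta> \<le> a"
    and n1: "\<forall>n\<ge>n1. \<forall>H :: nat hypergraph.
           uniform_hypergraph k H \<and> card (verts H) = n \<and>
           real (min_degree d H) \<ge> (\<delta> + a) * real n ^ (k - d) \<longrightarrow>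
           (\<exists>X s e. X \<subseteq> verts H \<and> real (card X) \<le> \<tau> * real n \<and>
              (\<forall>L. L \<subseteq> verts H - X \<and> real (card L) \<le> \<eta> * real n \<and> (m - l) dvd card L \<longrightarrow>
                 (\<exists>t P f. is_chain l m A t P \<and> embedding f P H \<and> f ` verts P = X \<union> L \<and>
                    (\<forall>i \<in> {1..l}. f i = s i \<and> f ((m - l) * t + i) = e i))))"
    using Ab[unfolded prop_Ab_def, rule_format, OF a] by (elim exE conjE) (rule that)
  show ?thesis
  proof (rule exI[of _ \<tau>], rule exI[of _ \<eta>], rule exI[of _ "n1 + d"], intro conjI te allI impI, elim conjE)
    fix V S :: "nat set" and E
    assume fin: "finite V" "S \<subseteq> V" and n: "n1 + d \<le> card S" and E: "uniform_edges k V E"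
      and deg: "degree_into d p V E S (\<delta> + a)"
    have fS: "finite S" using fin finite_subset by blast
    define H where "H = (S, {e \<in> E. e \<subseteq> S})"
    have fE: "finite E" using finite_uniform_edges[OF fin(1) E] .
    have "(\<delta> + a) * real (card S) ^ p \<le> real (min_degree d H)"
      unfolding H_def by (rule min_degree_host[OF fS fin(2) _ deg]) (use n fE in auto)
    moreover have "uniform_hypergraph k H"
      using E fS by (auto simp: uniform_hypergraph_def uniform_edges_def H_def)
    ultimately have "\<exists>X s e. X \<subseteq> verts H \<and> real (card X) \<le> \<tau> * real (card S) \<and>
              (\<forall>L. L \<subseteq> verts H - X \<and> real (card L) \<le> \<eta> * real (card S) \<and> (m - l) dvd card L \<longrightarrow>
                 (\<exists>t P f. is_chain l m A t P \<and> embedding f P H \<and> f ` verts P = X \<union> L \<and>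
                    (\<forall>i \<in> {1..l}. f i = s i \<and> f ((m - l) * t + i) = e i)))"
      using n k by (intro n1[rule_format]) (auto simp: H_def)
    then obtain X s e where X: "X \<subseteq> verts H" "real (card X) \<le> \<tau> * real (card S)"
      and L: "\<forall>L. L \<subseteq> verts H - X \<and> real (card L) \<le> \<eta> * real (card S) \<and> (m - l) dvd card L \<longrightarrow>
                 (\<exists>t P f. is_chain l m A t P \<and> embedding f P H \<and> f ` verts P = X \<union> L \<and>
                    (\<forall>i \<in> {1..l}. f i = s i \<and> f ((m - l) * t + i) = e i))"
      by (elim exE conjE) (rule that)
    have XS: "X \<subseteq> S" using X(1) by (simp add: H_def)
    have absorb: "\<exists>t f. 1 \<le> t \<and> chain_map t f \<and> span t f = X \<union> L' \<and> emb_edges t f \<subseteq> E \<and>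
                (\<forall>i\<in>{1..l}. f i = s i \<and> f (h * t + i) = e i)"
      if "L' \<subseteq> S - X \<and> real (card L') \<le> \<eta> * real (card S) \<and> h dvd card L'" for L'
    proof -
      from that have "\<exists>t P f. is_chain l m A t P \<and> embedding f P H \<and> f ` verts P = X \<union> L' \<and>
                    (\<forall>i \<in> {1..l}. f i = s i \<and> f ((m - l) * t + i) = e i)"
        by (intro L[rule_format]) (auto simp: H_def h_def)
      then obtain t P f where P: "is_chain l m A t P" "embedding f P H" "f ` verts P = X \<union> L'"
         "\<forall>i \<in> {1..l}. f i = s i \<and> f ((m - l) * t + i) = e i" by (elim exE conjE) (rule that)
      have t: "1 \<le> t" and Peq: "P = ({1..h * t + l}, initial_edges t)" using P(1) by (auto simp: is_chain_iff)
      have "chain_map t f" "emb_edges t f \<subseteq> E"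
        using P(2) unfolding Peq embedding_chain_iff by (auto simp: H_def)
      moreover have "span t f = X \<union> L'" using P(3) by (simp add: Peq span_def)
      ultimately show ?thesis using t P(4) unfolding h_def[symmetric]
        by (intro exI[of _ t] exI[of _ f] conjI) assumption+
    qed
    show "\<exists>X s e. X \<subseteq> S \<and> real (card X) \<le> \<tau> * real (card S) \<and>
          (\<forall>L. L \<subseteq> S - X \<and> real (card L) \<le> \<eta> * real (card S) \<and> h dvd card L \<longrightarrow>
             (\<exists>t f. 1 \<le> t \<and> chain_map t f \<and> span t f = X \<union> L \<and> emb_edges t f \<subseteq> E \<and>
                (\<forall>i\<in>{1..l}. f i = s i \<and> f (h * t + i) = e i)))"
      by (rule exI[of _ X], rule exI[of _ s], rule exI[of _ e], intro conjI allI impI, rule XS, rule X(2),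
          rule absorb, assumption)
  qed
qed

text \<open>Con is applied to the free part of the reservoir together with the two ends. The ends
  may lie anywhere in \<open>V\<close>, and the degrees survive their addition because
  \<open>degree_into\<close> speaks of all \<open>d\<close>-sets of \<open>V\<close>.\<close>

lemma connecting_chains:
  fixes \<delta> a :: real
  assumes Con: "prop_Con k l m A d \<delta>" and k: "k = d + p" "p \<ge> 1" and a: "a > 0"
    and \<delta>: "0 \<le> \<delta>" "\<delta> + a \<le> 1"
  shows "\<exists>c\<ge>1. \<exists>n0. \<forall>(V :: nat set) S E Z s e.
     finite V \<and> S \<subseteq> V \<and> n0 \<le> card S \<and> uniform_edges k V E \<and> degree_into d p V E S (\<delta> + 2 * a) \<and>
     real (card (S \<inter> Z)) \<le> slack p a * real (card S) \<and> inj_on s {1..l} \<and> inj_on e {1..l} \<and>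
     s ` {1..l} \<subseteq> V \<and> e ` {1..l} \<subseteq> V \<and> s ` {1..l} \<inter> e ` {1..l} = {} \<longrightarrow> connects S E c Z s e"
proof -
  obtain c n1 :: nat where c: "1 \<le> c" and n1: "\<forall>n\<ge>n1. \<forall>H :: nat hypergraph.
           uniform_hypergraph k H \<and> card (verts H) = n \<and>
           real (min_degree d H) \<ge> (\<delta> + a) * real n ^ (k - d) \<longrightarrow>
           (\<forall>s e. embedding s (link_start l A) H \<and> embedding e (link_start l A) H \<and>
              s ` {1..l} \<inter> e ` {1..l} = {} \<longrightarrow>
              (\<exists>t P f. t \<le> c \<and> is_chain l m A t P \<and> embedding f P H \<and>
                 (\<forall>i \<in> {1..l}. f i = s i \<and> f ((m - l) * t + i) = e i)))"
    using Con[unfolded prop_Con_def, rule_format, OF a] by (elim exE conjE) (rule that)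
  have sl: "0 < slack p a" "slack p a \<le> 1 / 2" by (rule slack[OF a])+
  obtain n2 :: nat where n2: "real (2 * l) / slack p a \<le> real n2" using real_arch_simple by blast
  show ?thesis
  proof (rule exI[of _ c], rule conjI, rule c, rule exI[of _ "2 * n1 + 2 * d + n2"], intro allI impI, elim conjE)
    fix V S :: "nat set" and E Z and s e :: "nat \<Rightarrow> nat"
    assume fin: "finite V" "S \<subseteq> V" and n: "2 * n1 + 2 * d + n2 \<le> card S" and E: "uniform_edges k V E"
      and deg: "degree_into d p V E S (\<delta> + 2 * a)" and Z: "real (card (S \<inter> Z)) \<le> slack p a * real (card S)"
      and s: "inj_on s {1..l}" "s ` {1..l} \<subseteq> V" and e: "inj_on e {1..l}" "e ` {1..l} \<subseteq> V"
      and disj: "s ` {1..l} \<inter> e ` {1..l} = {}"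
    have fS: "finite S" using fin finite_subset by blast
    define T where "T = (S - Z) \<union> s ` {1..l} \<union> e ` {1..l}"
    have fT: "finite T" using fS by (simp add: T_def)
    have TV: "T \<subseteq> V" using fin s e by (auto simp: T_def)
    have "S - T \<subseteq> S \<inter> Z" by (auto simp: T_def)
    then have "card (S - T) \<le> card (S \<inter> Z)" using fS by (intro card_mono) auto
    then have lost: "real (card (S - T)) \<le> slack p a * real (card S)" using Z by linarith
    have "card T \<le> card (S - Z) + card (s ` {1..l}) + card (e ` {1..l})"
      unfolding T_def by (meson add_le_mono card_Un_le order_refl order_trans)
    also have "\<dots> \<le> card S + l + l"
      using card_image_le[of "{1..l}" s] card_image_le[of "{1..l}" e] card_mono[of S "S - Z"] fS
      by (intro add_le_mono) auto
    finally have cT: "card T \<le> card S + 2 * l" by simp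
    have "real (2 * l) \<le> slack p a * real n2" using n2 sl by (simp add: field_simps)
    also have "\<dots> \<le> slack p a * real (card S)" using n sl by (intro mult_left_mono) auto
    finally have "real (2 * l) \<le> slack p a * real (card S)" .
    then have size: "real (card T) \<le> (1 + slack p a) * real (card S)"
      using cT by (simp add: distrib_right)
    have degT: "degree_into d p V E T (\<delta> + a)"
    proof (rule degree_into_change[OF fin fT k(2) a _ _ _ lost size])
      show "uniform_edges (d + p) V E" using E k by simp
      have "\<delta> + 2 * a = \<delta> + a + a" by simp
      then show "degree_into d p V E S (\<delta> + a + a)" using deg by (simp only:)
    qed (use \<delta> a in auto)
    have big: "n1 + d \<le> card T"
    proof -
      have "slack p a * real (card S) \<le> 1 / 2 * real (card S)" using sl by (intro mult_right_mono) auto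
      moreover have "card S \<le> card (S - T) + card T"
        using card_mono[of "(S - T) \<union> T" S] card_Un_le[of "S - T" T] fS fT by auto
      ultimately show ?thesis using lost n by linarith
    qed
    \<comment> \<open>Con asks for copies of the start inside the host, whereas the edges of the
      given ends may lie outside \<open>E\<close>; so they are added to the host.\<close>
    define E' where "E' = {e \<in> E. e \<subseteq> T} \<union> emb_edges 0 s \<union> emb_edges 0 e"
    have fE: "finite E" using finite_uniform_edges[OF fin(1) E] .
    have start_edges: "g \<subseteq> u ` {1..l} \<and> card g = k" if u: "inj_on u {1..l}" "g \<in> emb_edges 0 u" for g and u :: "nat \<Rightarrow> nat"
    proof -
      obtain g0 where g0: "g0 \<in> chain_edges" "g0 \<subseteq> {1..l}" "g = u ` g0"
        using u(2) by (auto simp: emb_edges_def initial_edges_def)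
      then have "card g = card g0" using inj_on_subset[OF u(1) g0(2)] by (simp add: card_image)
      then show ?thesis using g0 chain_edges_bounds[OF g0(1)] by auto
    qed
    define H where "H = (T, E')"
    have "(\<delta> + a) * real (card T) ^ p \<le> real (min_degree d H)"
      unfolding H_def by (rule min_degree_host[OF fT TV _ degT]) (use big fE in \<open>auto simp: E'_def\<close>)
    moreover have "uniform_hypergraph k H"
      unfolding uniform_hypergraph_def H_def fst_conv snd_conv
    proof (intro conjI ballI fT)
      fix g assume "g \<in> E'"
      then consider "g \<in> E" "g \<subseteq> T" | "g \<in> emb_edges 0 s" | "g \<in> emb_edges 0 e" by (auto simp: E'_def)
      then have "g \<subseteq> T \<and> card g = k"
      proof cases
        case 1
        then show ?thesis using E by (auto simp: uniform_edges_def)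
      next
        case 2
        then show ?thesis using start_edges[OF s(1) 2] by (auto simp: T_def)
      next
        case 3
        then show ?thesis using start_edges[OF e(1) 3] by (auto simp: T_def)
      qed
      then show "g \<subseteq> T" "card g = k" by auto
    qed
    moreover have "embedding s (link_start l A) H" "embedding e (link_start l A) H"
      using s(1) e(1) initial_edges_0 unfolding embedding_def
      by (auto simp: link_start_def induced_def H_def T_def E'_def emb_edges_def)
    ultimately have "\<exists>t P f. t \<le> c \<and> is_chain l m A t P \<and> embedding f P H \<and>
                 (\<forall>i \<in> {1..l}. f i = s i \<and> f ((m - l) * t + i) = e i)"
      using big k(1) disj by (intro n1[rule_format, of "card T" H]) (auto simp: H_def)
    then obtain t P f where P: "t \<le> c" "is_chain l m A t P" "embedding f P H"
         "\<forall>i \<in> {1..l}. f i = s i \<and> f ((m - l) * t + i) = e i" by (elim exE conjE) (rule that)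
    have t: "1 \<le> t" and Peq: "P = ({1..h * t + l}, initial_edges t)" using P(2) by (auto simp: is_chain_iff)
    have "chain_map t f" "span t f \<subseteq> T" "emb_edges t f \<subseteq> E'"
      using P(3) unfolding Peq embedding_chain_iff by (auto simp: H_def)
    moreover have "E' \<subseteq> E \<union> emb_edges 0 s \<union> emb_edges 0 e" by (auto simp: E'_def)
    ultimately show "connects S E c Z s e"
      using t P(1,4) unfolding connects_def T_def h_def[symmetric] by blast
  qed
qed

text \<open>Fac is transported from the vertex set \<open>{1..N}\<close> and a list of hypergraphs
  to an arbitrary vertex set \<open>S\<close> and colour set \<open>R\<close>, along an enumeration
  \<open>b\<close> of \<open>S\<close> and a list \<open>cs\<close> of the colours.\<close>

lemma transversal_factor:
  fixes \<delta> a :: real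
  assumes Fac: "prop_Fac k A d \<delta>" and k: "k = d + p" and a: "a > 0"
  shows "\<exists>\<beta>>0. \<exists>n0. \<forall>(V :: nat set) S (R :: nat set) H.
     finite V \<and> S \<subseteq> V \<and> n0 \<le> card S \<and> finite R \<and> real (card R) \<le> \<beta> * real (card S) \<and> card (edges A) dvd card R \<and>
     (\<forall>c\<in>R. uniform_edges k V (H c) \<and> degree_into d p V (H c) S (\<delta> + a)) \<longrightarrow>
     (\<exists>f \<phi>. (\<forall>j<card R div card (edges A). chain_map 1 (f j) \<and> span 1 (f j) \<subseteq> S) \<and>
        (\<forall>i<card R div card (edges A). \<forall>j<card R div card (edges A). i \<noteq> j \<longrightarrow> span 1 (f i) \<inter> span 1 (f j) = {}) \<and>
        bij_betw \<phi> (\<Union>j<card R div card (edges A). emb_edges 1 (f j)) R \<and>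
        (\<forall>e\<in>(\<Union>j<card R div card (edges A). emb_edges 1 (f j)). e \<in> H (\<phi> e)))"
proof -
  obtain \<beta> :: real and n1 :: nat where \<beta>: "0 < \<beta>" and n1: "\<forall>n\<ge>n1. \<forall>\<beta>'\<le>\<beta>. \<forall>Hs :: nat hypergraph list.
           hypergraph_collection k {1..n} Hs \<and> real (length Hs) \<le> \<beta>' * real n \<and>
           collection_min_degree d Hs \<ge> ereal ((\<delta> + a) * real n ^ (k - d)) \<and>
           card (edges A) dvd length Hs \<longrightarrow>
           (\<exists>f. let r = length Hs div card (edges A) in
              (\<forall>j<r. inj_on (f j) (verts A) \<and> f j ` verts A \<subseteq> {1..n}) \<and>
              (\<forall>i<r. \<forall>j<r. i \<noteq> j \<longrightarrow> f i ` verts A \<inter> f j ` verts A = {}) \<and>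
              transversal Hs (\<Union>j<r. f j ` verts A, \<Union>j<r. (`) (f j) ` edges A))"
    using Fac[unfolded prop_Fac_def, rule_format, OF a] by (elim exE conjE) (rule that)
  have vA: "verts A = {1..h * 1 + l}" using is_link h_l by (simp add: is_link_def)
  show ?thesis
  proof (intro exI[of _ \<beta>] exI[of _ "n1 + d"] conjI \<beta> allI impI, elim conjE)
    fix V S R :: "nat set" and H
    assume fin: "finite V" "S \<subseteq> V" and n: "n1 + d \<le> card S" and R: "finite R" "real (card R) \<le> \<beta> * real (card S)"
      "card (edges A) dvd card R" and H: "\<forall>c\<in>R. uniform_edges k V (H c) \<and> degree_into d p V (H c) S (\<delta> + a)"
    have fS: "finite S" using fin finite_subset by blast
    define N where "N = card S"
    obtain b where b: "bij_betw b {1..N} S" using ex_bij_betw_nat_finite_1[OF fS] by (auto simp: N_def)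
    have bi: "inj_on b {1..N}" and bs: "b ` {1..N} = S" using b by (auto simp: bij_betw_def)
    obtain cs where cs: "set cs = R" "distinct cs" using finite_distinct_list[OF R(1)] by blast
    have len: "length cs = card R" using distinct_card[OF cs(2)] cs(1) by simp
    define G where "G c = {g. g \<subseteq> {1..N} \<and> b ` g \<in> H c}" for c
    define Hs where "Hs = map (\<lambda>c. ({1..N}, G c)) cs"
    have lenH: "length Hs = card R" by (simp add: Hs_def len)
    \<comment> \<open>On subsets of \<open>S\<close> this inverts the passage to images under
      \<open>b\<close>.\<close>
    define u where "u e = {i \<in> {1..N}. b i \<in> e}" for e
    have ub: "u (b ` g) = g" if "g \<subseteq> {1..N}" for g
      using that inj_on_eq_iff[OF bi] by (auto simp: u_def)
    have bu: "b ` u e = e" if "e \<subseteq> S" for e using that bs by (auto simp: u_def)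
    have unif: "uniform_hypergraph k ({1..N}, G c)" if "c \<in> R" for c
    proof -
      have "card g = k" if "g \<in> G c" for g
      proof -
        have g: "g \<subseteq> {1..N}" "b ` g \<in> H c" using that by (auto simp: G_def)
        have "card (b ` g) = k" using H \<open>c \<in> R\<close> g(2) by (auto simp: uniform_edges_def)
        then show ?thesis using card_image[OF inj_on_subset[OF bi g(1)]] by simp
      qed
      then show ?thesis by (auto simp: uniform_hypergraph_def G_def)
    qed
    have mind: "(\<delta> + a) * real N ^ p \<le> real (min_degree d ({1..N}, G c))" if c: "c \<in> R" for c
    proof (rule min_degree_geI)
      show "finite {1..N}" "d \<le> card {1..N}" using n by (auto simp: N_def)
      fix D assume D: "D \<subseteq> {1..N}" "card D = d"
      have bD: "b ` D \<subseteq> V" "card (b ` D) = d"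
        using D bs fin(2) card_image[OF inj_on_subset[OF bi D(1)]] by auto
      have fG: "finite {g \<in> G c. D \<subseteq> g}" by (rule finite_subset[of _ "Pow {1..N}"]) (auto simp: G_def)
      have "{e \<in> H c. b ` D \<subseteq> e \<and> e - b ` D \<subseteq> S} \<subseteq> (`) b ` {g \<in> G c. D \<subseteq> g}"
      proof
        fix e assume e: "e \<in> {e \<in> H c. b ` D \<subseteq> e \<and> e - b ` D \<subseteq> S}"
        then have "e \<subseteq> S" using D(1) bs by blast
        then have "b ` u e = e" by (rule bu)
        moreover have "D \<subseteq> u e" using e D(1) by (auto simp: u_def)
        moreover have "u e \<in> G c" using e \<open>b ` u e = e\<close> by (auto simp: G_def u_def)
        ultimately show "e \<in> (`) b ` {g \<in> G c. D \<subseteq> g}" by blast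
      qed
      then have "card {e \<in> H c. b ` D \<subseteq> e \<and> e - b ` D \<subseteq> S} \<le> card {g \<in> G c. D \<subseteq> g}"
        using fG by (rule surj_card_le[rotated])
      moreover have "(\<delta> + a) * real N ^ p \<le> real (card {e \<in> H c. b ` D \<subseteq> e \<and> e - b ` D \<subseteq> S})"
        using H c bD unfolding degree_into_def N_def by blast
      ultimately show "(\<delta> + a) * real N ^ p \<le> real (card {e \<in> G c. D \<subseteq> e})" by linarith
    qed
    have "\<exists>f. let r = length Hs div card (edges A) in
              (\<forall>j<r. inj_on (f j) (verts A) \<and> f j ` verts A \<subseteq> {1..N}) \<and>
              (\<forall>i<r. \<forall>j<r. i \<noteq> j \<longrightarrow> f i ` verts A \<inter> f j ` verts A = {}) \<and>
              transversal Hs (\<Union>j<r. f j ` verts A, \<Union>j<r. (`) (f j) ` edges A)"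
    proof (rule n1[rule_format, of N \<beta>], use n in \<open>simp add: N_def\<close>, simp, intro conjI)
      show "hypergraph_collection k {1..N} Hs"
        using unif cs(1) by (auto simp: hypergraph_collection_def Hs_def)
      show "real (length Hs) \<le> \<beta> * real N" using R(2) by (simp add: lenH N_def)
      show "ereal ((\<delta> + a) * real N ^ (k - d)) \<le> collection_min_degree d Hs"
        unfolding collection_min_degree_def
        by (rule INF_greatest) (use mind cs(1) k in \<open>auto simp: Hs_def\<close>)
      show "card (edges A) dvd length Hs" using R(3) by (simp add: lenH)
    qed
    then obtain f where f: "\<forall>j<card R div card (edges A). inj_on (f j) (verts A) \<and> f j ` verts A \<subseteq> {1..N}"
        "\<forall>i<card R div card (edges A). \<forall>j<card R div card (edges A). i \<noteq> j \<longrightarrow> f i ` verts A \<inter> f j ` verts A = {}"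
        "transversal Hs (\<Union>j<card R div card (edges A). f j ` verts A, \<Union>j<card R div card (edges A). (`) (f j) ` edges A)"
      unfolding Let_def lenH by blast
    define r' where "r' = card R div card (edges A)"
    define E0 where "E0 = (\<Union>j<r'. (`) (f j) ` edges A)"
    obtain \<phi> where \<phi>: "bij_betw \<phi> E0 {..<card R}" "\<forall>e\<in>E0. e \<in> edges (Hs ! \<phi> e)"
      using f(3) unfolding transversal_def lenH E0_def r'_def by auto
    have E0: "e \<subseteq> {1..N}" if e: "e \<in> E0" for e
    proof -
      obtain j g where j: "j < r'" "g \<in> edges A" "e = f j ` g" using e by (auto simp: E0_def)
      have "g \<subseteq> verts A" using edges_A(1)[OF j(2)] is_link by (simp add: is_link_def)
      then show ?thesis using f(1) j by (auto simp: r'_def)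
    qed
    define F where "F j = b \<circ> f j" for j
    have chF: "chain_map 1 (F j) \<and> span 1 (F j) \<subseteq> S" if "j < r'" for j
    proof -
      have fj: "inj_on (f j) (verts A)" "f j ` verts A \<subseteq> {1..N}" using f(1) that by (auto simp: r'_def)
      have "inj_on (b \<circ> f j) (verts A)" by (rule comp_inj_on[OF fj(1) inj_on_subset[OF bi fj(2)]])
      moreover have "(b \<circ> f j) ` verts A \<subseteq> S" using fj(2) bs by auto
      ultimately show ?thesis unfolding chain_map_def span_def F_def vA by simp
    qed
    have dF: "span 1 (F i) \<inter> span 1 (F j) = {}" if ij: "i < r'" "j < r'" "i \<noteq> j" for i j
    proof -
      have s: "span 1 (F i) = b ` (f i ` verts A)" for i by (simp only: span_def F_def vA image_comp)
      have "f i ` verts A \<subseteq> {1..N}" "f j ` verts A \<subseteq> {1..N}" "f i ` verts A \<inter> f j ` verts A = {}"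
        using f(1,2) ij by (auto simp: r'_def)
      then show ?thesis unfolding s
        using inj_on_image_Int[OF bi, of "f i ` verts A" "f j ` verts A"] by simp
    qed
    have EF: "(\<Union>j<r'. emb_edges 1 (F j)) = (`) b ` E0"
      using initial_edges_1 by (simp add: emb_edges_def F_def E0_def image_UN image_comp o_def)
    have b1: "bij_betw u ((`) b ` E0) E0"
      by (rule bij_betw_byWitness[where f' = "(`) b"]) (use ub E0 in \<open>auto simp: image_iff\<close>)
    have b2: "bij_betw ((!) cs) {..<card R} R" using bij_betw_nth[OF cs(2)] len cs(1) by simp
    define \<psi> where "\<psi> e = cs ! \<phi> (u e)" for e
    have "bij_betw (((!) cs) \<circ> (\<phi> \<circ> u)) ((`) b ` E0) R"
      by (rule bij_betw_trans[OF bij_betw_trans[OF b1 \<phi>(1)] b2])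
    then have bij: "bij_betw \<psi> ((`) b ` E0) R" by (simp add: \<psi>_def[abs_def] o_def)
    have mem: "e \<in> H (\<psi> e)" if e: "e \<in> (`) b ` E0" for e
    proof -
      obtain g where g: "g \<in> E0" "e = b ` g" using e by blast
      have ue: "u e = g" using ub[OF E0[OF g(1)]] g(2) by simp
      have "\<phi> g < length cs" using bij_betwE[OF \<phi>(1)] g(1) len by auto
      then have "g \<in> G (cs ! \<phi> g)" using \<phi>(2) g(1) by (auto simp: Hs_def)
      moreover have "\<psi> e = cs ! \<phi> g" by (simp add: \<psi>_def ue)
      ultimately show ?thesis using g(2) by (simp add: G_def)
    qed
    show "\<exists>f \<phi>. (\<forall>j<card R div card (edges A). chain_map 1 (f j) \<and> span 1 (f j) \<subseteq> S) \<and>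
        (\<forall>i<card R div card (edges A). \<forall>j<card R div card (edges A). i \<noteq> j \<longrightarrow> span 1 (f i) \<inter> span 1 (f j) = {}) \<and>
        bij_betw \<phi> (\<Union>j<card R div card (edges A). emb_edges 1 (f j)) R \<and>
        (\<forall>e\<in>(\<Union>j<card R div card (edges A). emb_edges 1 (f j)). e \<in> H (\<phi> e))"
      unfolding r'_def[symmetric]
      by (intro exI[of _ F] exI[of _ \<psi>], unfold EF) (use chF dF bij mem in blast)
  qed
qed

end

section \<open>Rainbow colourings\<close>

definition rainbow :: "(nat \<Rightarrow> 'a set set) \<Rightarrow> nat set \<Rightarrow> 'a set set \<Rightarrow> ('a set \<Rightarrow> nat) \<Rightarrow> bool" where
  "rainbow H R E \<phi> \<longleftrightarrow> inj_on \<phi> E \<and> \<phi> ` E \<subseteq> R \<and> (\<forall>e\<in>E. e \<in> H (\<phi> e))"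

lemma exists_rainbow_greedy:
  assumes "finite E" "finite R" "\<And>e. e \<in> E \<Longrightarrow> card E \<le> card {c \<in> R. e \<in> H c}"
  shows "\<exists>\<phi>. rainbow H R E \<phi>"
proof -
  have "\<exists>\<phi>. inj_on \<phi> E \<and> (\<forall>e\<in>E. \<phi> e \<in> {c \<in> R. e \<in> H c})"
    using assms by (intro exists_greedy_colouring) auto
  then show ?thesis unfolding rainbow_def by blast
qed

lemma rainbow_Un:
  assumes "rainbow H R1 E1 \<phi>1" "rainbow H R2 E2 \<phi>2" "E1 \<inter> E2 = {}" "R1 \<inter> R2 = {}"
  shows "\<exists>\<phi>. rainbow H (R1 \<union> R2) (E1 \<union> E2) \<phi> \<and> \<phi> ` (E1 \<union> E2) = \<phi>1 ` E1 \<union> \<phi>2 ` E2"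
proof -
  define \<phi> where "\<phi> e = (if e \<in> E1 then \<phi>1 e else \<phi>2 e)" for e
  have 1: "\<phi> e = \<phi>1 e" if "e \<in> E1" for e using that by (simp add: \<phi>_def)
  have 2: "\<phi> e = \<phi>2 e" if "e \<in> E2" for e using that assms(3) by (auto simp: \<phi>_def)
  have i1: "\<phi> ` E1 = \<phi>1 ` E1" and i2: "\<phi> ` E2 = \<phi>2 ` E2" using 1 2 by (auto intro: image_cong)
  have "inj_on \<phi> E1" using assms(1) 1 unfolding rainbow_def inj_on_def by auto
  moreover have "inj_on \<phi> E2" using assms(2) 2 unfolding rainbow_def inj_on_def by auto
  moreover have "\<phi> ` E1 \<inter> \<phi> ` E2 = {}" using assms(1,2,4) unfolding i1 i2 rainbow_def by blast
  ultimately have "inj_on \<phi> (E1 \<union> E2)"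
    unfolding inj_on_Un by blast
  moreover have "\<phi> ` (E1 \<union> E2) = \<phi>1 ` E1 \<union> \<phi>2 ` E2" by (simp add: image_Un i1 i2)
  moreover have "\<phi> ` (E1 \<union> E2) \<subseteq> R1 \<union> R2" using assms(1,2) unfolding image_Un i1 i2 rainbow_def by blast
  moreover have "\<forall>e\<in>E1 \<union> E2. e \<in> H (\<phi> e)" using assms(1,2) 1 2 unfolding rainbow_def by auto
  ultimately show ?thesis unfolding rainbow_def by blast
qed

lemma rainbow_mono: "rainbow H R E \<phi> \<Longrightarrow> R \<subseteq> R' \<Longrightarrow> rainbow H R' E \<phi>"
  unfolding rainbow_def by blast

context link
begin

text \<open>Each chain is found without colours, among the edges that are popular for the colours still
  unused; as there are many of these compared to the length of the chain, greedy colouring works.\<close>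

lemma exists_rainbow_chains:
  fixes x a \<gamma> :: real and V :: "nat set"
  assumes long: "\<forall>(V :: nat set) S E t. finite V \<and> S \<subseteq> V \<and> n0 \<le> card S \<and> uniform_edges k V E \<and>
     degree_into d p V E S (x + 2 * a) \<and> h * t + l + m \<le> card S \<longrightarrow>
     (\<exists>f. chain_map t f \<and> span t f \<subseteq> S \<and> emb_edges t f \<subseteq> E)"
    and k: "k = d + p" and V: "finite V" and R: "finite R" and \<gamma>: "\<gamma> \<ge> 0"
    and W: "\<And>i. i < j \<Longrightarrow> W i \<subseteq> V \<and> n0 \<le> card (W i) \<and> h * t + l + m \<le> card (W i)"
    and Wd: "\<And>i i'. i < j \<Longrightarrow> i' < j \<Longrightarrow> i \<noteq> i' \<Longrightarrow> W i \<inter> W i' = {}"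
    and H: "\<And>c. c \<in> R \<Longrightarrow> uniform_edges k V (H c)"
    and deg: "\<And>c i. c \<in> R \<Longrightarrow> i < j \<Longrightarrow> degree_into d p V (H c) (W i) (x + 2 * a + \<gamma>)"
    and B: "real (es + r * t) \<le> \<gamma> * real B" "1 \<le> B" and many: "j * (es + r * t) + B \<le> card R"
  shows "\<exists>f \<phi>. (\<forall>i<j. chain_map t (f i) \<and> span t (f i) \<subseteq> W i) \<and> rainbow H R (\<Union>i<j. emb_edges t (f i)) \<phi> \<and>
    card (\<Union>i<j. emb_edges t (f i)) = j * (es + r * t)"
  using W Wd deg many
proof (induction j)
  case 0
  then show ?case by (auto simp: rainbow_def)
next
  case (Suc j)
  let ?e = "es + r * t"
  have "\<exists>f \<phi>. (\<forall>i<j. chain_map t (f i) \<and> span t (f i) \<subseteq> W i) \<and> rainbow H R (\<Union>i<j. emb_edges t (f i)) \<phi> \<and>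
    card (\<Union>i<j. emb_edges t (f i)) = j * ?e"
    by (rule Suc.IH) (use Suc.prems in auto)
  then obtain f \<phi> where f: "\<forall>i<j. chain_map t (f i) \<and> span t (f i) \<subseteq> W i"
    and \<phi>: "rainbow H R (\<Union>i<j. emb_edges t (f i)) \<phi>" and cE: "card (\<Union>i<j. emb_edges t (f i)) = j * ?e"
    by (elim exE conjE) (rule that)
  let ?E = "\<Union>i<j. emb_edges t (f i)"
  define R' where "R' = R - \<phi> ` ?E"
  have "card (\<phi> ` ?E) = j * ?e" using cE \<phi> card_image[of \<phi> ?E] by (simp add: rainbow_def)
  moreover have "card R' = card R - card (\<phi> ` ?E)" unfolding R'_def
    using R \<phi> by (intro card_Diff_subset) (auto simp: rainbow_def intro: finite_subset)
  ultimately have cR': "?e + B \<le> card R'" using Suc.prems(4) by simp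
  have "0 < card R'" using cR' B(2) by linarith
  then have R': "finite R'" "R' \<noteq> {}" "R' \<subseteq> R" by (auto simp: card_gt_0_iff R'_def)
  let ?K = "popular_edges \<gamma> k V H R'"
  have Wj: "W j \<subseteq> V" "n0 \<le> card (W j)" "h * t + l + m \<le> card (W j)" using Suc.prems(1)[of j] by auto
  have "degree_into d p V ?K (W j) (x + 2 * a + \<gamma> - \<gamma>)"
    unfolding k using R'(3) H Suc.prems(3)[of _ j] k
    by (intro degree_into_popular[OF V Wj(1) R'(1,2) \<gamma>]) auto
  then have "degree_into d p V ?K (W j) (x + 2 * a)" by simp
  then obtain g where g: "chain_map t g" "span t g \<subseteq> W j" "emb_edges t g \<subseteq> ?K"
    using long[rule_format, of V "W j" ?K t] V Wj uniform_popular_edges[of k V \<gamma> H R'] by blast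
  have "\<exists>\<psi>. rainbow H R' (emb_edges t g) \<psi>"
  proof (rule exists_rainbow_greedy)
    fix e assume "e \<in> emb_edges t g"
    then have "\<gamma> * real (card R') \<le> real (card {c \<in> R'. e \<in> H c})" using g(3) by (auto simp: popular_edges_def)
    moreover have "\<gamma> * real B \<le> \<gamma> * real (card R')" using cR' \<gamma> by (intro mult_left_mono) auto
    ultimately have "real ?e \<le> real (card {c \<in> R'. e \<in> H c})" using B(1) by linarith
    then show "card (emb_edges t g) \<le> card {c \<in> R'. e \<in> H c}"
      unfolding card_emb_edges[OF g(1)] of_nat_le_iff .
  qed (use R' in auto)
  then obtain \<psi> where \<psi>: "rainbow H R' (emb_edges t g) \<psi>" by blast
  define f' where "f' = f(j := g)"
  have f': "chain_map t (f' i) \<and> span t (f' i) \<subseteq> W i" if "i < Suc j" for i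
    using f g(1,2) that by (cases "i = j") (auto simp: f'_def less_Suc_eq)
  have U: "(\<Union>i<Suc j. emb_edges t (f' i)) = ?E \<union> emb_edges t g"
  proof -
    have "(\<Union>i<j. emb_edges t (f' i)) = ?E" by (rule SUP_cong) (auto simp: f'_def)
    then show ?thesis unfolding lessThan_Suc UN_insert by (auto simp: f'_def)
  qed
  have disj: "?E \<inter> emb_edges t g = {}"
  proof -
    have False if e: "i < j" "e \<in> emb_edges t (f i)" "e \<in> emb_edges t g" for i e
    proof -
      have "e \<subseteq> W i" "e \<subseteq> W j"
        using emb_edges_subset_span[OF e(2)] emb_edges_subset_span[OF e(3)] f e(1) g(2) by auto
      moreover have "W i \<inter> W j = {}" using Suc.prems(2)[of i j] e(1) by simp
      ultimately show False using emb_edges_nonempty[OF e(3)] by blast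
    qed
    then show ?thesis by blast
  qed
  have "rainbow H (\<phi> ` ?E) ?E \<phi>" using \<phi> by (simp add: rainbow_def)
  from rainbow_Un[OF this \<psi> disj] obtain \<chi> where "rainbow H (\<phi> ` ?E \<union> R') (?E \<union> emb_edges t g) \<chi>"
    by (auto simp: R'_def)
  moreover have "\<phi> ` ?E \<union> R' \<subseteq> R" using \<phi> R'(3) by (auto simp: rainbow_def)
  ultimately have "rainbow H R (\<Union>i<Suc j. emb_edges t (f' i)) \<chi>" unfolding U by (rule rainbow_mono)
  moreover have "card (\<Union>i<Suc j. emb_edges t (f' i)) = Suc j * ?e"
    unfolding U using disj cE card_emb_edges[OF g(1)] by (subst card_Un_disjoint) auto
  ultimately show ?case using f' by blast
qed


text \<open>\<open>connect_pieces\<close> for a list, since the pieces of the cycle come from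
  families of different kinds.\<close>

lemma connect_piece_list:
  fixes ps :: "(nat \<times> (nat \<Rightarrow> nat)) list"
  assumes finS: "finite S"
    and con: "\<And>Z s e. real (card (S \<inter> Z)) \<le> \<xi> \<Longrightarrow> inj_on s {1..l} \<Longrightarrow> inj_on e {1..l} \<Longrightarrow>
        s ` {1..l} \<subseteq> V \<Longrightarrow> e ` {1..l} \<subseteq> V \<Longrightarrow> s ` {1..l} \<inter> e ` {1..l} = {} \<Longrightarrow> connects S E c Z s e"
    and ne: "ps \<noteq> []"
    and pieces: "\<And>t f. (t, f) \<in> set ps \<Longrightarrow> chain_map t f \<and> span t f \<subseteq> V \<inter> Z"
    and SV: "S \<subseteq> V"
    and disj: "sorted_wrt (\<lambda>P Q. span (fst P) (snd P) \<inter> span (fst Q) (snd Q) = {}) ps"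
    and room: "real (card (S \<inter> Z)) + real (length ps * (h * c + l)) \<le> \<xi>"
  shows "\<exists>t F. chain_map t F \<and>
     (\<forall>i\<in>{1..l}. F i = snd (hd ps) i \<and> F (h * t + i) = snd (last ps) (h * fst (last ps) + i)) \<and>
     (\<Union>(t, f)\<in>set ps. span t f) \<subseteq> span t F \<and>
     span t F \<subseteq> (\<Union>(t, f)\<in>set ps. span t f) \<union> (S - Z) \<and>
     (\<Union>(t, f)\<in>set ps. emb_edges t f) \<subseteq> emb_edges t F \<and>
     emb_edges t F \<subseteq> (\<Union>(t, f)\<in>set ps. emb_edges t f) \<union> E"
proof -
  define N where "N = length ps - 1"
  have N: "i \<le> N \<longleftrightarrow> i < length ps" for i using ne by (cases ps) (auto simp: N_def)
  define tf where "tf i = fst (ps ! i)" for i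
  define f where "f i = snd (ps ! i)" for i
  have nth: "(tf i, f i) \<in> set ps" if "i \<le> N" for i using that N by (auto simp: tf_def f_def)
  have U: "(\<Union>i\<le>N. G (tf i) (f i)) = (\<Union>(t, f)\<in>set ps. G t f)" for G :: "nat \<Rightarrow> (nat \<Rightarrow> nat) \<Rightarrow> 'z set"
  proof -
    have "set ps = (!) ps ` {..N}" using N by (auto simp: set_conv_nth)
    then show ?thesis by (simp add: tf_def f_def case_prod_beta)
  qed
  have "\<exists>t F. chain_map t F \<and> (\<forall>i\<in>{1..l}. F i = f 0 i \<and> F (h * t + i) = f N (h * tf N + i)) \<and>
     (\<Union>i\<le>N. span (tf i) (f i)) \<subseteq> span t F \<and>
     span t F \<subseteq> (\<Union>i\<le>N. span (tf i) (f i)) \<union> (S - Z) \<and>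
     card (span t F - (\<Union>i\<le>N. span (tf i) (f i))) \<le> N * (h * c + l) \<and>
     (\<Union>i\<le>N. emb_edges (tf i) (f i)) \<subseteq> emb_edges t F \<and>
     emb_edges t F \<subseteq> (\<Union>i\<le>N. emb_edges (tf i) (f i)) \<union> E"
  proof (rule connect_pieces[where V = V and \<xi> = \<xi>])
    show "chain_map (tf i) (f i) \<and> span (tf i) (f i) \<subseteq> V \<inter> Z" if "i \<le> N" for i
      by (rule pieces[OF nth[OF that]])
    have less: "span (tf i) (f i) \<inter> span (tf j) (f j) = {}" if "i < j" "j \<le> N" for i j
      using disj that N unfolding sorted_wrt_iff_nth_less tf_def f_def by simp
    show "span (tf i) (f i) \<inter> span (tf j) (f j) = {}" if "i \<le> N" "j \<le> N" "i \<noteq> j" for i j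
    proof (cases "i < j")
      case True
      then show ?thesis using less that by simp
    next
      case False
      then show ?thesis using less[of j i] that by (simp add: Int_commute)
    qed
    have "N * (h * c + l) \<le> length ps * (h * c + l)" by (intro mult_right_mono) (auto simp: N_def)
    then show "real (card (S \<inter> Z)) + real (N * (h * c + l)) \<le> \<xi>" using room by linarith
  qed (use finS con SV in auto)
  then obtain t F where F: "chain_map t F" "\<forall>i\<in>{1..l}. F i = f 0 i \<and> F (h * t + i) = f N (h * tf N + i)"
     "(\<Union>i\<le>N. span (tf i) (f i)) \<subseteq> span t F"
     "span t F \<subseteq> (\<Union>i\<le>N. span (tf i) (f i)) \<union> (S - Z)"
     "(\<Union>i\<le>N. emb_edges (tf i) (f i)) \<subseteq> emb_edges t F"
     "emb_edges t F \<subseteq> (\<Union>i\<le>N. emb_edges (tf i) (f i)) \<union> E"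
    by (elim exE conjE) (rule that)
  have ends: "f 0 = snd (hd ps)" "f N = snd (last ps)" "tf N = fst (last ps)"
    using ne by (simp_all add: f_def tf_def N_def hd_conv_nth last_conv_nth)
  show ?thesis using F unfolding U ends by (intro exI[of _ t] exI[of _ F] conjI) assumption+
qed

text \<open>The flexible chain. All its edges are popular for the full set of colours, so
  \<open>exists_flexible_matching\<close> yields edges \<open>X2\<close> and colours
  \<open>C\<close>; the other edges receive fixed colours \<open>B\<close> outside \<open>C\<close>
  once and for all. Thus any part of \<open>C\<close> of the right size completes the
  colouring.\<close>

lemma exists_colour_absorber:
  fixes x a \<gamma> \<zeta> :: real
  assumes suff: "hamilton_degree_suffices k l m A d x" and k: "k = d + p" "p \<ge> 1" and r: "r \<ge> 1"
    and a: "a > 0" and x: "0 \<le> x" "x + a \<le> 1" and \<gamma>: "0 < \<gamma>" "\<gamma> \<le> 1 / 2" and \<zeta>: "\<zeta> > 0"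
  shows "\<exists>\<omega>>0. \<exists>n0. \<forall>(V :: nat set) M H. finite V \<and> n0 \<le> card V \<and> M * h = r * card V \<and>
     (\<forall>c<M. uniform_edges k V (H c) \<and> degree_into d p V (H c) V (x + 2 * a + \<gamma>)) \<longrightarrow>
     (\<exists>t f B C w. chain_map t f \<and> span t f \<subseteq> V \<and> real (card (span t f)) \<le> \<zeta> * real (card V) \<and>
        B \<subseteq> {..<M} \<and> C \<subseteq> {..<M} \<and> B \<inter> C = {} \<and> card B + card C = card (emb_edges t f) + w \<and>
        3 * card (emb_edges t f) \<le> M \<and>
        \<omega> * real (card V) \<le> real w \<and> real w \<le> \<gamma> / 2 * real (card C) \<and>
        (\<forall>U\<subseteq>C. card U + card B = card (emb_edges t f) \<longrightarrow> (\<exists>\<phi>. rainbow H (B \<union> U) (emb_edges t f) \<phi>)))"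
proof -
  obtain n1 where long: "\<forall>(V :: nat set) S E t. finite V \<and> S \<subseteq> V \<and> n1 \<le> card S \<and> uniform_edges k V E \<and>
     degree_into d p V E S (x + 2 * a) \<and> h * t + l + m \<le> card S \<longrightarrow>
     (\<exists>f. chain_map t f \<and> span t f \<subseteq> S \<and> emb_edges t f \<subseteq> E)"
    using exists_long_chain[OF suff k a x] by (elim exE) (rule that)
  have \<gamma>1: "\<gamma> \<le> 1" using \<gamma> by simp
  obtain \<omega>' q0 where om: "\<omega>' > 0" and flex: "\<forall>(X :: nat set set) (Y :: nat set) adj.
     finite X \<and> finite Y \<and> q0 \<le> card X \<and> card X \<le> card Y \<and>
     (\<forall>x\<in>X. \<gamma> * real (card Y) \<le> real (card {y \<in> Y. adj x y})) \<longrightarrow>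
     (\<exists>X2\<subseteq>X. \<exists>Y2\<subseteq>Y. \<exists>w. card Y2 = card X2 + w \<and> \<omega>' * real (card X) \<le> real w \<and> real w \<le> \<gamma> / 2 * real (card Y2) \<and>
        (\<forall>U\<subseteq>Y2. card U = card X2 \<longrightarrow> (\<exists>f. bij_betw f X2 U \<and> (\<forall>x\<in>X2. adj x (f x)))))"
    using exists_flexible_matching[OF \<gamma>(1) \<gamma>1, where 'a = "nat set" and 'b = nat] by (elim exE conjE) (rule that)
  have hp: "real h \<ge> 1" and rp: "real r \<ge> 1" using h_pos r by auto
  \<comment> \<open>The three terms keep the vertices of a chain of about
    \<open>\<kappa> * n\<close> blocks below the proportion \<open>\<zeta>\<close>, its edges below
    \<open>\<gamma> * M / 3\<close>, and let the chain fit into \<open>V\<close>.\<close>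
  define \<kappa> where "\<kappa> = min (min (\<zeta> / (2 * real h)) (\<gamma> / (6 * real h * real r))) (1 / (4 * real h))"
  have kap: "\<kappa> > 0" "\<kappa> * real h \<le> \<zeta> / 2" "real r * \<kappa> * (6 * real h) \<le> \<gamma>" "\<kappa> * real h \<le> 1 / 4"
  proof -
    show "\<kappa> > 0" using \<gamma> \<zeta> hp rp by (auto simp: \<kappa>_def)
    have "\<kappa> \<le> \<zeta> / (2 * real h)" "\<kappa> \<le> \<gamma> / (6 * real h * real r)" "\<kappa> \<le> 1 / (4 * real h)" by (auto simp: \<kappa>_def)
    then show "\<kappa> * real h \<le> \<zeta> / 2" "real r * \<kappa> * (6 * real h) \<le> \<gamma>" "\<kappa> * real h \<le> 1 / 4"
      using hp rp by (simp_all add: field_simps)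
  qed
  define Z where "Z = real n1 + 2 * real l / \<zeta> + 6 * real h * real es / \<gamma> + (2 * real q0 + 2) / \<kappa> + 4 * real m"
  obtain n0 :: nat where n0: "Z \<le> real n0" using real_arch_simple by blast
  show ?thesis
  proof (rule exI[of _ "\<omega>' * \<kappa> / 2"], rule conjI, use om kap in simp, rule exI[of _ n0], intro allI impI, elim conjE)
    fix V :: "nat set" and M H
    assume V: "finite V" and nV: "n0 \<le> card V" and M: "M * h = r * card V"
      and H: "\<forall>c<M. uniform_edges k V (H c) \<and> degree_into d p V (H c) V (x + 2 * a + \<gamma>)"
    define n where "n = real (card V)"
    have Zn: "Z \<le> n" using n0 nV by (simp add: n_def)
    have pos: "0 \<le> 2 * real l / \<zeta>" "0 \<le> 6 * real h * real es / \<gamma>" "0 \<le> (2 * real q0 + 2) / \<kappa>"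
      using \<zeta> \<gamma> kap hp by auto
    have "real n1 \<le> n" "2 * real l / \<zeta> \<le> n" "6 * real h * real es / \<gamma> \<le> n" "(2 * real q0 + 2) / \<kappa> \<le> n" "4 * real m \<le> n"
      using Zn pos unfolding Z_def by linarith+
    then have big: "n1 \<le> card V" "2 * real l \<le> \<zeta> * n" "6 * real h * real es \<le> \<gamma> * n" "2 * real q0 + 2 \<le> \<kappa> * n" "4 * real m \<le> n"
      using \<zeta> \<gamma> kap by (auto simp: n_def field_simps)
    define t where "t = nat \<lfloor>\<kappa> * n\<rfloor>"
    have "0 \<le> \<kappa> * n" using kap by (simp add: n_def)
    then have t: "real t \<le> \<kappa> * n" "\<kappa> * n - 1 < real t" unfolding t_def by linarith+
    have ht: "real h * real t \<le> \<kappa> * real h * n"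
      using mult_left_mono[OF t(1), of "real h"] by (simp add: mult.assoc mult.left_commute)
    have lm: "real l < real m" using l_less_m by simp
    have n0': "0 \<le> n" by (simp add: n_def)
    have kn: "\<kappa> * real h * n \<le> 1 / 4 * n" "\<kappa> * real h * n \<le> \<zeta> / 2 * n"
      by (rule mult_right_mono[OF kap(4) n0'], rule mult_right_mono[OF kap(2) n0'])
    have fits: "h * t + l + m \<le> card V"
    proof -
      have "real (h * t + l + m) = real h * real t + real l + real m" by simp
      then have "real (h * t + l + m) \<le> n" using ht kn(1) big(5) lm by linarith
      then show ?thesis by (simp only: n_def of_nat_le_iff)
    qed
    let ?K = "popular_edges \<gamma> k V H {..<M}"
    have npos: "n > 0" using big(5) lm by linarith
    have Mn: "n \<le> real M * real h"
    proof -
      have "card V * 1 \<le> card V * r" using r by (intro mult_left_mono) auto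
      then have "card V \<le> M * h" using M by (simp add: mult.commute)
      then show ?thesis unfolding n_def by (simp only: of_nat_mult[symmetric] of_nat_le_iff)
    qed
    have "M \<noteq> 0" using Mn npos by (intro notI) simp
    have "degree_into d p V ?K V (x + 2 * a + \<gamma> - \<gamma>)"
      unfolding k using H k \<gamma> \<open>M \<noteq> 0\<close> by (intro degree_into_popular[OF V]) auto
    then have "degree_into d p V ?K V (x + 2 * a)" by simp
    then obtain f where f: "chain_map t f" "span t f \<subseteq> V" "emb_edges t f \<subseteq> ?K"
      using long[rule_format, of V V ?K t] V big(1) fits uniform_popular_edges[of k V \<gamma> H "{..<M}"] by blast
    let ?E = "emb_edges t f"
    define q where "q = card ?E"
    have q: "q = es + r * t" using card_emb_edges[OF f(1)] by (simp add: q_def)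
    have q_big: "real q \<ge> \<kappa> / 2 * n" "q0 \<le> q"
    proof -
      have "1 * real t \<le> real r * real t" using rp by (intro mult_right_mono) auto
      then have "real t \<le> real q" by (simp add: q)
      then show "real q \<ge> \<kappa> / 2 * n" "q0 \<le> q" using t big(4) by linarith+
    qed
    have "6 * real h * real q \<le> 2 * (\<gamma> * n)"
    proof -
      have "real r * real t \<le> real r * (\<kappa> * n)" using t by (intro mult_left_mono) auto
      then have "6 * real h * (real r * real t) \<le> 6 * real h * (real r * (\<kappa> * n))" by (rule mult_left_mono) simp
      also have "\<dots> = (real r * \<kappa> * (6 * real h)) * n" by simp
      also have "\<dots> \<le> \<gamma> * n" using kap(3) npos by (intro mult_right_mono) auto
      finally show ?thesis using big(3) by (simp add: q algebra_simps)
    qed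
    also have "\<dots> \<le> 2 * (\<gamma> * (real M * real h))" using Mn \<gamma> by simp
    finally have "real h * (6 * real q) \<le> real h * (2 * (\<gamma> * real M))" by (simp add: algebra_simps)
    then have q3: "3 * real q \<le> \<gamma> * real M" using hp by simp
    have "\<gamma> * real M \<le> 1 * real M" using \<gamma>1 by (intro mult_right_mono) auto
    then have q3M: "3 * q \<le> M" using q3 by linarith
    have deg: "\<gamma> * real M \<le> real (card {c \<in> {..<M}. e \<in> H c})" if "e \<in> ?E" for e
      using f(3) that by (auto simp: popular_edges_def)
    have "\<exists>X2\<subseteq>?E. \<exists>Y2\<subseteq>{..<M}. \<exists>w. card Y2 = card X2 + w \<and> \<omega>' * real (card ?E) \<le> real w \<and> real w \<le> \<gamma> / 2 * real (card Y2) \<and>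
        (\<forall>U\<subseteq>Y2. card U = card X2 \<longrightarrow> (\<exists>f. bij_betw f X2 U \<and> (\<forall>x\<in>X2. x \<in> H (f x))))"
      using q_big(2) q3M deg by (intro flex[rule_format]) (auto simp: q_def)
    then obtain X2 C w where X2: "X2 \<subseteq> ?E" and C: "C \<subseteq> {..<M}" and cC: "card C = card X2 + w"
      and w: "\<omega>' * real (card ?E) \<le> real w" "real w \<le> \<gamma> / 2 * real (card C)"
      and match: "\<forall>U\<subseteq>C. card U = card X2 \<longrightarrow> (\<exists>f. bij_betw f X2 U \<and> (\<forall>x\<in>X2. x \<in> H (f x)))"
      by (elim exE conjE) (rule that)
    have fX2: "finite X2" using X2 by (rule finite_subset) simp
    have fC: "finite C" using C by (rule finite_subset) simp
    have cX2: "card X2 \<le> q" unfolding q_def using X2 by (intro card_mono) auto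
    have "\<gamma> / 2 * real (card C) \<le> 1 / 2 * real (card C)" using \<gamma>1 by (intro mult_right_mono) auto
    \<comment> \<open>As \<open>w\<close> is at most half of \<open>card C = card X2 + w\<close>,
      removing \<open>C\<close> costs a popular edge at most \<open>2 * q\<close> of its at least
      \<open>3 * q\<close> colours.\<close>
    then have C2q: "real (card C) \<le> 2 * real q" using w(2) cC cX2 by linarith
    have "\<exists>\<phi>. rainbow H ({..<M} - C) (?E - X2) \<phi>"
    proof (rule exists_rainbow_greedy)
      fix e assume e: "e \<in> ?E - X2"
      have "card {c \<in> {..<M}. e \<in> H c} \<le> card ({c \<in> {..<M} - C. e \<in> H c} \<union> C)"
        using fC by (intro card_mono) auto
      also have "\<dots> \<le> card {c \<in> {..<M} - C. e \<in> H c} + card C" by (rule card_Un_le)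
      finally have le: "card {c \<in> {..<M}. e \<in> H c} \<le> card {c \<in> {..<M} - C. e \<in> H c} + card C" .
      have "e \<in> ?E" using e by simp
      from deg[OF this] have "q \<le> card {c \<in> {..<M} - C. e \<in> H c}" using le q3 C2q by linarith
      moreover have "card (?E - X2) \<le> q" unfolding q_def by (intro card_mono) auto
      ultimately show "card (?E - X2) \<le> card {c \<in> {..<M} - C. e \<in> H c}" by linarith
    qed auto
    then obtain \<phi> where \<phi>: "rainbow H ({..<M} - C) (?E - X2) \<phi>" by blast
    define B where "B = \<phi> ` (?E - X2)"
    have BM: "B \<subseteq> {..<M} - C" using \<phi> by (auto simp: B_def rainbow_def)
    have "card B = card (?E - X2)" unfolding B_def using \<phi> by (intro card_image) (simp add: rainbow_def)
    then have cB: "card B = q - card X2" using fX2 X2 by (simp add: card_Diff_subset q_def)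
    have abs: "\<exists>\<psi>. rainbow H (B \<union> U) ?E \<psi>" if U: "U \<subseteq> C" "card U + card B = card ?E" for U
    proof -
      have "card U = card X2" using U(2) cB cX2 by (simp add: q_def)
      then obtain g where g: "bij_betw g X2 U" "\<forall>x\<in>X2. x \<in> H (g x)" using match[rule_format, OF U(1)] by blast
      have 1: "rainbow H U X2 g" using g by (auto simp: rainbow_def bij_betw_def)
      have 2: "rainbow H B (?E - X2) \<phi>" using \<phi> by (auto simp: rainbow_def B_def)
      have "B \<inter> U = {}" using BM U(1) by blast
      then obtain \<psi> where "rainbow H (B \<union> U) ((?E - X2) \<union> X2) \<psi>"
        using rainbow_Un[OF 2 1 _ \<open>B \<inter> U = {}\<close>] by blast
      moreover have "(?E - X2) \<union> X2 = ?E" using X2 by blast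
      ultimately show ?thesis by auto
    qed
    have size: "real (card (span t f)) \<le> \<zeta> * real (card V)"
    proof -
      have "real (h * t + l) = real h * real t + real l" by simp
      then show ?thesis using ht kn(2) big(2) unfolding card_span[OF f(1)] n_def[symmetric] by linarith
    qed
    have om_w: "\<omega>' * \<kappa> / 2 * real (card V) \<le> real w"
    proof -
      have "\<omega>' * (\<kappa> / 2 * n) \<le> \<omega>' * real q" using q_big(1) om by (intro mult_left_mono) auto
      then show ?thesis using w(1) by (simp add: q_def n_def)
    qed
    have sum: "card B + card C = card ?E + w" using cB cC cX2 by (simp add: q_def)
    have BM': "B \<subseteq> {..<M}" and BC: "B \<inter> C = {}" using BM by blast+
    have q3M': "3 * card ?E \<le> M" using q3M by (simp add: q_def)
    show "\<exists>t f B C w. chain_map t f \<and> span t f \<subseteq> V \<and> real (card (span t f)) \<le> \<zeta> * real (card V) \<and>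
        B \<subseteq> {..<M} \<and> C \<subseteq> {..<M} \<and> B \<inter> C = {} \<and> card B + card C = card (emb_edges t f) + w \<and>
        3 * card (emb_edges t f) \<le> M \<and>
        \<omega>' * \<kappa> / 2 * real (card V) \<le> real w \<and> real w \<le> \<gamma> / 2 * real (card C) \<and>
        (\<forall>U\<subseteq>C. card U + card B = card (emb_edges t f) \<longrightarrow> (\<exists>\<phi>. rainbow H (B \<union> U) (emb_edges t f) \<phi>))"
      by (rule exI[of _ t], rule exI[of _ f], rule exI[of _ B], rule exI[of _ C], rule exI[of _ w],
          intro conjI allI impI, fact f(1), fact f(2), fact size, fact BM', fact C, fact BC, fact sum,
          fact q3M', fact om_w, fact w(2), rule abs)
  qed
qed

text \<open>The cycle has exactly \<open>M\<close> edges. Therefore the number of colours of \<open>Cn\<close> left after the greedy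
  colouring of the edges in \<open>K\<close> is precisely what the flexible chain needs.\<close>

lemma assemble_cycle:
  assumes V: "finite V" "3 * m \<le> card V" and hV: "h dvd card V" and M: "M * h = r * card V"
    and X: "X \<subseteq> V" and SV: "S \<subseteq> V" "V - S \<subseteq> span tW FW" and XS: "X \<subseteq> S"
    and absorb: "\<And>L. L \<subseteq> S - X \<Longrightarrow> real (card L) \<le> b \<Longrightarrow> h dvd card L \<Longrightarrow>
       \<exists>t f. 1 \<le> t \<and> chain_map t f \<and> span t f = X \<union> L \<and> emb_edges t f \<subseteq> K \<and>
         (\<forall>i\<in>{1..l}. f i = s i \<and> f (h * t + i) = e i)"
    and W: "chain_map tW FW" "span tW FW \<subseteq> V" "\<And>i. i \<in> {1..l} \<Longrightarrow> FW i = e i \<and> FW (h * tW + i) = s i"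
    and XW: "X \<inter> span tW FW = s ` {1..l} \<union> e ` {1..l}" and se: "s ` {1..l} \<inter> e ` {1..l} = {}"
    and small: "0 \<le> b" "real (card (V - X - span tW FW)) \<le> b"
    and EW: "EQ \<union> EP \<subseteq> emb_edges tW FW" "emb_edges tW FW \<subseteq> K \<union> EQ \<union> EP \<union> emb_edges 0 s \<union> emb_edges 0 e"
      "EQ \<inter> EP = {}"
    and P: "rainbow H RP EP \<phi>P" "card RP = card EP" "finite RP"
    and colours: "B \<union> Cn \<union> RP = {..<M}" "B \<inter> Cn = {}" "B \<inter> RP = {}" "Cn \<inter> RP = {}"
    and K: "\<And>g. g \<in> K \<Longrightarrow> M \<le> card {c \<in> Cn. g \<in> H c} + card EQ + card EP"
    and Q: "\<And>U. U \<subseteq> Cn \<Longrightarrow> card U + card B = card EQ \<Longrightarrow> \<exists>\<phi>. rainbow H (B \<union> U) EQ \<phi>"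
  shows "\<exists>C. hamilton_cycle_on l m A V C \<and> (\<exists>\<phi>. bij_betw \<phi> (edges C) {..<M} \<and> (\<forall>g\<in>edges C. g \<in> H (\<phi> g)))"
proof -
  let ?W = "span tW FW"
  define L where "L = V - X - ?W"
  have fin: "finite X" "finite L" using V X finite_subset by (auto simp: L_def)
  have cs: "card (s ` {1..l}) = l"
  proof -
    have "inj_on s {1..l}"
    proof (rule inj_onI)
      fix i j assume ij: "i \<in> {1..l}" "j \<in> {1..l}" "s i = s j"
      then have "FW (h * tW + i) = FW (h * tW + j)" using W(3) by simp
      then have "h * tW + i = h * tW + j"
        using inj_onD[of FW "{1..h * tW + l}" "h * tW + i" "h * tW + j"] W(1) ij by (auto simp: chain_map_def)
      then show "i = j" by simp
    qed
    then show ?thesis by (simp add: card_image)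
  qed
  have ce: "card (e ` {1..l}) = l"
  proof -
    have "inj_on FW {1..l}" using W(1) unfolding chain_map_def by (rule inj_on_subset) auto
    then have "inj_on e {1..l}" by (rule inj_on_cong[THEN iffD1, rotated]) (rule W(3)[THEN conjunct1])
    then show ?thesis by (simp add: card_image)
  qed
  have cXW: "card (X \<inter> ?W) = 2 * l" unfolding XW using se cs ce by (simp add: card_Un_disjoint)
  have Vun: "V = (X \<union> ?W) \<union> L" using X W(2) by (auto simp: L_def)
  have "card V = card (X \<union> ?W) + card L"
    by (subst Vun, rule card_Un_disjoint) (use fin in \<open>auto simp: L_def\<close>)
  moreover have "card (X \<union> ?W) + 2 * l = card X + card ?W"
    using card_Un_Int[of X ?W] fin cXW by simp
  ultimately have count: "card V + 2 * l = card X + (h * tW + l) + card L"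
    using card_span[OF W(1)] by simp
  \<comment> \<open>Absorbing the empty set shows that \<open>card X\<close> is \<open>l\<close>
    modulo \<open>h\<close>, from which \<open>h dvd card L\<close> follows by counting.\<close>
  have "\<exists>t f. 1 \<le> t \<and> chain_map t f \<and> span t f = X \<union> {} \<and> emb_edges t f \<subseteq> K \<and>
         (\<forall>i\<in>{1..l}. f i = s i \<and> f (h * t + i) = e i)"
    by (rule absorb) (use small in auto)
  then obtain t' f' where "chain_map t' f'" "span t' f' = X" by auto
  then have cX: "card X = h * t' + l" using card_span[of t' f'] by simp
  have hL: "h dvd card L"
  proof -
    have "card V = h * (t' + tW) + card L" using count cX by (simp add: algebra_simps)
    then show ?thesis using hV dvd_add_right_iff[of h "h * (t' + tW)" "card L"] by simp
  qed
  have LS: "L \<subseteq> S - X" using SV by (auto simp: L_def)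
  have "\<exists>t f. 1 \<le> t \<and> chain_map t f \<and> span t f = X \<union> L \<and> emb_edges t f \<subseteq> K \<and>
         (\<forall>i\<in>{1..l}. f i = s i \<and> f (h * t + i) = e i)"
    by (rule absorb[OF LS _ hL]) (use small(2) in \<open>simp add: L_def\<close>)
  then obtain tX fX where fX: "1 \<le> tX" "chain_map tX fX" "span tX fX = X \<union> L" "emb_edges tX fX \<subseteq> K"
    and fXe: "\<forall>i\<in>{1..l}. fX i = s i \<and> fX (h * tX + i) = e i" by (elim exE conjE) (rule that)
  define t where "t = tX + tW"
  define F where "F = glue tX fX FW"
  have agree: "FW i = fX (h * tX + i)" if "i \<in> {1..l}" for i using fXe W(3)[OF that] that by simp
  have "card (X \<union> L) = card X + card L" using fin by (intro card_Un_disjoint) (auto simp: L_def)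
  then have "h * tX + l = card X + card L" using card_span[OF fX(2)] fX(3) by simp
  then have ht: "h * t = card V" using count by (simp add: t_def algebra_simps)
  have spF: "span t F = V"
  proof -
    have "span t F = span tX fX \<union> ?W" unfolding t_def F_def
      by (rule span_glue[where f' = FW and f = fX and t = tX, OF agree])
    then show ?thesis using fX(3) Vun by blast
  qed
  have edF: "emb_edges t F = emb_edges tX fX \<union> emb_edges tW FW" unfolding t_def F_def
    by (rule emb_edges_glue[where f' = FW and f = fX and t = tX, OF agree])
  have lh: "l \<le> h * t" using ht V(2) l_less_m by simp
  have per: "F (h * t + i) = F i" if i: "i \<in> {1..l}" for i
  proof -
    have "F (h * t + i) = glue tX fX FW (h * tX + (h * tW + i))" by (simp add: F_def t_def algebra_simps)
    also have "\<dots> = FW (h * tW + i)"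
      by (rule glue_right[where f' = FW and f = fX and t = tX, OF agree]) (use i in auto)
    also have "\<dots> = s i" using W(3)[OF i] by simp
    also have "\<dots> = F i" unfolding F_def using fXe i by (subst glue_left) auto
    finally show ?thesis .
  qed
  have FV: "F ` {1..h * t} = V"
  proof
    show "F ` {1..h * t} \<subseteq> V" using spF by (auto simp: span_def)
    show "V \<subseteq> F ` {1..h * t}"
    proof
      fix v assume "v \<in> V"
      then obtain i where i: "i \<in> {1..h * t + l}" "v = F i" using spF by (auto simp: span_def)
      show "v \<in> F ` {1..h * t}"
      proof (cases "i \<le> h * t")
        case False
        then have j: "i - h * t \<in> {1..l}" "h * t + (i - h * t) = i" using i by auto
        then have "v = F (i - h * t)" using per[OF j(1)] i(2) by simp
        moreover have "i - h * t \<in> {1..h * t}" using j(1) lh by auto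
        ultimately show ?thesis by blast
      qed (use i in auto)
    qed
  qed
  \<comment> \<open>A surjection between finite sets of the same size
    \<open>h * t = card V\<close>.\<close>
  have injF: "inj_on F {1..h * t}" by (rule eq_card_imp_inj_on) (use FV ht in auto)
  have "1 \<le> t" using fX(1) by (simp add: t_def)
  have ham: "hamilton_cycle_on l m A V (V, emb_edges t F)"
    using cycle_of_map[OF injF per \<open>1 \<le> t\<close> lh] FV by simp
  have "card (emb_edges t F) = r * t" by (rule card_cycle_edges[OF injF per]) (use ht V(2) in auto)
  moreover have "M = r * t"
  proof -
    have "M * h = (r * t) * h" using M ht by (simp add: mult.commute mult.left_commute)
    then show ?thesis using h_pos by simp
  qed
  ultimately have cE: "card (emb_edges t F) = M" by simp
  define Y where "Y = emb_edges t F - (EQ \<union> EP)"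
  have sub: "EQ \<union> EP \<subseteq> emb_edges t F" using EW(1) edF by blast
  have fE: "finite EQ" "finite EP" "finite Y" using finite_subset[OF sub] by (auto simp: Y_def)
  have "card (EQ \<union> EP) = card EQ + card EP" by (rule card_Un_disjoint[OF fE(1,2) EW(3)])
  moreover have "card Y = card (emb_edges t F) - card (EQ \<union> EP)"
    unfolding Y_def using fE sub by (intro card_Diff_subset) auto
  moreover have "card (EQ \<union> EP) \<le> card (emb_edges t F)" using sub by (intro card_mono) auto
  ultimately have cY: "card Y + card EQ + card EP = M" using cE by linarith
  have YK: "Y \<subseteq> K"
  proof -
    \<comment> \<open>The ends of the absorber occur as bare copies of the start; their edges are in
      \<open>K\<close> because the absorbing chain begins and ends there.\<close>
    have "emb_edges 0 s = emb_edges 0 fX" using fXe by (intro emb_edges_cong) auto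
    then have 1: "emb_edges 0 s \<subseteq> K" using emb_edges_start[of fX tX] fX(4) by blast
    have "emb_edges 0 e = emb_edges 0 (\<lambda>i. fX (h * tX + i))" using fXe by (intro emb_edges_cong) auto
    then have 2: "emb_edges 0 e \<subseteq> K" using emb_edges_end[of fX tX] fX(4) by blast
    show ?thesis using 1 2 EW(2) fX(4) unfolding edF Y_def by blast
  qed
  have fCn: "finite Cn" using finite_subset[of Cn "{..<M}"] colours(1) by auto
  have fB: "finite B" using finite_subset[of B "{..<M}"] colours(1) by auto
  have "\<exists>\<phi>. rainbow H Cn Y \<phi>"
  proof (rule exists_rainbow_greedy[OF fE(3) fCn])
    fix g assume "g \<in> Y"
    then have "M \<le> card {c \<in> Cn. g \<in> H c} + card EQ + card EP" using YK K by blast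
    then show "card Y \<le> card {c \<in> Cn. g \<in> H c}" using cY by linarith
  qed
  then obtain \<phi>Y where Y: "rainbow H Cn Y \<phi>Y" by blast
  define U where "U = Cn - \<phi>Y ` Y"
  have cim: "card (\<phi>Y ` Y) = card Y" using Y by (intro card_image) (simp add: rainbow_def)
  have imC: "\<phi>Y ` Y \<subseteq> Cn" using Y by (simp add: rainbow_def)
  have "card U = card Cn - card Y" unfolding U_def using imC fE(3) cim by (simp add: card_Diff_subset)
  moreover have "card Y \<le> card Cn" using card_mono[OF fCn imC] cim by simp
  moreover have "card B + card Cn + card RP = M"
  proof -
    have "card (B \<union> Cn \<union> RP) = card (B \<union> Cn) + card RP"
      using fB fCn P(3) colours by (intro card_Un_disjoint) auto
    also have "card (B \<union> Cn) = card B + card Cn" using fB fCn colours by (intro card_Un_disjoint) auto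
    finally show ?thesis using colours(1) by simp
  qed
  ultimately have "card U + card B = card EQ" using cY P(2) by linarith
  then obtain \<phi>Q where Qc: "rainbow H (B \<union> U) EQ \<phi>Q" using Q[of U] by (auto simp: U_def)
  have dQP: "(B \<union> U) \<inter> RP = {}" using colours by (auto simp: U_def)
  obtain \<phi>1 where \<phi>1: "rainbow H ((B \<union> U) \<union> RP) (EQ \<union> EP) \<phi>1"
    using rainbow_Un[OF Qc P(1) EW(3) dQP] by blast
  have Y': "rainbow H (\<phi>Y ` Y) Y \<phi>Y" using Y by (simp add: rainbow_def)
  have dY: "(EQ \<union> EP) \<inter> Y = {}" by (auto simp: Y_def)
  have dcol: "((B \<union> U) \<union> RP) \<inter> \<phi>Y ` Y = {}" using colours imC by (auto simp: U_def)
  obtain \<phi> where \<phi>: "rainbow H ((B \<union> U) \<union> RP \<union> \<phi>Y ` Y) ((EQ \<union> EP) \<union> Y) \<phi>"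
    using rainbow_Un[OF \<phi>1 Y' dY dcol] by blast
  have EY: "(EQ \<union> EP) \<union> Y = emb_edges t F" using sub by (auto simp: Y_def)
  have "inj_on \<phi> (emb_edges t F)" using \<phi> unfolding EY rainbow_def by blast
  moreover have "\<phi> ` emb_edges t F \<subseteq> {..<M}"
    using \<phi> imC colours(1) unfolding EY rainbow_def U_def by blast
  ultimately have "bij_betw \<phi> (emb_edges t F) {..<M}"
    unfolding bij_betw_def using cE card_image[of \<phi> "emb_edges t F"] by (intro conjI card_subset_eq) auto
  moreover have "\<forall>g\<in>emb_edges t F. g \<in> H (\<phi> g)" using \<phi> unfolding EY rainbow_def by blast
  ultimately show ?thesis using ham by (intro exI[of _ "(V, emb_edges t F)"]) auto
qed


section \<open>Linking the pieces into one cycle\<close>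

lemma emb_edges_disjoint:
  assumes "span t f \<inter> span t' f' = {}"
  shows "emb_edges t f \<inter> emb_edges t' f' = {}"
proof -
  have False if "g \<in> emb_edges t f" "g \<in> emb_edges t' f'" for g
  proof -
    have "g \<subseteq> {}" using emb_edges_subset_span[OF that(1)] emb_edges_subset_span[OF that(2)] assms by blast
    then show False using emb_edges_nonempty[OF that(1)] by blast
  qed
  then show ?thesis by blast
qed

text \<open>The linked chain runs from the end \<open>e\<close> of the absorber through all pieces
  back to its start \<open>s\<close>, both taken as chains of length 0. So it can be built before
  the absorbing chain is known: the vertices that it leaves uncovered decide which chain on
  \<open>X\<close> is inserted.\<close>

lemma connect_and_assemble:
  assumes V: "finite V" "3 * m \<le> card V" and hV: "h dvd card V" and M: "M * h = r * card V"
    and Q: "chain_map tQ fQ" "span tQ fQ \<subseteq> V"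
    and X: "X \<subseteq> V - span tQ fQ" and s: "inj_on s {1..l}" "s ` {1..l} \<subseteq> X"
    and e: "inj_on e {1..l}" "e ` {1..l} \<subseteq> X" and se: "s ` {1..l} \<inter> e ` {1..l} = {}"
    and absorb: "\<And>L. L \<subseteq> (V - span tQ fQ) - X \<Longrightarrow> real (card L) \<le> b \<Longrightarrow> h dvd card L \<Longrightarrow>
       \<exists>t f. 1 \<le> t \<and> chain_map t f \<and> span t f = X \<union> L \<and> emb_edges t f \<subseteq> K \<and>
         (\<forall>i\<in>{1..l}. f i = s i \<and> f (h * t + i) = e i)"
    and V0: "V0 \<subseteq> V - span tQ fQ - X" and V3: "V3 \<subseteq> V - span tQ fQ - X" and V03: "V0 \<inter> V3 = {}"
    and bulk: "\<And>i. i < j \<Longrightarrow> chain_map t0 (fb i) \<and> span t0 (fb i) \<subseteq> V3"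
      "\<And>i i'. i < j \<Longrightarrow> i' < j \<Longrightarrow> i \<noteq> i' \<Longrightarrow> span t0 (fb i) \<inter> span t0 (fb i') = {}"
    and fac: "\<And>i. i < NF \<Longrightarrow> chain_map 1 (fF i) \<and> span 1 (fF i) \<subseteq> V0"
      "\<And>i i'. i < NF \<Longrightarrow> i' < NF \<Longrightarrow> i \<noteq> i' \<Longrightarrow> span 1 (fF i) \<inter> span 1 (fF i') = {}"
    and con: "\<And>Z s e. real (card (V0 \<inter> Z)) \<le> \<xi> \<Longrightarrow> inj_on s {1..l} \<Longrightarrow> inj_on e {1..l} \<Longrightarrow>
        s ` {1..l} \<subseteq> V \<Longrightarrow> e ` {1..l} \<subseteq> V \<Longrightarrow> s ` {1..l} \<inter> e ` {1..l} = {} \<Longrightarrow> connects V0 K c Z s e"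
    and room: "real (NF * m) + real ((3 + j + NF) * (h * c + l)) \<le> \<xi>"
    and small: "0 \<le> b" "real (card V) - real (card X) - real (h * tQ) - real (j * (h * t0)) \<le> b"
    and Eb: "Eb = (\<Union>i<j. emb_edges t0 (fb i))" and EF: "EF = (\<Union>i<NF. emb_edges 1 (fF i))"
    and b: "rainbow H Rb Eb \<phi>b" "card Rb = card Eb" "finite Rb"
    and F: "rainbow H RF EF \<phi>F" "card RF = card EF" "finite RF" and bF: "Rb \<inter> RF = {}"
    and colours: "B \<union> Cn \<union> (Rb \<union> RF) = {..<M}" "B \<inter> Cn = {}" "B \<inter> (Rb \<union> RF) = {}" "Cn \<inter> (Rb \<union> RF) = {}"
    and K: "\<And>g. g \<in> K \<Longrightarrow> M \<le> card {c \<in> Cn. g \<in> H c} + card (emb_edges tQ fQ) + (card Eb + card EF)"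
    and abs: "\<And>U. U \<subseteq> Cn \<Longrightarrow> card U + card B = card (emb_edges tQ fQ) \<Longrightarrow>
        \<exists>\<phi>. rainbow H (B \<union> U) (emb_edges tQ fQ) \<phi>"
  shows "\<exists>C. hamilton_cycle_on l m A V C \<and> (\<exists>\<phi>. bij_betw \<phi> (edges C) {..<M} \<and> (\<forall>g\<in>edges C. g \<in> H (\<phi> g)))"
proof -
  define mb where "mb = map (\<lambda>i. (t0, fb i)) [0..<j]"
  define mF where "mF = map (\<lambda>i. (1::nat, fF i)) [0..<NF]"
  define ps where "ps = (0, e) # (tQ, fQ) # mb @ mF @ [(0, s)]"
  have set_mb: "P \<in> set mb \<longleftrightarrow> (\<exists>i<j. P = (t0, fb i))" for P by (auto simp: mb_def)
  have set_mF: "P \<in> set mF \<longleftrightarrow> (\<exists>i<NF. P = (1, fF i))" for P by (auto simp: mF_def)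
  define Sb where "Sb = (\<Union>i<j. span t0 (fb i))"
  define SF where "SF = (\<Union>i<NF. span 1 (fF i))"
  define ends where "ends = s ` {1..l} \<union> e ` {1..l}"
  let ?Q = "span tQ fQ"
  have sp0: "span 0 s = s ` {1..l}" "span 0 e = e ` {1..l}" by (simp_all add: span_def)
  have Un: "(\<Union>(t, f)\<in>set ps. G t f) = G 0 e \<union> G tQ fQ \<union> (\<Union>i<j. G t0 (fb i)) \<union> (\<Union>i<NF. G 1 (fF i)) \<union> G 0 s"
    for G :: "nat \<Rightarrow> (nat \<Rightarrow> nat) \<Rightarrow> 'z set"
    unfolding ps_def mb_def mF_def by (auto simp: atLeast0LessThan)
  define Z where "Z = (\<Union>(t, f)\<in>set ps. span t f)"
  have Z: "Z = ends \<union> ?Q \<union> Sb \<union> SF" unfolding Z_def Un sp0 Sb_def SF_def ends_def by (simp only: Un_ac)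
  have endsX: "ends \<subseteq> X" using s(2) e(2) unfolding ends_def by (rule Un_least)
  have Sb3: "Sb \<subseteq> V3" unfolding Sb_def using bulk(1) by blast
  have SF0: "SF \<subseteq> V0" unfolding SF_def using fac(1) by blast
  have XV: "X \<subseteq> V" "X \<inter> ?Q = {}" and V0V: "V0 \<subseteq> V" "V0 \<inter> ?Q = {}" "V0 \<inter> X = {}"
    and V3V: "V3 \<subseteq> V" "V3 \<inter> ?Q = {}" "V3 \<inter> X = {}" using X V0 V3 by blast+
  have ZV: "Z \<subseteq> V" using Z endsX XV(1) Q(2) Sb3 SF0 V0V(1) V3V(1) by blast
  have fV0: "finite V0" using V0V(1) V(1) by (rule finite_subset)
  \<comment> \<open>Among the pieces only the copies of \<open>A\<close> from Fac touch the
    reservoir.\<close>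
  have V0Z: "V0 \<inter> Z = SF" using Z endsX Sb3 SF0 V0V V03 by blast
  have cSF: "card SF \<le> NF * m"
  proof -
    have "card SF \<le> (\<Sum>i<NF. card (span 1 (fF i)))" unfolding SF_def by (rule card_UN_le) simp
    also have "\<dots> = (\<Sum>i<NF. m)"
    proof (rule sum.cong[OF refl])
      fix i assume "i \<in> {..<NF}"
      then have "chain_map 1 (fF i)" using fac(1)[of i] by simp
      from card_span[OF this] show "card (span 1 (fF i)) = m" using h_l(1) by simp
    qed
    finally show ?thesis by simp
  qed
  have len: "length ps = 3 + j + NF" by (simp add: ps_def mb_def mF_def)
  have pieces: "chain_map t f \<and> span t f \<subseteq> V \<inter> Z" if "(t, f) \<in> set ps" for t f
  proof -
    have "span t f \<subseteq> Z" using that unfolding Z_def by blast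
    moreover have "chain_map t f"
    proof -
      consider "t = 0" "f = e" | "t = tQ" "f = fQ" | "(t, f) \<in> set mb" | "(t, f) \<in> set mF" | "t = 0" "f = s"
        using \<open>(t, f) \<in> set ps\<close> unfolding ps_def by auto
      then show ?thesis
      proof cases
        case 1
        then show ?thesis using e(1) by (simp add: chain_map_def)
      next
        case 2
        then show ?thesis using Q(1) by simp
      next
        case 3
        then show ?thesis using bulk(1) unfolding set_mb by blast
      next
        case 4
        then show ?thesis using fac(1) unfolding set_mF by blast
      next
        case 5
        then show ?thesis using s(1) by (simp add: chain_map_def)
      qed
    qed
    ultimately show ?thesis using ZV by blast
  qed
  let ?D = "\<lambda>P P'. span (fst P) (snd P) \<inter> span (fst P') (snd P') = {}"
  have sub_mb: "span (fst P) (snd P) \<subseteq> V3" if P: "P \<in> set mb" for P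
  proof -
    obtain i where "i < j" "P = (t0, fb i)" using P set_mb by blast
    then show ?thesis using bulk(1)[of i] by simp
  qed
  have sub_mF: "span (fst P) (snd P) \<subseteq> V0" if P: "P \<in> set mF" for P
  proof -
    obtain i where "i < NF" "P = (1, fF i)" using P set_mF by blast
    then show ?thesis using fac(1)[of i] by simp
  qed
  have smb: "sorted_wrt ?D mb"
    unfolding sorted_wrt_iff_nth_less
  proof (intro allI impI)
    fix i i' assume "i < i'" "i' < length mb"
    then show "?D (mb ! i) (mb ! i')" using bulk(2)[of i i'] by (simp add: mb_def)
  qed
  have smF: "sorted_wrt ?D mF"
    unfolding sorted_wrt_iff_nth_less
  proof (intro allI impI)
    fix i i' assume "i < i'" "i' < length mF"
    then show "?D (mF ! i) (mF ! i')" using fac(2)[of i i'] by (simp add: mF_def)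
  qed
  have spX: "span 0 e \<subseteq> X" "span 0 s \<subseteq> X" "span 0 e \<inter> span 0 s = {}"
    unfolding sp0 using s(2) e(2) se by (simp_all add: Int_commute)
  have d_e: "?D (0, e) P" if P: "P \<in> set ((tQ, fQ) # mb @ mF @ [(0, s)])" for P
  proof -
    consider "P = (tQ, fQ)" | "P \<in> set mb" | "P \<in> set mF" | "P = (0, s)" using P by auto
    then show ?thesis
    proof cases
      case 1
      then show ?thesis using spX(1) XV(2) by auto
    next
      case 2
      then show ?thesis using sub_mb[OF 2] spX(1) V3V(3) unfolding fst_conv snd_conv by blast
    next
      case 3
      then show ?thesis using sub_mF[OF 3] spX(1) V0V(3) unfolding fst_conv snd_conv by blast
    next
      case 4
      then show ?thesis using spX(3) by simp
    qed
  qed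
  have d_Q: "?D (tQ, fQ) P" if P: "P \<in> set (mb @ mF @ [(0, s)])" for P
  proof -
    consider "P \<in> set mb" | "P \<in> set mF" | "P = (0, s)" using P by auto
    then show ?thesis
    proof cases
      case 1
      then show ?thesis using sub_mb[OF 1] V3V(2) unfolding fst_conv snd_conv by blast
    next
      case 2
      then show ?thesis using sub_mF[OF 2] V0V(2) unfolding fst_conv snd_conv by blast
    next
      case 3
      then show ?thesis using spX(2) XV(2) by auto
    qed
  qed
  have d_b: "?D P P'" if P: "P \<in> set mb" "P' \<in> set (mF @ [(0, s)])" for P P'
  proof -
    consider "P' \<in> set mF" | "P' = (0, s)" using P by auto
    then show ?thesis
    proof cases
      case 1
      then show ?thesis using sub_mb[OF P(1)] sub_mF[OF 1] V03 by blast
    next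
      case 2
      then show ?thesis using sub_mb[OF P(1)] spX(2) V3V(3) unfolding 2 fst_conv snd_conv by blast
    qed
  qed
  have d_F: "?D P P'" if P: "P \<in> set mF" "P' \<in> set [(0, s)]" for P P'
  proof -
    have 2: "P' = (0, s)" using P by simp
    show ?thesis using sub_mF[OF P(1)] spX(2) V0V(3) unfolding 2 fst_conv snd_conv by blast
  qed
  have "sorted_wrt ?D (mF @ [(0, s)])"
    unfolding sorted_wrt_append by (intro conjI ballI smF d_F) simp_all
  then have "sorted_wrt ?D (mb @ mF @ [(0, s)])"
    unfolding sorted_wrt_append[of _ mb] by (intro conjI ballI smb d_b) 
  then have "sorted_wrt ?D ((tQ, fQ) # mb @ mF @ [(0, s)])"
    unfolding sorted_wrt.simps(2)[of _ "(tQ, fQ)"] by (intro conjI ballI d_Q)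
  then have disj: "sorted_wrt ?D ps"
    unfolding ps_def sorted_wrt.simps(2)[of _ "(0, e)"] by (intro conjI ballI d_e)
  have "\<exists>t F. chain_map t F \<and>
     (\<forall>i\<in>{1..l}. F i = snd (hd ps) i \<and> F (h * t + i) = snd (last ps) (h * fst (last ps) + i)) \<and>
     (\<Union>(t, f)\<in>set ps. span t f) \<subseteq> span t F \<and>
     span t F \<subseteq> (\<Union>(t, f)\<in>set ps. span t f) \<union> (V0 - Z) \<and>
     (\<Union>(t, f)\<in>set ps. emb_edges t f) \<subseteq> emb_edges t F \<and>
     emb_edges t F \<subseteq> (\<Union>(t, f)\<in>set ps. emb_edges t f) \<union> K"
  proof (rule connect_piece_list[OF fV0, where V = V and \<xi> = \<xi>])
    show "ps \<noteq> []" by (simp add: ps_def)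
    show "V0 \<subseteq> V" by (rule V0V(1))
    have "real (card (V0 \<inter> Z)) \<le> real (NF * m)" unfolding V0Z using cSF by (simp only: of_nat_le_iff)
    then show "real (card (V0 \<inter> Z)) + real (length ps * (h * c + l)) \<le> \<xi>" unfolding len using room by linarith
  qed (fact con | fact pieces | fact disj)+
  then obtain tW FW where W: "chain_map tW FW"
     "\<forall>i\<in>{1..l}. FW i = snd (hd ps) i \<and> FW (h * tW + i) = snd (last ps) (h * fst (last ps) + i)"
     "(\<Union>(t, f)\<in>set ps. span t f) \<subseteq> span tW FW"
     "span tW FW \<subseteq> (\<Union>(t, f)\<in>set ps. span t f) \<union> (V0 - Z)"
     "(\<Union>(t, f)\<in>set ps. emb_edges t f) \<subseteq> emb_edges tW FW"
     "emb_edges tW FW \<subseteq> (\<Union>(t, f)\<in>set ps. emb_edges t f) \<union> K"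
    by (elim exE conjE) (rule that)
  have FW_ends: "FW i = e i \<and> FW (h * tW + i) = s i" if "i \<in> {1..l}" for i
    using W(2)[rule_format, OF that] by (simp add: ps_def)
  have W3: "Z \<subseteq> span tW FW" and W4: "span tW FW \<subseteq> Z \<union> (V0 - Z)" using W(3,4) unfolding Z_def by blast+
  let ?EQ = "emb_edges tQ fQ"
  have EU: "(\<Union>(t, f)\<in>set ps. emb_edges t f) = emb_edges 0 e \<union> ?EQ \<union> Eb \<union> EF \<union> emb_edges 0 s"
    unfolding Un Eb EF ..
  have ebF: "Eb \<inter> EF = {}"
  proof -
    have "emb_edges t0 (fb i) \<inter> emb_edges 1 (fF i') = {}" if "i < j" "i' < NF" for i i'
      by (rule emb_edges_disjoint) (use bulk(1)[OF that(1)] fac(1)[OF that(2)] V03 in blast)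
    then show ?thesis unfolding Eb EF by blast
  qed
  have eQ: "?EQ \<inter> (Eb \<union> EF) = {}"
  proof -
    have "?EQ \<inter> emb_edges t0 (fb i) = {}" if "i < j" for i
      by (rule emb_edges_disjoint) (use bulk(1)[OF that] V3V(2) in blast)
    moreover have "?EQ \<inter> emb_edges 1 (fF i) = {}" if "i < NF" for i
      by (rule emb_edges_disjoint) (use fac(1)[OF that] V0V(2) in blast)
    ultimately show ?thesis unfolding Eb EF by blast
  qed
  obtain \<phi>P where \<phi>P: "rainbow H (Rb \<union> RF) (Eb \<union> EF) \<phi>P" using rainbow_Un[OF b(1) F(1) ebF bF] by blast
  have fE: "finite Eb" "finite EF" by (simp_all add: Eb EF)
  have cP: "card (Eb \<union> EF) = card Eb + card EF" by (rule card_Un_disjoint[OF fE ebF])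
  have cR: "card (Rb \<union> RF) = card Rb + card RF" by (rule card_Un_disjoint[OF b(3) F(3) bF])
  have leftover: "real (card (V - X - span tW FW)) \<le> b"
  proof -
    have f: "finite X" "finite ?Q" "finite Sb" using finite_subset[OF XV(1) V(1)] by (simp_all add: Sb_def)
    have cb: "card Sb = j * (h * t0 + l)"
    proof -
      have "card Sb = (\<Sum>i<j. card (span t0 (fb i)))"
        unfolding Sb_def by (rule card_UN_disjoint) (use bulk(2) in auto)
      also have "\<dots> = (\<Sum>i<j. h * t0 + l)"
        by (rule sum.cong[OF refl], rule card_span) (use bulk(1) in auto)
      finally show ?thesis by simp
    qed
    have "V - X - span tW FW \<subseteq> V - (X \<union> ?Q \<union> Sb)" using W3 Z by blast
    then have "card (V - X - span tW FW) \<le> card (V - (X \<union> ?Q \<union> Sb))"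
      using V(1) by (intro card_mono) auto
    moreover have "X \<union> ?Q \<union> Sb \<subseteq> V" using XV Q(2) Sb3 V3V by blast
    then have "card (V - (X \<union> ?Q \<union> Sb)) + card (X \<union> ?Q \<union> Sb) = card V"
      using V(1) card_mono[of V "X \<union> ?Q \<union> Sb"] f by (subst card_Diff_subset) auto
    moreover have "card (X \<union> ?Q \<union> Sb) = card (X \<union> ?Q) + card Sb"
      using f XV V3V Sb3 by (intro card_Un_disjoint) blast+
    moreover have "card (X \<union> ?Q) = card X + card ?Q"
      using f XV by (intro card_Un_disjoint) blast+
    moreover have "h * tQ \<le> card ?Q" using card_span[OF Q(1)] by simp
    moreover have "j * (h * t0) \<le> j * (h * t0 + l)" by simp
    ultimately have "card (V - X - span tW FW) + card X + h * tQ + j * (h * t0) \<le> card V" using cb by linarith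
    then have "real (card (V - X - span tW FW)) + real (card X) + real (h * tQ) + real (j * (h * t0)) \<le> real (card V)"
      by (simp only: of_nat_add[symmetric] of_nat_le_iff)
    then show ?thesis using small(2) by linarith
  qed
  show ?thesis
  proof (rule assemble_cycle[where S = "V - ?Q" and X = X and b = b and K = K and s = s and e = e
        and EQ = ?EQ and EP = "Eb \<union> EF" and RP = "Rb \<union> RF" and \<phi>P = \<phi>P and B = B and Cn = Cn
        and tW = tW and FW = FW, OF V hV M])
    show "X \<subseteq> V" by (rule XV(1))
    show "X \<subseteq> V - ?Q" by (rule X)
    show "V - ?Q \<subseteq> V" by (rule Diff_subset)
    show "V - (V - ?Q) \<subseteq> span tW FW" using W3 Z by blast
    show "span tW FW \<subseteq> V" using W4 ZV V0V(1) by blast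
    show "X \<inter> span tW FW = s ` {1..l} \<union> e ` {1..l}"
      unfolding ends_def[symmetric] using W3 W4 Z XV endsX Sb3 SF0 V0V V3V by blast
    show "?EQ \<union> (Eb \<union> EF) \<subseteq> emb_edges tW FW" using W(5) unfolding EU by blast
    show "emb_edges tW FW \<subseteq> K \<union> ?EQ \<union> (Eb \<union> EF) \<union> emb_edges 0 s \<union> emb_edges 0 e"
      using W(6) unfolding EU by blast
    show "card (Rb \<union> RF) = card (Eb \<union> EF)" using cP cR b(2) F(2) by simp
    show "finite (Rb \<union> RF)" using b(3) F(3) by simp
    show "M \<le> card {c \<in> Cn. g \<in> H c} + card ?EQ + card (Eb \<union> EF)" if "g \<in> K" for g
      unfolding cP by (rule K[OF that])
  qed (fact absorb | fact W(1) | fact se | fact small(1) | fact leftover | fact eQ | fact \<phi>P | fact colours(1)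
      | fact colours(2) | fact colours(3) | fact colours(4) | (rule FW_ends, assumption) | (rule abs; assumption))+
qed

end

section \<open>The rainbow Hamilton cycle\<close>

text \<open>Every requirement on the number of vertices has the form
  \<open>K \<le> \<kappa> * n\<close>, so one threshold is taken for the whole list.\<close>

lemma exists_common_threshold:
  fixes Ls :: "(real \<times> real) list"
  assumes "\<forall>(K, \<kappa>)\<in>set Ls. 0 < \<kappa>"
  shows "\<exists>n0. \<forall>n\<ge>n0. \<forall>(K, \<kappa>)\<in>set Ls. K \<le> \<kappa> * real n"
  using assms
proof (induction Ls)
  case (Cons L Ls)
  obtain K \<kappa> where L: "L = (K, \<kappa>)" by (cases L)
  have \<kappa>: "0 < \<kappa>" using Cons.prems L by simp
  obtain n1 where n1: "\<forall>n\<ge>n1. \<forall>(K, \<kappa>)\<in>set Ls. K \<le> \<kappa> * real n" using Cons by auto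
  obtain n2 :: nat where n2: "K / \<kappa> \<le> real n2" using real_arch_simple by blast
  have "K \<le> \<kappa> * real n" if "n2 \<le> n" for n
  proof -
    have "K / \<kappa> \<le> real n" using n2 that by linarith
    then show ?thesis using \<kappa> by (simp add: field_simps)
  qed
  then show ?case using n1 L by (intro exI[of _ "max n1 n2"]) auto
qed simp

lemma degree_into_mono: "degree_into d p V E S x \<Longrightarrow> y \<le> x \<Longrightarrow> degree_into d p V E S y"
  unfolding degree_into_def
proof (intro allI impI)
  fix D assume *: "\<forall>D\<subseteq>V. card D = d \<longrightarrow> x * real (card S) ^ p \<le> real (card {e \<in> E. D \<subseteq> e \<and> e - D \<subseteq> S})"
    and yx: "y \<le> x" and D: "D \<subseteq> V" "card D = d"
  have "y * real (card S) ^ p \<le> x * real (card S) ^ p" using yx by (rule mult_right_mono) simp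
  also have "\<dots> \<le> real (card {e \<in> E. D \<subseteq> e \<and> e - D \<subseteq> S})" using * D by blast
  finally show "y * real (card S) ^ p \<le> real (card {e \<in> E. D \<subseteq> e \<and> e - D \<subseteq> S})" .
qed

lemma degree_into_subset:
  assumes "finite V" "S \<subseteq> V" "S' \<subseteq> S" "p \<ge> 1" "a > 0" "0 \<le> x" "x \<le> 1" "uniform_edges (d + p) V E"
    and "real (card (S - S')) \<le> slack p a * real (card S)" "degree_into d p V E S (x + a)"
  shows "degree_into d p V E S' x"
proof (rule degree_into_change[OF assms(1,2) _ assms(4,5,6,7,8,9) _ assms(10)])
  have fS: "finite S" using assms(2,1) by (rule finite_subset)
  show "finite S'" using assms(3) fS by (rule finite_subset)
  have "real (card S') \<le> real (card S)" using card_mono[OF fS assms(3)] by simp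
  also have "\<dots> \<le> (1 + slack p a) * real (card S)"
    using slack(1)[OF assms(5), of p] by (simp add: distrib_right)
  finally show "real (card S') \<le> (1 + slack p a) * real (card S)" .
qed

context link
begin

text \<open>The density \<open>\<delta> + 16 * a\<close> loses one \<open>a\<close> when the
  flexible chain and the absorber are removed, one for the reservoir or its complement, one for the
  parts of the bulk, and one when popular edges replace the edges of a single colour. What is left
  suffices for the threshold and the three properties, which are applied with at most
  \<open>3 * a\<close> above \<open>\<delta>\<close>.\<close>

lemma transversal_hamilton_cycle:
  fixes \<delta> a :: real
  assumes suff: "hamilton_degree_suffices k l m A d \<delta>" and k: "k = d + p" "p \<ge> 1" and ne: "edges A \<noteq> {}"
    and Ab: "prop_Ab k l m A d \<delta>" and Con: "prop_Con k l m A d \<delta>" and Fac: "prop_Fac k A d \<delta>"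
    and a: "a > 0" and \<delta>: "0 \<le> \<delta>" "\<delta> + 16 * a \<le> 1"
  shows "\<exists>n0. \<forall>(V :: nat set) M H. finite V \<and> n0 \<le> card V \<and> h dvd card V \<and> M * h = r * card V \<and>
     (\<forall>c<M. uniform_edges k V (H c) \<and> degree_into d p V (H c) V (\<delta> + 16 * a)) \<longrightarrow>
     (\<exists>C. hamilton_cycle_on l m A V C \<and> (\<exists>\<phi>. bij_betw \<phi> (edges C) {..<M} \<and> (\<forall>g\<in>edges C. g \<in> H (\<phi> g))))"
proof -
  have a16: "a \<le> 1 / 16" "a \<le> 1 / 2" using \<delta> by linarith+
  define \<xi> where "\<xi> = slack p a"
  have xi: "0 < \<xi>" "\<xi> \<le> 1 / 2" unfolding \<xi>_def by (rule slack[OF a])+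
  define \<rho> where "\<rho> = real r / real h"
  have r1: "r \<ge> 1" by (rule r_pos[OF ne])
  have rho: "\<rho> > 0" using r1 h_pos by (simp add: \<rho>_def)
  have rho_h: "\<rho> * real h = real r" using h_pos by (simp add: \<rho>_def)
  have da: "\<delta> + a \<le> 1" using \<delta>(2) a by linarith
  define eA where "eA = card (edges A)"
  have eA: "eA = es + r" "eA \<ge> 1" using card_edges_A r1 by (auto simp: eA_def)
  obtain nL where long: "\<forall>(V :: nat set) S E t. finite V \<and> S \<subseteq> V \<and> nL \<le> card S \<and> uniform_edges k V E \<and>
     degree_into d p V E S (\<delta> + 2 * a) \<and> h * t + l + m \<le> card S \<longrightarrow>
     (\<exists>f. chain_map t f \<and> span t f \<subseteq> S \<and> emb_edges t f \<subseteq> E)"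
    using exists_long_chain[OF suff k a \<delta>(1) da] by (elim exE) (rule that)
  obtain c nC where con: "\<forall>(V :: nat set) S E Z s e.
     finite V \<and> S \<subseteq> V \<and> nC \<le> card S \<and> uniform_edges k V E \<and> degree_into d p V E S (\<delta> + 2 * a) \<and>
     real (card (S \<inter> Z)) \<le> slack p a * real (card S) \<and> inj_on s {1..l} \<and> inj_on e {1..l} \<and>
     s ` {1..l} \<subseteq> V \<and> e ` {1..l} \<subseteq> V \<and> s ` {1..l} \<inter> e ` {1..l} = {} \<longrightarrow> connects S E c Z s e"
    using connecting_chains[OF Con k a \<delta>(1) da] by (elim exE conjE) (rule that)
  obtain \<beta>F nF where betaF: "0 < \<beta>F" and fac: "\<forall>(V :: nat set) S (R :: nat set) H.
     finite V \<and> S \<subseteq> V \<and> nF \<le> card S \<and> finite R \<and> real (card R) \<le> \<beta>F * real (card S) \<and> card (edges A) dvd card R \<and>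
     (\<forall>c\<in>R. uniform_edges k V (H c) \<and> degree_into d p V (H c) S (\<delta> + a)) \<longrightarrow>
     (\<exists>f \<phi>. (\<forall>j<card R div card (edges A). chain_map 1 (f j) \<and> span 1 (f j) \<subseteq> S) \<and>
        (\<forall>i<card R div card (edges A). \<forall>j<card R div card (edges A). i \<noteq> j \<longrightarrow> span 1 (f i) \<inter> span 1 (f j) = {}) \<and>
        bij_betw \<phi> (\<Union>j<card R div card (edges A). emb_edges 1 (f j)) R \<and>
        (\<forall>e\<in>(\<Union>j<card R div card (edges A). emb_edges 1 (f j)). e \<in> H (\<phi> e)))"
    using transversal_factor[OF Fac k(1) a] by (elim exE conjE) (rule that)
  have xi8: "\<xi> / 8 > 0" using xi by simp
  obtain \<omega> nA where om: "\<omega> > 0" and absorber: "\<forall>(V :: nat set) M H. finite V \<and> nA \<le> card V \<and> M * h = r * card V \<and>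
     (\<forall>c<M. uniform_edges k V (H c) \<and> degree_into d p V (H c) V (\<delta> + 2 * a + a)) \<longrightarrow>
     (\<exists>t f B C w. chain_map t f \<and> span t f \<subseteq> V \<and> real (card (span t f)) \<le> \<xi> / 8 * real (card V) \<and>
        B \<subseteq> {..<M} \<and> C \<subseteq> {..<M} \<and> B \<inter> C = {} \<and> card B + card C = card (emb_edges t f) + w \<and>
        3 * card (emb_edges t f) \<le> M \<and>
        \<omega> * real (card V) \<le> real w \<and> real w \<le> a / 2 * real (card C) \<and>
        (\<forall>U\<subseteq>C. card U + card B = card (emb_edges t f) \<longrightarrow> (\<exists>\<phi>. rainbow H (B \<union> U) (emb_edges t f) \<phi>)))"
    using exists_colour_absorber[OF suff k r1 a \<delta>(1) da a a16(2) xi8] by (elim exE conjE) (rule that)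
  \<comment> \<open>\<open>aA\<close> bounds both the degree slack and the sizes
    \<open>\<tau>\<close>, \<open>\<eta>\<close> in Ab. The bound by \<open>a\<close> fits the
    degree budget, \<open>\<xi> / 8\<close> keeps the absorber within the slack for removing
    vertices, and \<open>\<omega> / (4 * \<rho>)\<close> makes the absorber and the vertices it
    takes in so few that the flexible surplus provides colours for them.\<close>
  define aA where "aA = min (min a (\<xi> / 8)) (\<omega> / (4 * \<rho>))"
  have aA: "aA > 0" "aA \<le> a" "aA \<le> \<xi> / 8" "aA \<le> \<omega> / (4 * \<rho>)" using a xi om rho by (auto simp: aA_def)
  have rho_aA: "\<rho> * aA \<le> \<omega> / 4" using aA(4) rho by (simp add: field_simps)
  obtain \<tau> \<eta> nAb where te: "0 < \<tau>" "\<tau> \<le> aA" "0 < \<eta>" "\<eta> \<le> aA"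
    and absorb: "\<forall>(V :: nat set) S E. finite V \<and> S \<subseteq> V \<and> nAb \<le> card S \<and> uniform_edges k V E \<and>
       degree_into d p V E S (\<delta> + aA) \<longrightarrow>
       (\<exists>X s e. X \<subseteq> S \<and> real (card X) \<le> \<tau> * real (card S) \<and>
          (\<forall>L. L \<subseteq> S - X \<and> real (card L) \<le> \<eta> * real (card S) \<and> h dvd card L \<longrightarrow>
             (\<exists>t f. 1 \<le> t \<and> chain_map t f \<and> span t f = X \<union> L \<and> emb_edges t f \<subseteq> E \<and>
                (\<forall>i\<in>{1..l}. f i = s i \<and> f (h * t + i) = e i))))"
    using absorbing_set[OF Ab k(1) aA(1)] by (elim exE conjE) (rule that)
  have te16: "\<tau> \<le> \<xi> / 8" "\<eta> \<le> \<xi> / 8" "\<tau> \<le> 1 / 16" "\<eta> \<le> 1 / 16" using te aA xi by linarith+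
  \<comment> \<open>The reservoir will have between 2 and 6 times \<open>v * card S1\<close>
    vertices. The first bound makes this small compared with \<open>\<eta> * N\<close>, the second
    lets the rest of \<open>S1\<close> keep its degrees.\<close>
  obtain s1 :: nat where s1: "max (32 / \<eta>) (4 / \<xi>) \<le> real s1" using real_arch_simple by blast
  have "32 / \<eta> > 1" using te te16 by (simp add: field_simps)
  then have s1_1: "s1 \<ge> 1" using s1 by linarith
  have s1_eta: "32 \<le> \<eta> * real s1" and s1_xi: "4 \<le> \<xi> * real s1" using s1 te xi by (auto simp: field_simps)
  define v where "v = 1 / (4 * real s1)"
  have v: "v > 0" using s1_1 by (simp add: v_def)
  define K0 where "K0 = h * c + l"
  have mK: "real (m + K0) > 0" using l_less_m by simp
  \<comment> \<open>The four terms, in this order: the colours left for Fac stay below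
    \<open>\<beta>F * card V0\<close>; the reservoir has room for the copies from Fac and their
    links; the error in the number of uncovered vertices stays below the capacity of the absorber;
    \<open>R0\<close> contains at least \<open>Bn\<close> colours.\<close>
  define \<beta> where "\<beta> = min (min (\<beta>F * v / 4) (\<xi> * v / (16 * real (m + K0)))) (min (\<rho> * \<eta> / 64) (\<rho> / 8))"
  have beta: "\<beta> > 0" "\<beta> \<le> \<beta>F * v / 4" "\<beta> \<le> \<xi> * v / (16 * real (m + K0))" "\<beta> \<le> \<rho> * \<eta> / 64" "\<beta> \<le> \<rho> / 8"
  proof -
    show "\<beta> > 0" unfolding \<beta>_def using betaF v xi mK rho te by simp
  qed (unfold \<beta>_def, simp_all only: min_le_iff_disj order_refl simp_thms)
  have beta_mK: "16 * (\<beta> * real (m + K0)) \<le> \<xi> * v" using beta(3) mK by (simp add: field_simps)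
  have ab: "a * \<beta> > 0" using a beta by simp
  obtain s2' :: nat where s2': "2 * \<rho> / (a * \<beta>) \<le> real s2'" using real_arch_simple by blast
  define s2 where "s2 = s2' + 1"
  have s2: "s2 \<ge> 1" "2 * \<rho> \<le> a * \<beta> * real s2"
  proof -
    have "2 * \<rho> / (a * \<beta>) \<le> real s2" using s2' by (simp add: s2_def)
    then show "2 * \<rho> \<le> a * \<beta> * real s2" using ab by (simp add: field_simps)
  qed (simp add: s2_def)
  \<comment> \<open>Tolerances for the sizes of the parts: half of the average size for the
    reservoir, but the proportion \<open>\<eta> / 32\<close> for the bulk, whose uncovered vertices
    burden the absorber.\<close>
  have e1: "1 / (2 * real s1) > 0" using s1_1 by simp
  have e2: "\<eta> / (32 * real s2) > 0" using s2 te by simp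
  have x14: "0 \<le> \<delta> + 14 * a" "\<delta> + 14 * a \<le> 1" and x13: "0 \<le> \<delta> + 13 * a" "\<delta> + 13 * a \<le> 1"
    and x15: "0 \<le> \<delta> + 15 * a" "\<delta> + 15 * a \<le> 1" using \<delta> a by linarith+
  obtain nP1 where part1: "\<forall>(V :: nat set) S M H. finite V \<and> S \<subseteq> V \<and> nP1 \<le> card S \<and> card V \<le> 2 * card S \<and> M \<le> card S ^ 2 \<and>
     (\<forall>c<M. uniform_edges (d + p) V (H c) \<and> degree_into d p V (H c) S (\<delta> + 14 * a + a)) \<longrightarrow>
     (\<exists>W. (\<forall>j<s1. W j \<subseteq> S \<and> real (card S) / real s1 - 1 / (2 * real s1) * real (card S) \<le> real (card (W j)) \<and>
              real (card (W j)) \<le> real (card S) / real s1 + 1 / (2 * real s1) * real (card S)) \<and>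
          (\<forall>i<s1. \<forall>j<s1. i \<noteq> j \<longrightarrow> W i \<inter> W j = {}) \<and>
          (\<forall>j<s1. \<forall>c<M. degree_into d p V (H c) (W j) (\<delta> + 14 * a)))"
    using exists_degree_partition[OF k(2) s1_1 a e1 x14, where 'a = nat, of d] by (elim exE) (rule that)
  obtain nP2 where part2: "\<forall>(V :: nat set) S M H. finite V \<and> S \<subseteq> V \<and> nP2 \<le> card S \<and> card V \<le> 2 * card S \<and> M \<le> card S ^ 2 \<and>
     (\<forall>c<M. uniform_edges (d + p) V (H c) \<and> degree_into d p V (H c) S (\<delta> + 13 * a + a)) \<longrightarrow>
     (\<exists>W. (\<forall>j<s2. W j \<subseteq> S \<and> real (card S) / real s2 - \<eta> / (32 * real s2) * real (card S) \<le> real (card (W j)) \<and>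
              real (card (W j)) \<le> real (card S) / real s2 + \<eta> / (32 * real s2) * real (card S)) \<and>
          (\<forall>i<s2. \<forall>j<s2. i \<noteq> j \<longrightarrow> W i \<inter> W j = {}) \<and>
          (\<forall>j<s2. \<forall>c<M. degree_into d p V (H c) (W j) (\<delta> + 13 * a)))"
    using exists_degree_partition[OF k(2) s2(1) a e2 x13, where 'a = nat, of d] by (elim exE) (rule that)
  \<comment> \<open>A pair \<open>(K, \<kappa>)\<close> stands for
    \<open>K \<le> \<kappa> * N\<close>; the facts \<open>big\<close> list these conditions in the
    same order.\<close>
  define Ls where "Ls = [(real nA, 1), (real nAb, 1/2), (real nP1, 1/2), (real nP2, 1/2), (real nL, 1 / (4 * real s2)),
    (real nC, v), (real nF, v), (3 * real m, 1), (4 * real r, 1), (1 + real eA, \<beta>),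
    (2 * (3 + real s2) * real K0, \<xi> * v), (2 * real es, a * \<beta>), (4 * real m + 1, 1 / (8 * real s2)),
    (real es * (2 + real s2) + 2, \<rho> * \<eta> / 16), (4 * real m * real s2 + 4 * real m, \<eta> / 32), (real eA, \<omega>),
    (2, \<rho>), (4 * real m * real h, \<eta>)]"
  have "\<forall>(K, \<kappa>)\<in>set Ls. 0 < \<kappa>"
    unfolding Ls_def using v beta xi a s2 rho te om by simp
  from exists_common_threshold[OF this]
  obtain n0 where n0: "\<forall>n\<ge>n0. \<forall>(K, \<kappa>)\<in>set Ls. K \<le> \<kappa> * real n" by (elim exE) (rule that)
  show ?thesis
  proof (rule exI[of _ n0], intro allI impI, elim conjE)
    fix V :: "nat set" and M and H :: "nat \<Rightarrow> nat set set"
    assume V: "finite V" and nV: "n0 \<le> card V" and hV: "h dvd card V" and M: "M * h = r * card V"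
      and H: "\<forall>c<M. uniform_edges k V (H c) \<and> degree_into d p V (H c) V (\<delta> + 16 * a)"
    define N where "N = real (card V)"
    have "\<forall>(K, \<kappa>)\<in>set Ls. K \<le> \<kappa> * N" using n0 nV by (simp add: N_def)
    then have big: "real nA \<le> N" "real nAb \<le> 1/2 * N" "real nP1 \<le> 1/2 * N" "real nP2 \<le> 1/2 * N"
      "real nL \<le> 1 / (4 * real s2) * N" "real nC \<le> v * N" "real nF \<le> v * N" "3 * real m \<le> N" "4 * real r \<le> N"
      "1 + real eA \<le> \<beta> * N" "2 * (3 + real s2) * real K0 \<le> \<xi> * v * N" "2 * real es \<le> a * \<beta> * N"
      "4 * real m + 1 \<le> 1 / (8 * real s2) * N" "real es * (2 + real s2) + 2 \<le> \<rho> * \<eta> / 16 * N"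
      "4 * real m * real s2 + 4 * real m \<le> \<eta> / 32 * N" "real eA \<le> \<omega> * N" "2 \<le> \<rho> * N" "4 * real m * real h \<le> \<eta> * N"
      unfolding Ls_def by (simp_all only: list.set ball_simps case_prod_conv mult_1)
    have lm: "real l < real m" "real m \<ge> 1" using l_less_m by auto
    have N: "N > 0" using big(8) lm by linarith
    have M_real: "real M = \<rho> * N"
    proof -
      have "real M * real h = real r * N" using arg_cong[OF M, of real] by (simp add: N_def)
      then show ?thesis using h_pos by (simp add: \<rho>_def field_simps)
    qed
    have Hu: "uniform_edges k V (H c)" "uniform_edges (d + p) V (H c)" and Hd: "degree_into d p V (H c) V (\<delta> + 16 * a)"
      if "c < M" for c using H that k by auto
    have "\<exists>t f B C w. chain_map t f \<and> span t f \<subseteq> V \<and> real (card (span t f)) \<le> \<xi> / 8 * real (card V) \<and>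
        B \<subseteq> {..<M} \<and> C \<subseteq> {..<M} \<and> B \<inter> C = {} \<and> card B + card C = card (emb_edges t f) + w \<and>
        3 * card (emb_edges t f) \<le> M \<and>
        \<omega> * real (card V) \<le> real w \<and> real w \<le> a / 2 * real (card C) \<and>
        (\<forall>U\<subseteq>C. card U + card B = card (emb_edges t f) \<longrightarrow> (\<exists>\<phi>. rainbow H (B \<union> U) (emb_edges t f) \<phi>))"
    proof (rule absorber[rule_format], intro conjI allI impI)
      show "nA \<le> card V" using big(1) by (simp add: N_def)
      fix c assume c: "c < M"
      show "uniform_edges k V (H c)" by (rule Hu[OF c])
      show "degree_into d p V (H c) V (\<delta> + 2 * a + a)" by (rule degree_into_mono[OF Hd[OF c]]) (use a in linarith)
    qed (use V M in auto)
    then obtain tQ fQ B C w where Q: "chain_map tQ fQ" "span tQ fQ \<subseteq> V" "real (card (span tQ fQ)) \<le> \<xi> / 8 * real (card V)"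
      and BC: "B \<subseteq> {..<M}" "C \<subseteq> {..<M}" "B \<inter> C = {}" and cBC: "card B + card C = card (emb_edges tQ fQ) + w"
      and q3: "3 * card (emb_edges tQ fQ) \<le> M" and w: "\<omega> * real (card V) \<le> real w" "real w \<le> a / 2 * real (card C)"
      and absQ: "\<forall>U\<subseteq>C. card U + card B = card (emb_edges tQ fQ) \<longrightarrow> (\<exists>\<phi>. rainbow H (B \<union> U) (emb_edges tQ fQ) \<phi>)"
      by (elim exE conjE) (rule that)
    define q where "q = card (emb_edges tQ fQ)"
    have q_eq: "q = es + r * tQ" unfolding q_def by (rule card_emb_edges[OF Q(1)])
    have cQ: "card (span tQ fQ) = h * tQ + l" by (rule card_span[OF Q(1)])
    have fB: "finite B" and fC: "finite C" using finite_subset[OF BC(1)] finite_subset[OF BC(2)] by simp_all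
    have wN: "\<omega> * N \<le> real w" using w(1) by (simp add: N_def)
    have "\<omega> * N > 0" using om N by simp
    then have "real w > 0" using wN by linarith
    have aC: "a / 2 * real (card C) \<le> 1 / 32 * real (card C)" using a16 by (intro mult_right_mono) auto
    have wC: "real w \<le> 1 / 32 * real (card C)" using w(2) aC by linarith
    then have "card C > 0" using \<open>real w > 0\<close> by linarith
    then have Cne: "C \<noteq> {}" by auto
    have CM: "card C \<le> M" using card_mono[OF _ BC(2)] by simp
    define S0 where "S0 = V - span tQ fQ"
    have S0V: "S0 \<subseteq> V" by (auto simp: S0_def)
    have fQs: "finite (span tQ fQ)" by simp
    have cS0: "real (card S0) = N - real (card (span tQ fQ))"
      unfolding S0_def N_def using Q(2) V card_mono[OF V Q(2)] by (simp add: card_Diff_subset of_nat_diff)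
    have xiN: "\<xi> / 8 * N \<le> 1 / 16 * N" using xi N by (intro mult_right_mono) auto
    have QN: "real (card (span tQ fQ)) \<le> \<xi> / 8 * N" using Q(3) by (simp add: N_def)
    have S0N: "real (card S0) \<ge> 15 / 16 * N" "real (card S0) \<le> N" using cS0 QN xiN by linarith+
    have VS0: "V - S0 = span tQ fQ" using Q(2) by (auto simp: S0_def)
    define K where "K = popular_edges a k V H C"
    have Ku: "uniform_edges k V K" unfolding K_def by (rule uniform_popular_edges)
    have xi_N: "\<xi> / 8 * N + \<xi> / 8 * N \<le> \<xi> * N" using xi N by simp
    have KS: "degree_into d p V K S (x - a)" if "S \<subseteq> V" "\<And>c. c < M \<Longrightarrow> degree_into d p V (H c) S x" for S x
      unfolding K_def k(1) using that Hu(2) BC(2) a fC Cne by (intro degree_into_popular[OF V]) auto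
    have HS0: "degree_into d p V (H c) S0 (\<delta> + 15 * a)" if c: "c < M" for c
    proof (rule degree_into_subset[OF V order_refl S0V k(2) a x15 Hu(2)[OF c]])
      have "\<xi> / 8 * N \<le> \<xi> * N" using xi N by simp
      then show "real (card (V - S0)) \<le> slack p a * real (card V)"
        unfolding VS0 \<xi>_def[symmetric] N_def[symmetric] using QN by linarith
      have "\<delta> + 15 * a + a = \<delta> + 16 * a" by simp
      then show "degree_into d p V (H c) V (\<delta> + 15 * a + a)" using Hd[OF c] by (simp only:)
    qed
    have "degree_into d p V K S0 (\<delta> + 15 * a - a)" by (rule KS[OF S0V HS0])
    then have KS0: "degree_into d p V K S0 (\<delta> + aA)" by (rule degree_into_mono) (use aA a in linarith)
    have "nAb \<le> card S0" using big(2) S0N N by linarith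
    then have "\<exists>X s e. X \<subseteq> S0 \<and> real (card X) \<le> \<tau> * real (card S0) \<and>
          (\<forall>L. L \<subseteq> S0 - X \<and> real (card L) \<le> \<eta> * real (card S0) \<and> h dvd card L \<longrightarrow>
             (\<exists>t f. 1 \<le> t \<and> chain_map t f \<and> span t f = X \<union> L \<and> emb_edges t f \<subseteq> K \<and>
                (\<forall>i\<in>{1..l}. f i = s i \<and> f (h * t + i) = e i)))"
      using V S0V Ku KS0 by (intro absorb[rule_format, of V]) simp
    then obtain X s e where X: "X \<subseteq> S0" "real (card X) \<le> \<tau> * real (card S0)"
      and abX: "\<forall>L. L \<subseteq> S0 - X \<and> real (card L) \<le> \<eta> * real (card S0) \<and> h dvd card L \<longrightarrow>
             (\<exists>t f. 1 \<le> t \<and> chain_map t f \<and> span t f = X \<union> L \<and> emb_edges t f \<subseteq> K \<and>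
                (\<forall>i\<in>{1..l}. f i = s i \<and> f (h * t + i) = e i))"
      by (elim exE conjE) (rule that)
    have "\<tau> * real (card S0) \<le> \<tau> * N" using te S0N by (intro mult_left_mono) auto
    then have X\<tau>: "real (card X) \<le> \<tau> * N" using X(2) by linarith
    have "\<tau> * N \<le> \<xi> / 8 * N" using te16 N by (intro mult_right_mono) auto
    then have XN: "real (card X) \<le> \<xi> / 8 * N" using X\<tau> by linarith
    have etaN: "\<eta> * N > 0" "\<eta> * N \<le> 1 / 16 * N" using te te16 N by (auto intro!: mult_right_mono)
    have eta0: "0 \<le> \<eta> * real (card S0)" using te by simp
    have etaS0: "\<eta> * N / 2 \<le> \<eta> * real (card S0)"
    proof -
      have "\<eta> * (1 / 2 * N) \<le> \<eta> * real (card S0)" using te S0N N by (intro mult_left_mono) linarith+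
      then show ?thesis by simp
    qed
    have fX: "finite X" using X(1) S0V V finite_subset by (meson subset_trans)
    have ends: "inj_on s {1..l}" "s ` {1..l} \<subseteq> X" "inj_on e {1..l}" "e ` {1..l} \<subseteq> X"
    proof -
      obtain t f where f: "chain_map t f" "span t f = X" "\<forall>i\<in>{1..l}. f i = s i \<and> f (h * t + i) = e i"
        using abX[rule_format, of "{}"] eta0 by auto
      have inj: "inj_on f {1..h * t + l}" using f(1) by (simp add: chain_map_def)
      show "inj_on s {1..l}"
      proof (rule inj_onI)
        fix i i' assume i: "i \<in> {1..l}" "i' \<in> {1..l}" "s i = s i'"
        then have "f i = f i'" using f(3) by simp
        then show "i = i'" using inj_onD[OF inj, of i i'] i by auto
      qed
      show "inj_on e {1..l}"
      proof (rule inj_onI)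
        fix i i' assume i: "i \<in> {1..l}" "i' \<in> {1..l}" "e i = e i'"
        then have "f (h * t + i) = f (h * t + i')" using f(3) by simp
        then have "h * t + i = h * t + i'" using inj_onD[OF inj, of "h * t + i" "h * t + i'"] i by auto
        then show "i = i'" by simp
      qed
      have "s i \<in> X" "e i \<in> X" if i: "i \<in> {1..l}" for i
      proof -
        have "f i \<in> span t f" "f (h * t + i) \<in> span t f" using i unfolding span_def by auto
        then show "s i \<in> X" "e i \<in> X" using f(2,3) i by auto
      qed
      then show "s ` {1..l} \<subseteq> X" "e ` {1..l} \<subseteq> X" by blast+
    qed
    define S1 where "S1 = S0 - X"
    have S1V: "S1 \<subseteq> V" using S0V by (auto simp: S1_def)
    have fS1: "finite S1" using S1V V by (rule finite_subset)
    have fS0: "finite S0" using S0V V by (rule finite_subset)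
    have cS1: "real (card S1) = N - real (card (span tQ fQ)) - real (card X)"
      unfolding S1_def using X(1) fX card_mono[OF fS0 X(1)] cS0 by (simp add: card_Diff_subset of_nat_diff)
    have S1N: "real (card S1) \<ge> 14 / 16 * N" "real (card S1) \<le> N" using cS1 QN XN xiN by linarith+
    \<comment> \<open>Feeding the absorber a set \<open>L\<close> of \<open>2 * m * h\<close>
      vertices makes its chain so long that start and end occupy different positions. As
      \<open>s\<close> and \<open>e\<close> do not depend on \<open>L\<close>, they are disjoint
      once and for all.\<close>
    have se: "s ` {1..l} \<inter> e ` {1..l} = {}"
    proof -
      have "real (h * (2 * m)) \<le> \<eta> * N / 2" using big(18) by (simp add: mult_ac)
      then have hm: "real (h * (2 * m)) \<le> \<eta> * real (card S0)" "real (h * (2 * m)) \<le> real (card S1)"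
        using etaS0 etaN S1N N by linarith+
      then have "h * (2 * m) \<le> card S1" by (simp only: of_nat_le_iff)
      then obtain L where L: "L \<subseteq> S1" "card L = h * (2 * m)" "finite L" using obtain_subset_with_card_n by blast
      obtain t f where f: "chain_map t f" "span t f = X \<union> L" "\<forall>i\<in>{1..l}. f i = s i \<and> f (h * t + i) = e i"
        using abX[rule_format, of L] L hm(1) by (auto simp: S1_def)
      have inj: "inj_on f {1..h * t + l}" using f(1) by (simp add: chain_map_def)
      have "h * (2 * m) \<le> card (X \<union> L)" unfolding L(2)[symmetric] using fX L(3) by (intro card_mono) auto
      then have "h * (2 * m) \<le> h * t + l" using card_span[OF f(1)] f(2) by simp
      moreover have "1 * (2 * m) \<le> h * (2 * m)" using h_pos by (rule mult_right_mono) simp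
      ultimately have lt: "l \<le> h * t" using l_less_m by linarith
      have False if i: "i \<in> {1..l}" "i' \<in> {1..l}" "s i = e i'" for i i'
      proof -
        have "f i = f (h * t + i')" using f(3) i by simp
        then have "i = h * t + i'" using inj_onD[OF inj, of i "h * t + i'"] i by auto
        then show False using lt i by auto
      qed
      then show ?thesis by blast
    qed
    define y where "y = \<rho> * (real (card X) + \<eta> * N / 4)"
    have y0: "0 \<le> y" using rho etaN by (simp add: y_def)
    \<comment> \<open>\<open>w'\<close> is the number of colours of \<open>C'\<close> that are not used on the flexible chain. A chain on
      the absorber \<open>X\<close> and \<open>\<eta> N / 4\<close> further vertices has about \<open>y\<close> edges: this choice
      makes the number of uncovered vertices land in the range that the absorber can handle.\<close>
    define w' where "w' = nat \<lfloor>y\<rfloor>"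
    have w': "real w' \<le> y" "y < real w' + 1" unfolding w'_def using y0 by linarith+
    have y_om: "y \<le> \<omega> * N"
    proof -
      have "\<tau> * N \<le> aA * N" "\<eta> * N \<le> aA * N" using te N by (auto intro!: mult_right_mono)
      then have "real (card X) + \<eta> * N / 4 \<le> 2 * (aA * N)" using X\<tau> etaN by linarith
      then have "y \<le> \<rho> * (2 * (aA * N))" unfolding y_def using rho by (intro mult_left_mono) auto
      also have "\<dots> = 2 * ((\<rho> * aA) * N)" by simp
      also have "\<dots> \<le> 2 * (\<omega> / 4 * N)" using rho_aA N by (intro mult_left_mono mult_right_mono) auto
      finally show ?thesis using \<open>\<omega> * N > 0\<close> by linarith
    qed
    have ww: "w' \<le> w" using w'(1) y_om wN by linarith
    have wC': "w \<le> card C" using wC by linarith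
    \<comment> \<open>The \<open>w - w'\<close> colours taken out of \<open>C\<close> join
      \<open>R0\<close> and will be used up by the bulk and by Fac. Then \<open>M\<close> exceeds
      \<open>card R0\<close> by exactly \<open>q + w'\<close>.\<close>
    obtain C' where C': "C' \<subseteq> C" "card C' = card C - (w - w')" "finite C'"
      using obtain_subset_with_card_n[of "card C - (w - w')" C] by auto
    have C'M: "C' \<subseteq> {..<M}" using C'(1) BC(2) by blast
    have BC': "B \<inter> C' = {}" using C'(1) BC(3) by blast
    define R0 where "R0 = {..<M} - B - C'"
    have cR0: "card R0 + q + w' = M"
    proof -
      have "card (B \<union> C') = card B + card C'" by (rule card_Un_disjoint[OF fB C'(3) BC'])
      moreover have "card ({..<M} - (B \<union> C')) = M - card (B \<union> C')"
        using fB C'(3) BC(1) C'M by (subst card_Diff_subset) auto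
      moreover have "card (B \<union> C') \<le> M" using card_mono[of "{..<M}" "B \<union> C'"] BC(1) C'M by simp
      moreover have "R0 = {..<M} - (B \<union> C')" by (auto simp: R0_def)
      ultimately show ?thesis using cBC C'(2) ww wC' by (simp add: q_def)
    qed
    have fR0: "finite R0" by (simp add: R0_def)
    \<comment> \<open>The bulk always leaves at least this many colours: the greedy colouring of
      each bulk chain relies on them, and they are about what Fac has to exhaust.\<close>
    define Bn where "Bn = nat \<lceil>\<beta> * N\<rceil>"
    have bN: "\<beta> * N > 0" using beta N by simp
    have Bn: "\<beta> * N \<le> real Bn" "real Bn < \<beta> * N + 1" unfolding Bn_def using bN by linarith+
    have Bn1: "1 \<le> Bn" using Bn(1) bN by linarith
    have VS1: "real (card (V - S1)) \<le> \<xi> * N"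
    proof -
      have "real (card (V - S1)) = N - real (card S1)"
        unfolding N_def using S1V fS1 card_mono[OF V S1V] by (simp add: card_Diff_subset of_nat_diff)
      then show ?thesis using cS1 QN XN xi_N by linarith
    qed
    have HS1: "degree_into d p V (H c) S1 (\<delta> + 15 * a)" if c: "c < M" for c
    proof (rule degree_into_subset[OF V order_refl S1V k(2) a x15 Hu(2)[OF c]])
      show "real (card (V - S1)) \<le> slack p a * real (card V)"
        unfolding \<xi>_def[symmetric] N_def[symmetric] by (rule VS1)
      have "\<delta> + 15 * a + a = \<delta> + 16 * a" by simp
      then show "degree_into d p V (H c) V (\<delta> + 15 * a + a)" using Hd[OF c] by (simp only:)
    qed
    have M_le: "M \<le> card S ^ 2" if S: "card V \<le> 2 * card S" for S :: "nat set"
    proof -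
      have "4 * r \<le> card V" using big(9) unfolding N_def by linarith
      then have "2 * r \<le> card S" using S by linarith
      have "M * 1 \<le> M * h" using h_pos by (rule mult_left_mono) simp
      then have "M \<le> r * card V" using M by simp
      also have "\<dots> \<le> r * (2 * card S)" using S by (rule mult_left_mono) simp
      also have "\<dots> = (2 * r) * card S" by simp
      also have "\<dots> \<le> card S * card S" using \<open>2 * r \<le> card S\<close> by (rule mult_right_mono) simp
      finally show ?thesis by (simp add: power2_eq_square)
    qed
    have VS1': "card V \<le> 2 * card S1" using S1N N unfolding N_def by linarith
    have "\<exists>W. (\<forall>j<s1. W j \<subseteq> S1 \<and> real (card S1) / real s1 - 1 / (2 * real s1) * real (card S1) \<le> real (card (W j)) \<and>
              real (card (W j)) \<le> real (card S1) / real s1 + 1 / (2 * real s1) * real (card S1)) \<and>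
          (\<forall>i<s1. \<forall>j<s1. i \<noteq> j \<longrightarrow> W i \<inter> W j = {}) \<and>
          (\<forall>j<s1. \<forall>c<M. degree_into d p V (H c) (W j) (\<delta> + 14 * a))"
    proof (rule part1[rule_format], intro conjI allI impI)
      show "nP1 \<le> card S1" using big(3) S1N N by linarith
      show "M \<le> card S1 ^ 2" by (rule M_le[OF VS1'])
      fix c assume c: "c < M"
      show "uniform_edges (d + p) V (H c)" by (rule Hu(2)[OF c])
      have "\<delta> + 14 * a + a = \<delta> + 15 * a" by simp
      then show "degree_into d p V (H c) S1 (\<delta> + 14 * a + a)" using HS1[OF c] by (simp only:)
    qed (fact V | fact S1V | fact VS1')+
    then obtain W1 where W1: "\<forall>j<s1. W1 j \<subseteq> S1 \<and> real (card S1) / real s1 - 1 / (2 * real s1) * real (card S1) \<le> real (card (W1 j)) \<and>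
              real (card (W1 j)) \<le> real (card S1) / real s1 + 1 / (2 * real s1) * real (card S1)"
      and W1d: "\<forall>j<s1. \<forall>c<M. degree_into d p V (H c) (W1 j) (\<delta> + 14 * a)" by (elim exE conjE) (rule that)
    \<comment> \<open>The partition serves to sample a random reservoir: \<open>V0\<close> is one of
      its parts, and \<open>V3\<close> will be the rest of \<open>S1\<close>.\<close>
    define V0 where "V0 = W1 0"
    have V0S: "V0 \<subseteq> S1" and V0c: "real (card S1) / real s1 - 1 / (2 * real s1) * real (card S1) \<le> real (card V0)"
        "real (card V0) \<le> real (card S1) / real s1 + 1 / (2 * real s1) * real (card S1)"
      and HV0: "\<And>c. c < M \<Longrightarrow> degree_into d p V (H c) V0 (\<delta> + 14 * a)"
      using W1 W1d s1_1 by (auto simp: V0_def)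
    have vz: "real (card S1) / real s1 = 4 * (v * real (card S1))" "1 / (2 * real s1) * real (card S1) = 2 * (v * real (card S1))"
      using s1_1 by (auto simp: v_def field_simps)
    have V0v: "2 * (v * real (card S1)) \<le> real (card V0)" "real (card V0) \<le> 6 * (v * real (card S1))"
      using V0c unfolding vz by linarith+
    have "v * (1 / 2 * N) \<le> v * real (card S1)" using v S1N N by (intro mult_left_mono) linarith+
    then have V0N: "v * N \<le> real (card V0)" using V0v by simp
    have v_eta: "v \<le> \<eta> / 128" and v_xi: "v \<le> \<xi> / 16" using s1_eta s1_xi s1_1 by (auto simp: v_def field_simps)
    have V0eta: "real (card V0) \<le> \<eta> * N / 16"
    proof -
      have "v * real (card S1) \<le> \<eta> / 128 * N" using v_eta S1N v by (intro mult_mono) auto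
      then show ?thesis using V0v etaN by linarith
    qed
    have V0xi: "real (card V0) \<le> \<xi> * real (card S1)"
    proof -
      have "v * real (card S1) \<le> \<xi> / 16 * real (card S1)" using v_xi by (intro mult_right_mono) auto
      moreover have "0 \<le> \<xi> * real (card S1)" using xi by simp
      ultimately show ?thesis using V0v by linarith
    qed
    have V0V: "V0 \<subseteq> V" using V0S S1V by (rule subset_trans)
    have fV0: "finite V0" using V0V V by (rule finite_subset)
    define V3 where "V3 = S1 - V0"
    have V3S: "V3 \<subseteq> S1" by (auto simp: V3_def)
    have V3V: "V3 \<subseteq> V" using V3S S1V by (rule subset_trans)
    have cV3: "real (card V3) = real (card S1) - real (card V0)"
      unfolding V3_def using V0S fV0 card_mono[OF fS1 V0S] by (simp add: card_Diff_subset of_nat_diff)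
    have V3N: "real (card V3) \<ge> 13 / 16 * N" "real (card V3) \<le> N" using cV3 V0eta etaN S1N N by linarith+
    have HV3: "degree_into d p V (H c) V3 (\<delta> + 13 * a + a)" if c: "c < M" for c
    proof -
      have "degree_into d p V (H c) V3 (\<delta> + 14 * a)"
      proof (rule degree_into_subset[OF V S1V V3S k(2) a x14 Hu(2)[OF c]])
        have "S1 - V3 = V0" using V0S by (auto simp: V3_def)
        then show "real (card (S1 - V3)) \<le> slack p a * real (card S1)"
          using V0xi unfolding \<xi>_def[symmetric] by simp
        have "\<delta> + 14 * a + a = \<delta> + 15 * a" by simp
        then show "degree_into d p V (H c) S1 (\<delta> + 14 * a + a)" using HS1[OF c] by (simp only:)
      qed
      moreover have "\<delta> + 13 * a + a = \<delta> + 14 * a" by simp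
      ultimately show ?thesis by (simp only:)
    qed
    have VV3: "card V \<le> 2 * card V3" using V3N N unfolding N_def by linarith
    have "\<exists>W. (\<forall>j<s2. W j \<subseteq> V3 \<and> real (card V3) / real s2 - \<eta> / (32 * real s2) * real (card V3) \<le> real (card (W j)) \<and>
              real (card (W j)) \<le> real (card V3) / real s2 + \<eta> / (32 * real s2) * real (card V3)) \<and>
          (\<forall>i<s2. \<forall>j<s2. i \<noteq> j \<longrightarrow> W i \<inter> W j = {}) \<and>
          (\<forall>j<s2. \<forall>c<M. degree_into d p V (H c) (W j) (\<delta> + 13 * a))"
    proof (rule part2[rule_format], intro conjI allI impI)
      show "nP2 \<le> card V3" using big(4) V3N N by linarith
      show "M \<le> card V3 ^ 2" by (rule M_le[OF VV3])
      fix c assume c: "c < M"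
      show "uniform_edges (d + p) V (H c)" by (rule Hu(2)[OF c])
      show "degree_into d p V (H c) V3 (\<delta> + 13 * a + a)" by (rule HV3[OF c])
    qed (fact V | fact V3V | fact VV3)+
    then obtain W where Ws: "\<forall>j<s2. W j \<subseteq> V3 \<and> real (card V3) / real s2 - \<eta> / (32 * real s2) * real (card V3) \<le> real (card (W j)) \<and>
              real (card (W j)) \<le> real (card V3) / real s2 + \<eta> / (32 * real s2) * real (card V3)"
      and Wdisj: "\<forall>i<s2. \<forall>j<s2. i \<noteq> j \<longrightarrow> W i \<inter> W j = {}"
      and Wdeg: "\<forall>j<s2. \<forall>c<M. degree_into d p V (H c) (W j) (\<delta> + 13 * a)" by (elim exE conjE) (rule that)
    define z where "z = real (card V3) / real s2"
    define u where "u = 1 / (8 * real s2) * N"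
    define y2 where "y2 = z - \<eta> / 32 * z"
    have sz: "real s2 * z = real (card V3)" using s2 by (simp add: z_def)
    have su: "real s2 * u = N / 8" using s2 by (simp add: u_def)
    have z_u: "6 * u \<le> z" "z \<le> 8 * u" "0 < u"
    proof -
      have "real s2 * (6 * u) \<le> real s2 * z" "real s2 * z \<le> real s2 * (8 * u)" using su sz V3N by linarith+
      then show "6 * u \<le> z" "z \<le> 8 * u" using s2 by auto
      show "0 < u" using s2 N by (simp add: u_def)
    qed
    have eta_z: "\<eta> / 32 * z \<le> 1 / 2 * z" "0 \<le> \<eta> / 32 * z" using te te16 z_u by (auto intro!: mult_right_mono)
    have y2: "3 * u \<le> y2" "y2 \<le> z" using eta_z z_u unfolding y2_def by linarith+
    have Wc: "y2 \<le> real (card (W j))" if "j < s2" for j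
    proof -
      have "\<eta> / (32 * real s2) * real (card V3) = \<eta> / 32 * z" by (simp add: z_def)
      then show ?thesis using Ws that unfolding y2_def z_def[symmetric] by auto
    qed
    have um: "4 * real m + 1 \<le> u" using big(13) by (simp only: u_def)
    have uL: "real nL \<le> 2 * u" using big(5) by (simp add: u_def)
    \<comment> \<open>\<open>t0\<close> is chosen as large as possible such that a chain of length
      \<open>t0\<close>, with \<open>m\<close> spare vertices, fits into \<open>y2\<close> vertices,
      the lower bound for the size of every \<open>W j\<close>.\<close>
    define x0 where "x0 = (y2 - (real l + real m)) / real h"
    have "real h > 0" using h_pos by simp
    then have x0h: "real h * x0 = y2 - (real l + real m)" by (simp add: x0_def)
    have x0: "0 \<le> x0" unfolding x0_def using y2 um lm z_u by (intro divide_nonneg_nonneg) linarith+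
    define t0 where "t0 = nat \<lfloor>x0\<rfloor>"
    have "real t0 \<le> x0" "x0 < real t0 + 1" unfolding t0_def using x0 by linarith+
    then have "real h * real t0 \<le> real h * x0" "real h * x0 \<le> real h * (real t0 + 1)"
      by (auto intro!: mult_left_mono)
    moreover have "real h * (real t0 + 1) = real h * real t0 + real h" by (simp add: distrib_left)
    moreover have hm: "real h \<le> real m" by (simp add: h_def)
    ultimately have t0: "real h * real t0 \<le> y2 - (real l + real m)" "y2 - 3 * real m \<le> real h * real t0"
      unfolding x0h using lm by linarith+
    have t0pos: "t0 \<ge> 1"
    proof (rule ccontr)
      assume "\<not> t0 \<ge> 1"
      then have "t0 = 0" by simp
      then show False using t0(2) y2 um z_u lm by simp
    qed
    have Wfit: "W i \<subseteq> V \<and> nL \<le> card (W i) \<and> h * t0 + l + m \<le> card (W i)" if i: "i < s2" for i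
    proof (intro conjI)
      show "W i \<subseteq> V" using Ws i V3V by blast
      show "nL \<le> card (W i)" using Wc[OF i] uL y2 z_u by linarith
      have "real (h * t0 + l + m) = real h * real t0 + real l + real m" by simp
      then have "real (h * t0 + l + m) \<le> real (card (W i))" using Wc[OF i] t0(1) by linarith
      then show "h * t0 + l + m \<le> card (W i)" by (simp only: of_nat_le_iff)
    qed
    define e0 where "e0 = es + r * t0"
    have rt0: "real (r * t0) = \<rho> * (real h * real t0)" using rho_h by (simp add: mult.assoc[symmetric])
    have e0a: "real e0 \<le> a * (\<beta> * N)"
    proof -
      have "real h * real t0 \<le> 8 * u" using t0(1) y2 z_u lm by linarith
      then have "\<rho> * (real h * real t0) \<le> \<rho> * (8 * u)" using rho by (intro mult_left_mono) auto
      also have "\<dots> \<le> (a * \<beta> * real s2 / 2) * (8 * u)" using s2(2) z_u by (intro mult_right_mono) auto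
      also have "\<dots> = a * \<beta> * (4 * (real s2 * u))" by simp
      also have "\<dots> = a * \<beta> * N / 2" unfolding su by simp
      finally have "real (r * t0) \<le> a * \<beta> * N / 2" unfolding rt0 .
      then show ?thesis using big(12) by (simp add: e0_def mult.assoc)
    qed
    have "a * (\<beta> * N) \<le> 1 * (\<beta> * N)" using a16 bN by (intro mult_right_mono) auto
    then have e0b: "real e0 \<le> \<beta> * N" using e0a by linarith
    have "a * (\<beta> * N) \<le> a * real Bn" using Bn(1) a by (intro mult_left_mono) auto
    then have e0Bn: "real e0 \<le> a * real Bn" using e0a by linarith
    have "1 * 1 \<le> r * t0" using r1 t0pos by (rule mult_le_mono)
    then have e0pos: "e0 \<ge> 1" unfolding e0_def by linarith
    have R0Bn: "Bn \<le> card R0"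
    proof -
      have "\<beta> * N \<le> \<rho> / 8 * N" using beta(5) N by (intro mult_right_mono) auto
      then have "real Bn < real M / 8 + 1" using Bn(2) M_real by linarith
      moreover have "real w' \<le> real M / 32" using ww wC CM by linarith
      moreover have "3 * real q \<le> real M" using q3 by (simp add: q_def)
      moreover have "2 \<le> real M" using big(17) M_real by simp
      moreover have "real (card R0) + real q + real w' = real M" using cR0 by (simp flip: of_nat_add)
      ultimately show ?thesis by linarith
    qed
    define j where "j = (card R0 - Bn) div e0"
    have j: "j * e0 + Bn \<le> card R0" "card R0 < j * e0 + Bn + e0"
    proof -
      have "j * e0 \<le> card R0 - Bn" unfolding j_def by (rule div_times_less_eq_dividend)
      then show "j * e0 + Bn \<le> card R0" using R0Bn by linarith
      have "card R0 - Bn < e0 + j * e0" unfolding j_def using e0pos by (intro dividend_less_div_times) simp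
      then show "card R0 < j * e0 + Bn + e0" by linarith
    qed
    define J where "J = real j * (real h * real t0)"
    define T where "T = real h * real tQ"
    have je0: "real (j * e0) = real j * real es + \<rho> * J"
    proof -
      have "real (j * e0) = real j * real es + real j * real (r * t0)" by (simp add: e0_def distrib_left)
      then show ?thesis unfolding rt0 J_def by simp
    qed
    have qT: "real q = real es + \<rho> * T"
      unfolding q_eq T_def using rho_h by (simp add: mult.assoc[symmetric])
    have cR0r: "real (card R0) = \<rho> * N - real q - real w'"
      using arg_cong[OF cR0, of real] M_real by simp
    have yexp: "y = \<rho> * real (card X) + \<rho> * (\<eta> * N / 4)" by (simp add: y_def distrib_left)
    \<comment> \<open>The colour count turned into vertices, at \<open>\<rho>\<close> colours per
      vertex: up to lower order, the bulk, the flexible chain and the absorber leave at least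
      \<open>\<eta> * N / 4\<close> vertices uncovered.\<close>
    have JT: "J + T + real (card X) + \<eta> * N / 4 \<le> N"
    proof -
      have "real (j * e0) + real Bn \<le> real (card R0)" using j(1) by (simp only: of_nat_add[symmetric] of_nat_le_iff)
      moreover have "0 \<le> real j * real es" by simp
      ultimately have "\<rho> * J + \<rho> * T + \<rho> * real (card X) + \<rho> * (\<eta> * N / 4) \<le> \<rho> * N"
        using cR0r je0 qT w'(2) yexp Bn1 by linarith
      then have "\<rho> * (J + T + real (card X) + \<eta> * N / 4) \<le> \<rho> * N" by (simp only: distrib_left)
      then show ?thesis using rho by (simp only: mult_le_cancel_left_pos)
    qed
    have cQr: "real (card (span tQ fQ)) = T + real l" unfolding cQ T_def by simp
    \<comment> \<open>There are enough parts for the bulk: with more than \<open>s2\<close> chains,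
      fewer than \<open>\<eta> * N / 4\<close> vertices would stay uncovered even if the reservoir
      is counted among them, against \<open>JT\<close>. So the colours run out before the parts
      do.\<close>
    have js2: "j \<le> s2"
    proof (rule ccontr)
      assume "\<not> j \<le> s2"
      then have "real s2 * (real h * real t0) \<le> J" unfolding J_def by (intro mult_right_mono) auto
      moreover have "real s2 * (y2 - 3 * real m) \<le> real s2 * (real h * real t0)"
        using t0(2) by (rule mult_left_mono) simp
      moreover have "real s2 * (y2 - 3 * real m) = real (card V3) - \<eta> / 32 * real (card V3) - 3 * (real m * real s2)"
        unfolding y2_def sz[symmetric] by (simp add: algebra_simps)
      moreover have "\<eta> / 32 * real (card V3) \<le> \<eta> / 32 * N" using V3N te by (intro mult_left_mono) auto
      moreover have "0 \<le> real m * real s2" by simp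
      ultimately show False using JT cV3 cS1 cQr V0eta big(15) lm etaN by linarith
    qed
    have "\<exists>f \<phi>. (\<forall>i<j. chain_map t0 (f i) \<and> span t0 (f i) \<subseteq> W i) \<and> rainbow H R0 (\<Union>i<j. emb_edges t0 (f i)) \<phi> \<and>
        card (\<Union>i<j. emb_edges t0 (f i)) = j * (es + r * t0)"
    proof (rule exists_rainbow_chains[OF long k(1) V fR0])
      show "0 \<le> a" using a by simp
      show "W i \<subseteq> V \<and> nL \<le> card (W i) \<and> h * t0 + l + m \<le> card (W i)" if "i < j" for i
        using Wfit[of i] that js2 by simp
      show "W i \<inter> W i' = {}" if "i < j" "i' < j" "i \<noteq> i'" for i i' using Wdisj that js2 by simp
      show "uniform_edges k V (H c)" if "c \<in> R0" for c using Hu(1)[of c] that by (simp add: R0_def)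
      show "degree_into d p V (H c) (W i) (\<delta> + 2 * a + a)" if "c \<in> R0" "i < j" for c i
      proof (rule degree_into_mono)
        show "degree_into d p V (H c) (W i) (\<delta> + 13 * a)" using Wdeg that js2 by (simp add: R0_def)
      qed (use a in linarith)
      show "real (es + r * t0) \<le> a * real Bn" using e0Bn by (simp only: e0_def)
      show "1 \<le> Bn" by (rule Bn1)
      show "j * (es + r * t0) + Bn \<le> card R0" using j(1) by (simp only: e0_def)
    qed
    then obtain fb \<phi>b where fb: "\<forall>i<j. chain_map t0 (fb i) \<and> span t0 (fb i) \<subseteq> W i"
      and \<phi>b: "rainbow H R0 (\<Union>i<j. emb_edges t0 (fb i)) \<phi>b"
      and cEb': "card (\<Union>i<j. emb_edges t0 (fb i)) = j * (es + r * t0)" by (elim exE conjE) (rule that)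
    define Eb where "Eb = (\<Union>i<j. emb_edges t0 (fb i))"
    define Rb where "Rb = \<phi>b ` Eb"
    have cEb: "card Eb = j * e0" using cEb' by (simp only: Eb_def e0_def)
    have RbR: "Rb \<subseteq> R0" and inb: "inj_on \<phi>b Eb" using \<phi>b unfolding rainbow_def Eb_def Rb_def by auto
    have cRb: "card Rb = card Eb" unfolding Rb_def by (rule card_image[OF inb])
    have rb: "rainbow H Rb Eb \<phi>b" using \<phi>b unfolding rainbow_def Eb_def Rb_def by blast
    have fRb: "finite Rb" using RbR fR0 by (rule finite_subset)
    define R where "R = R0 - Rb"
    have cRR: "card R + j * e0 = card R0"
      unfolding R_def using RbR fRb card_mono[OF fR0 RbR] cRb cEb by (simp add: card_Diff_subset)
    \<comment> \<open>This many colours of \<open>C'\<close> fill \<open>card R\<close> up to a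
      multiple of \<open>eA\<close>. The value lies between 1 and \<open>eA\<close>: it is
      \<open>eA\<close>, not 0, if \<open>card R\<close> is a multiple already.\<close>
    define uu where "uu = eA - card R mod eA"
    have "card R mod eA < eA" using eA(2) by (intro mod_less_divisor) linarith
    then have uu: "uu \<le> eA" "card R + uu = eA * (card R div eA) + eA"
      unfolding uu_def using mult_div_mod_eq[of eA "card R"] by linarith+
    have "eA \<le> card C'"
    proof -
      have "real eA \<le> real w" using big(16) wN by linarith
      then show ?thesis using C'(2) wC by linarith
    qed
    then obtain C'' where C'': "C'' \<subseteq> C'" "card C'' = uu" "finite C''"
      using obtain_subset_with_card_n[of uu C'] uu(1) by auto
    define RF where "RF = R \<union> C''"
    have RC: "R0 \<inter> C' = {}" by (auto simp: R0_def)
    have fR: "finite R" using fR0 by (simp add: R_def)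
    have cRF: "card RF = card R + uu"
      unfolding RF_def C''(2)[symmetric] using fR C''(1,3) RC by (intro card_Un_disjoint) (auto simp: R_def)
    have RFN: "real (card RF) \<le> 3 * (\<beta> * N)"
    proof -
      have "card RF < Bn + e0 + eA + 1" using cRF cRR j(2) uu(1) by linarith
      then have "real (card RF) \<le> real Bn + real e0 + real eA"
        by (simp only: of_nat_add[symmetric] of_nat_le_iff)
      then show ?thesis using Bn(2) e0b big(10) by linarith
    qed
    have RFM: "RF \<subseteq> {..<M}" unfolding RF_def R_def R0_def using C''(1) C'M by blast
    define NF where "NF = card RF div card (edges A)"
    have "\<exists>f \<phi>. (\<forall>j<card RF div card (edges A). chain_map 1 (f j) \<and> span 1 (f j) \<subseteq> V0) \<and>
        (\<forall>i<card RF div card (edges A). \<forall>j<card RF div card (edges A). i \<noteq> j \<longrightarrow> span 1 (f i) \<inter> span 1 (f j) = {}) \<and>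
        bij_betw \<phi> (\<Union>j<card RF div card (edges A). emb_edges 1 (f j)) RF \<and>
        (\<forall>e\<in>(\<Union>j<card RF div card (edges A). emb_edges 1 (f j)). e \<in> H (\<phi> e))"
    proof (rule fac[rule_format, of V V0 RF H], intro conjI ballI)
      show "nF \<le> card V0" using big(7) V0N by linarith
      show "finite RF" using RFM by (rule finite_subset) simp
      have "4 * \<beta> \<le> \<beta>F * v" using beta(2) by simp
      then have "4 * \<beta> * N \<le> \<beta>F * v * N" using N by (intro mult_right_mono) auto
      moreover have "\<beta>F * (v * N) \<le> \<beta>F * real (card V0)" using V0N betaF by (intro mult_left_mono) auto
      ultimately show "real (card RF) \<le> \<beta>F * real (card V0)" using RFN bN by (simp only: mult.assoc)
      show "card (edges A) dvd card RF" unfolding cRF uu(2) eA_def by simp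
      fix c assume "c \<in> RF"
      then have c: "c < M" using RFM by auto
      show "uniform_edges k V (H c)" by (rule Hu(1)[OF c])
      show "degree_into d p V (H c) V0 (\<delta> + a)" by (rule degree_into_mono[OF HV0[OF c]]) (use a in linarith)
    qed (fact V | fact V0V)+
    then obtain fF \<phi>F where fF: "\<forall>j<NF. chain_map 1 (fF j) \<and> span 1 (fF j) \<subseteq> V0"
        "\<forall>i<NF. \<forall>j<NF. i \<noteq> j \<longrightarrow> span 1 (fF i) \<inter> span 1 (fF j) = {}"
      and \<phi>F: "bij_betw \<phi>F (\<Union>j<NF. emb_edges 1 (fF j)) RF" "\<forall>e\<in>(\<Union>j<NF. emb_edges 1 (fF j)). e \<in> H (\<phi>F e)"
      unfolding NF_def[symmetric] by (elim exE conjE) (rule that)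
    define EF where "EF = (\<Union>j<NF. emb_edges 1 (fF j))"
    have rF: "rainbow H RF EF \<phi>F" using \<phi>F unfolding rainbow_def EF_def bij_betw_def by simp
    have cEF: "card RF = card EF" using bij_betw_same_card[OF \<phi>F(1)] by (simp only: EF_def)
    have NF: "real NF \<le> 3 * (\<beta> * N)"
    proof -
      have "NF \<le> card RF" unfolding NF_def by (rule div_le_dividend)
      then have "real NF \<le> real (card RF)" by (simp only: of_nat_le_iff)
      then show ?thesis using RFN by linarith
    qed
    define Cn where "Cn = C' - C''"
    have KV0: "degree_into d p V K V0 (\<delta> + 2 * a)"
      by (rule degree_into_mono[OF KS[OF V0V HV0]]) (use a in simp_all)
    have room: "real (NF * m) + real ((3 + j + NF) * (h * c + l)) \<le> \<xi> * real (card V0)"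
    proof -
      have "real NF * real (m + K0) \<le> 3 * (\<beta> * N) * real (m + K0)" using NF by (rule mult_right_mono) simp
      moreover have "3 * (\<beta> * N) * real (m + K0) = 3 * (\<beta> * real (m + K0)) * N" by simp
      moreover have "3 * (\<beta> * real (m + K0)) * N \<le> (\<xi> * v / 4) * N"
      proof (rule mult_right_mono)
        have "0 \<le> \<beta> * real (m + K0)" using beta(1) mK by simp
        then show "3 * (\<beta> * real (m + K0)) \<le> \<xi> * v / 4" using beta_mK by linarith
      qed (use N in simp)
      moreover have "(3 + real j) * real K0 \<le> (3 + real s2) * real K0" using js2 by (intro mult_right_mono) auto
      moreover have "real (NF * m) + real ((3 + j + NF) * (h * c + l)) = real NF * real (m + K0) + (3 + real j) * real K0"
        unfolding K0_def[symmetric] by (simp add: algebra_simps)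
      moreover have "\<xi> * (v * N) \<le> \<xi> * real (card V0)" using V0N xi by (intro mult_left_mono) auto
      moreover have "\<xi> * (v * N) = \<xi> * v * N" "(\<xi> * v / 4) * N = \<xi> * v * N / 4" by simp_all
      moreover have "0 \<le> \<xi> * v * N" using xi v N by simp
      ultimately show ?thesis using big(11) by linarith
    qed
    \<comment> \<open>The counterpart of \<open>JT\<close>: fewer than \<open>Bn + e0\<close>
      colours of \<open>R0\<close> are left by the bulk, so beyond the \<open>\<eta> * N / 4\<close>
      vertices built into \<open>y\<close> only a smaller error arises, and the absorber can take in
      the total.\<close>
    have small: "real (card V) - real (card X) - real (h * tQ) - real (j * (h * t0)) \<le> \<eta> * real (card S0)"
    proof -
      have "real (card R0) < real (j * e0) + real Bn + real e0" using j(2) by (simp only: of_nat_add[symmetric] of_nat_less_iff)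
      then have "\<rho> * N - \<rho> * T - \<rho> * J - \<rho> * real (card X) - \<rho> * (\<eta> * N / 4)
          < real es + real j * real es + real Bn + real e0"
        using cR0r je0 qT w'(1) yexp by linarith
      moreover have "real j * real es \<le> real s2 * real es" using js2 by (intro mult_right_mono) auto
      moreover have "real es * (2 + real s2) = 2 * real es + real s2 * real es" by (simp add: algebra_simps)
      moreover have "\<beta> * N \<le> \<rho> * \<eta> / 64 * N" using beta(4) N by (intro mult_right_mono) auto
      moreover have "\<rho> * \<eta> / 16 * N = \<rho> * (\<eta> * N / 4) / 4" "\<rho> * \<eta> / 64 * N = \<rho> * (\<eta> * N / 4) / 16" by simp_all
      moreover have "0 \<le> \<rho> * (\<eta> * N / 4)" "0 \<le> real es" using rho etaN by simp_all
      ultimately have "\<rho> * N - \<rho> * T - \<rho> * J - \<rho> * real (card X) \<le> \<rho> * (\<eta> * N / 4) + \<rho> * (\<eta> * N / 4)"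
        using Bn(2) e0b big(14) by linarith
      then have "\<rho> * (N - T - J - real (card X)) \<le> \<rho> * (\<eta> * N / 2)" by (simp add: algebra_simps)
      then have "N - T - J - real (card X) \<le> \<eta> * N / 2" using rho by (simp only: mult_le_cancel_left_pos)
      moreover have "real (h * tQ) = T" "real (j * (h * t0)) = J" by (simp_all add: T_def J_def)
      ultimately show ?thesis using etaS0 unfolding N_def by linarith
    qed
    \<comment> \<open>The edges left for greedy colouring number \<open>w' - uu\<close>, since
      \<open>M - q = card R0 + w'\<close> and \<open>card Eb + card EF = card R0 + uu\<close>. An
      edge popular for \<open>C\<close> has at least \<open>w\<close> colours there, and passing to
      \<open>Cn\<close> removes at most \<open>w - w'\<close> and \<open>uu\<close> of them.\<close>
    have Kc: "M \<le> card {c \<in> Cn. g \<in> H c} + card (emb_edges tQ fQ) + (card Eb + card EF)" if g: "g \<in> K" for g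
    proof -
      have "a * real (card C) \<le> real (card {c \<in> C. g \<in> H c})" using g by (simp add: K_def popular_edges_def)
      moreover have "card {c \<in> C. g \<in> H c} \<le> card {c \<in> Cn. g \<in> H c} + (w - w') + uu"
      proof -
        have "card {c \<in> C. g \<in> H c} \<le> card ({c \<in> Cn. g \<in> H c} \<union> ((C - C') \<union> C''))"
          using fC C'(3) C''(3) by (intro card_mono) (auto simp: Cn_def)
        also have "\<dots> \<le> card {c \<in> Cn. g \<in> H c} + (card (C - C') + card C'')"
          by (rule order_trans[OF card_Un_le add_left_mono[OF card_Un_le]])
        also have "card (C - C') = w - w'" using C' wC' by (simp add: card_Diff_subset)
        finally show ?thesis using C''(2) by simp
      qed
      moreover have "real w \<le> a * real (card C)" using w(2) a by simp
      ultimately have "w' \<le> card {c \<in> Cn. g \<in> H c} + uu" using ww by linarith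
      moreover have "card Eb + card EF = card R0 + uu" using cEb cEF cRF cRR by linarith
      ultimately show ?thesis using cR0 by (simp add: q_def)
    qed
    have V0sub: "V0 \<subseteq> V - span tQ fQ - X" and V3sub: "V3 \<subseteq> V - span tQ fQ - X" and Xsub: "X \<subseteq> V - span tQ fQ"
      using V0S V3S X(1) unfolding S1_def S0_def by blast+
    show "\<exists>C. hamilton_cycle_on l m A V C \<and> (\<exists>\<phi>. bij_betw \<phi> (edges C) {..<M} \<and> (\<forall>g\<in>edges C. g \<in> H (\<phi> g)))"
    proof (rule connect_and_assemble[where tQ = tQ and fQ = fQ and X = X and s = s and e = e and K = K
          and b = "\<eta> * real (card S0)" and ?V0.0 = V0 and ?V3.0 = V3 and j = j and ?t0.0 = t0 and fb = fb
          and NF = NF and fF = fF and c = c and \<xi> = "\<xi> * real (card V0)" and Eb = Eb and EF = EF and Rb = Rb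
          and RF = RF and \<phi>b = \<phi>b and \<phi>F = \<phi>F and B = B and Cn = Cn, OF V _ hV M Q(1,2) Xsub ends se])
      show "3 * m \<le> card V" using big(8) unfolding N_def by linarith
      show "\<exists>t f. 1 \<le> t \<and> chain_map t f \<and> span t f = X \<union> L \<and> emb_edges t f \<subseteq> K \<and>
         (\<forall>i\<in>{1..l}. f i = s i \<and> f (h * t + i) = e i)"
        if "L \<subseteq> V - span tQ fQ - X" "real (card L) \<le> \<eta> * real (card S0)" "h dvd card L" for L
        by (rule abX[rule_format]) (use that in \<open>simp add: S0_def\<close>)
      show "V0 \<inter> V3 = {}" by (auto simp: V3_def)
      show "chain_map t0 (fb i) \<and> span t0 (fb i) \<subseteq> V3" if "i < j" for i
      proof -
        have "W i \<subseteq> V3" using Ws that js2 by simp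
        then show ?thesis using fb that by blast
      qed
      show "span t0 (fb i) \<inter> span t0 (fb i') = {}" if "i < j" "i' < j" "i \<noteq> i'" for i i'
      proof -
        have "W i \<inter> W i' = {}" using Wdisj that js2 by simp
        then show ?thesis using fb that by blast
      qed
      show "chain_map 1 (fF i) \<and> span 1 (fF i) \<subseteq> V0" if "i < NF" for i using fF(1) that by blast
      show "span 1 (fF i) \<inter> span 1 (fF i') = {}" if "i < NF" "i' < NF" "i \<noteq> i'" for i i' using fF(2) that by blast
      show "connects V0 K c Z s e"
        if "real (card (V0 \<inter> Z)) \<le> \<xi> * real (card V0)" "inj_on s {1..l}" "inj_on e {1..l}"
          "s ` {1..l} \<subseteq> V" "e ` {1..l} \<subseteq> V" "s ` {1..l} \<inter> e ` {1..l} = {}" for Z s e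
      proof (rule con[rule_format, of V], intro conjI)
        show "nC \<le> card V0" using big(6) V0N by linarith
        show "real (card (V0 \<inter> Z)) \<le> slack p a * real (card V0)" using that(1) by (simp only: \<xi>_def)
      qed (fact V | fact V0V | fact Ku | fact KV0 | fact that)+
      show "Rb \<inter> RF = {}" unfolding RF_def R_def using RbR C''(1) RC by blast
      show "B \<union> Cn \<union> (Rb \<union> RF) = {..<M}"
        unfolding RF_def R_def Cn_def using RbR C''(1) C'M BC(1) by (auto simp: R0_def)
      show "B \<inter> Cn = {}" using BC' by (auto simp: Cn_def)
      show "B \<inter> (Rb \<union> RF) = {}" unfolding RF_def R_def using RbR C''(1) BC' by (auto simp: R0_def)
      show "Cn \<inter> (Rb \<union> RF) = {}" unfolding RF_def R_def Cn_def using RbR RC by blast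
      show "\<exists>\<phi>. rainbow H (B \<union> U) (emb_edges tQ fQ) \<phi>"
        if "U \<subseteq> Cn" "card U + card B = card (emb_edges tQ fQ)" for U
        using absQ that C'(1) by (auto simp: Cn_def)
      show "finite RF" using RFM by (rule finite_subset) simp
    qed (fact V0sub | fact V3sub | fact room | fact eta0 | fact small | fact Eb_def | fact EF_def | fact rb | fact cRb
      | fact fRb | fact rF | fact cEF | (rule Kc, assumption))+
  qed
qed

end

section \<open>Degenerate cases and the final reduction\<close>

theorem theorem2p6:
  fixes k l m d :: nat and A :: "nat hypergraph" and \<delta>0 :: real
  assumes "l < m"
    and "is_link k l m A"
    and "d \<in> {1..k - 1}"
    and "\<delta>0 \<ge> hamilton_threshold k l m A d"
    and "good_link k l m A \<delta>0 d"
  shows "\<forall>\<alpha>>0. \<exists>n0::nat. \<forall>n\<ge>n0. (m - l) dvd n \<longrightarrow>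
    (\<forall>Hs :: nat hypergraph list.
       hypergraph_collection k {1..n} Hs \<and>
       real (length Hs) =
         (real (card (edges A)) - real (card (edges (link_start l A)))) / real (m - l) * real n \<and>
       collection_min_degree d Hs \<ge> ereal ((\<delta>0 + \<alpha>) * real n ^ (k - d)) \<longrightarrow>
       (\<exists>C. hamilton_cycle_on l m A {1..n} C \<and> transversal Hs C))"
proof (intro allI impI)
  fix \<alpha> :: real assume \<alpha>: "\<alpha> > 0"
  define p where "p = k - d"
  have k: "k = d + p" "p \<ge> 1" "k \<ge> 1" using assms(3) by (auto simp: p_def)
  interpret link k l m A using assms(1,2) k(3) by unfold_locales
  define coll where "coll n Hs \<longleftrightarrow> hypergraph_collection k {1..n} Hs \<and>
       real (length Hs) =
         (real (card (edges A)) - real (card (edges (link_start l A)))) / real (m - l) * real n \<and>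
       collection_min_degree d Hs \<ge> ereal ((\<delta>0 + \<alpha>) * real n ^ (k - d))" for n and Hs :: "nat hypergraph list"
  have "\<exists>n0::nat. \<forall>n\<ge>n0. (m - l) dvd n \<longrightarrow>
    (\<forall>Hs. coll n Hs \<longrightarrow> (\<exists>C. hamilton_cycle_on l m A {1..n} C \<and> transversal Hs C))"
  proof (cases "edges A = {}")
    \<comment> \<open>For an edgeless link the collection is empty and any arrangement of the
      vertices gives a cycle. The case is separate because \<open>hamilton_threshold\<close> is then
      unspecified.\<close>
    case True
    have "\<exists>C. hamilton_cycle_on l m A {1..n} C \<and> transversal Hs C"
      if n: "n \<ge> m" "(m - l) dvd n" and Hs: "coll n Hs" for n Hs
    proof -
      obtain t where t: "n = h * t" using n(2) unfolding h_def by (elim dvdE)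
      define F where "F i = (if i \<le> n then i else i - n)" for i
      have inj: "inj_on F {1..h * t}" unfolding t[symmetric] by (auto simp: inj_on_def F_def)
      have img: "F ` {1..h * t} = {1..n}" unfolding t[symmetric] by (auto simp: F_def image_iff)
      have per: "F (h * t + i) = F i" if "i \<in> {1..l}" for i
        using that n(1) l_less_m unfolding t[symmetric] by (auto simp: F_def)
      have "t \<noteq> 0" using n(1) t l_less_m by (intro notI) simp
      moreover have "l \<le> h * t" using n(1) t l_less_m by simp
      ultimately have "hamilton_cycle_on l m A {1..n} ({1..n}, emb_edges t F)"
        using cycle_of_map[OF inj per] img by simp
      moreover have "emb_edges t F = {}"
        using True by (auto simp: emb_edges_def initial_edges_def chain_edges_def)
      moreover have "length Hs = 0"
        using Hs True by (simp add: coll_def link_start_def induced_def)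
      ultimately show ?thesis
        by (intro exI[of _ "({1..n}, emb_edges t F)"]) (auto simp: transversal_def bij_betw_def)
    qed
    then show ?thesis by (intro exI[of _ m]) blast
  next
    case False
    note thr = hamilton_threshold_suffices[OF False k(1)]
    have suff: "hamilton_degree_suffices k l m A d \<delta>0"
      using hamilton_degree_suffices_mono[OF thr(1) assms(4)] .
    have \<delta>0: "0 \<le> \<delta>0" using thr(2) assms(4) by linarith
    have r1: "r \<ge> 1" by (rule r_pos[OF False])
    have len: "length Hs * h = r * n" if "coll n Hs" for n Hs
    proof -
      have "real (card (edges A)) - real (card (edges (link_start l A))) = real r"
        using card_edges_A by (simp add: es_def)
      then have "real (length Hs) = real r / real h * real n" using that by (simp add: coll_def h_def)
      then have "real (length Hs * h) = real (r * n)" using h_pos by simp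
      then show ?thesis by (simp only: of_nat_eq_iff)
    qed
    have host: "uniform_edges k {1..n} (edges (Hs ! c)) \<and> degree_into d p {1..n} (edges (Hs ! c)) {1..n} (\<delta>0 + \<alpha>)"
      if coll: "coll n Hs" and c: "c < length Hs" for n Hs c
    proof -
      have H: "uniform_hypergraph k (Hs ! c)" "verts (Hs ! c) = {1..n}"
        using coll c by (auto simp: coll_def hypergraph_collection_def)
      have "collection_min_degree d Hs \<le> ereal (real (min_degree d (Hs ! c)))"
        unfolding collection_min_degree_def by (rule INF_lower) (use c in simp)
      then have "ereal ((\<delta>0 + \<alpha>) * real n ^ (k - d)) \<le> ereal (real (min_degree d (Hs ! c)))"
        using coll order_trans unfolding coll_def by blast
      then have "(\<delta>0 + \<alpha>) * real (card {1..n}) ^ p \<le> real (min_degree d (Hs ! c))"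
        by (simp add: p_def)
      from degree_into_min_degree[OF H this] H show ?thesis
        by (auto simp: uniform_hypergraph_def uniform_edges_def)
    qed
    show ?thesis
    \<comment> \<open>For density above 1 and large \<open>n\<close> there are no such collections,
      by \<open>degree_into_le_one\<close>; otherwise the density fits the range of
      \<open>transversal_hamilton_cycle\<close>.\<close>
    proof (cases "\<delta>0 + \<alpha> \<le> 1")
      case True
      define a where "a = \<alpha> / 16"
      have a: "a > 0" "\<delta>0 + 16 * a \<le> 1" "\<delta>0 + 16 * a = \<delta>0 + \<alpha>" using \<alpha> True by (auto simp: a_def)
      have good: "prop_Ab k l m A d \<delta>0" "prop_Con k l m A d \<delta>0" "prop_Fac k A d \<delta>0"
        using assms(5) by (auto simp: good_link_def)
      obtain n0 where n0: "\<forall>(V :: nat set) M H. finite V \<and> n0 \<le> card V \<and> h dvd card V \<and> M * h = r * card V \<and>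
         (\<forall>c<M. uniform_edges k V (H c) \<and> degree_into d p V (H c) V (\<delta>0 + 16 * a)) \<longrightarrow>
         (\<exists>C. hamilton_cycle_on l m A V C \<and> (\<exists>\<phi>. bij_betw \<phi> (edges C) {..<M} \<and> (\<forall>g\<in>edges C. g \<in> H (\<phi> g))))"
        using transversal_hamilton_cycle[OF suff k(1,2) False good a(1) \<delta>0 a(2)] by (elim exE) (rule that)
      have "\<exists>C. hamilton_cycle_on l m A {1..n} C \<and> transversal Hs C"
        if n: "n \<ge> n0" "(m - l) dvd n" and Hs: "coll n Hs" for n Hs
      proof -
        have "\<exists>C. hamilton_cycle_on l m A {1..n} C \<and>
            (\<exists>\<phi>. bij_betw \<phi> (edges C) {..<length Hs} \<and> (\<forall>g\<in>edges C. g \<in> edges (Hs ! \<phi> g)))"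
          using n len[OF Hs] host[OF Hs] a(3)
          by (intro n0[rule_format, of "{1..n}" "length Hs" "\<lambda>c. edges (Hs ! c)"]) (simp add: h_def)
        then show ?thesis unfolding transversal_def .
      qed
      then show ?thesis by (intro exI[of _ n0]) blast
    next
      case False
      have "\<not> coll n Hs" if n: "n \<ge> max d 1" for n Hs
      proof
        assume coll: "coll n Hs"
        have "1 * 1 \<le> r * n" using r1 n by (intro mult_le_mono) auto
        then have "length Hs \<noteq> 0" using len[OF coll] by (intro notI) simp
        then have "uniform_edges (d + p) {1..n} (edges (Hs ! 0))"
            "degree_into d p {1..n} (edges (Hs ! 0)) {1..n} (\<delta>0 + \<alpha>)"
          using host[OF coll, of 0] k(1) by auto
        then have "\<delta>0 + \<alpha> \<le> 1" using n by (intro degree_into_le_one) auto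
        then show False using False by simp
      qed
      then show ?thesis by (intro exI[of _ "max d 1"]) blast
    qed
  qed
  then show "\<exists>n0::nat. \<forall>n\<ge>n0. (m - l) dvd n \<longrightarrow>
    (\<forall>Hs :: nat hypergraph list.
       hypergraph_collection k {1..n} Hs \<and>
       real (length Hs) =
         (real (card (edges A)) - real (card (edges (link_start l A)))) / real (m - l) * real n \<and>
       collection_min_degree d Hs \<ge> ereal ((\<delta>0 + \<alpha>) * real n ^ (k - d)) \<longrightarrow>
       (\<exists>C. hamilton_cycle_on l m A {1..n} C \<and> transversal Hs C))"
    unfolding coll_def .
qed

end
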